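(* For $E>0$ define $$\mathcal D(E)=\sup\bigl\{\,1+\ln\pi-h(W_\rho)\;:\;\rho\ge 0,\ \operatorname{Tr}\rho=1,\ W_\rho\ge 0 \text{ everywhere},\ \operatorname{Tr}(\hat N\rho)\le E\,\bigr\},$$ the supremum being over all one-mode density operators $\rho$ (including those of infinite Fock support) satisfying the stated conditions. Let $r_*\in(1/3,3/8)$ be the unique solution in that interval of $r_*\ln(2e/r_* )=1$, and set $$b_*=\ln(2/r_* )=r_*^{-1}-1,\qquad c_*=\frac{3/2-4r_*/3}{b_*},\qquad \gamma=1-r_*\ln 2,\qquad \beta=1-c_*\ln 2.$$ Then there are positive constants $C_1,C_2,E_0$ such that, for every $0<E<E_0$, $$C_1\frac{E^\gamma}{[\ln(1/E)]^\beta}\le\mathcal D(E)\le C_2\frac{E^\gamma}{[\ln(1/E)]^\beta}.$$ Moreover, the lower bound is realised by physical states with strictly positive Wigner functions: for every $0<E<E_0$ there is a density operator $\rho$ with $W_\rho>0$ everywhere, $\operatorname{Tr}(\hat N\rho)\le E$ and $1+\ln\pi-h(W_\rho)\ge C_1E^\gamma/[\ln(1/E)]^\beta$.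
   Context: One bosonic mode on $L^2(\mathbb R)$ with $[\hat q,\hat p]=i$, $\hat a=(\hat q+i\hat p)/\sqrt2$, number operator $\hat N=\hat a^\dagger\hat a=(\hat q^2+\hat p^2-1)/2$. For a density operator $\rho$ (positive, trace one) the Wigner function is $W_\rho(q,p)=\frac1\pi\int_{\mathbb R}e^{2ipy}\langle q-y|\rho|q+y\rangle\,dy$; equivalently $W_\rho(q,p)=\frac1\pi\operatorname{Tr}[\rho D(2\alpha)\Pi]$ with $\alpha=(q+ip)/\sqrt2$, $D(\alpha)=\exp(\alpha\hat a^\dagger-\alpha^*\hat a)$, $\Pi=(-1)^{\hat N}$ (this expression is defined for every density operator and is continuous). For $W_\rho\ge0$, $h(W_\rho)=-\int_{\mathbb R^2}W_\rho\ln W_\rho\,dq\,dp$ (natural logarithm, $0\ln0=0$). The vacuum has $W_0=\pi^{-1}e^{-q^2-p^2}$ and $h(W_0)=1+\ln\pi$. *)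

theory Defs
  imports "HOL-Analysis.Analysis"
begin

section \<open>Operators on \<open>L\<^sup>2(\<real>)\<close>\<close>

text \<open>
  Elements of \<open>L\<^sup>2(\<real>)\<close> are represented by Borel functions, and operators by maps on functions.
  A map satisfying \<open>bounded_op\<close> respects equality almost everywhere, since linearity and the bound
  together give that the difference of the images of two representatives has norm zero; it therefore
  is the same thing as a bounded operator on the quotient space.
\<close>

type_synonym wavefun = "real \<Rightarrow> complex"

definition L2 :: "wavefun set" where
  "L2 = {f. f \<in> borel_measurable lborel \<and> integrable lborel (\<lambda>x. (cmod (f x))\<^sup>2)}"

definition inner_L2 :: "wavefun \<Rightarrow> wavefun \<Rightarrow> complex" where
  "inner_L2 f g = (LINT x|lborel. cnj (f x) * g x)"

definition norm_L2 :: "wavefun \<Rightarrow> real" where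
  "norm_L2 f = sqrt (LINT x|lborel. (cmod (f x))\<^sup>2)"

definition bounded_op :: "(wavefun \<Rightarrow> wavefun) \<Rightarrow> bool" where
  "bounded_op T \<longleftrightarrow>
     (\<forall>f\<in>L2. T f \<in> L2) \<and>
     (\<forall>f\<in>L2. \<forall>g\<in>L2. \<forall>a b. AE x in lborel. T (\<lambda>y. a * f y + b * g y) x = a * T f x + b * T g x) \<and>
     (\<exists>C. \<forall>f\<in>L2. norm_L2 (T f) \<le> C * norm_L2 f)"

definition positive_op :: "(wavefun \<Rightarrow> wavefun) \<Rightarrow> bool" where
  "positive_op T \<longleftrightarrow> (\<forall>f\<in>L2. Im (inner_L2 f (T f)) = 0 \<and> 0 \<le> Re (inner_L2 f (T f)))"

section \<open>One bosonic mode\<close>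

definition position :: "wavefun \<Rightarrow> wavefun" where
  "position \<psi> = (\<lambda>x. of_real x * \<psi> x)"

definition momentum :: "wavefun \<Rightarrow> wavefun" where
  "momentum \<psi> = (\<lambda>x. - \<i> * vector_derivative \<psi> (at x))"

definition annihilation :: "wavefun \<Rightarrow> wavefun" where
  "annihilation \<psi> = (\<lambda>x. (position \<psi> x + \<i> * momentum \<psi> x) / of_real (sqrt 2))"

definition creation :: "wavefun \<Rightarrow> wavefun" where
  "creation \<psi> = (\<lambda>x. (position \<psi> x - \<i> * momentum \<psi> x) / of_real (sqrt 2))"

definition number_op :: "wavefun \<Rightarrow> wavefun" where
  "number_op \<psi> = creation (annihilation \<psi>)"

text \<open>The Fock (Hermite) orthonormal basis.\<close>

fun fock :: "nat \<Rightarrow> wavefun" where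
  "fock 0 = (\<lambda>x. of_real (pi powr (-1/4) * exp (- x\<^sup>2 / 2)))"
| "fock (Suc n) = (\<lambda>x. creation (fock n) x / of_real (sqrt (real (Suc n))))"

text \<open>
  Schroedinger representation of \<open>D(\<alpha>) = exp (\<alpha> a\<^sup>\<dagger> - \<alpha>\<^sup>* a) = exp (i (p\<^sub>0 q - q\<^sub>0 p))\<close> with
  \<open>\<alpha> = (q\<^sub>0 + i p\<^sub>0) / sqrt 2\<close>. That \<open>t \<mapsto> D(t \<alpha>)\<close> is the one-parameter group with the stated
  generator is \<open>displacement_group\<close> and \<open>displacement_generator\<close> below.
\<close>

definition displacement :: "complex \<Rightarrow> wavefun \<Rightarrow> wavefun" where
  "displacement \<alpha> \<psi> =
     (let q\<^sub>0 = sqrt 2 * Re \<alpha>; p\<^sub>0 = sqrt 2 * Im \<alpha>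
      in (\<lambda>x. cis (p\<^sub>0 * x - p\<^sub>0 * q\<^sub>0 / 2) * \<psi> (x - q\<^sub>0)))"

text \<open>\<open>(-1)\<^sup>N\<close> is the reflection of the line; see \<open>parity_fock\<close>.\<close>

definition parity :: "wavefun \<Rightarrow> wavefun" where
  "parity \<psi> = (\<lambda>x. \<psi> (- x))"

section \<open>Density operators, Wigner function and entropy\<close>

text \<open>
  Traces are computed in the Fock basis; for positive and for trace-class operators
  the choice of orthonormal basis is immaterial.
\<close>

definition trace_op :: "(wavefun \<Rightarrow> wavefun) \<Rightarrow> complex" where
  "trace_op T = (\<Sum>n. inner_L2 (fock n) (T (fock n)))"

definition density_operator :: "(wavefun \<Rightarrow> wavefun) \<Rightarrow> bool" where
  "density_operator \<rho> \<longleftrightarrow>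
     bounded_op \<rho> \<and> positive_op \<rho> \<and> (\<lambda>n. inner_L2 (fock n) (\<rho> (fock n))) sums 1"

text \<open>
  \<open>Tr(N \<rho>) \<in> [0, \<infinity>]\<close>. The symmetric unbounded operator \<open>N\<close> is moved to the left argument, so that
  by \<open>number_op_fock\<close> the \<open>n\<close>-th term is the non-negative number
  \<open>n * \<langle>n|\<rho>|n\<rangle>\<close>.
\<close>

definition mean_photon_number :: "(wavefun \<Rightarrow> wavefun) \<Rightarrow> ennreal" where
  "mean_photon_number \<rho> = (\<Sum>n. ennreal (Re (inner_L2 (number_op (fock n)) (\<rho> (fock n)))))"

text \<open>
  \<open>D(2 \<alpha>) (-1)\<^sup>N\<close> is self-adjoint, so the trace is real and \<open>Re\<close> only adjusts the type.
\<close>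

definition wigner :: "(wavefun \<Rightarrow> wavefun) \<Rightarrow> real \<Rightarrow> real \<Rightarrow> real" where
  "wigner \<rho> q p =
     (let \<alpha> = Complex q p / of_real (sqrt 2)
      in Re (trace_op (\<lambda>\<psi>. \<rho> (displacement (2 * \<alpha>) (parity \<psi>)))) / pi)"

text \<open>Since \<open>ln 0 = 0\<close>, the convention \<open>0 ln 0 = 0\<close> is automatic.\<close>

definition wigner_entropy :: "(real \<Rightarrow> real \<Rightarrow> real) \<Rightarrow> real" where
  "wigner_entropy W = - (LINT (q, p)|lborel. W q p * ln (W q p))"

text \<open>The supremum is taken in the extended reals, so no boundedness is presupposed.\<close>

definition entropy_deficit_sup :: "real \<Rightarrow> ereal" where
  "entropy_deficit_sup E =
     Sup {ereal (1 + ln pi - wigner_entropy (wigner \<rho>)) | \<rho>.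
            density_operator \<rho> \<and> (\<forall>q p. 0 \<le> wigner \<rho> q p) \<and> mean_photon_number \<rho> \<le> ennreal E}"

section \<open>The exponents\<close>

definition r_star :: real where
  "r_star = (THE r. 1/3 < r \<and> r < 3/8 \<and> r * ln (2 * exp 1 / r) = 1)"

definition b_star :: real where
  "b_star = ln (2 / r_star)"

definition c_star :: real where
  "c_star = (3/2 - 4 * r_star / 3) / b_star"

definition gamma_exp :: real where
  "gamma_exp = 1 - r_star * ln 2"

definition beta_exp :: real where
  "beta_exp = 1 - c_star * ln 2"

lemma r_star_unique: "\<exists>!r::real. 1/3 < r \<and> r < 3/8 \<and> r * ln (2 * exp 1 / r) = 1"
proof -
  define g :: "real \<Rightarrow> real" where "g r = r * ln (2 * exp 1 / r)" for r
  have g: "g r = r * (ln 2 + 1 - ln r)" if "r > 0" for r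
    using that by (simp add: g_def ln_div ln_mult)
  have mono: "g r < g s" if "0 < r" "r < s" "s < 2" for r s
  proof (rule DERIV_pos_imp_increasing [OF \<open>r < s\<close>])
    fix x assume x: "r \<le> x" "x \<le> s"
    have "((\<lambda>x. x * (ln 2 + 1 - ln x)) has_real_derivative ln 2 - ln x) (at x)"
      using x that by (auto intro!: derivative_eq_intros simp: field_simps)
    then have "(g has_real_derivative ln 2 - ln x) (at x)"
      by (rule has_field_derivative_transform_within_open [of _ _ _ "{0<..}"])
         (use x that g in auto)
    moreover have "ln x < ln 2" using x that by simp
    ultimately show "\<exists>y. (g has_real_derivative y) (at x) \<and> 0 < y" by (intro exI [of _ "ln 2 - ln x"]) simp
  qed
  have e: "exp 1 \<ge> (5/2::real)"
    using exp_lower_Taylor_quadratic [of "1::real"] by simp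
  have lo: "g (1/3) < 1"
  proof -
    have "(6::real) < (5/2) ^ 2" by (simp add: power2_eq_square)
    also have "\<dots> \<le> exp 1 ^ 2" using e by (intro power_mono) auto
    also have "\<dots> = exp (2::real)" by (simp flip: exp_of_nat_mult)
    finally have "ln 6 < (2::real)" by (metis ln_exp ln_less_cancel_iff exp_gt_zero zero_less_numeral)
    moreover have "ln (6::real) = ln 2 + ln 3" using ln_mult [of 2 "3::real"] by simp
    ultimately show ?thesis by (simp add: g ln_div)
  qed
  have hi: "g (3/8) > 1"
  proof -
    have "exp (5/3) ^ 3 = (exp 1 :: real) ^ 5" by (simp flip: exp_of_nat_mult)
    also have "\<dots> \<le> (272/100) ^ 5" using e_less_272 by (intro power_mono) auto
    also have "\<dots> < (16/3::real) ^ 3" by (simp add: power_numeral_reduce)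
    finally have "exp (5/3) < (16/3::real)" by (rule power_less_imp_less_base) simp
    then have "5/3 < ln (16/3::real)" by (metis ln_exp ln_less_cancel_iff exp_gt_zero less_trans)
    moreover have "ln (16/3::real) = ln 2 - ln (3/8)" using ln_div [of 2 "3/8::real"] by simp
    ultimately show ?thesis by (simp add: g)
  qed
  have "continuous_on {1/3..3/8} g"
    unfolding g_def by (intro continuous_intros) auto
  then obtain r where r: "1/3 \<le> r" "r \<le> 3/8" "g r = 1"
    using IVT' [of g "1/3" 1 "3/8"] lo hi by auto
  show ?thesis
  proof (rule ex1I [of _ r])
    show "1/3 < r \<and> r < 3/8 \<and> r * ln (2 * exp 1 / r) = 1"
    proof -
      have "r \<noteq> 1/3" by (rule notI) (use r(3) lo in \<open>simp only: less_irrefl\<close>)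
      moreover have "r \<noteq> 3/8" by (rule notI) (use r(3) hi in \<open>simp only: less_irrefl\<close>)
      ultimately have "1/3 < r \<and> r < 3/8" using r by linarith
      with r(3) show ?thesis by (simp only: g_def simp_thms)
    qed
  next
    fix s :: real assume s: "1/3 < s \<and> s < 3/8 \<and> s * ln (2 * exp 1 / s) = 1"
    show "s = r"
      using s r mono [of s r] mono [of r s] by (cases s r rule: linorder_cases) (auto simp: g_def)
  qed
qed

lemma r_star: "1/3 < r_star" "r_star < 3/8" "r_star * ln (2 * exp 1 / r_star) = 1"
  using theI' [OF r_star_unique] by (auto simp: r_star_def)

lemma b_star_eq: "b_star = 1 / r_star - 1"
proof -
  have "r_star > 0" using r_star(1) by simp
  then have "ln (2 * exp 1 / r_star) = b_star + 1"
    by (simp add: b_star_def ln_div ln_mult)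
  with r_star(3) \<open>r_star > 0\<close> show ?thesis by (simp add: field_simps)
qed

section \<open>Consistency of the Schroedinger representation\<close>

lemma displacement_scaled:
  "displacement (of_real t * \<alpha>) \<psi> x =
     (let q = sqrt 2 * Re \<alpha>; p = sqrt 2 * Im \<alpha>
      in cis (t * p * x - t * t * (p * q / 2)) * \<psi> (x - t * q))"
proof -
  have R: "sqrt 2 * Re (of_real t * \<alpha>) = t * (sqrt 2 * Re \<alpha>)"
    and I: "sqrt 2 * Im (of_real t * \<alpha>) = t * (sqrt 2 * Im \<alpha>)"
    by simp_all
  have ph: "t * p * x - t * p * (t * q) / 2 = t * p * x - t * t * (p * q / 2)" for p q
    by simp
  show ?thesis
    unfolding displacement_def Let_def R I ph ..
qed

lemma displacement_group:
  "displacement (of_real s * \<alpha>) (displacement (of_real t * \<alpha>) \<psi>) = displacement (of_real (s + t) * \<alpha>) \<psi>"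
proof
  fix x
  define q p where "q = sqrt 2 * Re \<alpha>" and "p = sqrt 2 * Im \<alpha>"
  have D: "displacement (of_real r * \<alpha>) f y = cis (r * p * y - r * r * (p * q / 2)) * f (y - r * q)" for r f y
    unfolding displacement_scaled Let_def q_def p_def ..
  have ph: "s * p * x - s * s * (p * q / 2) + (t * p * (x - s * q) - t * t * (p * q / 2))
          = (s + t) * p * x - (s + t) * (s + t) * (p * q / 2)"
    by algebra
  have ar: "x - s * q - t * q = x - (s + t) * q"
    by algebra
  show "displacement (of_real s * \<alpha>) (displacement (of_real t * \<alpha>) \<psi>) x = displacement (of_real (s + t) * \<alpha>) \<psi> x"
    unfolding D mult.assoc [symmetric, of "cis _"] cis_mult ph ar ..
qed

lemma displacement_generator:
  assumes "\<psi> differentiable (at x)"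
  shows "((\<lambda>t. displacement (of_real t * \<alpha>) \<psi> x) has_vector_derivative
            (\<alpha> * creation \<psi> x - cnj \<alpha> * annihilation \<psi> x)) (at 0)"
proof -
  define q p where "q = sqrt 2 * Re \<alpha>" and "p = sqrt 2 * Im \<alpha>"
  define d where "d = vector_derivative \<psi> (at x)"
  have \<alpha>: "\<alpha> = (of_real q + \<i> * of_real p) / of_real (sqrt 2)"
    by (simp add: complex_eq_iff q_def p_def)
  have sq: "complex_of_real (sqrt 2) * complex_of_real (sqrt 2) = 2"
    by (simp flip: of_real_mult)
  have \<psi>: "(\<psi> has_vector_derivative d) (at (x - 0 * q))"
    using assms by (simp add: d_def vector_derivative_works)
  have "((\<lambda>t. x - t * q) has_vector_derivative - q) (at 0)"
    by (auto intro!: derivative_eq_intros)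
  from vector_diff_chain_at [OF this \<psi>]
  have 1: "((\<lambda>t. \<psi> (x - t * q)) has_vector_derivative - of_real q * d) (at 0)"
    by (simp add: o_def scaleR_conv_of_real)
  have "((\<lambda>t. t * p * x - t * t * (p * q / 2)) has_real_derivative p * x) (at 0)"
    by (auto intro!: derivative_eq_intros)
  then have "((\<lambda>t. \<i> * of_real (t * p * x - t * t * (p * q / 2))) has_vector_derivative \<i> * of_real (p * x)) (at 0)"
    by (intro has_vector_derivative_mult_right has_vector_derivative_of_real)
  from field_vector_diff_chain_at [OF this DERIV_exp]
  have 2: "((\<lambda>t. cis (t * p * x - t * t * (p * q / 2))) has_vector_derivative \<i> * of_real (p * x)) (at 0)"
    by (simp add: o_def cis_conv_exp)
  have "((\<lambda>t. cis (t * p * x - t * t * (p * q / 2)) * \<psi> (x - t * q)) has_vector_derivative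
          \<i> * of_real (p * x) * \<psi> x - of_real q * d) (at 0)"
    using has_vector_derivative_mult [OF 2 1] by simp
  moreover have "displacement (of_real t * \<alpha>) \<psi> x = cis (t * p * x - t * t * (p * q / 2)) * \<psi> (x - t * q)" for t
    unfolding displacement_scaled Let_def q_def p_def ..
  moreover have "\<alpha> * creation \<psi> x - cnj \<alpha> * annihilation \<psi> x = \<i> * of_real (p * x) * \<psi> x - of_real q * d"
  proof -
    have "cnj \<alpha> = (of_real q - \<i> * of_real p) / of_real (sqrt 2)"
      by (simp add: \<alpha>)
    moreover have "creation \<psi> x = (of_real x * \<psi> x - d) / of_real (sqrt 2)"
      by (simp add: creation_def position_def momentum_def d_def)
    moreover have "annihilation \<psi> x = (of_real x * \<psi> x + d) / of_real (sqrt 2)"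
      by (simp add: annihilation_def position_def momentum_def d_def)
    ultimately have "\<alpha> * creation \<psi> x - cnj \<alpha> * annihilation \<psi> x =
        ((of_real q + \<i> * of_real p) * (of_real x * \<psi> x - d)
          - (of_real q - \<i> * of_real p) * (of_real x * \<psi> x + d)) / 2"
      unfolding \<alpha> by (simp only: times_divide_times_eq sq diff_divide_distrib [symmetric])
    also have "\<dots> = \<i> * of_real (p * x) * \<psi> x - of_real q * d"
      by (simp add: ring_distribs mult_ac)
    finally show ?thesis .
  qed
  ultimately show ?thesis by (simp only:)
qed

definition gauss_poly :: "real poly \<Rightarrow> wavefun" where
  "gauss_poly P = (\<lambda>x. of_real (poly P x * exp (- x\<^sup>2 / 2)))"

fun fock_poly :: "nat \<Rightarrow> real poly" where
  "fock_poly 0 = [:pi powr (-1/4):]"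
| "fock_poly (Suc n) = smult (1 / sqrt (2 * real (Suc n))) ([:0, 2:] * fock_poly n - pderiv (fock_poly n))"

lemma vector_derivative_gauss_poly:
  "vector_derivative (gauss_poly P) (at x) = gauss_poly (pderiv P - [:0, 1:] * P) x"
proof -
  have "((\<lambda>x. poly P x * exp (- x\<^sup>2 / 2)) has_real_derivative
          poly (pderiv P - [:0, 1:] * P) x * exp (- x\<^sup>2 / 2)) (at x)"
    by (auto intro!: derivative_eq_intros simp: algebra_simps)
  then have "(gauss_poly P has_vector_derivative gauss_poly (pderiv P - [:0, 1:] * P) x) (at x)"
    unfolding gauss_poly_def
    by (intro has_vector_derivative_of_real)
  then show ?thesis by (rule vector_derivative_at)
qed

lemma annihilation_gauss_poly: "annihilation (gauss_poly P) = gauss_poly (smult (1 / sqrt 2) (pderiv P))"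
  by (rule ext)
     (simp add: annihilation_def position_def momentum_def vector_derivative_gauss_poly,
      simp add: gauss_poly_def field_simps)

lemma creation_gauss_poly:
  "creation (gauss_poly P) = gauss_poly (smult (1 / sqrt 2) ([:0, 2:] * P - pderiv P))"
  by (rule ext)
     (simp add: creation_def position_def momentum_def vector_derivative_gauss_poly,
      simp add: gauss_poly_def field_simps)

lemma fock_eq_gauss_poly: "fock n = gauss_poly (fock_poly n)"
proof (induction n)
  case 0
  show ?case by (simp add: gauss_poly_def)
next
  case (Suc n)
  show ?case
    by (rule ext, simp only: fock.simps Suc creation_gauss_poly)
       (simp add: gauss_poly_def real_sqrt_mult field_simps del: of_nat_Suc)
qed

lemma fock_poly_ode:
  "[:0, 2:] * pderiv (fock_poly n) - pderiv (pderiv (fock_poly n)) = smult (2 * real n) (fock_poly n)"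
proof (induction n)
  case 0
  show ?case by (simp add: pderiv_pCons)
next
  case (Suc n)
  define P where "P = fock_poly n"
  define c where "c = 1 / sqrt (2 * real (Suc n))"
  have P': "fock_poly (Suc n) = smult c ([:0, 2:] * P - pderiv P)"
    by (simp add: P_def c_def)
  have IH: "[:0, 2:] * pderiv P - pderiv (pderiv P) = smult (2 * real n) P"
    using Suc by (simp add: P_def)
  have "pderiv ([:0, 2:] * P - pderiv P) = smult 2 P + ([:0, 2:] * pderiv P - pderiv (pderiv P))"
    by (simp add: pderiv_diff pderiv_mult pderiv_pCons pderiv_smult)
  also have "\<dots> = smult (2 * real (Suc n)) P"
  proof -
    have "2 + 2 * real n = 2 * real (Suc n)" by simp
    then show ?thesis by (simp only: IH smult_add_left [symmetric])
  qed
  finally have d: "pderiv (fock_poly (Suc n)) = smult (c * (2 * real (Suc n))) P"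
    by (simp only: P' pderiv_smult smult_smult)
  show ?case
    by (simp only: d pderiv_smult mult_smult_right flip: smult_diff_right)
       (simp only: P' smult_smult mult.commute)
qed

lemma parity_fock: "parity (fock n) = (\<lambda>x. (- 1) ^ n * fock n x)"
proof -
  have "pcompose (fock_poly n) [:0, - 1:] = smult ((- 1) ^ n) (fock_poly n)"
  proof (induction n)
    case (Suc n)
    have "pderiv (pcompose (fock_poly n) [:0, - 1:]) = - pcompose (pderiv (fock_poly n)) [:0, - 1:]"
      by (simp add: pderiv_pcompose pderiv_pCons)
    then have "pcompose (pderiv (fock_poly n)) [:0, - 1:] = - smult ((- 1) ^ n) (pderiv (fock_poly n))"
      by (simp add: Suc pderiv_smult)
    then show ?case
      by (simp add: pcompose_smult pcompose_diff pcompose_mult pcompose_pCons Suc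
            smult_diff_right smult_minus_left)
         (simp add: algebra_simps smult_add_right)
  qed auto
  then have "poly (fock_poly n) (- x) = (- 1) ^ n * poly (fock_poly n) x" for x
    using poly_pcompose [of "fock_poly n" "[:0, - 1:]" x] by simp
  then show ?thesis
    by (simp add: parity_def fock_eq_gauss_poly gauss_poly_def fun_eq_iff)
qed

lemma number_op_fock: "number_op (fock n) = (\<lambda>x. of_nat n * fock n x)"
proof -
  have "number_op (fock n) =
          gauss_poly (smult (1/2) ([:0, 2:] * pderiv (fock_poly n) - pderiv (pderiv (fock_poly n))))"
    by (simp add: number_op_def fock_eq_gauss_poly annihilation_gauss_poly creation_gauss_poly pderiv_smult)
       (simp add: gauss_poly_def fun_eq_iff field_simps)
  then show ?thesis
    by (simp only: fock_poly_ode) (simp add: fock_eq_gauss_poly gauss_poly_def fun_eq_iff)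
qed

text \<open>
  For \<open>\<rho> = |\<psi>\<rangle>\<langle>\<psi>|\<close> the trace formula for the Wigner function
  is the integral of \<open>exp (2 i p y) \<langle>q - y|\<rho>|q + y\<rangle>\<close> over \<open>y\<close>.
\<close>

lemma inner_displaced_parity:
  "inner_L2 \<psi> (displacement (2 * (Complex q p / of_real (sqrt 2))) (parity \<psi>)) =
     (LINT y|lborel. cis (2 * p * y) * (\<psi> (q - y) * cnj (\<psi> (q + y))))"
proof -
  have r: "sqrt 2 * Re (2 * (Complex q p / of_real (sqrt 2))) = 2 * q"
    and i: "sqrt 2 * Im (2 * (Complex q p / of_real (sqrt 2))) = 2 * p"
    by (simp_all add: Re_divide_of_real Im_divide_of_real)
  have "inner_L2 \<psi> (displacement (2 * (Complex q p / of_real (sqrt 2))) (parity \<psi>)) =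
          (LINT x|lborel. cnj (\<psi> x) * (cis (2 * p * x - 2 * p * q) * \<psi> (2 * q - x)))"
    unfolding inner_L2_def displacement_def Let_def r i parity_def by (simp add: mult.assoc)
  also have "\<dots> = (LINT y|lborel. cnj (\<psi> (q + y)) * (cis (2 * p * (q + y) - 2 * p * q) * \<psi> (2 * q - (q + y))))"
    by (subst lborel_integral_real_affine [where c = 1 and t = q]) simp_all
  also have "\<dots> = (LINT y|lborel. cis (2 * p * y) * (\<psi> (q - y) * cnj (\<psi> (q + y))))"
    by (intro Bochner_Integration.integral_cong) (simp_all add: ring_distribs mult_ac)
  finally show ?thesis .
qed

end

theory Submission
  imports Defs "HOL-Probability.Probability" "HOL-Complex_Analysis.Complex_Analysis" "HOL-Real_Asymp.Real_Asymp"
begin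

text \<open>
 Put \<open>E = exp (- L)\<close>, \<open>R = L + 4/3 * ln L\<close>, \<open>s = q\<^sup>2 + p\<^sup>2\<close>. Upper bound: inside \<open>s < R\<close> the deficit is at
 most the chi-square distance of \<open>W\<close> from the vacuum, and \<open>s \<ge> R\<close> is negligible; up to \<open>O(E)\<close> the former
 is \<open>\<Sum>k. |\<rho>\<^sub>0\<^sub>k|\<^sup>2 * 2 ^ k / k! * (\<integral>s=0..R. s ^ k * exp (- s))\<close>. For small \<open>k\<close> use
 \<open>k * |\<rho>\<^sub>0\<^sub>k|\<^sup>2 \<le> E\<close>. For large \<open>k\<close> use \<open>W \<ge> 0\<close>: on a circle the \<open>k\<close>-th harmonic is dominated by the mean,
 whose averages over windows next to \<open>s = R\<close> are \<open>O(exp (- R))\<close>, because windows of \<open>exp (- s) * L\<^sub>n (2 * s)\<close> are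
 \<open>O(R powr (- 1/3))\<close> (van der Corput, third derivative). The two bounds balance at \<open>k = r\<^sub>* L + c\<^sub>* ln L\<close>.
 Lower bound: superpose \<open>|0>\<close> with weight about \<open>E / n\<close> of \<open>|n>\<close> for this \<open>n = k\<close>, and mix in a ring of about
 \<open>L powr (1/3)\<close> squeezed states at radius \<open>s = R\<close>, whose tails outweigh the cross term for \<open>s > R\<close>.
\<close>

section \<open>Polar coordinates\<close>

text \<open>The exponent 4/3 in \<open>R\<close> arises twice. Above, levels
  \<open>n > L / 20\<close> are charged to the energy: a window integral of size
  \<open>L powr (- 1/3)\<close> is at most \<open>20 * n / L\<close> times that, so the mean
  harmonic is \<open>O(E * L powr (- 4/3))\<close>, that is \<open>O(exp (- R))\<close>. Below, a
  weight of order \<open>E / L\<close> is shared by about \<open>L powr (1/3)\<close> squeezed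
  states, enough for their thin direction to follow the arc between neighbours; again each has
  weight of order \<open>exp (- R)\<close>. The obstacle: the \<open>k\<close>-th harmonic also
  contains the entries \<open>dm n (n + k)\<close> with \<open>n > 0\<close>, a priori of size
  \<open>E\<close>. Comparing the harmonic at \<open>s\<close> and \<open>s + 1\<close> removes
  them, because Laguerre functions vary slowly there, whereas the row-0 term at least halves. The
  energy bounds the \<open>k\<close>-th summand by \<open>E * 2 ^ k / k\<close>, which grows,
  positivity by a multiple of \<open>k! / R ^ k\<close>, which decays. Equality means
  \<open>k * k! = E * (2 * R) ^ k\<close>. In Stirling's form the terms linear in \<open>L\<close>
  cancel by the equation for \<open>r_star\<close>, those in \<open>ln L\<close> by
  \<open>b_star * c_star = 3/2 - 4 * r_star / 3\<close>.\<close>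

lemma nn_integral_substitution_UN:
 fixes f :: "real \<Rightarrow> ennreal" and a b :: "nat \<Rightarrow> real"
 assumes f [measurable]: "f \<in> borel_measurable borel"
  and ab: "\<And>i. a i < b i" "decseq a" "incseq b"
  and g: "\<And>x. x \<in> S \<Longrightarrow> (g has_real_derivative g' x) (at x)"
  and g': "continuous_on S g'" "\<And>x. x \<in> S \<Longrightarrow> 0 \<le> g' x"
  and S: "S = (\<Union>i. {a i..b i})" and T: "T = (\<Union>i. {g (a i)..g (b i)})"
 shows "(\<integral>\<^sup>+x. f x * indicator T x \<partial>lborel) = (\<integral>\<^sup>+x. f (g x) * ennreal (g' x) * indicator S x \<partial>lborel)"
proof -
 have sub: "{a i..b i} \<subseteq> S" for i using S by auto
 have mono: "{a i..b i} \<subseteq> {a j..b j}" if "i \<le> j" for i j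
  using ab(2) [unfolded decseq_def, rule_format, OF that] ab(3) [unfolded incseq_def, rule_format, OF that] by auto
 have gm: "g x \<le> g y" if "x \<le> y" "{x..y} \<subseteq> S" for x y
  by (rule DERIV_nonneg_imp_nondecreasing [OF that(1)]) (use that g g' in force)
 have gmono: "{g (a i)..g (b i)} \<subseteq> {g (a j)..g (b j)}" if "i \<le> j" for i j
 proof -
  have "a j \<le> a i" "b i \<le> b j" using that ab by (auto simp: decseq_def incseq_def)
  moreover have "a i < b i" using ab by simp
  ultimately have "g (a j) \<le> g (a i)" "g (b i) \<le> g (b j)"
   using sub [of j] by (intro gm; force)+
  then show ?thesis by simp
 qed
 have cont: "continuous_on {a i..b i} g'" for i using g'(1) sub continuous_on_subset by blast
 have contg: "continuous_on {a i..b i} g" for i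
  by (rule has_real_derivative_imp_continuous_on) (use g sub in blast)
 have SUPI: "(SUP i. (indicator {c i..d i} x :: ennreal)) = indicator (\<Union>i. {c i..d i}) x" for c d :: "nat \<Rightarrow> real" and x
  by (rule antisym) (auto intro!: SUP_least split: split_indicator simp: SUP_upper2)
 \<comment> \<open>Compact intervals exhaust \<open>S\<close> and their images exhaust
   \<open>T\<close>; monotone convergence on both sides carries the substitution rule over from the
   compact case.\<close>
 have "(\<integral>\<^sup>+x. f x * indicator T x \<partial>lborel) = (\<integral>\<^sup>+x. (SUP i. f x * indicator {g (a i)..g (b i)} x) \<partial>lborel)"
  unfolding T by (simp add: SUPI SUP_mult_left_ennreal [symmetric])
 also have "\<dots> = (SUP i. \<integral>\<^sup>+x. f x * indicator {g (a i)..g (b i)} x \<partial>lborel)"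
  by (rule nn_integral_monotone_convergence_SUP)
    (auto simp: incseq_def le_fun_def intro!: mult_left_mono indicator_leI dest: subsetD [OF gmono])
 also have "\<dots> = (SUP i. \<integral>\<^sup>+x. f (g x) * ennreal (g' x) * indicator {a i..b i} x \<partial>lborel)"
 proof (rule SUP_cong [OF refl])
  fix i
  show "(\<integral>\<^sup>+x. f x * indicator {g (a i)..g (b i)} x \<partial>lborel) = (\<integral>\<^sup>+x. f (g x) * ennreal (g' x) * indicator {a i..b i} x \<partial>lborel)"
   using sub [of i] by (intro nn_integral_substitution_aux g g' ab cont f) auto
 qed
 also have "\<dots> = (\<integral>\<^sup>+x. (SUP i. f (g x) * ennreal (g' x) * indicator {a i..b i} x) \<partial>lborel)"
 proof (rule nn_integral_monotone_convergence_SUP [symmetric])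
  show "incseq (\<lambda>i x. f (g x) * ennreal (g' x) * indicator {a i..b i} x)"
   by (auto simp: incseq_def le_fun_def intro!: mult_left_mono indicator_leI dest: subsetD [OF mono])
  fix i
  have [measurable]: "set_borel_measurable borel {a i..b i} g" "set_borel_measurable borel {a i..b i} g'"
   using cont contg by (auto intro!: set_measurable_continuous_on)
  \<comment> \<open>\<open>g\<close> and \<open>g'\<close> are known to be continuous only on the
    intervals, so they are cut off by the indicator to obtain globally measurable functions.\<close>
  have "(\<lambda>x. f (g x) * ennreal (g' x) * indicator {a i..b i} x) =
    (\<lambda>x. f (indicator {a i..b i} x *\<^sub>R g x) * ennreal (indicator {a i..b i} x *\<^sub>R g' x) * indicator {a i..b i} x)"
   by (auto split: split_indicator)
  also have "\<dots> \<in> borel_measurable lborel"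
   using \<open>set_borel_measurable borel {a i..b i} g\<close> \<open>set_borel_measurable borel {a i..b i} g'\<close>
   unfolding set_borel_measurable_def by measurable
  finally show "(\<lambda>x. f (g x) * ennreal (g' x) * indicator {a i..b i} x) \<in> borel_measurable lborel" .
 qed
 also have "\<dots> = (\<integral>\<^sup>+x. f (g x) * ennreal (g' x) * indicator S x \<partial>lborel)"
  unfolding S by (simp add: SUPI SUP_mult_left_ennreal [symmetric])
 finally show ?thesis .
qed

text \<open>The radial variable is the squared radius: the Jacobian becomes the constant 1/2, and
  the vacuum turns into \<open>exp (- s) / pi\<close>.\<close>

definition polar :: "real \<times> real \<Rightarrow> real \<times> real" where
 "polar = (\<lambda>(s, t). (sqrt s * cos t, sqrt s * sin t))"

lemma polar_measurable [measurable]: "polar \<in> borel_measurable borel"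
 unfolding polar_def by (auto intro!: borel_measurable_continuous_onI continuous_intros simp: split_beta)

text \<open>Used with \<open>c = 1 + t^2\<close>, where \<open>s = c * p^2\<close> is the squared
  radius of the point \<open>(- p * t, p)\<close>.\<close>

lemma nn_integral_square_subst:
 fixes f :: "real \<Rightarrow> ennreal"
 assumes [measurable]: "f \<in> borel_measurable borel" and c: "c > 0"
 shows "(\<integral>\<^sup>+p. f p * ennreal p * indicator {0<..} p \<partial>lborel)
    = (\<integral>\<^sup>+s. f (sqrt (s / c)) * ennreal (1 / (2 * c)) * indicator {0<..} s \<partial>lborel)"
proof -
 let ?T = "\<Union>i. {c * (1 / real (Suc (Suc i)))^2..c * (real (Suc i))^2}"
 let ?S = "\<Union>i. {1 / real (Suc (Suc i))..real (Suc i)}"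
 have "(\<integral>\<^sup>+s. f (sqrt (s / c)) * ennreal (1 / (2 * c)) * indicator {0<..} s \<partial>lborel)
   = (\<integral>\<^sup>+p. f (sqrt (c * p^2 / c)) * ennreal (1 / (2 * c)) * ennreal (2 * c * p) * indicator {0<..} p \<partial>lborel)"
 proof (rule nn_integral_substitution_UN [where a = "\<lambda>i. 1 / real (Suc (Suc i))" and b = "\<lambda>i. real (Suc i)"
     and g = "\<lambda>p. c * p^2"])
  show S: "{0<..} = ?S"
  proof (intro equalityI subsetI)
   fix x :: real assume x: "x \<in> {0<..}"
   obtain i where i: "x \<le> real i" using real_arch_simple by blast
   obtain j where j: "1 / x \<le> real j" using real_arch_simple by blast
   have "x \<le> real (Suc (i + j))" using i by simp
   moreover have "1 / x \<le> real (Suc (Suc (i + j)))" using j by simp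
   then have "1 / real (Suc (Suc (i + j))) \<le> x" using x by (simp add: field_simps)
   ultimately show "x \<in> ?S" by (auto intro!: exI [of _ "i + j"])
  next
   fix x :: real assume "x \<in> ?S"
   then obtain i where "1 / real (Suc (Suc i)) \<le> x" by auto
   then have "0 < x" by (rule less_le_trans [rotated]) simp
   then show "x \<in> {0<..}" by simp
  qed
  show "{0<..} = ?T"
  proof (intro equalityI subsetI)
   fix x :: real assume x: "x \<in> {0<..}"
   then have "sqrt (x / c) \<in> {0<..}" using c by simp
   then obtain i where i: "1 / real (Suc (Suc i)) \<le> sqrt (x / c)" "sqrt (x / c) \<le> real (Suc i)" unfolding S by auto
   have xc: "(sqrt (x / c))^2 = x / c" using x c by simp
   have "(1 / real (Suc (Suc i)))^2 \<le> x / c" using power_mono [OF i(1), of 2] xc by simp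
   moreover have "x / c \<le> (real (Suc i))^2" using power_mono [OF i(2), of 2] xc x c by simp
   ultimately show "x \<in> ?T"
    using c by (intro UN_I [of i]) (simp_all del: of_nat_Suc add: field_simps)
  next
   fix x :: real assume "x \<in> ?T"
   then obtain i where i: "c * (1 / real (Suc (Suc i)))^2 \<le> x" by auto
   have "0 < c * (1 / real (Suc (Suc i)))^2" using c by simp
   with i have "0 < x" by linarith
   then show "x \<in> {0<..}" by simp
  qed
  show "1 / real (Suc (Suc i)) < real (Suc i)" for i
  proof -
   have "1 / real (Suc (Suc i)) < 1" by simp
   also have "\<dots> \<le> real (Suc i)" by simp
   finally show ?thesis .
  qed
  show "decseq (\<lambda>i. 1 / real (Suc (Suc i)))" by (auto simp: decseq_def field_simps)
  show "((\<lambda>p. c * p^2) has_real_derivative 2 * c * x) (at x)" for x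
   by (auto intro!: derivative_eq_intros)
  show "0 \<le> 2 * c * x" if "x \<in> {0<..}" for x using that c by simp
 qed (auto simp: incseq_def intro!: continuous_intros)
 also have "\<dots> = (\<integral>\<^sup>+p. f p * ennreal p * indicator {0<..} p \<partial>lborel)"
 proof (rule nn_integral_cong)
  fix p :: real
  have "ennreal (1 / (2 * c)) * ennreal (2 * c * p) = ennreal p" if "p > 0"
   using that c by (simp add: ennreal_mult [symmetric])
  then show "f (sqrt (c * p^2 / c)) * ennreal (1 / (2 * c)) * ennreal (2 * c * p) * indicator {0<..} p = f p * ennreal p * indicator {0<..} p"
   by (auto split: split_indicator simp: mult.assoc)
 qed
 finally show ?thesis by simp
qed

lemma nn_integral_cot_subst:
 fixes f :: "real \<Rightarrow> ennreal"
 assumes [measurable]: "f \<in> borel_measurable borel"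
 shows "(\<integral>\<^sup>+t. f t \<partial>lborel) = (\<integral>\<^sup>+u. f (- cot u) * ennreal (1 / (sin u)^2) * indicator {0<..<pi} u \<partial>lborel)"
proof -
 define a b :: "nat \<Rightarrow> real" where "a i = 1 / real (Suc (Suc i))" and "b i = pi - 1 / real (Suc (Suc i))" for i
 have ai: "0 < a i" "a i \<le> 1/2" for i by (auto simp: a_def field_simps)
 have bi: "b i = pi - a i" for i by (simp add: a_def b_def)
 have a0: "a \<longlonglongrightarrow> 0"
  using LIMSEQ_ignore_initial_segment [OF lim_inverse_n', of 2] unfolding a_def by simp
 have "(\<integral>\<^sup>+t. f t * indicator UNIV t \<partial>lborel) = (\<integral>\<^sup>+u. f (- cot u) * ennreal (1 / (sin u)^2) * indicator {0<..<pi} u \<partial>lborel)"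
 proof (rule nn_integral_substitution_UN [where a = a and b = b and g = "\<lambda>u. - cot u"])
  show "a i < b i" for i using ai [of i] pi_gt3 by (simp add: bi)
  show "decseq a" "incseq b" by (auto simp: decseq_def incseq_def a_def b_def field_simps)
  fix x :: real assume x: "x \<in> {0<..<pi}"
  then have "sin x > 0" by (simp add: sin_gt_zero)
  then show "((\<lambda>u. - cot u) has_real_derivative 1 / (sin x)^2) (at x)"
   using DERIV_minus [OF DERIV_cot [of x]] by (simp add: inverse_eq_divide)
  show "0 \<le> 1 / (sin x)^2" by simp
 next
  show "continuous_on {0<..<pi} (\<lambda>x. 1 / (sin x)^2)"
   by (intro continuous_intros) (use sin_gt_zero in fastforce)
  show "{0<..<pi} = (\<Union>i. {a i..b i})"
  proof (intro equalityI subsetI)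
   fix x assume x: "x \<in> {0<..<pi}"
   then have "eventually (\<lambda>i. a i < min x (pi - x)) sequentially" by (intro order_tendstoD(2) [OF a0], auto)
   then obtain i where "a i < min x (pi - x)" by (auto simp: eventually_sequentially)
   then show "x \<in> (\<Union>i. {a i..b i})" by (intro UN_I [of i]) (auto simp: bi)
  next
   fix x assume "x \<in> (\<Union>i. {a i..b i})"
   then obtain i where "a i \<le> x" "x \<le> pi - a i" by (auto simp: bi)
   then show "x \<in> {0<..<pi}" using ai(1) [of i] by auto
  qed
  have cotb: "- cot (b i) = cot (a i)" for i by (simp add: bi cot_def)
  have big: "1 / (2 * a i) \<le> cot (a i)" for i
  proof -
   have "cos (a i) \<ge> cos (pi / 3)" using ai [of i] pi_gt3 by (intro cos_monotone_0_pi_le) auto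
   then have "cos (a i) \<ge> 1/2" by (simp add: cos_60)
   moreover have "sin (a i) \<le> a i" using ai [of i] by (intro sin_x_le_x) auto
   moreover have "sin (a i) > 0" using ai [of i] pi_gt3 by (intro sin_gt_zero) auto
   ultimately have "1/2 / a i \<le> cos (a i) / sin (a i)" by (intro frac_le, auto)
   then show ?thesis by (simp add: cot_def)
  qed
  show "UNIV = (\<Union>i. {- cot (a i)..- cot (b i)})"
  proof (intro equalityI subsetI)
   fix x :: real
   obtain i where i: "\<bar>x\<bar> \<le> real i" using real_arch_simple by blast
   have "\<bar>x\<bar> \<le> 1 / (2 * a (2 * i))" using i by (simp add: a_def)
   also have "\<dots> \<le> cot (a (2*i))" by (rule big)
   finally show "x \<in> (\<Union>i. {- cot (a i)..- cot (b i)})" using cotb [of "2*i"] by (intro UN_I [of "2*i"]) auto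
  qed auto
 qed auto
 then show ?thesis by simp
qed

text \<open>In the upper half-plane put \<open>q = - p * t\<close>, so that
  \<open>s = p^2 * (1 + t^2)\<close>, and then \<open>t = - cot u\<close>, which turns the parameter
  of the ray into its angle. Both substitutions are one-dimensional and are linked by
  Fubini.\<close>

lemma nn_integral_half_polar:
 fixes f :: "real \<times> real \<Rightarrow> ennreal"
 assumes f [measurable]: "f \<in> borel_measurable borel"
 shows "(\<integral>\<^sup>+p. (\<integral>\<^sup>+q. f (q, p) \<partial>lborel) * indicator {0<..} p \<partial>lborel)
    = (\<integral>\<^sup>+s. (\<integral>\<^sup>+u. f (polar (s, u)) * ennreal (1/2) * indicator {0<..<pi} u \<partial>lborel) * indicator {0<..} s \<partial>lborel)"
proof -
 let ?K = "\<lambda>s t. f (- sqrt (s / (1 + t^2)) * t, sqrt (s / (1 + t^2))) * ennreal (1 / (2 * (1 + t^2))) * indicator {0<..} s"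
 let ?I = "\<lambda>s. \<integral>\<^sup>+u. f (polar (s, u)) * ennreal (1/2) * indicator {0<..<pi} u \<partial>lborel"
 let ?h = "\<lambda>p. \<integral>\<^sup>+q. f (q, p) \<partial>lborel"
 let ?k = "\<lambda>s. \<integral>\<^sup>+t. ?K s t \<partial>lborel"
 have [measurable]: "f \<in> borel_measurable (borel \<Otimes>\<^sub>M borel)" by (simp add: borel_prod)
 have [measurable]: "polar \<in> borel_measurable (borel \<Otimes>\<^sub>M borel)" by (simp add: borel_prod)
 have "(\<integral>\<^sup>+p. ?h p * indicator {0<..} p \<partial>lborel)
   = (\<integral>\<^sup>+p. (\<integral>\<^sup>+t. f (- p * t, p) * ennreal p * indicator {0<..} p \<partial>lborel) \<partial>lborel)"
 proof (rule nn_integral_cong)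
  fix p :: real
  show "?h p * indicator {0<..} p = (\<integral>\<^sup>+t. f (- p * t, p) * ennreal p * indicator {0<..} p \<partial>lborel)"
  proof (cases "p > 0")
   case True
   have "?h p = ennreal \<bar>- p\<bar> * (\<integral>\<^sup>+t. f (0 + - p * t, p) \<partial>lborel)"
    using True by (intro nn_integral_real_affine) auto
   also have "\<dots> = (\<integral>\<^sup>+t. f (- p * t, p) * ennreal p \<partial>lborel)"
    using True by (subst nn_integral_cmult [symmetric]) (auto simp: mult_ac)
   finally show ?thesis using True by simp
  qed simp
 qed
 also have "\<dots> = (\<integral>\<^sup>+t. (\<integral>\<^sup>+p. f (- p * t, p) * ennreal p * indicator {0<..} p \<partial>lborel) \<partial>lborel)"
  by (rule lborel_pair.Fubini') measurable
 also have "\<dots> = (\<integral>\<^sup>+t. (\<integral>\<^sup>+s. ?K s t \<partial>lborel) \<partial>lborel)"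
  by (intro nn_integral_cong nn_integral_square_subst [where f = "\<lambda>p. f (- p * _, p)"])
    (auto simp: add_pos_nonneg)
 also have "\<dots> = (\<integral>\<^sup>+s. ?k s \<partial>lborel)"
  by (rule lborel_pair.Fubini') measurable
 also have "\<dots> = (\<integral>\<^sup>+s. ?I s * indicator {0<..} s \<partial>lborel)"
 proof (rule nn_integral_cong)
  fix s :: real
  have "?k s
    = (\<integral>\<^sup>+u. ?K s (- cot u)
      * ennreal (1 / (sin u)^2) * indicator {0<..<pi} u \<partial>lborel)"
   by (rule nn_integral_cot_subst) measurable
  also have "\<dots> = (\<integral>\<^sup>+u. f (polar (s, u)) * ennreal (1/2) * indicator {0<..<pi} u * indicator {0<..} s \<partial>lborel)"
  proof (rule nn_integral_cong)
   fix u :: real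
   show "?K s (- cot u)
      * ennreal (1 / (sin u)^2) * indicator {0<..<pi} u = f (polar (s, u)) * ennreal (1/2) * indicator {0<..<pi} u * indicator {0<..} s"
   proof (cases "0 < u \<and> u < pi")
    case True
    then have sp: "sin u > 0" by (simp add: sin_gt_zero)
    have c: "1 + (- cot u)^2 = 1 / (sin u)^2" using sp by (simp add: cot_def field_simps)
    have r: "sqrt (s / (1 / (sin u)^2)) = sqrt s * sin u" using sp by (simp add: real_sqrt_mult)
    have e: "ennreal (1 / (2 * (1 / (sin u)^2))) * ennreal (1 / (sin u)^2) = ennreal (1/2)"
     using sp by (subst ennreal_mult [symmetric]) auto
    have "- (sqrt s * sin u) * (- cot u) = sqrt s * cos u" using sp by (simp add: cot_def)
    moreover have perm: "a * b * c * d * e = a * (b * d) * e * c" for a b c d e :: ennreal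
     by (simp only: mult_ac)
    ultimately show ?thesis unfolding c r polar_def by (simp only: perm e split)
   qed (auto split: split_indicator)
  qed
  also have "\<dots> = ?I s * indicator {0<..} s"
   by (rule nn_integral_multc) measurable
  finally show "?k s =
    ?I s * indicator {0<..} s" .
 qed
 finally show ?thesis .
qed

text \<open>The lower half-plane is the upper one rotated by \<open>pi\<close>; the axis
  \<open>p = 0\<close> and the angle \<open>pi\<close> are null sets.\<close>

lemma nn_integral_polar:
 fixes f :: "real \<times> real \<Rightarrow> ennreal"
 assumes f [measurable]: "f \<in> borel_measurable borel"
 shows "(\<integral>\<^sup>+z. f z \<partial>lborel)
    = (\<integral>\<^sup>+s. (\<integral>\<^sup>+t. f (polar (s, t)) * ennreal (1/2) * indicator {0<..<2*pi} t \<partial>lborel) * indicator {0<..} s \<partial>lborel)"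
proof -
 let ?I = "\<lambda>A s. \<integral>\<^sup>+t. f (polar (s, t)) * ennreal (1/2) * indicator A t \<partial>lborel"
 let ?J = "\<lambda>A. \<integral>\<^sup>+s. ?I A s * indicator {0<..} s \<partial>lborel"
 have [measurable]: "f \<in> borel_measurable (borel \<Otimes>\<^sub>M borel)" by (simp add: borel_prod)
 have [measurable]: "polar \<in> borel_measurable (borel \<Otimes>\<^sub>M borel)" by (simp add: borel_prod)
 have "(\<lambda>(q, p). f (- q, - p)) \<in> borel_measurable (borel \<Otimes>\<^sub>M borel)" by measurable
 then have fm: "(\<lambda>(q, p). f (- q, - p)) \<in> borel_measurable borel" by (simp add: borel_prod)
 define h where "h p = (\<integral>\<^sup>+q. f (q, p) \<partial>lborel)" for p
 have [measurable]: "h \<in> borel_measurable borel" unfolding h_def by measurable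
 have "(\<integral>\<^sup>+z. f z \<partial>lborel) = (\<integral>\<^sup>+p. h p \<partial>lborel)"
  unfolding h_def lborel_prod [symmetric] by (rule lborel_pair.nn_integral_snd [symmetric]) measurable
 also have "\<dots> = (\<integral>\<^sup>+p. h p * indicator {0<..} p + h p * indicator {..<0} p \<partial>lborel)"
  by (rule nn_integral_cong_AE, rule AE_mp [OF AE_lborel_singleton [of "0"]])
    (auto split: split_indicator)
 also have "\<dots> = (\<integral>\<^sup>+p. h p * indicator {0<..} p \<partial>lborel) + (\<integral>\<^sup>+p. h p * indicator {..<0} p \<partial>lborel)"
  by (rule nn_integral_add) measurable
 also have "(\<integral>\<^sup>+p. h p * indicator {..<0} p \<partial>lborel) = (\<integral>\<^sup>+p. h (- p) * indicator {0<..} p \<partial>lborel)"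
  using nn_integral_real_affine [of "\<lambda>p. h p * indicator {..<0} p" "-1" 0] by (simp add: indicator_def)
 also have "(\<lambda>p. h (- p)) = (\<lambda>p. \<integral>\<^sup>+q. f (- q, - p) \<partial>lborel)"
 proof
  fix p :: real
  show "h (- p) = (\<integral>\<^sup>+q. f (- q, - p) \<partial>lborel)"
   unfolding h_def using nn_integral_real_affine [of "\<lambda>q. f (q, - p)" "-1" 0] by simp
 qed
 also have "(\<integral>\<^sup>+p. (\<integral>\<^sup>+q. f (- q, - p) \<partial>lborel) * indicator {0<..} p \<partial>lborel)
    = (\<integral>\<^sup>+s. (\<integral>\<^sup>+t. f (polar (s, t + pi)) * ennreal (1/2) * indicator {0<..<pi} t \<partial>lborel) * indicator {0<..} s \<partial>lborel)"
  using nn_integral_half_polar [OF fm] by (simp add: polar_def)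
 also have "\<dots> = ?J {pi<..<2*pi}"
 proof (rule nn_integral_cong, rule arg_cong2 [where f = "(*)", OF _ refl])
  fix s :: real
  show "(\<integral>\<^sup>+t. f (polar (s, t + pi)) * ennreal (1/2) * indicator {0<..<pi} t \<partial>lborel) = ?I {pi<..<2*pi} s"
   using nn_integral_real_affine [of "\<lambda>t. f (polar (s, t)) * ennreal (1/2) * indicator {pi<..<2*pi} t" 1 pi]
   by (simp add: indicator_def add.commute)
 qed
 also have "(\<integral>\<^sup>+p. h p * indicator {0<..} p \<partial>lborel)
    = ?J {0<..<pi}"
  unfolding h_def by (rule nn_integral_half_polar) measurable
 also have "\<dots> + ?J {pi<..<2*pi}
   = (\<integral>\<^sup>+s. ?I {0<..<pi} s * indicator {0<..} s
     + ?I {pi<..<2*pi} s * indicator {0<..} s \<partial>lborel)"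
  by (rule nn_integral_add [symmetric]) measurable
 also have "\<dots> = ?J {0<..<2*pi}"
 proof (rule nn_integral_cong)
  fix s :: real
  have "?I {0<..<2*pi} s =
   (\<integral>\<^sup>+t. f (polar (s, t)) * ennreal (1/2) * indicator {0<..<pi} t + f (polar (s, t)) * ennreal (1/2) * indicator {pi<..<2*pi} t \<partial>lborel)"
   by (rule nn_integral_cong_AE, rule AE_mp [OF AE_lborel_singleton [of "pi"]])
     (auto split: split_indicator)
  also have "\<dots> = ?I {0<..<pi} s
     + ?I {pi<..<2*pi} s"
   by (rule nn_integral_add) measurable
  finally show "?I {0<..<pi} s * indicator {0<..} s
     + ?I {pi<..<2*pi} s * indicator {0<..} s =
    ?I {0<..<2*pi} s * indicator {0<..} s"
   by (simp add: distrib_right)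
 qed
 finally show ?thesis .
qed

definition polar_measure :: "(real \<times> real) measure" where
 "polar_measure = density lborel (\<lambda>(s, t). ennreal (1/2) * indicator {0<..} s * indicator {0<..<2*pi} t)"

text \<open>Stated for measures, so that the change of variables passes from nonnegative to Bochner
  integrals through \<open>distr\<close> and \<open>density\<close>.\<close>

lemma lborel_eq_distr_polar: "lborel = distr polar_measure borel polar"
proof (rule measure_eqI)
 show "sets lborel = sets (distr polar_measure borel polar)" by simp
 fix X :: "(real \<times> real) set" assume "X \<in> sets lborel"
 then have X [measurable]: "X \<in> sets borel" by simp
 then have Xp [measurable]: "X \<in> sets (borel \<Otimes>\<^sub>M borel)" by (simp only: borel_prod)
 have pm [measurable]: "polar \<in> (borel \<Otimes>\<^sub>M borel) \<rightarrow>\<^sub>M (borel \<Otimes>\<^sub>M borel)" by (simp add: borel_prod)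
 have [measurable]: "polar \<in> measurable polar_measure borel" by (simp add: polar_measure_def)
 have dm: "(\<lambda>(s :: real, t). ennreal (1/2) * indicator {0<..} s * indicator {0<..<2*pi} t :: ennreal) \<in> borel_measurable (borel \<Otimes>\<^sub>M borel)"
  by measurable
 have Fm: "(\<lambda>(s, t). indicator X (polar (s, t)) * ennreal (1/2) * indicator {0<..<2*pi} t * indicator {0<..} s) \<in> borel_measurable (lborel \<Otimes>\<^sub>M lborel)"
  by measurable
 have "emeasure lborel X = (\<integral>\<^sup>+z. indicator X z \<partial>lborel)" by simp
 also have "\<dots> = (\<integral>\<^sup>+s. (\<integral>\<^sup>+t. indicator X (polar (s, t)) * ennreal (1/2) * indicator {0<..<2*pi} t \<partial>lborel) * indicator {0<..} s \<partial>lborel)"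
  by (rule nn_integral_polar) simp
 also have "\<dots> = (\<integral>\<^sup>+s. (\<integral>\<^sup>+t. indicator X (polar (s, t)) * ennreal (1/2) * indicator {0<..<2*pi} t * indicator {0<..} s \<partial>lborel) \<partial>lborel)"
  by (intro nn_integral_cong nn_integral_multc [symmetric]) measurable
 also have "\<dots> = (\<integral>\<^sup>+z. (case z of (s, t) \<Rightarrow> ennreal (1/2) * indicator {0<..} s * indicator {0<..<2*pi} t) * indicator X (polar z) \<partial>lborel)"
  using lborel.nn_integral_fst [OF Fm] unfolding lborel_prod by (simp, (intro nn_integral_cong, auto simp: mult_ac split: prod.split))
 also have "\<dots> = (\<integral>\<^sup>+z. indicator X (polar z) \<partial>polar_measure)"
  unfolding polar_measure_def
  by (subst nn_integral_density) (use dm in \<open>auto simp: borel_prod\<close>)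
 also have "\<dots> = (\<integral>\<^sup>+z. indicator (polar -` X \<inter> space polar_measure) z \<partial>polar_measure)"
  by (intro nn_integral_cong) (auto split: split_indicator)
 also have "\<dots> = emeasure (distr polar_measure borel polar) X"
  by (subst nn_integral_indicator) (auto simp: emeasure_distr)
 finally show "emeasure lborel X = emeasure (distr polar_measure borel polar) X" .
qed

lemma polar_measure_real:
 "polar_measure = density lborel (\<lambda>z. ennreal (indicator ({0<..} \<times> {0<..<2*pi}) z / 2))"
 unfolding polar_measure_def
 by (intro arg_cong [where f = "density lborel"] ext) (auto split: split_indicator simp: indicator_times)

lemma polar_weight_measurable [measurable]:
 "(\<lambda>z. indicator ({0<..} \<times> {0<..<2*pi}) z / 2 :: real) \<in> borel_measurable (borel :: (real \<times> real) measure)"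
 by (auto simp: borel_prod [symmetric] intro!: pair_measureI)

lemma integrable_polar_iff:
 fixes f :: "real \<times> real \<Rightarrow> 'b :: {banach, second_countable_topology}"
 assumes [measurable]: "f \<in> borel_measurable borel"
 shows "integrable lborel f \<longleftrightarrow>
  integrable (lborel \<Otimes>\<^sub>M lborel) (\<lambda>z. (indicator ({0<..} \<times> {0<..<2*pi}) z / 2) *\<^sub>R f (polar z))"
 apply (subst lborel_eq_distr_polar)
 apply (subst integrable_distr_eq)
  apply (simp add: polar_measure_real)
  apply simp
 apply (simp only: polar_measure_real lborel_prod)
 apply (subst integrable_density)
   apply (auto intro!: measurable_compose [OF polar_measurable])
 done

lemma integral_polar:
 fixes f :: "real \<times> real \<Rightarrow> 'b :: {banach, second_countable_topology}"
 assumes int: "integrable lborel f"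
 shows "(LINT z|lborel. f z) =
  (LINT s|lborel. (LINT t|lborel. (indicator {0<..} s * indicator {0<..<2*pi} t / 2) *\<^sub>R f (polar (s, t))))"
proof -
 from int have [measurable]: "f \<in> borel_measurable borel" by auto
 have "(LINT z|lborel. f z) = (LINT z|distr polar_measure borel polar. f z)"
  by (simp only: lborel_eq_distr_polar [symmetric])
 also have "\<dots> = (LINT z|polar_measure. f (polar z))"
  by (rule integral_distr) (simp_all add: polar_measure_def)
 also have "\<dots> = (LINT z|lborel. (indicator ({0<..} \<times> {0<..<2*pi}) z / 2) *\<^sub>R f (polar z))"
  unfolding polar_measure_real
  by (rule integral_density) (auto intro!: measurable_compose [OF polar_measurable])
 also have "\<dots> = (LINT z|(lborel \<Otimes>\<^sub>M lborel). (indicator ({0<..} \<times> {0<..<2*pi}) z / 2) *\<^sub>R f (polar z))"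
  by (simp only: lborel_prod)
 also have "\<dots> = (LINT s|lborel. (LINT t|lborel. (indicator ({0<..} \<times> {0<..<2*pi}) (s, t) / 2) *\<^sub>R f (polar (s, t))))"
  using int by (intro lborel_pair.integral_fst' [symmetric]) (simp add: integrable_polar_iff [symmetric])
 finally show ?thesis by (simp add: indicator_times)
qed

definition radius_sq :: "real \<times> real \<Rightarrow> real" where
 "radius_sq z = (fst z)^2 + (snd z)^2"

lemma radius_sq_measurable [measurable]: "radius_sq \<in> borel_measurable borel"
 unfolding radius_sq_def by (auto intro!: borel_measurable_continuous_onI continuous_intros)

lemma radius_sq_nonneg [simp]: "0 \<le> radius_sq z" by (simp add: radius_sq_def)

lemma radius_sq_polar [simp]: "0 \<le> s \<Longrightarrow> radius_sq (polar (s, t)) = s"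
 by (simp add: radius_sq_def polar_def power_mult_distrib flip: distrib_left)

lemma nn_integral_radial:
 assumes [measurable]: "g \<in> borel_measurable borel"
 shows "(\<integral>\<^sup>+z. g (radius_sq z) \<partial>lborel) = ennreal pi * (\<integral>\<^sup>+s. g s * indicator {0<..} s \<partial>lborel)"
proof -
 have "(\<integral>\<^sup>+z. g (radius_sq z) \<partial>lborel) =
  (\<integral>\<^sup>+s. (\<integral>\<^sup>+t. g (radius_sq (polar (s, t))) * ennreal (1/2) * indicator {0<..<2*pi} t \<partial>lborel) * indicator {0<..} s \<partial>lborel)"
  by (rule nn_integral_polar) measurable
 also have "\<dots> = (\<integral>\<^sup>+s. ennreal pi * (g s * indicator {0<..} s) \<partial>lborel)"
 proof (rule nn_integral_cong)
  fix s :: real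
  have "ennreal (1/2) * ennreal (2 * pi) = ennreal (1/2 * (2 * pi))" by (rule ennreal_mult [symmetric]) auto
  then have e: "ennreal (1/2) * ennreal (2 * pi) = ennreal pi" by simp
  show "(\<integral>\<^sup>+t. g (radius_sq (polar (s, t))) * ennreal (1/2) * indicator {0<..<2*pi} t \<partial>lborel) * indicator {0<..} s = ennreal pi * (g s * indicator {0<..} s)"
  proof (cases "s > 0")
   case True
   then have r: "radius_sq (polar (s, t)) = s" for t by simp
   have "(\<integral>\<^sup>+t. g s * ennreal (1/2) * indicator {0<..<2*pi} t \<partial>lborel) = g s * ennreal (1/2) * emeasure lborel {0<..<2*pi}"
    by (rule nn_integral_cmult_indicator) simp
   also have "emeasure lborel {0<..<2*pi} = ennreal (2 * pi)" by simp
   also have "g s * ennreal (1/2) * ennreal (2 * pi) = ennreal pi * g s" unfolding mult.assoc e by (rule mult.commute)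
   finally show ?thesis using True unfolding r by simp
  qed simp
 qed
 also have "\<dots> = ennreal pi * (\<integral>\<^sup>+s. g s * indicator {0<..} s \<partial>lborel)"
  by (rule nn_integral_cmult) measurable
 finally show ?thesis .
qed

lemma radial_integral:
 fixes g :: "real \<Rightarrow> real"
 assumes [measurable]: "g \<in> borel_measurable borel" and int: "set_integrable lborel {0<..} g"
 shows "integrable lborel (\<lambda>z. g (radius_sq z))"
  and "(LINT z|lborel. g (radius_sq z)) = pi * (LINT s:{0<..}|lborel. g s)"
proof -
 have fin: "(\<integral>\<^sup>+s. ennreal \<bar>g s\<bar> * indicator {0<..} s \<partial>lborel) < \<infinity>"
 proof -
  have "(\<integral>\<^sup>+s. ennreal \<bar>g s\<bar> * indicator {0<..} s \<partial>lborel) = (\<integral>\<^sup>+s. ennreal (norm (indicator {0<..} s *\<^sub>R g s)) \<partial>lborel)"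
   by (intro nn_integral_cong) (auto split: split_indicator)
  then show ?thesis using int unfolding set_integrable_def integrable_iff_bounded by simp
 qed
 show I: "integrable lborel (\<lambda>z. g (radius_sq z))"
  unfolding integrable_iff_bounded
 proof
  show "(\<integral>\<^sup>+z. ennreal (norm (g (radius_sq z))) \<partial>lborel) < \<infinity>"
   using nn_integral_radial [of "\<lambda>s. ennreal \<bar>g s\<bar>"] fin by (auto simp: ennreal_mult_less_top)
 qed measurable
 have "(LINT z|lborel. g (radius_sq z)) = (LINT s|lborel. pi * (indicator {0<..} s * g s))"
  unfolding integral_polar [OF I]
 proof (rule Bochner_Integration.integral_cong [OF refl])
  fix s :: real
  show "(LINT t|lborel. (indicator {0<..} s * indicator {0<..<2*pi} t / 2) *\<^sub>R g (radius_sq (polar (s, t)))) = pi * (indicator {0<..} s * g s)"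
  proof (cases "s > 0")
   case True
   have "(LINT t|lborel. (indicator {0<..} s * indicator {0<..<2*pi} t / 2) *\<^sub>R g (radius_sq (polar (s, t)))) = (LINT t|lborel. (g s / 2) * indicator {0<..<2*pi} t)"
    using True by simp
   also have "\<dots> = pi * g s" by simp
   finally show ?thesis using True by simp
  qed simp
 qed
 then show "(LINT z|lborel. g (radius_sq z)) = pi * (LINT s:{0<..}|lborel. g s)"
  by (simp add: set_lebesgue_integral_def)
qed

section \<open>Oscillatory integrals\<close>

text \<open>Integration by parts with \<open>cis y / u\<close>: since \<open>v\<close> is
  nonnegative, \<open>1 / u\<close> is monotone and its total variation telescopes to
  \<open>1 / u a - 1 / u b\<close>.\<close>

lemma van_der_Corput_first:
 fixes y u v :: "real \<Rightarrow> real"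
 assumes ab: "a \<le> b"
  and y: "\<And>t. t \<in> {a..b} \<Longrightarrow> (y has_real_derivative u t) (at t)"
  and u: "\<And>t. t \<in> {a..b} \<Longrightarrow> (u has_real_derivative v t) (at t)"
  and v: "continuous_on {a..b} v" "\<And>t. t \<in> {a..b} \<Longrightarrow> 0 \<le> v t"
  and l: "0 < l" "(\<forall>t\<in>{a..b}. l \<le> u t) \<or> (\<forall>t\<in>{a..b}. u t \<le> - l)"
 shows "norm (integral {a..b} (\<lambda>t. cis (y t))) \<le> 2 / l"
proof -
 have nz: "u t \<noteq> 0" if "t \<in> {a..b}" for t using l that by force
 have cu: "continuous_on {a..b} u" using u by (meson DERIV_isCont continuous_at_imp_continuous_on)
 have cy: "continuous_on {a..b} y" using y by (meson DERIV_isCont continuous_at_imp_continuous_on)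
 define G where "G t = cis (y t) * of_real (1 / u t)" for t
 define H where "H t = cis (y t) * of_real (v t / (u t)^2)" for t
 have cH: "continuous_on {a..b} H"
  unfolding H_def by (intro continuous_intros cy v cu) (use nz in auto)
 have cc: "continuous_on {a..b} (\<lambda>t. cis (y t))" by (intro continuous_intros cy)
 have G: "(G has_vector_derivative (\<i> * cis (y t) - H t)) (at t within {a..b})" if t: "t \<in> {a..b}" for t
 proof -
  have 1: "((\<lambda>t. cis (y t)) has_vector_derivative (\<i> * of_real (u t) * cis (y t))) (at t)"
  proof -
   have "((\<lambda>t. \<i> * of_real (y t)) has_vector_derivative \<i> * of_real (u t)) (at t)"
    by (intro has_vector_derivative_mult_right has_vector_derivative_of_real y t)
   from field_vector_diff_chain_at [OF this DERIV_exp] show ?thesis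
    by (simp add: o_def cis_conv_exp)
  qed
  have "((\<lambda>t. 1 / u t) has_real_derivative - (v t / (u t)^2)) (at t)"
   using u [OF t] nz [OF t] by (auto intro!: derivative_eq_intros simp: power2_eq_square)
  then have 2: "((\<lambda>t. of_real (1 / u t)) has_vector_derivative (of_real (- (v t / (u t)^2)) :: complex)) (at t)"
   by (rule has_vector_derivative_of_real)
  have "(G has_vector_derivative (cis (y t) * of_real (- (v t / (u t)^2)) + \<i> * of_real (u t) * cis (y t) * of_real (1 / u t))) (at t)"
   unfolding G_def by (rule has_vector_derivative_mult [OF 1 2])
  also have "cis (y t) * of_real (- (v t / (u t)^2)) + \<i> * of_real (u t) * cis (y t) * of_real (1 / u t) = \<i> * cis (y t) - H t"
   using nz [OF t] by (simp add: H_def)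
  finally show ?thesis by (rule has_vector_derivative_at_within)
 qed
 have "((\<lambda>t. \<i> * cis (y t) - H t) has_integral (G b - G a)) {a..b}"
  by (rule fundamental_theorem_of_calculus [OF ab G])
 then have "((\<lambda>t. \<i> * cis (y t) - H t + H t) has_integral (G b - G a + integral {a..b} H)) {a..b}"
  by (intro has_integral_add integrable_integral integrable_continuous_real cH)
 then have "((\<lambda>t. \<i> * cis (y t)) has_integral (G b - G a + integral {a..b} H)) {a..b}" by simp
 then have I: "\<i> * integral {a..b} (\<lambda>t. cis (y t)) = G b - G a + integral {a..b} H"
  by (metis integral_mult_right integral_unique)
 have nH: "norm (integral {a..b} H) \<le> integral {a..b} (\<lambda>t. v t / (u t)^2)"
 proof (rule integral_norm_bound_integral)
  show "H integrable_on {a..b}" by (rule integrable_continuous_real [OF cH])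
  show "(\<lambda>t. v t / (u t)^2) integrable_on {a..b}"
   by (intro integrable_continuous_real continuous_intros v cu) (use nz in auto)
  show "norm (H t) \<le> v t / (u t)^2" if "t \<in> {a..b}" for t
   using v(2) [OF that] by (simp add: H_def norm_mult norm_divide norm_power)
 qed
 have "((\<lambda>t. v t / (u t)^2) has_integral (- (1 / u b) - - (1 / u a))) {a..b}"
 proof (rule fundamental_theorem_of_calculus [OF ab])
  fix t assume t: "t \<in> {a..b}"
  have "((\<lambda>t. - (1 / u t)) has_real_derivative (v t / (u t)^2)) (at t)"
   using u [OF t] nz [OF t] by (auto intro!: derivative_eq_intros simp: power2_eq_square)
  then show "((\<lambda>t. - (1 / u t)) has_vector_derivative (v t / (u t)^2)) (at t within {a..b})"
   unfolding has_real_derivative_iff_has_vector_derivative by (rule has_vector_derivative_at_within)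
 qed
 then have vI: "integral {a..b} (\<lambda>t. v t / (u t)^2) = 1 / u a - 1 / u b" by auto
 have "norm (integral {a..b} (\<lambda>t. cis (y t))) = norm (\<i> * integral {a..b} (\<lambda>t. cis (y t)))"
  by (simp add: norm_mult)
 also have "\<dots> \<le> 1 / \<bar>u b\<bar> + 1 / \<bar>u a\<bar> + (1 / u a - 1 / u b)"
  using norm_triangle_ineq [of "G b - G a" "integral {a..b} H"] norm_triangle_ineq4 [of "G b" "G a"] nH vI unfolding I by (simp add: G_def norm_divide)
 \<comment> \<open>One endpoint term cancels against the variation and the other doubles: the sum is
   \<open>2 / u a\<close> for positive \<open>u\<close> and \<open>- 2 / u b\<close> for negative
   \<open>u\<close>.\<close>
 also have "\<dots> \<le> 2 / l"
  using l(2)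
 proof
  assume "\<forall>t\<in>{a..b}. l \<le> u t"
  then have "l \<le> u a" "l \<le> u b" using ab by auto
  moreover then have "1 / u a \<le> 1 / l" using l(1) by (intro frac_le) auto
  ultimately show ?thesis using l(1) by simp
 next
  assume "\<forall>t\<in>{a..b}. u t \<le> - l"
  then have "u a \<le> - l" "u b \<le> - l" using ab by auto
  moreover then have "1 / (- u b) \<le> 1 / l" using l(1) by (intro frac_le) auto
  ultimately show ?thesis using l(1) by simp
 qed
 finally show ?thesis .
qed

text \<open>
 A function of modulus at most one is integrated over the interval of length \<open>2 * d\<close> around the
 zero of \<open>g\<close> trivially, and the hypothesis takes care of the two remaining pieces.
\<close>

lemma integral_split_at_zero:
 fixes f :: "real \<Rightarrow> complex" and g :: "real \<Rightarrow> real"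
 assumes ab: "a \<le> b" and f: "continuous_on {a..b} f" "\<And>t. t \<in> {a..b} \<Longrightarrow> norm (f t) \<le> 1"
  and g: "continuous_on {a..b} g" "\<And>s t. a \<le> s \<Longrightarrow> s \<le> t \<Longrightarrow> t \<le> b \<Longrightarrow> k * (t - s) \<le> g t - g s"
  and kd: "0 < k" "0 < d" and B: "0 \<le> B"
  and pos: "\<And>p q. a \<le> p \<Longrightarrow> p \<le> q \<Longrightarrow> q \<le> b \<Longrightarrow> \<forall>t\<in>{p..q}. k * d \<le> g t \<Longrightarrow> norm (integral {p..q} f) \<le> B"
  and neg: "\<And>p q. a \<le> p \<Longrightarrow> p \<le> q \<Longrightarrow> q \<le> b \<Longrightarrow> \<forall>t\<in>{p..q}. g t \<le> - (k * d) \<Longrightarrow> norm (integral {p..q} f) \<le> B"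
 shows "norm (integral {a..b} f) \<le> 2 * B + 2 * d"
proof -
 \<comment> \<open>\<open>c\<close> is the zero of \<open>g\<close> or, when \<open>g\<close> does
   not change sign, the endpoint at which it is closest to 0; on either side \<open>g\<close> moves
   away from 0 at least linearly.\<close>
 obtain c where c: "a \<le> c" "c \<le> b" and cpos: "\<And>t. c < t \<Longrightarrow> t \<le> b \<Longrightarrow> k * (t - c) \<le> g t"
  and cneg: "\<And>t. a \<le> t \<Longrightarrow> t < c \<Longrightarrow> g t \<le> - (k * (c - t))"
 proof (cases "0 \<le> g a")
  case True
  show ?thesis
  proof (rule that [of a])
   show "k * (t - a) \<le> g t" if "a < t" "t \<le> b" for t using g(2) [of a t] True that by simp
  qed (use ab in auto)
 next
  case False
  show ?thesis
  proof (cases "g b \<le> 0")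
   case True
   show ?thesis
    proof (rule that [of b])
    show "g t \<le> - (k * (b - t))" if "a \<le> t" "t < b" for t using g(2) [of t b] True that by simp
   qed (use ab in auto)
  next
   case False
   with \<open>\<not> 0 \<le> g a\<close> obtain c where "a \<le> c" "c \<le> b" "g c = 0"
    using IVT' [of g a 0 b] g(1) ab by auto
   then show ?thesis using g(2) [of c] g(2) [of _ c] by (intro that [of c]) force+
  qed
 qed
 define p where "p = max a (c - d)"
 define q where "q = min b (c + d)"
 have pq: "a \<le> p" "p \<le> c" "c \<le> q" "q \<le> b" "q - p \<le> 2 * d"
  using c kd by (auto simp: p_def q_def)
 have fi: "f integrable_on {x..y}" if "a \<le> x" "y \<le> b" for x y
  using f(1) that by (intro integrable_continuous_real) (auto intro: continuous_on_subset)
 have eq: "integral {a..b} f = integral {a..p} f + integral {p..q} f + integral {q..b} f"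
  using pq c by (simp add: Henstock_Kurzweil_Integration.integral_combine fi)
 have "norm (integral {a..b} f) \<le> norm (integral {a..p} f) + norm (integral {p..q} f) + norm (integral {q..b} f)"
  unfolding eq using norm_triangle_ineq [of "integral {a..p} f + integral {p..q} f" "integral {q..b} f"]
   norm_triangle_ineq [of "integral {a..p} f" "integral {p..q} f"] by linarith
 moreover have "norm (integral {p..q} f) \<le> 2 * d"
 proof -
  have "norm (integral {p..q} f) \<le> integral {p..q} (\<lambda>_. 1)"
   using pq by (intro integral_norm_bound_integral fi f(2)) auto
  also have "\<dots> = q - p" using pq by simp
  finally show ?thesis using pq by simp
 qed
 moreover have "norm (integral {a..p} f) \<le> B"
 proof (cases "a = p")
  case False
  then have p: "p = c - d" by (auto simp: p_def)
  show ?thesis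
  proof (rule neg)
   show "\<forall>t\<in>{a..p}. g t \<le> - (k * d)"
   proof
    fix t assume t: "t \<in> {a..p}"
    have "k * d \<le> k * (c - t)" using t p kd by simp
    then show "g t \<le> - (k * d)" using cneg [of t] t pq p kd by (simp add: algebra_simps)
   qed
  qed (use pq c in auto)
 qed (use B in simp)
 moreover have "norm (integral {q..b} f) \<le> B"
 proof (cases "q = b")
  case False
  then have q: "q = c + d" by (auto simp: q_def)
  show ?thesis
  proof (rule pos)
   show "\<forall>t\<in>{q..b}. k * d \<le> g t"
   proof
    fix t assume t: "t \<in> {q..b}"
    have "k * d \<le> k * (t - c)" using t q kd by simp
    then show "k * d \<le> g t" using cpos [of t] t pq q kd by (simp add: algebra_simps)
   qed
  qed (use pq c in auto)
 qed (use B in simp)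
 ultimately show ?thesis by linarith
qed

lemma derivative_ge_imp_diff_ge:
 fixes g :: "real \<Rightarrow> real"
 assumes "\<And>t. t \<in> {a..b} \<Longrightarrow> (g has_real_derivative g' t) (at t)" "\<And>t. t \<in> {a..b} \<Longrightarrow> k \<le> g' t"
  and "a \<le> s" "s \<le> t" "t \<le> b"
 shows "k * (t - s) \<le> g t - g s"
proof -
 have "g s - k * s \<le> g t - k * t"
 proof (rule DERIV_nonneg_imp_nondecreasing [OF \<open>s \<le> t\<close>])
  fix x assume "s \<le> x" "x \<le> t"
  then have x: "x \<in> {a..b}" using assms by auto
  show "\<exists>y. ((\<lambda>x. g x - k * x) has_real_derivative y) (at x) \<and> 0 \<le> y"
   using assms(1) [OF x] assms(2) [OF x] by (auto intro!: derivative_eq_intros)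
 qed
 then show ?thesis by (simp add: algebra_simps)
qed

lemma van_der_Corput_second:
 fixes y u v :: "real \<Rightarrow> real"
 assumes ab: "a \<le> b"
  and y: "\<And>t. t \<in> {a..b} \<Longrightarrow> (y has_real_derivative u t) (at t)"
  and u: "\<And>t. t \<in> {a..b} \<Longrightarrow> (u has_real_derivative v t) (at t)"
  and v: "continuous_on {a..b} v" "\<And>t. t \<in> {a..b} \<Longrightarrow> m \<le> v t"
  and m: "0 < m"
 shows "norm (integral {a..b} (\<lambda>t. cis (y t))) \<le> 6 / sqrt m"
proof -
 \<comment> \<open>Balances the first-derivative bound \<open>2 / (m * d)\<close> outside the cut
   against the length \<open>2 * d\<close> inside.\<close>
 define d where "d = 1 / sqrt m"
 have d: "0 < d" "m * d = sqrt m" using m by (simp_all add: d_def real_div_sqrt)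
 have cu: "continuous_on {a..b} u" using u by (meson DERIV_isCont continuous_at_imp_continuous_on)
 have cy: "continuous_on {a..b} y" using y by (meson DERIV_isCont continuous_at_imp_continuous_on)
 have first: "norm (integral {p..q} (\<lambda>t. cis (y t))) \<le> 2 / (m * d)"
  if "a \<le> p" "p \<le> q" "q \<le> b" "(\<forall>t\<in>{p..q}. m * d \<le> u t) \<or> (\<forall>t\<in>{p..q}. u t \<le> - (m * d))" for p q
 proof (rule van_der_Corput_first [where u = u and v = v])
  show "continuous_on {p..q} v" using v(1) that by (auto intro: continuous_on_subset)
  show "0 \<le> v t" if "t \<in> {p..q}" for t using v(2) [of t] m that \<open>a \<le> p\<close> \<open>q \<le> b\<close> by auto
 qed (use that y u m d in auto)
 have "norm (integral {a..b} (\<lambda>t. cis (y t))) \<le> 2 * (2 / (m * d)) + 2 * d"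
 proof (rule integral_split_at_zero [where g = u and k = m])
  show "continuous_on {a..b} (\<lambda>t. cis (y t))" by (intro continuous_intros cy)
  show "m * (t - s) \<le> u t - u s" if "a \<le> s" "s \<le> t" "t \<le> b" for s t
   using u v(2) that by (rule derivative_ge_imp_diff_ge)
 qed (use first ab cu m d in \<open>simp_all\<close>)
 also have "\<dots> = 6 / sqrt m" using d by (simp add: d_def)
 finally show ?thesis .
qed

theorem van_der_Corput_third:
 fixes y u v w :: "real \<Rightarrow> real"
 assumes ab: "a \<le> b"
  and y: "\<And>t. t \<in> {a..b} \<Longrightarrow> (y has_real_derivative u t) (at t)"
  and u: "\<And>t. t \<in> {a..b} \<Longrightarrow> (u has_real_derivative v t) (at t)"
  and v: "\<And>t. t \<in> {a..b} \<Longrightarrow> (v has_real_derivative w t) (at t)"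
  and w: "\<And>t. t \<in> {a..b} \<Longrightarrow> l \<le> w t"
  and l: "0 < l"
 shows "norm (integral {a..b} (\<lambda>t. cis (y t))) \<le> 14 / l powr (1/3)"
proof -
 \<comment> \<open>Balances \<open>6 / sqrt (l * d)\<close> against \<open>d\<close>: both are
   multiples of \<open>l powr (- 1/3)\<close>, and \<open>14 = 2 * 6 + 2\<close>.\<close>
 define d where "d = 1 / l powr (1/3)"
 have d: "0 < d" using l by (simp add: d_def)
 have "sqrt (l * d) = (l powr (2/3)) powr (1/2)" using l powr_diff [of l 1 "1/3"] by (simp add: d_def powr_half_sqrt)
 then have sq: "sqrt (l * d) = l powr (1/3)" by (simp add: powr_powr)
 have cv: "continuous_on {a..b} v" using v by (meson DERIV_isCont continuous_at_imp_continuous_on)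
 have cy: "continuous_on {a..b} y" using y by (meson DERIV_isCont continuous_at_imp_continuous_on)
 have 1: "norm (integral {p..q} (\<lambda>t. cis (y t))) \<le> 6 / sqrt (l * d)"
  if "a \<le> p" "p \<le> q" "q \<le> b" "\<forall>t\<in>{p..q}. l * d \<le> v t" for p q
  by (rule van_der_Corput_second [where u = u and v = v])
    (use that y u l d cv in \<open>auto intro: continuous_on_subset\<close>)
 \<comment> \<open>Where \<open>v\<close> is negative the second-derivative bound is applied to
   \<open>- y\<close>, which only conjugates the integral.\<close>
 have 2: "norm (integral {p..q} (\<lambda>t. cis (y t))) \<le> 6 / sqrt (l * d)"
  if that: "a \<le> p" "p \<le> q" "q \<le> b" "\<forall>t\<in>{p..q}. v t \<le> - (l * d)" for p q
 proof -
  have "norm (integral {p..q} (\<lambda>t. cis (- y t))) \<le> 6 / sqrt (l * d)"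
  proof (rule van_der_Corput_second [where u = "\<lambda>t. - u t" and v = "\<lambda>t. - v t"])
   show "((\<lambda>t. - y t) has_real_derivative - u t) (at t)" if "t \<in> {p..q}" for t
    using y that \<open>a \<le> p\<close> \<open>q \<le> b\<close> by (intro DERIV_minus) auto
   show "((\<lambda>t. - u t) has_real_derivative - v t) (at t)" if "t \<in> {p..q}" for t
    using u that \<open>a \<le> p\<close> \<open>q \<le> b\<close> by (intro DERIV_minus) auto
   show "continuous_on {p..q} (\<lambda>t. - v t)"
    using cv \<open>a \<le> p\<close> \<open>q \<le> b\<close> by (intro continuous_intros) (auto intro: continuous_on_subset)
   show "l * d \<le> - v t" if "t \<in> {p..q}" for t using \<open>\<forall>t\<in>{p..q}. v t \<le> - (l * d)\<close> that by force
  qed (use that l d in auto)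
  also have "(\<lambda>t. cis (- y t)) = (\<lambda>t. cnj (cis (y t)))" by (simp add: cis_cnj)
  also have "integral {p..q} (\<lambda>t. cnj (cis (y t))) = cnj (integral {p..q} (\<lambda>t. cis (y t)))"
   by (rule integral_cnj [symmetric])
  finally show ?thesis by simp
 qed
 have "norm (integral {a..b} (\<lambda>t. cis (y t))) \<le> 2 * (6 / sqrt (l * d)) + 2 * d"
 proof (rule integral_split_at_zero [where g = v and k = l])
  show "continuous_on {a..b} (\<lambda>t. cis (y t))" by (intro continuous_intros cy)
  show "l * (t - s) \<le> v t - v s" if "a \<le> s" "s \<le> t" "t \<le> b" for s t
   using v w that by (rule derivative_ge_imp_diff_ge)
 qed (use 1 2 ab cv l d in \<open>simp_all\<close>)
 also have "\<dots> = 14 / l powr (1/3)" by (simp only: sq) (simp add: d_def)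
 finally show ?thesis .
qed

section \<open>Laguerre functions\<close>

lemma integral_cis_nat:
 "integral {0..2*pi} (\<lambda>t. cis (of_int k * t)) = (if k = 0 then of_real (2 * pi) else 0)"
proof (cases "k = 0")
 case False
 have "((\<lambda>t. cis (of_int k * t)) has_integral (cis (of_int k * (2*pi)) / (\<i> * of_int k) - cis (of_int k * 0) / (\<i> * of_int k))) {0..2*pi}"
 proof (rule fundamental_theorem_of_calculus)
  fix x :: real
  have "((\<lambda>t. \<i> * of_real (of_int k * t)) has_vector_derivative \<i> * of_real (of_int k)) (at x)"
   by (intro has_vector_derivative_mult_right has_vector_derivative_of_real) (auto intro!: derivative_eq_intros)
  from field_vector_diff_chain_at [OF this DERIV_exp]
  have "((\<lambda>t. cis (of_int k * t)) has_vector_derivative \<i> * of_int k * cis (of_int k * x)) (at x)"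
   by (simp add: o_def cis_conv_exp)
  then have "((\<lambda>t. cis (of_int k * t) / (\<i> * of_int k)) has_vector_derivative \<i> * of_int k * cis (of_int k * x) / (\<i> * of_int k)) (at x)"
   by (rule has_vector_derivative_divide)
  then have "((\<lambda>t. cis (of_int k * t) / (\<i> * of_int k)) has_vector_derivative cis (of_int k * x)) (at x)"
   using False by simp
  then show "((\<lambda>t. cis (of_int k * t) / (\<i> * of_int k)) has_vector_derivative cis (of_int k * x)) (at x within {0..2*pi})"
   by (rule has_vector_derivative_at_within)
 qed simp
 then show ?thesis using False cis_multiple_2pi [of "of_int k"] by (simp add: mult.commute integral_unique)
qed (simp add: scaleR_conv_of_real)

text \<open>Absolute summability at radius \<open>r\<close> makes the convergence uniform in
  \<open>v\<close>, so the coefficient can be read off term by term.\<close>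

lemma fourier_coeff_power_series:
 fixes a :: "nat \<Rightarrow> complex"
 assumes sm: "summable (\<lambda>j. norm (a j) * r ^ j)" and r: "0 \<le> r"
  and f: "\<And>v. (\<lambda>j. a j * (of_real r * cis v) ^ j) sums f v"
 shows "((\<lambda>v. f v * cis (- (real m * v))) has_integral (2 * pi * a m * of_real (r ^ m))) {0..2*pi}"
proof -
 define F where "F N v = (\<Sum>j<N. a j * (of_real r * cis v) ^ j * cis (- (real m * v)))" for N v
 have u: "uniform_limit {0..2*pi} F (\<lambda>v. \<Sum>j. a j * (of_real r * cis v) ^ j * cis (- (real m * v))) sequentially"
  unfolding F_def
  by (rule Weierstrass_m_test [OF _ sm]) (simp add: norm_mult norm_power r)
 have eq: "(\<Sum>j. a j * (of_real r * cis v) ^ j * cis (- (real m * v))) = f v * cis (- (real m * v))" for v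
  by (rule sums_unique [symmetric], rule sums_mult2 [OF f])
 have c: "continuous_on {0..2*pi} (F N)" for N
  unfolding F_def by (intro continuous_intros)
 from uniform_limit_integral [OF u c] obtain I J
  where I: "\<And>N. (F N has_integral I N) {0..2*pi}" and J: "((\<lambda>v. f v * cis (- (real m * v))) has_integral J) {0..2*pi}"
   and lim: "I \<longlonglongrightarrow> J" unfolding eq by auto
 have "I N = 2 * pi * a m * of_real (r ^ m)" if N: "N > m" for N
 proof -
  have t: "a j * (of_real r * cis v) ^ j * cis (- (real m * v)) = a j * of_real (r ^ j) * cis (of_int (int j - int m) * v)" for j v
  proof -
   have "cis v ^ j * cis (- (real m * v)) = cis (of_int (int j - int m) * v)"
    unfolding Complex.DeMoivre cis_mult by (simp add: left_diff_distrib)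
   then show ?thesis by (simp add: power_mult_distrib)
  qed
  have "I N = integral {0..2*pi} (F N)" by (rule integral_unique [OF I, symmetric])
  also have "\<dots> = (\<Sum>j<N. integral {0..2*pi} (\<lambda>v. a j * (of_real r * cis v) ^ j * cis (- (real m * v))))"
   unfolding F_def
   by (rule integral_sum) (auto intro!: integrable_continuous_real continuous_intros)
  also have "\<dots> = (\<Sum>j<N. if j = m then 2 * pi * a m * of_real (r ^ m) else 0)"
  proof (rule sum.cong [OF refl])
   fix j
   show "integral {0..2*pi} (\<lambda>v. a j * (of_real r * cis v) ^ j * cis (- (real m * v))) = (if j = m then 2 * pi * a m * of_real (r ^ m) else 0)"
    unfolding t integral_mult_right integral_cis_nat by simp
  qed
  also have "\<dots> = 2 * pi * a m * of_real (r ^ m)" using N by simp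
  finally show ?thesis .
 qed
 then have "I \<longlonglongrightarrow> 2 * pi * a m * of_real (r ^ m)"
  by (intro tendsto_eventually) (auto simp: eventually_sequentially intro!: exI [of _ "Suc m"])
 with lim have "J = 2 * pi * a m * of_real (r ^ m)" by (rule LIMSEQ_unique)
 with J show ?thesis by simp
qed

text \<open>The Laguerre polynomial with upper index \<open>d\<close>; \<open>lag1\<close> is the one with upper index \<open>-1\<close> and degree \<open>Suc m\<close>.\<close>

definition lag :: "nat \<Rightarrow> nat \<Rightarrow> real \<Rightarrow> real" where
 "lag m d x = (\<Sum>i\<le>m. (-1) ^ i * real ((m + d) choose (m - i)) * x ^ i / fact i)"

definition lag1 :: "nat \<Rightarrow> real \<Rightarrow> real" where
 "lag1 m x = (\<Sum>i\<le>m. (-1) ^ Suc i * real (m choose i) * x ^ Suc i / fact (Suc i))"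

lemma lag_0_conv:
 assumes "m \<le> N" shows "lag m 0 x = (\<Sum>i\<le>N. (-1) ^ i * real (m choose i) * x ^ i / fact i)"
proof -
 have "lag m 0 x = (\<Sum>i\<le>m. (-1) ^ i * real (m choose i) * x ^ i / fact i)"
  unfolding lag_def by (rule sum.cong) (auto simp: binomial_symmetric [symmetric])
 also have "\<dots> = (\<Sum>i\<le>N. (-1) ^ i * real (m choose i) * x ^ i / fact i)"
  using assms by (intro sum.mono_neutral_left) auto
 finally show ?thesis .
qed

lemma lag1_eq: "lag1 m x = lag (Suc m) 0 x - lag m 0 x"
proof -
 have "lag (Suc m) 0 x - lag m 0 x = (\<Sum>i\<le>Suc m. (-1) ^ i * (real (Suc m choose i) - real (m choose i)) * x ^ i / fact i)"
  by (simp only: lag_0_conv [of m "Suc m"] lag_0_conv [of "Suc m" "Suc m"] le_refl le_SucI sum_subtractf [symmetric])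
    (simp add: algebra_simps diff_divide_distrib)
 also have "\<dots> = lag1 m x" unfolding lag1_def by (subst sum.atMost_Suc_shift, simp)
 finally show ?thesis by simp
qed

lemma DERIV_lag1: "(lag1 m has_real_derivative - lag m 0 x) (at x)"
proof -
 have "((\<lambda>x. lag1 m x) has_real_derivative (\<Sum>i\<le>m. (-1) ^ Suc i * real (m choose i) * (real (Suc i) * x ^ i) / fact (Suc i))) (at x)"
  unfolding lag1_def
  by (intro DERIV_sum DERIV_cdivide DERIV_cmult) (use DERIV_pow [of "Suc _"] in simp)
 then show ?thesis unfolding lag_0_conv [OF le_refl] sum_negf [symmetric] by (simp add: field_simps del: of_nat_Suc)
qed

text \<open>Comparison of the coefficients of \<open>t i\<close>. Multiplication by \<open>x\<close>
  shifts the index, since \<open>x * t i = - (i + 1) * t (i + 1)\<close>; what remains is the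
  binomial identity \<open>co\<close>.\<close>

lemma lag_0_recurrence:
 "real (Suc (Suc m)) * lag (Suc (Suc m)) 0 x = (2 * real m + 3 - x) * lag (Suc m) 0 x - real (Suc m) * lag m 0 x"
proof -
 define N where "N = Suc (Suc m)"
 define t where "t i = (-1) ^ i * x ^ i / (fact i :: real)" for i
 have e: "lag k 0 x = (\<Sum>i\<le>N. real (k choose i) * t i)" if "k \<le> N" for k
  using lag_0_conv [OF that, of x] by (simp add: t_def mult_ac)
 have "x * lag (Suc m) 0 x = (\<Sum>i\<le>Suc m. real (Suc m choose i) * (x * t i))"
  using lag_0_conv [of "Suc m" "Suc m" x] by (simp add: t_def sum_distrib_left mult_ac del: sum.atMost_Suc)
 also have "\<dots> = (\<Sum>i\<le>Suc m. - (real (Suc i) * real (Suc m choose i) * t (Suc i)))"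
 proof (intro sum.cong refl)
  fix i
  show "real (Suc m choose i) * (x * t i) = - (real (Suc i) * real (Suc m choose i) * t (Suc i))"
   unfolding t_def fact_Suc by simp
 qed
 also have "\<dots> = (\<Sum>i\<le>N. - (real i * real (Suc m choose (i - 1)) * t i))"
  unfolding N_def by (subst (2) sum.atMost_Suc_shift) simp
 finally have x: "x * lag (Suc m) 0 x = (\<Sum>i\<le>N. - (real i * real (Suc m choose (i - 1)) * t i))" .
 have co: "real N * real (N choose i) = (2 * real m + 3) * real (Suc m choose i) + real i * real (Suc m choose (i - 1)) - real (Suc m) * real (m choose i)" for i
 proof (cases i)
  case 0 then show ?thesis by (simp add: N_def)
 next
  case (Suc j)
  have 1: "real (Suc j) * real (Suc m choose Suc j) = real (Suc m) * real (m choose j)"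
   using Suc_times_binomial [of j m] by (metis of_nat_mult)
  have 4: "real (Suc j) * real (N choose Suc j) = real N * real (Suc m choose j)"
   unfolding N_def using Suc_times_binomial [of j "Suc m"] by (metis of_nat_mult)
  show ?thesis using 1 4 unfolding Suc diff_Suc_1 by (simp add: N_def algebra_simps)
 qed
 have "real N * lag N 0 x = (\<Sum>i\<le>N. (real N * real (N choose i)) * t i)"
  by (simp only: e [OF le_refl] sum_distrib_left mult.assoc)
 also have "\<dots> = (\<Sum>i\<le>N. (2 * real m + 3) * (real (Suc m choose i) * t i) - (- (real i * real (Suc m choose (i - 1)) * t i)) - real (Suc m) * (real (m choose i) * t i))"
  unfolding co by (intro sum.cong refl) (simp add: algebra_simps)
 also have "\<dots> = (2 * real m + 3) * (\<Sum>i\<le>N. real (Suc m choose i) * t i) - (\<Sum>i\<le>N. - (real i * real (Suc m choose (i - 1)) * t i)) - real (Suc m) * (\<Sum>i\<le>N. real (m choose i) * t i)"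
  by (simp only: sum_subtractf sum_distrib_left)
 also have "\<dots> = (2 * real m + 3) * lag (Suc m) 0 x - x * lag (Suc m) 0 x - real (Suc m) * lag m 0 x"
  using e [of "Suc m"] e [of m] by (simp only: x) (simp add: N_def)
 finally show ?thesis by (simp add: N_def left_diff_distrib)
qed

lemma lag_0_0 [simp]: "lag 0 d x = 1" by (simp add: lag_def)

lemma lag_1_0: "lag (Suc 0) 0 x = 1 - x" by (simp add: lag_def)

text \<open>Beyond the oscillatory range the three-term recurrence preserves positivity and growth.
  With \<open>x = 2 * s\<close> this gives the sign of the Wigner function of the
  \<open>m\<close>-th Fock state far from the origin.\<close>

lemma alternating_lag_mono:
 assumes "x \<ge> 4 * real m + 2"
 shows "0 < (-1) ^ m * lag m 0 x \<and> (-1) ^ m * lag m 0 x \<le> (-1) ^ Suc m * lag (Suc m) 0 x"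
 using assms
proof (induction m)
 case 0 then show ?case by (simp add: lag_1_0)
next
 case (Suc m)
 define a where "a k = (-1) ^ k * lag k 0 x" for k
 have IH: "0 < a m" "a m \<le> a (Suc m)" using Suc by (auto simp: a_def)
 have "real (Suc (Suc m)) * a (Suc (Suc m)) = (-1) ^ m * (real (Suc (Suc m)) * lag (Suc (Suc m)) 0 x)"
  by (simp add: a_def)
 also have "\<dots> = (x - 2 * real m - 3) * a (Suc m) - real (Suc m) * a m"
  unfolding lag_0_recurrence by (simp add: a_def algebra_simps)
 also have "\<dots> \<ge> (x - 2 * real m - 3) * a (Suc m) - real (Suc m) * a (Suc m)" using IH by simp
 finally have "(x - 3 * real m - 4) * a (Suc m) \<le> real (Suc (Suc m)) * a (Suc (Suc m))"
  by (simp add: algebra_simps)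
 moreover have "real (Suc (Suc m)) * a (Suc m) \<le> (x - 3 * real m - 4) * a (Suc m)" using Suc.prems IH by simp
 ultimately have "real (Suc (Suc m)) * a (Suc m) \<le> real (Suc (Suc m)) * a (Suc (Suc m))" by linarith
 then show ?case using IH by ((simp del: of_nat_Suc), (simp add: a_def))
qed

text \<open>The generating function \<open>exp (- x t / (1 - t))\<close> of the differences of consecutive Laguerre polynomials.\<close>

definition lagdiff :: "real \<Rightarrow> nat \<Rightarrow> real" where
 "lagdiff x n = (case n of 0 \<Rightarrow> 1 | Suc m \<Rightarrow> lag1 m x)"

lemma lagdiff_recurrence:
 "real (Suc (Suc n)) * lagdiff x (Suc (Suc n)) = (2 * real (Suc n) - x) * lagdiff x (Suc n) - real n * lagdiff x n"
proof (cases n)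
 case 0
 show ?thesis using lag_0_recurrence [of 0 x] 0 by (simp add: lagdiff_def lag1_eq lag_1_0 algebra_simps)
next
 case (Suc k)
 define a b c d where "a = lag k 0 x" and "b = lag (Suc k) 0 x" and "c = lag (Suc (Suc k)) 0 x" and "d = lag (Suc (Suc (Suc k))) 0 x"
 show ?thesis
  using lag_0_recurrence [of k x] lag_0_recurrence [of "Suc k" x] unfolding Suc by (simp add: lagdiff_def lag1_eq c_def d_def algebra_simps)
qed

text \<open>The function satisfies \<open>(1 - t)^2 * f' = - x * f\<close>; comparing Taylor
  coefficients in this equation gives \<open>lagdiff_recurrence\<close>, and holomorphy on the unit
  disc gives convergence.\<close>

lemma lagdiff_generating:
 fixes t :: complex
 assumes t: "norm t < 1"
 shows "(\<lambda>n. of_real (lagdiff x n) * t ^ n) sums exp (- of_real x * t / (1 - t))"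
proof -
 define f :: "complex \<Rightarrow> complex" where "f t = exp (- of_real x * t / (1 - t))" for t
 have df: "(f has_field_derivative (- of_real x / (1 - z)^2 * f z)) (at z)" if "norm z < 1" for z
 proof -
  have "z \<noteq> 1" using that by auto
  then show ?thesis unfolding f_def
   by (auto intro!: derivative_eq_intros simp: field_simps power2_eq_square)
 qed
 have hol: "f holomorphic_on ball 0 1"
  by (rule holomorphic_onI, rule field_differentiable_at_within) (use df field_differentiable_def in auto)
 define F where "F = fps_expansion f 0"
 have F: "f has_fps_expansion F"
  unfolding F_def by (rule has_fps_expansion_fps_expansion [OF _ _ hol]) auto
 have ode: "deriv f z * (1 - z)^2 = - of_real x * f z" if "norm z < 1" for z
  using that DERIV_imp_deriv [OF df [OF that]] by auto
 have "(\<lambda>z. deriv f z * (1 - z)^2) has_fps_expansion fps_deriv F * (1 - fps_X)^2"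
  by (intro fps_expansion_intros F)
 moreover have "(\<lambda>z. - of_real x * f z) has_fps_expansion fps_const (- of_real x) * F"
  by (intro fps_expansion_intros F)
 moreover have ev: "eventually (\<lambda>z. deriv f z * (1 - z)^2 = - of_real x * f z) (nhds 0)"
  using eventually_nhds_in_open [of "ball 0 1" "0::complex"] by (rule eventually_mono [OF _ _]) (use ode in auto)
 ultimately have "(\<lambda>z. - of_real x * f z) has_fps_expansion fps_deriv F * (1 - fps_X)^2"
  using has_fps_expansion_cong [OF ev refl] by blast
 then have eq: "fps_deriv F * (1 - fps_X)^2 = fps_const (- of_real x) * F"
  using \<open>(\<lambda>z. - of_real x * f z) has_fps_expansion fps_const (- of_real x) * F\<close>
  by (rule fps_expansion_unique_complex)
 have sq: "(1 - fps_X :: complex fps)^2 = 1 - fps_const 2 * fps_X + fps_X * fps_X"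
  by (simp add: power2_eq_square flip: fps_numeral_fps_const)
 have eq': "fps_deriv F - fps_const 2 * (fps_X * fps_deriv F) + fps_X * (fps_X * fps_deriv F) = fps_const (- of_real x) * F"
  using eq unfolding sq by (simp add: algebra_simps)
 have co: "F $ n = of_real (lagdiff x n)" for n
 proof (induction n rule: less_induct)
  case (less n)
  consider "n = 0" | "n = 1" | k where "n = Suc (Suc k)" by (metis One_nat_def not0_implies_Suc)
  then show ?case
  proof cases
   case 1 then show ?thesis by (simp add: F_def fps_expansion_def f_def lagdiff_def)
  next
   case 2
   show ?thesis using arg_cong [OF eq', of "\<lambda>G :: complex fps. G $ 0"] 2 less [of 0] by (simp add: lagdiff_def lag1_def)
  next
   case (3 k)
   have "of_nat (k + 2) * F $ (k + 2) = (2 * of_nat (k + 1) - of_real x) * F $ (k + 1) - of_nat k * F $ k"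
    using arg_cong [OF eq', of "\<lambda>G :: complex fps. G $ (Suc k)"] by (simp add: algebra_simps split: if_splits)
   also have "\<dots> = of_real (real (k + 2) * lagdiff x (k + 2))"
    using less [of "k + 1"] less [of k] 3 lagdiff_recurrence [of k x] by simp
   finally show ?thesis using 3 by (simp del: of_nat_add of_nat_Suc)
  qed
 qed
 have "(\<lambda>n. (deriv ^^ n) f 0 / fact n * (t - 0) ^ n) sums f t"
  by (rule holomorphic_power_series [OF hol]) (use t in auto)
 moreover have "(deriv ^^ n) f 0 / fact n = of_real (lagdiff x n)" for n
  using co [of n] by (simp add: F_def fps_expansion_def)
 ultimately show ?thesis by (simp add: f_def)
qed

text \<open>Fourier coefficients on circles tending to the unit circle. There
  \<open>t / (1 - t)\<close> has real part -1/2, so the generating function has constant modulus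
  \<open>exp (x / 2)\<close>, which \<open>exp (- x / 2)\<close> cancels; a pure phase is left. The
  essential singularity at \<open>t = 1\<close> is avoided by excising two arcs of length
  \<open>e\<close>, each of which costs at most \<open>e\<close>.\<close>

lemma lag1_integral_bound:
 assumes x: "0 < x" and e: "0 < e" "e < pi"
 shows "2 * pi * exp (- x / 2) * \<bar>lag1 m x\<bar>
  \<le> norm (integral {e..2*pi - e} (\<lambda>u. cis (- (x / 2) * cot (u / 2) - real (Suc m) * u))) + 2 * e"
proof -
 define n where "n = Suc m"
 define r :: "nat \<Rightarrow> real" where "r k = 1 - 1 / real (Suc (Suc k))" for k
 have r: "0 < r k" "r k < 1" for k by (auto simp: r_def field_simps)
 have rlim: "r \<longlonglongrightarrow> 1"
 proof -
  have "(\<lambda>k. 1 - 1 / real (k + 2)) \<longlonglongrightarrow> 1 - 0"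
   by (intro tendsto_intros LIMSEQ_ignore_initial_segment [OF lim_inverse_n', of 2])
  moreover have "r = (\<lambda>k. 1 - 1 / real (k + 2))" by (rule ext) (simp add: r_def)
  ultimately show ?thesis by simp
 qed
 define f where "f u t = exp (- of_real x * t / (1 - t)) * cis (- (real n * u))" for u and t :: complex
 let ?F = "\<lambda>k u. f u (of_real (r k) * cis u)"
 let ?C = "\<lambda>k. complex_of_real (2 * pi) * of_real (lag1 m x) * of_real (r k ^ n)"
 let ?g = "\<lambda>u. f u (cis u)"
 let ?h = "\<lambda>u. cis (- (x / 2) * cot (u / 2) - real (Suc m) * u)"
 have coef: "((?F k) has_integral (?C k)) {0..2*pi}" for k
 proof -
  have "((\<lambda>u. exp (- of_real x * (of_real (r k) * cis u) / (1 - of_real (r k) * cis u)) * cis (- (real n * u)))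
    has_integral (complex_of_real (2 * pi) * of_real (lagdiff x n) * of_real (r k ^ n))) {0..2*pi}"
  proof (rule fourier_coeff_power_series)
   show "(\<lambda>j. of_real (lagdiff x j) * (of_real (r k) * cis u) ^ j) sums exp (- of_real x * (of_real (r k) * cis u) / (1 - of_real (r k) * cis u))" for u
    by (rule lagdiff_generating) (use r [of k] in \<open>simp add: norm_mult\<close>)
   define q where "q = (r k + 1) / 2"
   have q: "r k < q" "q < 1" using r [of k] by (auto simp: q_def)
   have "summable (\<lambda>n. of_real (lagdiff x n) * (of_real q :: complex) ^ n)"
    using lagdiff_generating [of "of_real q" x] q r [of k] by (auto simp: sums_iff)
   then have "summable (\<lambda>n. norm (of_real (lagdiff x n) * (of_real (r k) :: complex) ^ n))"
    by (rule powser_insidea) (use q r [of k] in auto)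
   then show "summable (\<lambda>j. norm (complex_of_real (lagdiff x j)) * r k ^ j)"
    using r [of k] by (simp add: norm_mult norm_power)
  qed (use r [of k] in auto)
  then show ?thesis by (simp add: f_def n_def lagdiff_def)
 qed
 have re: "Re (- of_real x * t / (1 - t)) \<le> x / 2" if t: "norm t \<le> 1" "t \<noteq> 1" for t
 proof -
  have eq: "t / (1 - t) = - (1/2) + (1/2) *\<^sub>R ((1 + t) / (1 - t))"
   using t by (simp add: scaleR_conv_of_real field_simps)
  have "Re ((1 + t) / (1 - t)) = (1 - (norm t)^2) / (norm (1 - t))^2"
   unfolding cmod_power2 by (simp add: Re_divide power2_eq_square algebra_simps)
  then have "x * (-1/2) \<le> x * Re (t / (1 - t))" using t x unfolding eq by (simp add: power_le_one algebra_simps)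
  moreover have "Re (- of_real x * t / (1 - t)) = - (x * Re (t / (1 - t)))"
  proof -
   have "- of_real x * t / (1 - t) = of_real (- x) * (t / (1 - t))" by simp
   then show ?thesis by (simp only: times_complex.sel Re_complex_of_real Im_complex_of_real)
  qed
  ultimately show ?thesis by simp
 qed
 have bound: "norm (f u t) \<le> exp (x / 2)" if "norm t \<le> 1" "t \<noteq> 1" for t u
  using re [OF that] by (simp add: f_def norm_mult)
 have ne1: "of_real (r k) * cis u \<noteq> 1" "norm (of_real (r k) * cis u) \<le> 1" for k u
 proof -
  have "norm (of_real (r k) * cis u) < 1" using r [of k] by (simp add: norm_mult)
  then show "of_real (r k) * cis u \<noteq> 1" "norm (of_real (r k) * cis u) \<le> 1" by auto
 qed
 have cont: "continuous_on S (?F k)" for S k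
 proof -
  have "1 - of_real (r k) * cis u \<noteq> 0" for u using ne1(1) [of k u] by (metis right_minus_eq)
  then show ?thesis unfolding f_def by (intro continuous_intros) auto
 qed
 have ii: "(?F k) integrable_on {a..b}" for a b k
  by (intro integrable_continuous_real cont)
 have small: "norm (integral {a..b} (?F k)) \<le> exp (x / 2) * (b - a)" if "a \<le> b" for a b k
 proof -
  have "norm (integral {a..b} (?F k)) \<le> integral {a..b} (\<lambda>_. exp (x / 2))"
   by (intro integral_norm_bound_integral ii bound ne1) auto
  then show ?thesis using that by (simp add: mult.commute)
 qed
 have main: "norm (?C k) \<le> norm (integral {e..2*pi - e} (?F k)) + 2 * (exp (x / 2) * e)" for k
 proof -
  let ?f = "\<lambda>u. f u (of_real (r k) * cis u)"
  have eq: "(?C k) = integral {0..e} (?F k) + integral {e..2*pi-e} (?F k) + integral {2*pi-e..2*pi} (?F k)"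
   using coef [of k] e by (simp add: integral_unique Henstock_Kurzweil_Integration.integral_combine ii)
  show ?thesis unfolding eq
   using small [of 0 e k] small [of "2*pi-e" "2*pi" k] e
    norm_triangle_ineq [of "integral {0..e} (?F k) + integral {e..2*pi-e} (?F k)" "integral {2*pi-e..2*pi} (?F k)"]
    norm_triangle_ineq [of "integral {0..e} (?F k)" "integral {e..2*pi-e} (?F k)"] by simp
 qed
 \<comment> \<open>On the remaining arc the integrand is bounded by \<open>exp (x / 2)\<close> for
   every radius and converges pointwise, since \<open>cis u\<close> is not 1.\<close>
 have "(\<lambda>k. integral {e..2*pi-e} (?F k)) \<longlonglongrightarrow> integral {e..2*pi-e} ?g"
 proof (rule dominated_convergence(2) [where h = "\<lambda>_. exp (x / 2)"])
  fix u assume u: "u \<in> {e..2*pi-e}"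
  have "cos u \<noteq> 1"
  proof
   assume "cos u = 1"
   then obtain j :: int where "u = of_int j * 2 * pi" unfolding cos_one_2pi_int by blast
   then have j: "of_int j * (2 * pi) = u" by simp
   have "0 < of_int j * (2 * pi)" "of_int j * (2 * pi) < 1 * (2 * pi)" unfolding j using u e by auto
   then have "0 < j" "j < 1" by (simp_all add: zero_less_mult_iff)
   then show False by linarith
  qed
  then have "cis u \<noteq> 1" by (auto simp: complex_eq_iff)
  then have "(\<lambda>k. f u (of_real (r k) * cis u)) \<longlonglongrightarrow> f u (of_real 1 * cis u)"
   unfolding f_def by (intro tendsto_intros rlim, auto)
  then show "(\<lambda>k. f u (of_real (r k) * cis u)) \<longlonglongrightarrow> f u (cis u)" by simp
 qed (use ii bound ne1 in auto)
 from tendsto_norm [OF this]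
 have L: "(\<lambda>k. norm (integral {e..2*pi-e} (?F k)) + 2 * (exp (x / 2) * e)) \<longlonglongrightarrow> norm (integral {e..2*pi-e} ?g) + 2 * (exp (x / 2) * e)"
  by (rule tendsto_add [OF _ tendsto_const])
 have "(\<lambda>k. norm (?C k)) \<longlonglongrightarrow> norm (complex_of_real (2 * pi) * of_real (lag1 m x) * of_real (1 ^ n))"
  by (intro tendsto_intros rlim)
 from LIMSEQ_le [OF this L] main
 have le: "2 * pi * \<bar>lag1 m x\<bar> \<le> norm (integral {e..2*pi-e} ?g) + 2 * (exp (x / 2) * e)"
  by (simp add: norm_mult)
 have fc: "f u (cis u) = of_real (exp (x / 2)) * cis (- (x / 2) * cot (u / 2) - real (Suc m) * u)" if u: "u \<in> {e..2*pi-e}" for u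
 proof -
  define a where "a = u / 2"
  have ca: "cis u = cis a * cis a" by (simp add: cis_mult a_def)
  have d: "1 - cis u = cis a * (- 2 * \<i> * of_real (sin a))"
  proof -
   have "1 - cis u = cis a * (cis (- a) - cis a)" by (simp add: cis_mult ca algebra_simps)
   also have "cis (- a) - cis a = - 2 * \<i> * of_real (sin a)" by (simp add: complex_eq_iff)
   finally show ?thesis .
  qed
  have "cis u / (1 - cis u) = cis a / (- 2 * \<i> * of_real (sin a))" by (simp only: d) (simp add: ca)
  also have "\<dots> = - 1/2 + \<i> * of_real (cot a / 2)"
  proof -
   have s': "sin a \<noteq> 0" using u e sin_gt_zero [of "u / 2"] by (simp add: a_def)
   then have "cis a = (- 1/2 + \<i> * of_real (cot a / 2)) * (- 2 * \<i> * of_real (sin a))"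
    by (simp add: complex_eq_iff cot_def)
   then show ?thesis using s' by simp
  qed
  finally have q: "cis u / (1 - cis u) = - 1/2 + \<i> * of_real (cot a / 2)" .
  have "- of_real x * cis u / (1 - cis u) = - of_real x * (cis u / (1 - cis u))" by simp
  also have "\<dots> = of_real (x / 2) + \<i> * of_real (- (x / 2) * cot a)"
   unfolding q by (simp add: algebra_simps)
  finally have "exp (- of_real x * cis u / (1 - cis u)) = of_real (exp (x / 2)) * cis (- (x / 2) * cot a)"
   by (simp only: exp_add exp_of_real cis_conv_exp)
  then show ?thesis unfolding f_def by (simp add: cis_mult a_def n_def)
 qed
 have "integral {e..2*pi-e} ?g = of_real (exp (x / 2)) * integral {e..2*pi-e} ?h"
  unfolding integral_mult_right [symmetric] by (rule integral_cong) (rule fc)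
 then have "norm (integral {e..2*pi-e} ?g) = exp (x / 2) * norm (integral {e..2*pi-e} ?h)"
  by (simp add: norm_mult)
 with le have "exp (- x / 2) * (2 * pi * \<bar>lag1 m x\<bar>) \<le> exp (- x / 2) * (exp (x / 2) * (norm (integral {e..2*pi-e} ?h) + 2 * e))"
  by (intro mult_left_mono) (simp_all add: algebra_simps)
 also have "\<dots> = norm (integral {e..2*pi-e} ?h) + 2 * e"
  by (simp add: exp_add [symmetric])
 finally show ?thesis by (simp add: mult_ac)
qed

text \<open>The third derivative of the phase is at least \<open>x / 8\<close> whatever
  \<open>m\<close> is, because the term containing \<open>m\<close> is linear in \<open>t\<close>.
  This uniformity in the degree makes the bound usable for all levels at once.\<close>

lemma lag1_bound:
 assumes x: "0 < x"
 shows "exp (- x / 2) * \<bar>lag1 m x\<bar> \<le> 14 / (pi * x powr (1/3))"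
proof -
 have I: "norm (integral {e..2*pi - e} (\<lambda>t. cis (- (x / 2) * cot (t / 2) - real (Suc m) * t))) \<le> 14 / (x / 8) powr (1/3)"
  if e: "0 < e" "e < pi" for e
 proof (rule van_der_Corput_third)
  fix t assume "t \<in> {e..2*pi-e}"
  then have s: "sin (t / 2) > 0" using e by (intro sin_gt_zero) auto
  then have s0: "sin (t / 2) \<noteq> 0" by simp
  show "((\<lambda>t. - (x / 2) * cot (t / 2) - real (Suc m) * t) has_real_derivative x / 4 / (sin (t / 2))^2 - real (Suc m)) (at t)"
  proof -
   have "((\<lambda>t. cot (t / 2)) has_real_derivative - inverse ((sin (t / 2))^2) * (1 / 2)) (at t)"
    by (rule DERIV_chain2 [where f = cot and g = "\<lambda>t. t / 2", OF DERIV_cot [OF s0]]) (auto intro!: derivative_eq_intros)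
   then show ?thesis by (auto intro!: derivative_eq_intros simp: field_simps)
  qed
  show "((\<lambda>t. x / 4 / (sin (t / 2))^2 - real (Suc m)) has_real_derivative - (x / 4) * cos (t / 2) / (sin (t / 2)) ^ 3) (at t)"
   using s0 by (auto intro!: derivative_eq_intros simp: power_numeral_reduce del: of_nat_Suc)
  show "((\<lambda>t. - (x / 4) * cos (t / 2) / (sin (t / 2)) ^ 3) has_real_derivative
    x / 8 * (1 / (sin (t / 2))^2 + 3 * (cos (t / 2))^2 / (sin (t / 2)) ^ 4)) (at t)"
   using s0 by (auto intro!: derivative_eq_intros simp: field_simps power_numeral_reduce)
  have "1 \<le> 1 / (sin (t / 2))^2" using s0 by (simp add: abs_square_le_1)
  then have "x / 8 * 1 \<le> x / 8 * (1 / (sin (t / 2))^2 + 3 * (cos (t / 2))^2 / (sin (t / 2)) ^ 4)"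
   using x by (intro mult_left_mono add_increasing2) auto
  then show "x / 8 \<le> x / 8 * (1 / (sin (t / 2))^2 + 3 * (cos (t / 2))^2 / (sin (t / 2)) ^ 4)" by simp
 qed (use x e in auto)
 have J: "2 * pi * exp (- x / 2) * \<bar>lag1 m x\<bar> \<le> 14 / (x / 8) powr (1/3) + 2 * e" if "0 < e" "e < pi" for e
  using lag1_integral_bound [OF x that, of m] I [OF that] by linarith
 \<comment> \<open>The excised arcs shrink, while the van der Corput bound does not depend on
   \<open>e\<close>.\<close>
 have "2 * pi * exp (- x / 2) * \<bar>lag1 m x\<bar> \<le> 14 / (x / 8) powr (1/3)"
 proof (rule field_le_epsilon)
  fix d :: real assume d: "0 < d"
  define e where "e = min (d / 2) 1"
  show "2 * pi * exp (- x / 2) * \<bar>lag1 m x\<bar> \<le> 14 / (x / 8) powr (1/3) + d"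
   using d pi_gt3 J [of e] by (force simp: e_def)
 qed
 moreover have "(x / 8) powr (1/3) = x powr (1/3) / 2"
 proof -
  have "(8::real) powr (1/3) = (2 powr 3) powr (1/3)" by simp
  also have "\<dots> = 2" unfolding powr_powr by simp
  finally show ?thesis by (simp add: powr_divide)
 qed
 ultimately show ?thesis using x by (simp add: field_simps)
qed

section \<open>Logarithm inequalities and explicit Stirling bounds\<close>

lemma ln_ge_two_quotient:
 assumes "1 \<le> (t::real)" shows "2 * (t - 1) / (t + 1) \<le> ln t"
proof -
 have "ln 1 - 2 * (1 - 1) / (1 + 1) \<le> ln t - 2 * (t - 1) / (t + 1)"
 proof (rule DERIV_nonneg_imp_nondecreasing [OF assms])
  fix x assume x: "1 \<le> x" "x \<le> t"
  have "((\<lambda>t. ln t - 2 * (t - 1) / (t + 1)) has_real_derivative 1 / x - (2 * (x + 1) - 2 * (x - 1)) / ((x + 1) * (x + 1))) (at x)"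
   using x by (auto intro!: derivative_eq_intros)
  also have "1 / x - (2 * (x + 1) - 2 * (x - 1)) / ((x + 1) * (x + 1)) = (x - 1)^2 / (x * (x + 1)^2)"
   using x by (simp add: divide_simps) (simp add: power2_eq_square algebra_simps)
  finally show "\<exists>y. ((\<lambda>t. ln t - 2 * (t - 1) / (t + 1)) has_real_derivative y) (at x) \<and> 0 \<le> y"
   using x by auto
 qed
 then show ?thesis by simp
qed

lemma ln_le_half_diff_inverse:
 assumes "1 \<le> (t::real)" shows "ln t \<le> (t - 1 / t) / 2"
proof -
 have "(1 - 1 / 1) / 2 - ln 1 \<le> (t - 1 / t) / 2 - ln t"
 proof (rule DERIV_nonneg_imp_nondecreasing [OF assms])
  fix x assume x: "1 \<le> x" "x \<le> t"
  have "((\<lambda>t. (t - 1 / t) / 2 - ln t) has_real_derivative (1 + 1 / (x * x)) / 2 - 1 / x) (at x)"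
   using x by (auto intro!: derivative_eq_intros)
  also have "(1 + 1 / (x * x)) / 2 - 1 / x = (x - 1)^2 / (2 * x^2)"
   using x by (simp add: divide_simps) (simp add: power2_eq_square algebra_simps)
  finally show "\<exists>y. ((\<lambda>t. (t - 1 / t) / 2 - ln t) has_real_derivative y) (at x) \<and> 0 \<le> y" by auto
 qed
 then show ?thesis by simp
qed

text \<open>The sequence \<open>s\<close> decreases by \<open>ln_ge_two_quotient\<close>, while
  \<open>s m - 1 / (4 * m)\<close> increases by \<open>ln_le_half_diff_inverse\<close>; with
  \<open>s 1 = 1\<close> this traps it between 3/4 and 1.\<close>

lemma ln_fact_bounds:
 assumes "1 \<le> m"
 shows "3/4 \<le> ln (fact m) + real m - (real m + 1/2) * ln (real m)"
  and "ln (fact m) + real m - (real m + 1/2) * ln (real m) \<le> 1"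
proof -
 define s :: "nat \<Rightarrow> real" where "s m = ln (fact m) + real m - (real m + 1/2) * ln (real m)" for m
 have step: "s (Suc m) - s m = 1 - (real m + 1/2) * ln (real (Suc m) / real m)" if "1 \<le> m" for m
 proof -
  have 1: "ln (fact (Suc m)) = ln (real (Suc m)) + ln (fact m :: real)" by (simp add: ln_mult)
  have 2: "ln (real (Suc m) / real m) = ln (real (Suc m)) - ln (real m)" by (simp add: ln_div)
  show ?thesis unfolding s_def 1 2 by (simp add: algebra_simps)
 qed
 have 1: "s (Suc m) \<le> s m" if m: "1 \<le> m" for m
 proof -
  have "2 * (real (Suc m) / real m - 1) / (real (Suc m) / real m + 1) \<le> ln (real (Suc m) / real m)"
   using m by (intro ln_ge_two_quotient) simp
  then show ?thesis using m step [OF m] by (simp add: field_simps)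
 qed
 have 2: "s m - 1 / (4 * real m) \<le> s (Suc m) - 1 / (4 * real (Suc m))" if m: "1 \<le> m" for m
 proof -
  have "(real m + 1/2) * ln (real (Suc m) / real m) \<le> (real m + 1/2) * ((real (Suc m) / real m - 1 / (real (Suc m) / real m)) / 2)"
   using m by (intro mult_left_mono ln_le_half_diff_inverse) auto
  also have "\<dots> = 1 + (1 / (4 * real m) - 1 / (4 * real (Suc m)))"
   using m by (simp add: divide_simps) (simp add: algebra_simps)
  finally show ?thesis using step [OF m] by linarith
 qed
 have "s m \<le> s 1 \<and> s 1 - 1/4 \<le> s m - 1 / (4 * real m)" if "1 \<le> m" for m
  using that
 proof (induction m rule: dec_induct)
  case (step n) then show ?case using 1 [of n] 2 [of n] by linarith
 qed simp
 from this [OF assms] have "s m \<le> s 1" "s 1 - 1/4 \<le> s m - 1 / (4 * real m)" by auto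
 moreover have "s 1 = 1" by (simp add: s_def)
 moreover have "0 \<le> 1 / (4 * real m)" by simp
 ultimately have "s m \<le> 1" "3/4 \<le> s m" by linarith+
 then show "3/4 \<le> ln (fact m) + real m - (real m + 1/2) * ln (real m)"
  and "ln (fact m) + real m - (real m + 1/2) * ln (real m) \<le> 1"
  unfolding s_def by simp_all
qed

lemma fact_upper:
 assumes "1 \<le> m" shows "fact m * exp (real m) \<le> exp 1 * sqrt (real m) * real m ^ m"
proof -
 have "ln (fact m * exp (real m)) \<le> 1 + (real m + 1/2) * ln (real m)"
  using ln_fact_bounds(2) [OF assms] by (simp add: ln_mult)
 also have "\<dots> = ln (exp 1 * sqrt (real m) * real m ^ m)"
  using assms by (simp add: ln_mult ln_sqrt ln_realpow algebra_simps)
 finally show ?thesis using assms by simp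
qed

lemma fact_lower:
 assumes "1 \<le> m" shows "sqrt (real m) * real m ^ m \<le> fact m * exp (real m)"
proof -
 have "1 * (sqrt (real m) * real m ^ m) \<le> exp (3/4) * (sqrt (real m) * real m ^ m)"
  by (intro mult_right_mono) auto
 also have "ln (exp (3/4) * (sqrt (real m) * real m ^ m)) = 3/4 + (real m + 1/2) * ln (real m)"
  using assms by (simp add: ln_mult ln_sqrt ln_realpow algebra_simps)
 then have "ln (exp (3/4) * (sqrt (real m) * real m ^ m)) \<le> ln (fact m * exp (real m))"
  using ln_fact_bounds(1) [OF assms] by (simp add: ln_mult)
 then have "exp (3/4) * (sqrt (real m) * real m ^ m) \<le> fact m * exp (real m)" using assms by simp
 finally show ?thesis by simp
qed

text \<open>The square root of the Poisson weight; strict concavity of \<open>n ln v - v^2 / 2\<close> in \<open>v = sqrt u\<close> gives a Gaussian tail.\<close>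

lemma sqrt_poisson_bound:
 assumes n: "1 \<le> n" and u: "0 \<le> u"
 shows "sqrt (u ^ n * exp (- u) / fact n) * (1 + (u - real n)^2 / real n) \<le> 16 * sqrt (real n ^ n * exp (- real n) / fact n)"
proof -
 define v w d where "v = sqrt u" and "w = sqrt (real n)" and "d = v - w"
 have w: "0 < w" "w^2 = real n" "1 \<le> w" using n by (simp_all add: w_def)
 have v: "0 \<le> v" "v^2 = u" using u by (simp_all add: v_def)
 have sq: "sqrt (z ^ n * exp (- z) / fact n) = sqrt z ^ n * exp (- z / 2) / sqrt (fact n)" if "0 \<le> z" for z
 proof -
  have "sqrt (exp (- z)) = exp (- z / 2)" by (rule real_sqrt_unique) (simp_all add: power2_eq_square flip: exp_add)
  then show ?thesis by (simp add: real_sqrt_divide real_sqrt_mult real_sqrt_power)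
 qed
 \<comment> \<open>As \<open>w^2 = n\<close>, the exponent becomes \<open>w * v - n\<close>;
   completing the square with \<open>- u / 2\<close> leaves
   \<open>- n / 2 - d^2 / 2\<close>.\<close>
 have "(v / w) ^ n \<le> exp (v / w - 1) ^ n"
  using exp_ge_add_one_self [of "v / w - 1"] v w by (intro power_mono) auto
 also have "\<dots> = exp (w * v - real n)"
 proof -
  have "real n * (v / w - 1) = w * v - real n" by (simp add: right_diff_distrib flip: w(2), simp add: power2_eq_square)
  then show ?thesis by (simp flip: exp_of_nat_mult)
 qed
 finally have "v ^ n * exp (- u / 2) \<le> w ^ n * exp (w * v - real n) * exp (- u / 2)"
  using w by (simp add: power_divide pos_divide_le_eq mult.commute)
 also have "\<dots> = w ^ n * exp (- real n / 2) * exp (- d\<^sup>2 / 2)"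
  by (simp add: add_divide_distrib diff_divide_distrib d_def power2_diff v(2) w(2) exp_add [symmetric])
 finally have 1: "v ^ n * exp (- u / 2) \<le> w ^ n * exp (- real n / 2) * exp (- d\<^sup>2 / 2)" .
 have "(u - real n)^2 / real n \<le> 8 * d^2 + 2 * d ^ 4"
 proof -
  have "(u - real n)^2 = d^2 * (d + 2 * w)^2"
   unfolding d_def v(2) [symmetric] w(2) [symmetric] by (simp add: power2_eq_square algebra_simps)
  also have "\<dots> \<le> d^2 * (2 * d^2 + 8 * w^2)"
   using zero_le_power2 [of "d - 2 * w"] by (intro mult_left_mono) (auto simp: power2_sum power2_diff power_mult_distrib)
  also have "\<dots> \<le> d^2 * (2 * d^2 * real n + 8 * real n)"
   using n by (intro mult_left_mono) (auto simp: w(2) intro!: mult_left_mono [of 1 "real n" "d^2", simplified])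
  finally show ?thesis using n by (simp add: field_simps)
 qed
 \<comment> \<open>The whole Gaussian factor is spent on the quartic polynomial; this turns Gaussian
   decay into the weight \<open>1 + (u - n)^2 / n\<close>, which integrates to an arctangent
   later.\<close>
 also have "1 + (8 * d^2 + 2 * d ^ 4) \<le> 16 * exp (d^2 / 2)"
 proof -
  have "1 + d^2 / 2 + (d^2 / 2)^2 / 2 \<le> exp (d^2 / 2)" by (rule exp_lower_Taylor_quadratic) simp
  then show ?thesis by (simp add: power2_eq_square power4_eq_xxxx)
 qed
 finally have 2: "1 + (u - real n)^2 / real n \<le> 16 * exp (d^2 / 2)" by simp
 have "v ^ n * exp (- u / 2) * (1 + (u - real n)^2 / real n)
   \<le> w ^ n * exp (- real n / 2) * exp (- d\<^sup>2 / 2) * (16 * exp (d^2 / 2))"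
  using w by (intro mult_mono 1 2) auto
 also have "\<dots> = 16 * (w ^ n * exp (- real n / 2))" by (simp add: mult.left_commute flip: exp_add)
 finally have "v ^ n * exp (- u / 2) * (1 + (u - real n)^2 / real n) / sqrt (fact n) \<le> 16 * (w ^ n * exp (- real n / 2)) / sqrt (fact n)"
  by (rule divide_right_mono) simp
 then show ?thesis
  unfolding sq [OF u] sq [OF of_nat_0_le_iff] v_def [symmetric] w_def [symmetric] by simp
qed

section \<open>Normalised Laguerre functions: contour integrals, a crude bound and a derivative
  bound\<close>

definition lagw :: "nat \<Rightarrow> nat \<Rightarrow> real \<Rightarrow> real" where
 "lagw m d x = sqrt (fact m / fact (m + d)) * sqrt x ^ d * exp (- x / 2) * lag m d x"

text \<open>The coefficient of \<open>y ^ j\<close> in \<open>exp (- x * y) * (1 + y) ^ n\<close>.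
  This function is entire in \<open>y\<close>, so contours may have any radius; \<open>j\<close> is
  independent of \<open>n\<close>, so that the derivative of \<open>lag\<close> can be expressed as
  well.\<close>

definition lagc :: "nat \<Rightarrow> real \<Rightarrow> nat \<Rightarrow> real" where
 "lagc n x j = (\<Sum>i\<le>j. (-1) ^ i * real (n choose (j - i)) * x ^ i / fact i)"

lemma lag_eq_lagc: "lag m d x = lagc (m + d) x m" by (simp add: lag_def lagc_def)

lemma lagc_sums:
 fixes y :: complex
 shows "(\<lambda>j. of_real (lagc n x j) * y ^ j) sums (exp (- of_real x * y) * (1 + y) ^ n)"
proof -
 define a where "a i = (- of_real x * y) ^ i /\<^sub>R fact i" for i
 define b where "b i = of_nat (n choose i) * y ^ i" for i
 have b0: "b i = 0" if "i \<notin> {..n}" for i using that by (simp add: b_def)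
 have bs: "b sums (\<Sum>i\<le>n. b i)" by (rule sums_finite) (use b0 in auto)
 have bn: "summable (\<lambda>i. norm (b i))" by (rule summable_finite [of "{..n}"]) (use b0 in auto)
 have "(\<Sum>i\<le>n. b i) = (1 + y) ^ n"
  unfolding b_def add.commute [of 1 y] binomial_ring by simp
 moreover have "(\<lambda>k. \<Sum>i\<le>k. a i * b (k - i)) sums ((\<Sum>i. a i) * (\<Sum>i. b i))"
  by (rule Cauchy_product_sums [OF _ bn]) (simp only: a_def summable_norm_exp)
 moreover have "(\<Sum>i\<le>k. a i * b (k - i)) = of_real (lagc n x k) * y ^ k" for k
  unfolding lagc_def of_real_sum sum_distrib_right
 proof (rule sum.cong [OF refl])
  fix i assume "i \<in> {..k}"
  then have "y ^ i * y ^ (k - i) = y ^ k" by (simp flip: power_add)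
  moreover have "(- of_real x * y) ^ i = (-1) ^ i * of_real x ^ i * y ^ i"
   by (simp add: power_mult_distrib [symmetric])
  ultimately show "a i * b (k - i) = of_real ((-1) ^ i * real (n choose (k - i)) * x ^ i / fact i) * y ^ k"
   by (simp add: a_def b_def scaleR_conv_of_real divide_inverse)
 qed
 ultimately show ?thesis using bs by (simp add: a_def exp_def sums_iff)
qed

lemma lagc_abs_le:
 assumes "0 \<le> x" shows "\<bar>lagc n x j\<bar> \<le> lagc n (- x) j"
proof -
 have "\<bar>lagc n x j\<bar> \<le> (\<Sum>i\<le>j. \<bar>(-1) ^ i * real (n choose (j - i)) * x ^ i / fact i\<bar>)"
  unfolding lagc_def by force
 also have "\<dots> = lagc n (- x) j"
  unfolding lagc_def by (rule sum.cong) (use assms in \<open>auto simp: abs_mult power_minus [of x]\<close>)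
 finally show ?thesis .
qed

lemma lagc_real_sums: "(\<lambda>j. lagc n x j * y ^ j) sums (exp (- x * y) * (1 + y) ^ n)" for y :: real
proof -
 have "(\<lambda>j. complex_of_real (lagc n x j * y ^ j)) sums complex_of_real (exp (- x * y) * (1 + y) ^ n)"
  using lagc_sums [of n x "of_real y"] by (simp add: exp_of_real [symmetric])
 then show ?thesis by (simp only: sums_of_real_iff)
qed

lemma lagc_summable:
 assumes "0 \<le> x" "0 \<le> r" shows "summable (\<lambda>j. norm (of_real (lagc n x j) :: complex) * r ^ j)"
proof (rule summable_comparison_test')
 show "summable (\<lambda>j. lagc n (- x) j * r ^ j)" using lagc_real_sums by (rule sums_summable)
 show "norm (norm (of_real (lagc n x j) :: complex) * r ^ j) \<le> lagc n (- x) j * r ^ j" for j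
  using lagc_abs_le [OF assms(1)] assms(2) by (simp add: abs_mult mult_right_mono)
qed

lemma lagc_contour:
 assumes "0 \<le> x" "0 \<le> r"
 shows "((\<lambda>t. exp (- of_real x * (of_real r * cis t)) * (1 + of_real r * cis t) ^ n * cis (- (real m * t)))
  has_integral (of_real (2 * pi) * of_real (lagc n x m) * of_real (r ^ m))) {0..2*pi}"
 by (rule fourier_coeff_power_series) (use assms lagc_summable lagc_sums in auto)

text \<open>Each coefficient is dominated by the one with \<open>- x\<close>, whose series has
  nonnegative terms and sum \<open>(1 + r) ^ (m + d) * exp (x * r)\<close>; a single term is at most
  this sum, for any radius \<open>r\<close>.\<close>

lemma lagw_crude:
 assumes x: "0 \<le> x" and r: "0 < r"
 shows "\<bar>lagw m d x\<bar> \<le> sqrt (x ^ d / fact d) * exp (- x / 2) * ((1 + r) ^ (m + d) * exp (x * r) / r ^ m)"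
proof -
 have "\<bar>lag m d x\<bar> * r ^ m \<le> lagc (m + d) (- x) m * r ^ m"
  using lagc_abs_le [OF x] r unfolding lag_eq_lagc by simp
 also have "\<dots> \<le> (\<Sum>j. lagc (m + d) (- x) j * r ^ j)"
 proof -
  have "0 \<le> lagc (m + d) (- x) j * r ^ j" for j
   using order_trans [OF abs_ge_zero lagc_abs_le [OF x]] r by simp
  then show ?thesis using sum_le_suminf [OF sums_summable [OF lagc_real_sums [of "m+d" "-x" r]], of "{m}"] by simp
 qed
 also have "\<dots> = (1 + r) ^ (m + d) * exp (x * r)" using lagc_real_sums [of "m+d" "-x" r] by (simp add: sums_iff)
 finally have 1: "\<bar>lag m d x\<bar> \<le> (1 + r) ^ (m + d) * exp (x * r) / r ^ m"
  using r by (simp add: pos_le_divide_eq)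
 have "fact m * fact d \<le> (fact (m + d) :: real)"
  using fact_fact_dvd_fact [of m d] dvd_imp_le [of "fact m * fact d" "fact (m + d) :: nat"]
  by (metis fact_gt_zero of_nat_fact of_nat_le_iff of_nat_mult)
 then have "sqrt (fact m / fact (m + d)) \<le> sqrt (1 / fact d)"
  by (intro real_sqrt_le_mono) (simp add: field_simps)
 then have "sqrt (fact m / fact (m + d)) * sqrt x ^ d \<le> sqrt (1 / fact d) * sqrt x ^ d"
  using x by (intro mult_right_mono) auto
 also have "\<dots> = sqrt (x ^ d / fact d)" by (simp add: real_sqrt_divide real_sqrt_power)
 finally have 2: "sqrt (fact m / fact (m + d)) * sqrt x ^ d \<le> sqrt (x ^ d / fact d)" .
 have "\<bar>lagw m d x\<bar> = sqrt (fact m / fact (m + d)) * sqrt x ^ d * exp (- x / 2) * \<bar>lag m d x\<bar>"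
  unfolding lagw_def using x by (simp add: abs_mult)
 also have "\<dots> \<le> sqrt (x ^ d / fact d) * exp (- x / 2) * ((1 + r) ^ (m + d) * exp (x * r) / r ^ m)"
  using x r by (intro mult_mono 1 2) auto
 finally show ?thesis .
qed

lemma DERIV_lagw:
 assumes x: "0 < x"
 shows "(lagw (Suc k) d has_real_derivative
  sqrt (fact (Suc k) / fact (Suc k + d)) * sqrt x ^ d * exp (- x / 2) *
   ((real d / (2 * x) - 1/2) * lag (Suc k) d x - lagc (Suc k + d) x k)) (at x)"
proof -
 define n where "n = Suc k + d"
 have L: "(lag (Suc k) d has_real_derivative - lagc n x k) (at x)"
 proof -
  have "((\<lambda>x. \<Sum>i\<le>Suc k. (-1) ^ i * real (n choose (Suc k - i)) * x ^ i / fact i) has_real_derivative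
    (\<Sum>i\<le>Suc k. (-1) ^ i * real (n choose (Suc k - i)) * (real i * x ^ (i - 1)) / fact i)) (at x)"
   by (intro DERIV_sum DERIV_cdivide DERIV_cmult) (use DERIV_pow [of _ x] in simp)
  moreover have "(\<Sum>i\<le>Suc k. (-1) ^ i * real (n choose (Suc k - i)) * (real i * x ^ (i - 1)) / fact i) = - lagc n x k"
   unfolding lagc_def sum_negf [symmetric] by ((subst sum.atMost_Suc_shift, simp), (rule sum.cong [OF refl], simp add: field_simps))
  moreover have "lag (Suc k) d = (\<lambda>x. \<Sum>i\<le>Suc k. (-1) ^ i * real (n choose (Suc k - i)) * x ^ i / fact i)"
   by (rule ext) (simp add: lag_def n_def)
  ultimately show ?thesis by simp
 qed
 have P: "((\<lambda>x. sqrt x ^ d) has_real_derivative sqrt x ^ d * (real d / (2 * x))) (at x)"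
 proof (cases d)
  case (Suc e)
  have "((\<lambda>x. sqrt x ^ d) has_real_derivative real d * sqrt x ^ (d - Suc 0) * (inverse (sqrt x) / 2)) (at x)"
   using DERIV_power [OF DERIV_real_sqrt [OF x], of d] by (simp add: mult_ac)
  also have "real d * sqrt x ^ (d - Suc 0) * (inverse (sqrt x) / 2) = sqrt x ^ d * (real d / (2 * x))"
   using x Suc by (simp add: field_simps del: of_nat_Suc)
  finally show ?thesis .
 qed simp
 have E: "((\<lambda>x. exp (- x / 2)) has_real_derivative exp (- x / 2) * (- 1/2)) (at x)"
  by (auto intro!: derivative_eq_intros)
 have "((\<lambda>x. sqrt (fact (Suc k) / fact n) * sqrt x ^ d * exp (- x / 2) * lag (Suc k) d x) has_real_derivative
   sqrt (fact (Suc k) / fact n) * sqrt x ^ d * exp (- x / 2) *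
   ((real d / (2 * x) - 1/2) * lag (Suc k) d x - lagc n x k)) (at x)"
  by (rule DERIV_cong [OF DERIV_mult [OF DERIV_mult [OF DERIV_cmult [OF P] E] L]]) (simp add: algebra_simps)
 then show ?thesis by (simp add: lagw_def [abs_def] n_def)
qed

text \<open>On an interval where \<open>sin\<close> keeps the sign \<open>e\<close>, the integrand
  is a multiple of the derivative of \<open>arctan ((p + q * cos t) / w)\<close>.\<close>

lemma sin_arctan_integral:
 assumes ab: "a \<le> b" and sgn: "\<And>t. t \<in> {a..b} \<Longrightarrow> \<bar>sin t\<bar> = e * sin t" and e: "\<bar>e\<bar> = 1"
  and q: "0 < q" and w: "0 < w"
 shows "integral {a..b} (\<lambda>t. \<bar>sin t\<bar> / (1 + ((p + q * cos t) / w)^2)) \<le> pi * w / q"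
proof -
 let ?g = "\<lambda>t. (p + q * cos t) / w"
 define A where "A t = - e * w / q * arctan (?g t)" for t
 have "((\<lambda>t. \<bar>sin t\<bar> / (1 + (?g t)^2)) has_integral (A b - A a)) {a..b}"
 proof (rule fundamental_theorem_of_calculus [OF ab])
  fix t assume t: "t \<in> {a..b}"
  have i: "((\<lambda>t. (p + q * cos t) / w) has_real_derivative - (q * sin t) / w) (at t)"
   using w by (auto intro!: derivative_eq_intros)
  have "(A has_real_derivative - e * w / q * (inverse (1 + (?g t)^2) * (- (q * sin t) / w))) (at t)"
   unfolding A_def by (intro DERIV_cmult DERIV_chain2 [OF DERIV_arctan i])
  also have "- e * w / q * (inverse (1 + (?g t)^2) * (- (q * sin t) / w)) = \<bar>sin t\<bar> / (1 + (?g t)^2)"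
  proof -
   have "- e * w / q * (X * (- (q * sin t) / w)) = e * sin t * X" for X
    using q w by (simp add: field_simps)
   then show ?thesis unfolding sgn [OF t] by (simp only: divide_inverse)
  qed
  finally show "(A has_vector_derivative \<bar>sin t\<bar> / (1 + (?g t)^2)) (at t within {a..b})"
   unfolding has_real_derivative_iff_has_vector_derivative by (rule has_vector_derivative_at_within)
 qed
 then have "integral {a..b} (\<lambda>t. \<bar>sin t\<bar> / (1 + (?g t)^2)) = A b - A a" by auto
 also have "\<dots> \<le> pi * w / q"
 proof -
  have b: "\<bar>A t\<bar> \<le> w / q * (pi / 2)" for t
  proof -
   have "\<bar>A t\<bar> = w / q * \<bar>arctan (?g t)\<bar>"
    unfolding A_def abs_mult using q w e by (simp add: abs_mult)
   also have "\<bar>arctan (?g t)\<bar> \<le> pi / 2"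
    using arctan_bounded [of "(p + q * cos t) / w"] by linarith
   finally show ?thesis using q w by (simp add: divide_right_mono)
  qed
  show ?thesis using b [of a] b [of b] unfolding abs_le_iff by (simp add: mult.commute)
 qed
 finally show ?thesis .
qed

text \<open>The derivative is the contour integral of \<open>lag\<close> with an additional factor
  \<open>c0 - Y\<close>. With the normalisation \<open>P / \<rho> ^ m\<close>, the modulus of the
  integrand without this factor is \<open>K\<close> times the square root of a Poisson weight at
  \<open>u y\<close>, concentrated where \<open>u y\<close> is within \<open>sqrt n\<close> of
  \<open>n\<close>. There the real part of \<open>c0 - Y\<close>, which is
  \<open>- (u y - n) / (2 * x)\<close>, is small, while its imaginary part is a multiple of
  \<open>sin y\<close> and integrates against the weight to an arctangent.\<close>

lemma lagw_deriv_bound: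
 assumes x: "0 < x"
 obtains D where "(lagw (Suc k) d has_real_derivative D) (at x)"
  "\<bar>D\<bar> \<le> 32 * sqrt (sqrt (real (Suc k) * real (Suc k + d))) / x"
proof -
 define m n where "m = Suc k" and "n = m + d"
 have mn: "1 \<le> m" "1 \<le> n" "m \<le> n" by (auto simp: m_def n_def)
 \<comment> \<open>The saddle points of \<open>exp (- x * y) * (1 + y) ^ n / y ^ m\<close> solve a
   quadratic equation whose roots have product \<open>m / x\<close>; in the oscillatory range they
   are conjugate and lie on this circle.\<close>
 define \<rho> where "\<rho> = sqrt (real m / x)"
 have \<rho>: "0 < \<rho>" "\<rho>\<^sup>2 = real m / x" using x mn by (auto simp: \<rho>_def)
 define c0 where "c0 = real d / (2 * x) - 1/2"
 define P where "P = sqrt (fact m / fact n) * sqrt x ^ d * exp (- x / 2)"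
 define D where "D = P * (c0 * lag m d x - lagc n x k)"
 have Dd: "(lagw (Suc k) d has_real_derivative D) (at x)"
  using DERIV_lagw [OF x, of k d] by (simp add: D_def P_def c0_def n_def m_def)
 define Y where "Y y = of_real \<rho> * cis y" for y
 let ?e = "\<lambda>y. norm (1 + Y y) ^ n * exp (- (x * \<rho> * cos y))"
 define h where "h y = (of_real c0 - Y y) * (exp (- of_real x * Y y) * (1 + Y y) ^ n * cis (- (real m * y)))" for y
 have I: "(h has_integral (of_real (2 * pi * (c0 * lag m d x - lagc n x k) * \<rho> ^ m))) {0..2*pi}"
 proof -
  have 1: "((\<lambda>y. exp (- of_real x * Y y) * (1 + Y y) ^ n * cis (- (real m * y))) has_integral (of_real (2 * pi) * of_real (lag m d x) * of_real (\<rho> ^ m))) {0..2*pi}"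
   using lagc_contour [of x \<rho> n m] x \<rho> by (simp add: Y_def lag_eq_lagc n_def)
  have 2: "((\<lambda>y. exp (- of_real x * Y y) * (1 + Y y) ^ n * cis (- (real k * y))) has_integral (of_real (2 * pi) * of_real (lagc n x k) * of_real (\<rho> ^ k))) {0..2*pi}"
   using lagc_contour [of x \<rho> n k] x \<rho> by (simp add: Y_def)
  have "((\<lambda>y. of_real c0 * (exp (- of_real x * Y y) * (1 + Y y) ^ n * cis (- (real m * y))) - of_real \<rho> * (exp (- of_real x * Y y) * (1 + Y y) ^ n * cis (- (real k * y)))) has_integral
   (of_real c0 * (of_real (2 * pi) * of_real (lag m d x) * of_real (\<rho> ^ m)) - of_real \<rho> * (of_real (2 * pi) * of_real (lagc n x k) * of_real (\<rho> ^ k)))) {0..2*pi}"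
   by (intro has_integral_diff has_integral_mult_right 1 2)
  moreover have "of_real c0 * (exp (- of_real x * Y y) * (1 + Y y) ^ n * cis (- (real m * y))) - of_real \<rho> * (exp (- of_real x * Y y) * (1 + Y y) ^ n * cis (- (real k * y))) = h y" for y
   by (simp add: cis_mult m_def algebra_simps h_def Y_def algebra_simps)
  ultimately show ?thesis by (simp add: m_def algebra_simps)
 qed
 define u where "u y = x + real m + 2 * x * \<rho> * cos y" for y
 have nY: "(norm (1 + Y y))^2 = u y / x" for y
 proof -
  have "(norm (1 + Y y))^2 = 1 + 2 * \<rho> * cos y + \<rho>\<^sup>2 * ((cos y)^2 + (sin y)^2)"
  proof -
   have "Re (1 + Y y) = 1 + \<rho> * cos y" "Im (1 + Y y) = \<rho> * sin y" by (simp_all add: Y_def)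
   then show ?thesis unfolding cmod_power2 by algebra
  qed
  then show ?thesis using x by (simp add: \<rho>(2) u_def field_simps)
 qed
 have u0: "0 \<le> u y" for y using nY [of y] x zero_le_power2 [of "norm (1 + Y y)"] by (simp add: zero_le_divide_iff)
 define G where "G z = sqrt (z ^ n * exp (- z) / fact n)" for z :: real
 define K where "K = sqrt (fact m * exp (real m) / real m ^ m)"
 have GK: "0 \<le> K" "0 \<le> G (real n)" by (auto simp: K_def G_def)
 \<comment> \<open>Squaring removes all roots. The radius was chosen so that \<open>x\<close> times
   the squared modulus of \<open>1 + Y y\<close> is \<open>u y\<close>, and the exponentials combine
   to \<open>exp (m - u y)\<close>.\<close>
 have mod: "P / \<rho> ^ m * ?e y = K * G (u y)" for y
 proof (rule power2_eq_imp_eq)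
  have "(P / \<rho> ^ m * ?e y)^2
   = fact m / fact n * x ^ d * exp (- x) / (real m / x) ^ m * ((u y / x) ^ n * exp (- (2 * x * \<rho> * cos y)))"
  proof -
   have e: "(exp z)^2 = exp (2 * z)" for z :: real by (simp add: exp_double)
   have "(P / \<rho> ^ m * ?e y)^2
     = (sqrt (fact m / fact n))^2 * ((sqrt x)^2) ^ d * (exp (- x / 2))^2 / (\<rho>\<^sup>2) ^ m * (((norm (1 + Y y))^2) ^ n * (exp (- (x * \<rho> * cos y)))^2)"
    unfolding P_def by (simp add: power_mult_distrib power_divide mult.commute [of 2] flip: power_mult)
   then show ?thesis using x unfolding e nY \<rho>(2) by simp
  qed
  also have "\<dots> = fact m / fact n * exp (- x) * exp (- (2 * x * \<rho> * cos y)) * u y ^ n / real m ^ m"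
   using x mn by (simp add: n_def power_add field_simps)
  also have "\<dots> = fact m * exp (real m) / real m ^ m * (u y ^ n * exp (- u y) / fact n)"
  proof -
   have "exp (- x) * exp (- (2 * x * \<rho> * cos y)) = exp (real m) * exp (- u y)" by (simp add: u_def flip: exp_add)
   then show ?thesis by (simp add: field_simps)
  qed
  also have "\<dots> = (K * G (u y))^2"
   using u0 [of y] by (simp add: power_mult_distrib K_def G_def)
  finally show "(P / \<rho> ^ m * ?e y)^2 = (K * G (u y))^2" .
 qed (use \<rho> x u0 in \<open>auto simp: P_def K_def G_def\<close>)
 define B where "B = 16 * K * G (real n)"
 have B0: "0 \<le> B" using GK by (simp add: B_def)
 have Gb: "G (u y) * (1 + (u y - real n)^2 / real n) \<le> 16 * G (real n)" for y
  unfolding G_def by (rule sqrt_poisson_bound [OF mn(2) u0])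
 define w where "w = sqrt (real n)"
 have w: "0 < w" "w^2 = real n" using mn by (auto simp: w_def)
 have pt: "P / \<rho> ^ m * norm (h y) \<le> B * w / (2 * x) + B * \<rho> * (\<bar>sin y\<bar> / (1 + ((x + real m - real n + 2 * x * \<rho> * cos y) / w)^2))" for y
 proof -
  have nh: "norm (h y) = norm (of_real c0 - Y y) * ?e y"
   by (simp add: h_def norm_mult norm_power Y_def)
  have "norm (of_real c0 - Y y) \<le> \<bar>c0 - \<rho> * cos y\<bar> + \<bar>\<rho> * sin y\<bar>"
   using cmod_le [of "of_real c0 - Y y"] by (simp add: Y_def)
  also have "c0 - \<rho> * cos y = - (u y - real n) / (2 * x)"
   using x by (simp add: c0_def u_def n_def field_simps)
  finally have 1: "norm (of_real c0 - Y y) \<le> \<bar>u y - real n\<bar> / (2 * x) + \<rho> * \<bar>sin y\<bar>"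
   using x \<rho> by (simp add: abs_mult abs_minus_commute)
  define v where "v = (u y - real n) / w"
  have v: "v^2 = (u y - real n)^2 / real n" "u y - real n = w * v" using w by (auto simp: v_def power_divide)
  have v': "(x + real m - real n + 2 * x * \<rho> * cos y) / w = v" by (simp add: v_def u_def)
  have g: "K * G (u y) * (1 + v^2) \<le> B" using mult_left_mono [OF Gb [of y] GK(1)] by (simp add: B_def v)
  have G0: "0 \<le> K * G (u y)" using GK u0 [of y] by (simp add: G_def)
  \<comment> \<open>The real part carries a factor \<open>v\<close>, which uses up the whole weight
    \<open>1 + v^2\<close> and leaves a constant; the imaginary part keeps the weight for the
    arctangent integral.\<close>
  have "\<bar>v\<bar> \<le> 1 + v^2" using zero_le_power2 [of "\<bar>v\<bar> - 1/2"] by (simp add: power2_diff power_divide)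
  then have a: "K * G (u y) * (\<bar>u y - real n\<bar> / (2 * x)) \<le> B * w / (2 * x)"
   using mult_left_mono [OF _ G0] g x w unfolding v(2) by (force simp: abs_mult field_simps)
  have "K * G (u y) \<le> B / (1 + v^2)" using g by (simp add: add_pos_nonneg pos_le_divide_eq)
  then have "K * G (u y) * (\<rho> * \<bar>sin y\<bar>) \<le> B / (1 + v^2) * (\<rho> * \<bar>sin y\<bar>)" using \<rho> by (intro mult_right_mono) auto
  then have b: "K * G (u y) * (\<rho> * \<bar>sin y\<bar>) \<le> B * \<rho> * (\<bar>sin y\<bar> / (1 + v^2))" by simp
  have "P / \<rho> ^ m * norm (h y) = K * G (u y) * norm (of_real c0 - Y y)" unfolding nh mod [symmetric] by simp
  also have "\<dots> \<le> K * G (u y) * (\<bar>u y - real n\<bar> / (2 * x) + \<rho> * \<bar>sin y\<bar>)"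
   by (rule mult_left_mono [OF 1 G0])
  finally show ?thesis unfolding v' using a b by (simp add: distrib_left)
 qed
 define s where "s y = \<bar>sin y\<bar> / (1 + ((x + real m - real n + 2 * x * \<rho> * cos y) / w)^2)" for y
 have cs: "continuous_on S s" for S
 proof -
  have "1 + z^2 \<noteq> 0" for z :: real by (metis add_pos_nonneg less_irrefl zero_le_power2 zero_less_one)
  then show ?thesis unfolding s_def using w by (intro continuous_intros) auto
 qed
 have ch: "continuous_on S h" for S unfolding h_def Y_def by (intro continuous_intros)
 have P0: "0 \<le> P / \<rho> ^ m" using x \<rho> by (simp add: P_def)
 have Is: "integral {0..2*pi} s \<le> 2 * (pi * w / (2 * x * \<rho>))"
 proof -
  have "integral {0..2*pi} s = integral {0..pi} s + integral {pi..2*pi} s"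
   by (rule Henstock_Kurzweil_Integration.integral_combine [symmetric]) (auto intro!: integrable_continuous_real cs)
  moreover have "integral {0..pi} s \<le> pi * w / (2 * x * \<rho>)"
   unfolding s_def by (rule sin_arctan_integral [where e = 1]) (use x \<rho> w sin_ge_zero in auto)
  moreover have "integral {pi..2*pi} s \<le> pi * w / (2 * x * \<rho>)"
   unfolding s_def
  proof (rule sin_arctan_integral [where e = "-1"])
   show "\<bar>sin y\<bar> = - 1 * sin y" if "y \<in> {pi..2*pi}" for y using that sin_le_zero [of y] by force
  qed (use x \<rho> w in auto)
  ultimately show ?thesis by linarith
 qed
 have "2 * pi * \<bar>D\<bar> = norm (of_real (P / \<rho> ^ m) * integral {0..2*pi} h)"
 proof -
  have "integral {0..2*pi} h = of_real (2 * pi * (c0 * lag m d x - lagc n x k) * \<rho> ^ m)" by (rule integral_unique [OF I])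
  then show ?thesis
   using \<rho> by ((simp add: D_def flip: of_real_mult of_real_divide of_real_power), (simp only: norm_of_real, simp add: abs_mult))
 qed
 also have "\<dots> = norm (integral {0..2*pi} (\<lambda>y. of_real (P / \<rho> ^ m) * h y))" by simp
 also have "\<dots> \<le> integral {0..2*pi} (\<lambda>y. B * w / (2 * x) + B * \<rho> * s y)"
 proof (rule integral_norm_bound_integral)
  show "norm (of_real (P / \<rho> ^ m) * h y) \<le> B * w / (2 * x) + B * \<rho> * s y" for y
   unfolding norm_mult norm_of_real abs_of_nonneg [OF P0] s_def by (rule pt)
 qed (intro integrable_continuous_real continuous_intros ch cs)+
 also have "\<dots> = 2 * pi * (B * w / (2 * x)) + B * \<rho> * integral {0..2*pi} s"
  by (subst integral_add) (auto intro!: integrable_continuous_real continuous_intros cs)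
 also have "\<dots> \<le> 2 * pi * (B * w / (2 * x)) + B * \<rho> * (2 * (pi * w / (2 * x * \<rho>)))"
  using Is B0 \<rho> by (intro add_left_mono mult_left_mono) auto
 also have "\<dots> = 2 * pi * (B * w / x)" using x \<rho> by simp
 finally have Db: "\<bar>D\<bar> \<le> B * w / x" by (rule mult_left_le_imp_le) simp
 have K2: "K \<le> sqrt (exp 1 * sqrt (real m))"
  unfolding K_def using fact_upper [OF mn(1)] mn by (intro real_sqrt_le_mono) (simp add: pos_divide_le_eq)
 have G2: "G (real n) \<le> sqrt (1 / sqrt (real n))"
  unfolding G_def using fact_lower [OF mn(2)] mn by (intro real_sqrt_le_mono) (simp add: field_simps exp_minus)
 \<comment> \<open>By Stirling \<open>K\<close> is at most of order \<open>m powr (1/4)\<close> and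
   \<open>G n\<close> of order \<open>n powr (- 1/4)\<close>; with \<open>w = sqrt n\<close> the
   product is a fourth root of \<open>m * n\<close>.\<close>
 have "K * G (real n) * w \<le> sqrt (exp 1 * sqrt (real m)) * sqrt (1 / sqrt (real n)) * w"
  using K2 G2 GK w by (intro mult_right_mono mult_mono) auto
 also have "\<dots> = sqrt (exp 1) * sqrt (sqrt (real m * real n))"
 proof -
  have "sqrt (1 / sqrt (real n)) * w = sqrt (sqrt (real n))"
  proof -
   define t where "t = sqrt (sqrt (real n))"
   show ?thesis using mn by (simp add: w_def real_sqrt_divide field_simps)
  qed
  then show ?thesis by (simp add: real_sqrt_mult)
 qed
 also have "\<dots> \<le> 2 * sqrt (sqrt (real m * real n))"
 proof -
  have "sqrt (exp 1) \<le> sqrt 4" using exp_le by (intro real_sqrt_le_mono) linarith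
  then show ?thesis by (intro mult_right_mono) auto
 qed
 finally have "\<bar>D\<bar> \<le> 32 * sqrt (sqrt (real m * real n)) / x" using x Db by (simp add: B_def field_simps)
 then show thesis using Dd that unfolding m_def n_def by blast
qed

section \<open>The Hilbert space\<close>

lemma L2_measurable [measurable_dest]: "f \<in> L2 \<Longrightarrow> f \<in> borel_measurable lborel" by (simp add: L2_def)

lemma cnj_measurable [measurable]:
 "f \<in> borel_measurable M \<Longrightarrow> (\<lambda>x. cnj (f x)) \<in> borel_measurable M"
 by (rule borel_measurable_continuous_on [where f = cnj]) (auto intro: continuous_intros)

lemma L2_integrable_sq: "f \<in> L2 \<Longrightarrow> integrable lborel (\<lambda>x. (cmod (f x))^2)" by (simp add: L2_def)

lemma L2_integrable_norm_mult:
 assumes "f \<in> L2" "g \<in> L2" shows "integrable lborel (\<lambda>x. cmod (f x) * cmod (g x))"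
proof (rule Bochner_Integration.integrable_bound)
 show "integrable lborel (\<lambda>x. (cmod (f x))^2 + (cmod (g x))^2)"
  using assms by (intro Bochner_Integration.integrable_add L2_integrable_sq)
 show "(\<lambda>x. cmod (f x) * cmod (g x)) \<in> borel_measurable lborel"
  using assms[THEN L2_measurable] by measurable
 have "cmod (f x) * cmod (g x) \<le> (cmod (f x))^2 + (cmod (g x))^2" for x
  using sum_squares_bound [of "cmod (f x)" "cmod (g x)"] mult_nonneg_nonneg [OF norm_ge_zero [of "f x"] norm_ge_zero [of "g x"]] by linarith
 then show "AE x in lborel. norm (cmod (f x) * cmod (g x)) \<le> norm ((cmod (f x))^2 + (cmod (g x))^2)" by simp
qed

lemma L2_inner_integrable:
 assumes "f \<in> L2" "g \<in> L2" shows "integrable lborel (\<lambda>x. cnj (f x) * g x)"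
proof (rule Bochner_Integration.integrable_bound [OF L2_integrable_norm_mult [OF assms]])
 show "(\<lambda>x. cnj (f x) * g x) \<in> borel_measurable lborel"
  using assms[THEN L2_measurable] by measurable
qed (simp add: norm_mult)

lemma L2_lincomb:
 assumes "f \<in> L2" "g \<in> L2" shows "(\<lambda>x. a * f x + b * g x) \<in> L2"
 unfolding L2_def
proof (intro CollectI conjI)
 show m: "(\<lambda>x. a * f x + b * g x) \<in> borel_measurable lborel"
  using assms[THEN L2_measurable] by measurable
 show "integrable lborel (\<lambda>x. (cmod (a * f x + b * g x))^2)"
 proof (rule Bochner_Integration.integrable_bound)
  show "integrable lborel (\<lambda>x. 2 * (cmod a)^2 * (cmod (f x))^2 + 2 * (cmod b)^2 * (cmod (g x))^2)"
   using assms by (intro Bochner_Integration.integrable_add integrable_mult_right L2_integrable_sq)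
  show "(\<lambda>x. (cmod (a * f x + b * g x))^2) \<in> borel_measurable lborel" using m by measurable
  have "(cmod (a * f x + b * g x))^2 \<le> 2 * (cmod a)^2 * (cmod (f x))^2 + 2 * (cmod b)^2 * (cmod (g x))^2" for x
  proof -
   have "(cmod (a * f x + b * g x))^2 \<le> (cmod (a * f x) + cmod (b * g x))^2"
    by (intro power_mono norm_triangle_ineq) auto
   also have "\<dots> \<le> 2 * (cmod (a * f x))^2 + 2 * (cmod (b * g x))^2"
    using sum_squares_bound [of "cmod (a * f x)" "cmod (b * g x)"] by (simp add: power2_sum)
   finally show ?thesis by (simp add: norm_mult power_mult_distrib)
  qed
  then show "AE x in lborel. norm ((cmod (a * f x + b * g x))^2) \<le> norm (2 * (cmod a)^2 * (cmod (f x))^2 + 2 * (cmod b)^2 * (cmod (g x))^2)"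
   by simp
 qed
qed

lemma L2_zero [simp]: "(\<lambda>x. 0) \<in> L2" by (simp add: L2_def)

lemma L2_scale: "f \<in> L2 \<Longrightarrow> (\<lambda>x. a * f x) \<in> L2" using L2_lincomb [of f "\<lambda>x. 0" a 0] by simp

lemma L2_add: "f \<in> L2 \<Longrightarrow> g \<in> L2 \<Longrightarrow> (\<lambda>x. f x + g x) \<in> L2" using L2_lincomb [of f g 1 1] by simp

lemma L2_diff: "f \<in> L2 \<Longrightarrow> g \<in> L2 \<Longrightarrow> (\<lambda>x. f x - g x) \<in> L2" using L2_lincomb [of f g 1 "-1"] by simp

lemma L2_sum: "(\<And>i. i \<in> I \<Longrightarrow> f i \<in> L2) \<Longrightarrow> (\<lambda>x. \<Sum>i\<in>I. a i * f i x) \<in> L2"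
proof (induction I rule: infinite_finite_induct)
 case (insert i I)
 have "(\<lambda>x. a i * f i x + (\<Sum>i\<in>I. a i * f i x)) \<in> L2"
  by (rule L2_add [OF L2_scale]) (use insert in auto)
 then show ?case using insert by simp
qed auto

lemma inner_add_right: "f \<in> L2 \<Longrightarrow> g \<in> L2 \<Longrightarrow> h \<in> L2 \<Longrightarrow> inner_L2 f (\<lambda>x. g x + h x) = inner_L2 f g + inner_L2 f h"
 unfolding inner_L2_def by (simp add: distrib_left L2_inner_integrable)

lemma inner_scale_right: "f \<in> L2 \<Longrightarrow> g \<in> L2 \<Longrightarrow> inner_L2 f (\<lambda>x. a * g x) = a * inner_L2 f g"
 unfolding inner_L2_def by (simp add: mult.left_commute [of _ a] L2_inner_integrable)

lemma inner_cnj: "f \<in> L2 \<Longrightarrow> g \<in> L2 \<Longrightarrow> inner_L2 f g = cnj (inner_L2 g f)"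
 unfolding inner_L2_def by (subst Bochner_Integration.integral_cnj [symmetric]) (simp add: mult.commute)

lemma inner_scale_left: "f \<in> L2 \<Longrightarrow> g \<in> L2 \<Longrightarrow> inner_L2 (\<lambda>x. a * g x) f = cnj a * inner_L2 g f"
 by (subst inner_cnj) (auto intro: L2_scale simp: inner_scale_right inner_cnj [of g f])

lemma inner_add_left: "f \<in> L2 \<Longrightarrow> g \<in> L2 \<Longrightarrow> h \<in> L2 \<Longrightarrow> inner_L2 (\<lambda>x. g x + h x) f = inner_L2 g f + inner_L2 h f"
 by (subst inner_cnj) (auto intro: L2_add simp: inner_add_right inner_cnj [of g f] inner_cnj [of h f])

lemma inner_diff_right: "f \<in> L2 \<Longrightarrow> g \<in> L2 \<Longrightarrow> h \<in> L2 \<Longrightarrow> inner_L2 f (\<lambda>x. g x - h x) = inner_L2 f g - inner_L2 f h"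
 unfolding inner_L2_def by (simp add: right_diff_distrib L2_inner_integrable)

lemma inner_diff_left: "f \<in> L2 \<Longrightarrow> g \<in> L2 \<Longrightarrow> h \<in> L2 \<Longrightarrow> inner_L2 (\<lambda>x. g x - h x) f = inner_L2 g f - inner_L2 h f"
 by (subst inner_cnj) (auto intro: L2_diff simp: inner_diff_right inner_cnj [of g f] inner_cnj [of h f])

lemma inner_zero_right [simp]: "inner_L2 f (\<lambda>x. 0) = 0" by (simp add: inner_L2_def)

lemma inner_sum_right:
 "f \<in> L2 \<Longrightarrow> (\<And>i. i \<in> I \<Longrightarrow> g i \<in> L2) \<Longrightarrow> inner_L2 f (\<lambda>x. \<Sum>i\<in>I. a i * g i x) = (\<Sum>i\<in>I. a i * inner_L2 f (g i))"
 by (induction I rule: infinite_finite_induct)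
   (auto simp: inner_add_right inner_scale_right L2_scale L2_sum)

lemma inner_sum_left:
 "f \<in> L2 \<Longrightarrow> (\<And>i. i \<in> I \<Longrightarrow> g i \<in> L2) \<Longrightarrow> inner_L2 (\<lambda>x. \<Sum>i\<in>I. a i * g i x) f = (\<Sum>i\<in>I. cnj (a i) * inner_L2 (g i) f)"
 by (subst inner_cnj) (auto simp: L2_sum inner_sum_right inner_cnj [of f])

lemma inner_self: "f \<in> L2 \<Longrightarrow> inner_L2 f f = of_real ((norm_L2 f)^2)"
proof -
 assume "f \<in> L2"
 have "cnj (f x) * f x = of_real ((cmod (f x))^2)" for x by (metis complex_norm_square mult.commute)
 then show ?thesis
  by (simp only: inner_L2_def norm_L2_def integral_complex_of_real) simp
qed

lemma norm_L2_nonneg [simp]: "0 \<le> norm_L2 f" by (simp add: norm_L2_def)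

lemma norm_L2_sq: "(norm_L2 f)^2 = (LINT x|lborel. (cmod (f x))^2)" by (simp add: norm_L2_def)

lemma Cauchy_Schwarz_integral:
 fixes F G :: "'a \<Rightarrow> real"
 assumes F: "integrable M (\<lambda>x. (F x)^2)" and G: "integrable M (\<lambda>x. (G x)^2)" and FG: "integrable M (\<lambda>x. F x * G x)"
 shows "(LINT x|M. F x * G x)^2 \<le> (LINT x|M. (F x)^2) * (LINT x|M. (G x)^2)"
proof -
 define A B C where "A = (LINT x|M. (F x)^2)" and "B = (LINT x|M. F x * G x)" and "C = (LINT x|M. (G x)^2)"
 have quad: "0 \<le> A - 2 * t * B + t^2 * C" for t
 proof -
  have "0 \<le> (LINT x|M. (F x - t * G x)^2)" by simp
  also have "\<dots> = (LINT x|M. (F x)^2 - 2 * t * (F x * G x) + t^2 * (G x)^2)"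
   by (rule Bochner_Integration.integral_cong) (auto simp: power2_diff power_mult_distrib)
  also have "\<dots> = A - 2 * t * B + t^2 * C" using F G FG by (simp add: A_def B_def C_def)
  finally show ?thesis .
 qed
 have C0: "0 \<le> C" unfolding C_def by simp
 have "B^2 \<le> A * C"
 proof (cases "C = 0")
  case True
  have "B = 0"
  proof (rule ccontr)
   assume "B \<noteq> 0"
   then show False using quad [of "(A + 1) / (2 * B)"] True by simp
  qed
  then show ?thesis using True by simp
 next
  case False
  then have C: "0 < C" using C0 by simp
  show ?thesis using quad [of "B / C"] C by (simp add: power2_eq_square field_simps)
 qed
 then show ?thesis by (simp add: A_def B_def C_def)
qed

lemma Cauchy_Schwarz_norm:
 assumes "f \<in> L2" "g \<in> L2" shows "(LINT x|lborel. cmod (f x) * cmod (g x)) \<le> norm_L2 f * norm_L2 g"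
proof -
 have "(LINT x|lborel. cmod (f x) * cmod (g x))^2 \<le> (norm_L2 f * norm_L2 g)^2"
  unfolding power_mult_distrib norm_L2_sq
  by (rule Cauchy_Schwarz_integral) (use assms L2_integrable_sq L2_integrable_norm_mult in auto)
 then show ?thesis by simp
qed

lemma inner_Cauchy_Schwarz:
 assumes "f \<in> L2" "g \<in> L2" shows "cmod (inner_L2 f g) \<le> norm_L2 f * norm_L2 g"
proof -
 have "cmod (inner_L2 f g) \<le> (LINT x|lborel. norm (cnj (f x) * g x))" unfolding inner_L2_def by simp
 also have "\<dots> = (LINT x|lborel. cmod (f x) * cmod (g x))" by (simp add: norm_mult)
 finally show ?thesis using Cauchy_Schwarz_norm [OF assms] by simp
qed

lemma norm_L2_triangle:
 assumes "f \<in> L2" "g \<in> L2" shows "norm_L2 (\<lambda>x. f x + g x) \<le> norm_L2 f + norm_L2 g"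
proof (rule power2_le_imp_le)
 have "(norm_L2 (\<lambda>x. f x + g x))^2 = Re (inner_L2 (\<lambda>x. f x + g x) (\<lambda>x. f x + g x))"
  using assms by (simp add: inner_self L2_add)
 also have "\<dots> = Re (inner_L2 f f) + Re (inner_L2 f g) + Re (inner_L2 g f) + Re (inner_L2 g g)"
  using assms by (simp add: inner_add_left inner_add_right L2_add)
 also have "\<dots> \<le> (norm_L2 f + norm_L2 g)^2"
  using order_trans [OF complex_Re_le_cmod inner_Cauchy_Schwarz [OF assms]] order_trans [OF complex_Re_le_cmod inner_Cauchy_Schwarz [OF assms(2,1)]] unfolding inner_self [OF assms(1)] inner_self [OF assms(2)] Re_complex_of_real by (simp add: power2_sum algebra_simps)
 finally show "(norm_L2 (\<lambda>x. f x + g x))^2 \<le> (norm_L2 f + norm_L2 g)^2" .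
qed simp

lemma norm_L2_scale: "f \<in> L2 \<Longrightarrow> norm_L2 (\<lambda>x. a * f x) = cmod a * norm_L2 f"
 unfolding norm_L2_def by (simp add: norm_mult power_mult_distrib real_sqrt_mult)

lemma norm_L2_cong_AE:
 assumes "f \<in> L2" "g \<in> L2" "AE x in lborel. f x = g x" shows "norm_L2 f = norm_L2 g"
 unfolding norm_L2_def
 by (rule arg_cong [where f = sqrt], rule integral_cong_AE) (use assms L2_measurable in auto)

lemma inner_cong_AE_right:
 assumes "f \<in> L2" "g \<in> L2" "h \<in> L2" "AE x in lborel. g x = h x" shows "inner_L2 f g = inner_L2 f h"
 unfolding inner_L2_def
 by (rule integral_cong_AE) (use assms[unfolded L2_def] in \<open>auto intro!: borel_measurable_times cnj_measurable\<close>)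

section \<open>Gaussian decay and integration by parts\<close>

text \<open>A class that contains Fock and squeezed vectors, is stable under translation, reflection
  and polynomial factors, lies in \<open>L2\<close> for measurable members, and makes boundary terms
  in integrations by parts vanish.\<close>

definition gauss_bounded :: "wavefun \<Rightarrow> bool" where
 "gauss_bounded f \<longleftrightarrow> (\<exists>C c. 0 < c \<and> (\<forall>x. cmod (f x) \<le> C * exp (- c * x^2)))"

lemma gauss_boundedI: "0 < c \<Longrightarrow> (\<And>x. cmod (f x) \<le> C * exp (- c * x^2)) \<Longrightarrow> gauss_bounded f"
 by (auto simp: gauss_bounded_def)

lemma gauss_boundedE:
 assumes "gauss_bounded f"
 obtains C c where "0 < c" "0 < C" "\<And>x. cmod (f x) \<le> C * exp (- c * x^2)"
proof -
 from assms obtain C c where c: "0 < c" "\<And>x. cmod (f x) \<le> C * exp (- c * x^2)" by (auto simp: gauss_bounded_def)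
 have "0 < C + 1" using order_trans [OF norm_ge_zero c(2) [of 0]] by simp
 moreover have "cmod (f x) \<le> (C + 1) * exp (- c * x^2)" for x
  using c(2) [of x] by (simp add: distrib_right add_increasing2)
 ultimately show thesis using c(1) that by blast
qed

lemma gauss_bounded_add:
 assumes "gauss_bounded f" "gauss_bounded g" shows "gauss_bounded (\<lambda>x. f x + g x)"
proof -
 obtain C c where f: "0 < c" "0 < C" "\<And>x. cmod (f x) \<le> C * exp (- c * x^2)" using assms gauss_boundedE by metis
 obtain D d where g: "0 < d" "0 < D" "\<And>x. cmod (g x) \<le> D * exp (- d * x^2)" using assms gauss_boundedE by metis
 show ?thesis
 proof (rule gauss_boundedI)
  show "0 < min c d" using f g by simp
  fix x
  have "cmod (f x + g x) \<le> C * exp (- c * x^2) + D * exp (- d * x^2)"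
   using f(3) [of x] g(3) [of x] norm_triangle_ineq [of "f x" "g x"] by linarith
  also have "\<dots> \<le> C * exp (- min c d * x^2) + D * exp (- min c d * x^2)"
   using f g by (intro add_mono mult_left_mono) (auto intro!: mult_right_mono)
  finally show "cmod (f x + g x) \<le> (C + D) * exp (- min c d * x^2)" by (simp add: distrib_right)
 qed
qed

lemma gauss_bounded_bounded_mult:
 assumes "gauss_bounded f" "\<And>x. cmod (g x) \<le> B" shows "gauss_bounded (\<lambda>x. g x * f x)"
proof -
 obtain C c where f: "0 < c" "0 < C" "\<And>x. cmod (f x) \<le> C * exp (- c * x^2)" using assms gauss_boundedE by metis
 show ?thesis
 proof (rule gauss_boundedI [OF f(1)])
  fix x
  have "0 \<le> B" using assms(2) [of 0] norm_ge_zero order_trans by blast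
  then have "cmod (g x) * cmod (f x) \<le> B * (C * exp (- c * x^2))" using f assms(2) by (intro mult_mono) auto
  then show "cmod (g x * f x) \<le> (B * C) * exp (- c * x^2)" by (simp add: norm_mult)
 qed
qed

lemma gauss_bounded_mult_id:
 assumes "gauss_bounded f" shows "gauss_bounded (\<lambda>x. of_real x * f x)"
proof -
 obtain C c where f: "0 < c" "0 < C" "\<And>x. cmod (f x) \<le> C * exp (- c * x^2)" using assms gauss_boundedE by metis
 show ?thesis
 proof (rule gauss_boundedI)
  show "0 < c / 2" using f by simp
  fix x
  have "\<bar>x\<bar> \<le> (1 + 1 / c) * exp (c / 2 * x^2)"
  proof -
   have "\<bar>x\<bar> \<le> 1 + 1 / c * (c / 2 * x^2)" using sum_squares_bound [of "\<bar>x\<bar>" 1] f by simp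
   also have "\<dots> \<le> exp (c / 2 * x^2) + 1 / c * exp (c / 2 * x^2)"
   proof (intro add_mono mult_left_mono)
    show "c / 2 * x^2 \<le> exp (c / 2 * x^2)" using exp_ge_add_one_self [of "c / 2 * x^2"] by linarith
   qed (use f in auto)
   finally show ?thesis by (simp add: distrib_right)
  qed
  then have "\<bar>x\<bar> * cmod (f x) \<le> (1 + 1 / c) * exp (c / 2 * x^2) * (C * exp (- c * x^2))"
   using f by (intro mult_mono) auto
  also have "\<dots> = ((1 + 1 / c) * C) * (exp (c / 2 * x^2) * exp (- c * x^2))" by simp
  also have "exp (c / 2 * x^2) * exp (- c * x^2) = exp (- (c / 2) * x^2)" by (simp flip: exp_add)
  finally show "cmod (of_real x * f x) \<le> ((1 + 1 / c) * C) * exp (- (c / 2) * x^2)" by (simp add: norm_mult)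
 qed
qed

lemma gauss_bounded_poly:
 assumes "gauss_bounded f" shows "gauss_bounded (\<lambda>x. of_real (poly P x) * f x)"
proof (induction P)
 case 0 then show ?case by (auto intro!: gauss_boundedI [of 1 _ 0])
next
 case (pCons a P)
 have "gauss_bounded (\<lambda>x. of_real a * f x + of_real x * (of_real (poly P x) * f x))"
  by (intro gauss_bounded_add gauss_bounded_mult_id pCons gauss_bounded_bounded_mult [OF assms, where B = "\<bar>a\<bar>"]) simp
 then show ?case by (simp add: algebra_simps)
qed

lemma gauss_bounded_shift:
 assumes "gauss_bounded f" shows "gauss_bounded (\<lambda>x. f (x - q))"
proof -
 obtain C c where f: "0 < c" "0 < C" "\<And>x. cmod (f x) \<le> C * exp (- c * x^2)" using assms gauss_boundedE by metis
 show ?thesis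
 proof (rule gauss_boundedI)
  show "0 < c / 2" using f by simp
  fix x
  have "c * (x^2 / 2 - q^2) \<le> c * (x - q)^2" using zero_le_power2 [of "x - 2 * q"] f by (simp add: power2_diff)
  then have "C * exp (- c * (x - q)^2) \<le> C * exp (c * q^2 + - (c / 2) * x^2)"
   using f by (intro mult_left_mono) (auto simp: algebra_simps)
  then show "cmod (f (x - q)) \<le> (C * exp (c * q^2)) * exp (- (c / 2) * x^2)"
   using f(3) [of "x - q"] unfolding exp_add by simp
 qed
qed

lemma gauss_bounded_neg: "gauss_bounded f \<Longrightarrow> gauss_bounded (\<lambda>x. f (- x))"
 unfolding gauss_bounded_def by (metis power2_minus)

lemma gauss_integrable:
 assumes "0 < c" shows "integrable lborel (\<lambda>x. exp (- c * x^2))" and "(LINT x|lborel. exp (- c * x^2)) = sqrt (pi / c)"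
proof -
 define \<sigma> where "\<sigma> = sqrt (1 / (2 * c))"
 have \<sigma>: "0 < \<sigma>" "2 * \<sigma>\<^sup>2 = 1 / c" using assms by (auto simp: \<sigma>_def)
 have eq: "exp (- c * x^2) = sqrt (pi / c) * normal_density 0 \<sigma> x" for x
 proof -
  have "sqrt (2 * pi * \<sigma>\<^sup>2) = sqrt (pi / c)" using \<sigma>(2) by (metis mult.assoc mult.commute mult.right_neutral times_divide_eq_right)
  then show ?thesis using assms unfolding normal_density_def \<sigma>(2) by simp
 qed
 show "integrable lborel (\<lambda>x. exp (- c * x^2))" unfolding eq using \<sigma> by simp
 show "(LINT x|lborel. exp (- c * x^2)) = sqrt (pi / c)" unfolding eq using \<sigma> by simp
qed

lemma gauss_bounded_integrable:
 assumes "gauss_bounded f" "f \<in> borel_measurable borel" shows "integrable lborel f"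
proof -
 obtain C c where f: "0 < c" "0 < C" "\<And>x. cmod (f x) \<le> C * exp (- c * x^2)" using assms gauss_boundedE by metis
 show ?thesis
  by (rule Bochner_Integration.integrable_bound [of _ "\<lambda>x. C * exp (- c * x^2)"])
    (use f assms gauss_integrable(1) [OF f(1)] in auto)
qed

lemma gauss_bounded_L2:
 assumes g: "gauss_bounded f" and m: "f \<in> borel_measurable borel" shows "f \<in> L2"
proof -
 obtain C c where f: "0 < c" "0 < C" "\<And>x. cmod (f x) \<le> C * exp (- c * x^2)" using assms gauss_boundedE by metis
 have "gauss_bounded (\<lambda>x. f x * f x)"
 proof (rule gauss_bounded_bounded_mult [OF g])
  fix x
  have "C * exp (- c * x^2) \<le> C * 1" using f by simp
  then show "cmod (f x) \<le> C" using f(3) [of x] by simp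
 qed
 then have "integrable lborel (\<lambda>x. f x * f x)" by (rule gauss_bounded_integrable) (use m in measurable)
 then have "integrable lborel (\<lambda>x. norm (f x * f x))" by simp
 then show ?thesis using m by (simp add: L2_def norm_mult power2_eq_square)
qed

lemma gauss_bounded_tendsto_at_top:
 assumes "gauss_bounded f" shows "(f \<longlongrightarrow> 0) at_top"
proof -
 obtain C c where f: "0 < c" "0 < C" "\<And>x. cmod (f x) \<le> C * exp (- c * x^2)" using assms gauss_boundedE by metis
 have b: "cmod (f x) \<le> C / (c * x)" if "1 \<le> x" for x
 proof -
  have "c * x \<le> c * x^2" using that f by (intro mult_left_mono, auto simp: power2_eq_square)
  also have "\<dots> \<le> exp (c * x^2)" using exp_ge_add_one_self [of "c * x^2"] by linarith
  finally have "C / exp (c * x^2) \<le> C / (c * x)" using f that by (intro divide_left_mono) auto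
  then show ?thesis using f(3) [of x] by (simp add: exp_minus divide_inverse)
 qed
 have "((\<lambda>x. C / (c * x)) \<longlongrightarrow> 0) at_top"
  by (intro tendsto_divide_0 [OF tendsto_const] filterlim_at_top_imp_at_infinity
    filterlim_tendsto_pos_mult_at_top [OF tendsto_const f(1)] filterlim_ident)
 moreover have "eventually (\<lambda>x. cmod (f x) \<le> C / (c * x)) at_top"
  using eventually_ge_at_top [of 1] by eventually_elim (rule b)
 ultimately show ?thesis by (rule Lim_null_comparison [rotated])
qed

lemma gauss_bounded_tendsto:
 assumes "gauss_bounded f" shows "(f \<longlongrightarrow> 0) at_top" "(f \<longlongrightarrow> 0) at_bot"
 unfolding filterlim_at_bot_mirror
 by (intro gauss_bounded_tendsto_at_top gauss_bounded_neg assms)+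

lemma integral_derivative_eq_0:
 fixes F :: "real \<Rightarrow> complex"
 assumes F: "\<And>x. (F has_vector_derivative f x) (at x)" and f: "continuous_on UNIV f" "integrable lborel f"
  and "gauss_bounded F"
 shows "(LINT x|lborel. f x) = 0"
proof -
 have "(LBINT x=-\<infinity>..\<infinity>. f x) = 0 - 0"
 proof (rule interval_integral_FTC_integrable)
  show "((F \<circ> real_of_ereal) \<longlongrightarrow> 0) (at_right (-\<infinity>))" "((F \<circ> real_of_ereal) \<longlongrightarrow> 0) (at_left \<infinity>)"
   using gauss_bounded_tendsto [OF assms(4)] by (simp_all add: ereal_tendsto_simps)
  show "set_integrable lborel (einterval (- \<infinity>) \<infinity>) f" using f(2) by (simp add: set_integrable_def)
  show "isCont f x" for x using f(1) by (simp add: continuous_on_eq_continuous_at)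
 qed (use F in auto)
 then show ?thesis by (simp add: interval_lebesgue_integral_def set_lebesgue_integral_def)
qed

text \<open>A domain on which \<open>creation\<close> and \<open>annihilation\<close> map into
  \<open>L2\<close> and are adjoint to each other, stable under displacement and parity.\<close>

definition smooth_gauss :: "wavefun \<Rightarrow> bool" where
 "smooth_gauss f \<longleftrightarrow> gauss_bounded f \<and> (\<exists>f'. (\<forall>x. (f has_vector_derivative f' x) (at x)) \<and> continuous_on UNIV f' \<and> gauss_bounded f')"

lemma smooth_gaussD:
 assumes "smooth_gauss f"
 shows "gauss_bounded f" "(f has_vector_derivative vector_derivative f (at x)) (at x)"
  "continuous_on UNIV (\<lambda>x. vector_derivative f (at x))" "gauss_bounded (\<lambda>x. vector_derivative f (at x))"
  "continuous_on UNIV f" "f \<in> L2" "(\<lambda>x. vector_derivative f (at x)) \<in> L2" "position f \<in> L2"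
  "creation f \<in> L2" "annihilation f \<in> L2"
proof -
 let ?d = "\<lambda>x. vector_derivative f (at x)"
 from assms obtain f' where f': "\<And>x. (f has_vector_derivative f' x) (at x)" "continuous_on UNIV f'" "gauss_bounded f'"
  and g: "gauss_bounded f" by (auto simp: smooth_gauss_def)
 have e: "vector_derivative f (at x) = f' x" for x using f'(1) by (rule vector_derivative_at)
 show "gauss_bounded f" by (rule g)
 show "(f has_vector_derivative vector_derivative f (at x)) (at x)"
  "continuous_on UNIV ?d" "gauss_bounded ?d"
  using f' by (simp_all add: e)
 show c: "continuous_on UNIV f"
  using f'(1) has_vector_derivative_continuous by (blast intro: continuous_at_imp_continuous_on)
 then show f: "f \<in> L2" by (intro gauss_bounded_L2 g borel_measurable_continuous_onI)
 show d: "?d \<in> L2" unfolding e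
  by (intro gauss_bounded_L2 f' borel_measurable_continuous_onI)
 show p: "position f \<in> L2" unfolding position_def
  by (intro gauss_bounded_L2 gauss_bounded_mult_id g borel_measurable_continuous_onI continuous_intros c)
 have cr: "creation f = (\<lambda>x. 1 / of_real (sqrt 2) * position f x + (- 1 / of_real (sqrt 2)) * vector_derivative f (at x))"
  by (rule ext) (simp add: creation_def momentum_def field_simps)
 show "creation f \<in> L2" unfolding cr by (rule L2_lincomb [OF p d])
 have an: "annihilation f = (\<lambda>x. 1 / of_real (sqrt 2) * position f x + (1 / of_real (sqrt 2)) * vector_derivative f (at x))"
  by (rule ext) (simp add: annihilation_def momentum_def field_simps)
 show "annihilation f \<in> L2" unfolding an by (rule L2_lincomb [OF p d])
qed

text \<open>Multiplication by \<open>x\<close> is symmetric and differentiation antisymmetric; the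
  latter is integration by parts, with boundary terms killed by the Gaussian decay of
  \<open>cnj f * g\<close>.\<close>

lemma creation_adjoint:
 assumes "smooth_gauss f" "smooth_gauss g"
 shows "inner_L2 (creation f) g = inner_L2 f (annihilation g)"
proof -
 note F = smooth_gaussD [OF assms(1)] and G = smooth_gaussD [OF assms(2)]
 let ?f = "\<lambda>x. vector_derivative f (at x)" and ?g = "\<lambda>x. vector_derivative g (at x)"
 have "(LINT x|lborel. cnj (f x) * ?g x + cnj (?f x) * g x) = 0"
 proof (rule integral_derivative_eq_0 [where F = "\<lambda>x. cnj (f x) * g x"])
  show "((\<lambda>x. cnj (f x) * g x) has_vector_derivative cnj (f x) * ?g x + cnj (?f x) * g x) (at x)" for x
   by (rule has_vector_derivative_mult [OF has_vector_derivative_cnj [OF F(2)] G(2)])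
  show "continuous_on UNIV (\<lambda>x. cnj (f x) * ?g x + cnj (?f x) * g x)" by (intro continuous_intros F G)
  show "integrable lborel (\<lambda>x. cnj (f x) * ?g x + cnj (?f x) * g x)"
   by (intro Bochner_Integration.integrable_add L2_inner_integrable F G)
  obtain C c where C: "0 < c" "0 < C" "\<And>x. cmod (f x) \<le> C * exp (- c * x^2)" using F(1) gauss_boundedE by metis
  have "cmod (cnj (f x)) \<le> C" for x
  proof -
   have "C * exp (- c * x^2) \<le> C * 1" using C by simp
   then show ?thesis using C(3) [of x] by simp
  qed
  then show "gauss_bounded (\<lambda>x. cnj (f x) * g x)" by (rule gauss_bounded_bounded_mult [OF G(1)])
 qed
 then have ibp: "inner_L2 ?f g = - inner_L2 f ?g"
  by ((subst (asm) Bochner_Integration.integral_add, (intro L2_inner_integrable F G)+), (simp add: inner_L2_def add_eq_0_iff))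
 have pos: "inner_L2 (position f) g = inner_L2 f (position g)" by (simp add: inner_L2_def position_def mult_ac)
 define s where "s = 1 / complex_of_real (sqrt 2)"
 have cs: "cnj s = s" by (simp add: s_def)
 have cr: "creation f = (\<lambda>x. s * position f x + (- s) * ?f x)"
  by (rule ext) (simp add: creation_def momentum_def s_def field_simps)
 have an: "annihilation g = (\<lambda>x. s * position g x + s * ?g x)"
  by (rule ext) (simp add: annihilation_def momentum_def s_def field_simps)
 show ?thesis
  unfolding cr an
  by (subst inner_add_left, (intro L2_scale F G)+, subst inner_add_right, (intro L2_scale F G)+)
    (simp only: inner_scale_left inner_scale_right F G pos ibp cs complex_cnj_minus, simp)
qed

lemma creation_adjoint':
 assumes "smooth_gauss f" "smooth_gauss g"
 shows "inner_L2 (annihilation f) g = inner_L2 f (creation g)"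
proof -
 note F = smooth_gaussD [OF assms(1)] and G = smooth_gaussD [OF assms(2)]
 show ?thesis using creation_adjoint [OF assms(2,1)] inner_cnj [OF F(10) G(6)] inner_cnj [OF F(6) G(9)] by simp
qed

lemma smooth_gaussI:
 assumes "\<And>x. (f has_vector_derivative f' x) (at x)" "continuous_on UNIV f'" "gauss_bounded f" "gauss_bounded f'"
 shows "smooth_gauss f"
 using assms by (auto simp: smooth_gauss_def)

lemma gauss_bounded_gauss_poly: "gauss_bounded (gauss_poly P)"
proof -
 have "gauss_bounded (\<lambda>x. of_real (exp (- x\<^sup>2 / 2)))" by (rule gauss_boundedI [of "1/2" _ 1]) auto
 from gauss_bounded_poly [OF this, of P] show ?thesis by (simp add: gauss_poly_def)
qed

lemma gauss_poly_continuous: "continuous_on A (gauss_poly P)"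
 unfolding gauss_poly_def by (intro continuous_intros) auto

lemma smooth_gauss_poly: "smooth_gauss (gauss_poly P)"
proof (rule smooth_gaussI [OF _ gauss_poly_continuous gauss_bounded_gauss_poly gauss_bounded_gauss_poly])
 fix x
 show "(gauss_poly P has_vector_derivative gauss_poly (pderiv P - [:0, 1:] * P) x) (at x)"
  unfolding gauss_poly_def by (auto intro!: derivative_eq_intros simp: algebra_simps)
qed

lemma smooth_gauss_fock: "smooth_gauss (fock n)"
 unfolding fock_eq_gauss_poly by (rule smooth_gauss_poly)

lemma fock_L2 [simp]: "fock n \<in> L2" by (rule smooth_gaussD [OF smooth_gauss_fock])

lemma annihilation_fock_0: "annihilation (fock 0) = (\<lambda>x. 0)"
 by (simp add: fock_eq_gauss_poly annihilation_gauss_poly del: fock.simps) (simp add: gauss_poly_def pderiv_pCons)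

lemma annihilation_fock_Suc: "annihilation (fock (Suc n)) = (\<lambda>x. of_real (sqrt (real (Suc n))) * fock n x)"
proof -
 define P c where "P = fock_poly n" and "c = 1 / sqrt (2 * real (Suc n))"
 have "pderiv ([:0, 2:] * P - pderiv P) = smult 2 P + ([:0, 2:] * pderiv P - pderiv (pderiv P))"
  by (simp add: pderiv_diff pderiv_pCons pderiv_smult)
 also have "[:0, 2:] * pderiv P - pderiv (pderiv P) = smult (2 * real n) P"
  unfolding P_def by (rule fock_poly_ode)
 also have "smult 2 P + smult (2 * real n) P = smult (2 * real (Suc n)) P"
  by (simp flip: smult_add_left)
 finally have d: "pderiv (fock_poly (Suc n)) = smult (c * (2 * real (Suc n))) P" by (simp add: P_def c_def pderiv_smult)
 have "1 / sqrt 2 * (c * (2 * real (Suc n))) = sqrt (real (Suc n))"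
  unfolding c_def by (simp add: real_sqrt_mult field_simps del: of_nat_Suc)
 then show ?thesis
  by (simp only: fock_eq_gauss_poly annihilation_gauss_poly d smult_smult P_def)
    (simp add: gauss_poly_def fun_eq_iff del: of_nat_Suc)
qed

lemma creation_fock: "creation (fock n) = (\<lambda>x. of_real (sqrt (real (Suc n))) * fock (Suc n) x)"
 by (rule ext) (simp add: real_sqrt_eq_zero_cancel_iff del: of_nat_Suc)

section \<open>Parity and displacement on functions with Gaussian decay\<close>

lemma parity_L2: "f \<in> L2 \<Longrightarrow> parity f \<in> L2"
proof -
 assume f: "f \<in> L2"
 then have [measurable]: "f \<in> borel_measurable lborel" by (rule L2_measurable)
 have "integrable lborel (\<lambda>x. (cmod (f (0 + - 1 * x)))^2)"
  by (rule lborel_integrable_real_affine [OF L2_integrable_sq [OF f]]) simp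
 then show "parity f \<in> L2" by (simp add: L2_def parity_def)
qed

lemma displacement_L2: "f \<in> L2 \<Longrightarrow> displacement a f \<in> L2"
proof -
 assume f: "f \<in> L2"
 define q p where "q = sqrt 2 * Re a" and "p = sqrt 2 * Im a"
 have d: "displacement a f = (\<lambda>x. cis (p * x - p * q / 2) * f (x - q))"
  by (simp add: displacement_def Let_def q_def p_def)
 from f have [measurable]: "f \<in> borel_measurable lborel" by (rule L2_measurable)
 have [measurable]: "(\<lambda>x. cis (p * x - p * q / 2)) \<in> borel_measurable lborel"
  by (simp, intro borel_measurable_continuous_onI continuous_intros)
 have "integrable lborel (\<lambda>x. (cmod (f (- q + 1 * x)))^2)"
  by (rule lborel_integrable_real_affine [OF L2_integrable_sq [OF f]]) simp
 then show "displacement a f \<in> L2" by (simp add: L2_def d norm_mult)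
qed

lemma smooth_gauss_parity: "smooth_gauss f \<Longrightarrow> smooth_gauss (parity f)"
proof -
 assume f: "smooth_gauss f"
 note F = smooth_gaussD [OF f]
 show ?thesis
 proof (rule smooth_gaussI)
  show "(parity f has_vector_derivative - vector_derivative f (at (- x))) (at x)" for x
  proof -
   have "((\<lambda>x. - x) has_vector_derivative - 1) (at x)" by (auto intro!: derivative_eq_intros)
   from vector_diff_chain_at [OF this F(2)] show ?thesis by (simp add: parity_def o_def)
  qed
  show "continuous_on UNIV (\<lambda>x. - vector_derivative f (at (- x)))"
   by (intro continuous_intros continuous_on_compose2 [OF F(3)]) auto
  show "gauss_bounded (parity f)" unfolding parity_def by (rule gauss_bounded_neg [OF F(1)])
  show "gauss_bounded (\<lambda>x. - vector_derivative f (at (- x)))"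
   using gauss_bounded_neg [OF F(4)] by (simp add: gauss_bounded_def)
 qed
qed

lemma displacement_derivative:
 fixes a :: complex
 assumes f: "smooth_gauss f"
 defines "q \<equiv> sqrt 2 * Re a" and "p \<equiv> sqrt 2 * Im a"
 shows "(displacement a f has_vector_derivative
  \<i> * of_real p * displacement a f x + displacement a (\<lambda>x. vector_derivative f (at x)) x) (at x)"
proof -
 note F = smooth_gaussD [OF f]
 have d: "displacement a g = (\<lambda>x. cis (p * x - p * q / 2) * g (x - q))" for g
  by (simp add: displacement_def Let_def q_def p_def)
 have "((\<lambda>x. \<i> * of_real (p * x - p * q / 2)) has_vector_derivative \<i> * of_real p) (at x)"
  by (intro has_vector_derivative_mult_right has_vector_derivative_of_real) (auto intro!: derivative_eq_intros)
 from field_vector_diff_chain_at [OF this DERIV_exp]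
 have 1: "((\<lambda>x. cis (p * x - p * q / 2)) has_vector_derivative \<i> * of_real p * cis (p * x - p * q / 2)) (at x)"
  by (simp add: o_def cis_conv_exp)
 have "((\<lambda>x. x - q) has_vector_derivative 1) (at x)" by (auto intro!: derivative_eq_intros)
 from vector_diff_chain_at [OF this F(2)]
 have 2: "((\<lambda>x. f (x - q)) has_vector_derivative vector_derivative f (at (x - q))) (at x)" by (simp add: o_def)
 show ?thesis unfolding d using has_vector_derivative_mult [OF 1 2] by (simp add: add.commute mult.assoc)
qed

lemma smooth_gauss_displacement: "smooth_gauss f \<Longrightarrow> smooth_gauss (displacement a f)"
proof -
 assume f: "smooth_gauss f"
 note F = smooth_gaussD [OF f]
 define q p where "q = sqrt 2 * Re a" and "p = sqrt 2 * Im a"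
 have d: "displacement a g = (\<lambda>x. cis (p * x - p * q / 2) * g (x - q))" for g
  by (simp add: displacement_def Let_def q_def p_def)
 have gb: "gauss_bounded (displacement a g)" if "gauss_bounded g" for g
  unfolding d by (rule gauss_bounded_bounded_mult [OF gauss_bounded_shift [OF that], where B = 1]) simp
 have cd: "continuous_on UNIV (displacement a g)" if "continuous_on UNIV g" for g
  unfolding d by (intro continuous_intros continuous_on_compose2 [OF that]) auto
 show ?thesis
 proof (rule smooth_gaussI [OF displacement_derivative [OF f]])
  show "continuous_on UNIV (\<lambda>x. \<i> * of_real (sqrt 2 * Im a) * displacement a f x + displacement a (\<lambda>x. vector_derivative f (at x)) x)"
   by (intro continuous_on_add continuous_on_mult continuous_on_const cd [OF F(3)] cd [OF F(5)])
  show "gauss_bounded (displacement a f)" by (rule gb [OF F(1)])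
  show "gauss_bounded (\<lambda>x. \<i> * of_real (sqrt 2 * Im a) * displacement a f x + displacement a (\<lambda>x. vector_derivative f (at x)) x)"
   by (rule gauss_bounded_add [OF gauss_bounded_bounded_mult [OF gb [OF F(1)], where B = "cmod (\<i> * of_real (sqrt 2 * Im a))"] gb [OF F(4)]]) simp
 qed
qed

lemma annihilation_displacement:
 assumes "smooth_gauss f"
 shows "annihilation (displacement a f) = (\<lambda>x. displacement a (annihilation f) x + a * displacement a f x)"
proof
 fix x
 define q p where "q = sqrt 2 * Re a" and "p = sqrt 2 * Im a"
 have al: "a = (of_real q + \<i> * of_real p) / of_real (sqrt 2)" by (simp add: complex_eq_iff q_def p_def)
 have d: "displacement a g x = cis (p * x - p * q / 2) * g (x - q)" for g
  by (simp add: displacement_def Let_def q_def p_def)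
 have vd: "vector_derivative (displacement a f) (at x) = \<i> * of_real p * displacement a f x + displacement a (\<lambda>x. vector_derivative f (at x)) x"
  unfolding p_def by (rule vector_derivative_at [OF displacement_derivative [OF assms]])
 show "annihilation (displacement a f) x = displacement a (annihilation f) x + a * displacement a f x"
  unfolding annihilation_def momentum_def position_def vd d
  by (simp add: al field_simps)
qed

lemma creation_displacement:
 assumes "smooth_gauss f"
 shows "creation (displacement a f) = (\<lambda>x. displacement a (creation f) x + cnj a * displacement a f x)"
proof
 fix x
 define q p where "q = sqrt 2 * Re a" and "p = sqrt 2 * Im a"
 have al: "cnj a = (of_real q - \<i> * of_real p) / of_real (sqrt 2)" by (simp add: complex_eq_iff q_def p_def)
 have d: "displacement a g x = cis (p * x - p * q / 2) * g (x - q)" for g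
  by (simp add: displacement_def Let_def q_def p_def)
 have vd: "vector_derivative (displacement a f) (at x) = \<i> * of_real p * displacement a f x + displacement a (\<lambda>x. vector_derivative f (at x)) x"
  unfolding p_def by (rule vector_derivative_at [OF displacement_derivative [OF assms]])
 show "creation (displacement a f) x = displacement a (creation f) x + cnj a * displacement a f x"
  unfolding creation_def momentum_def position_def vd d al by (simp add: field_simps)
qed

lemma vector_derivative_parity:
 assumes "smooth_gauss f" shows "vector_derivative (parity f) (at x) = - vector_derivative f (at (- x))"
proof -
 have "((\<lambda>x. - x) has_vector_derivative - 1) (at x)" by (auto intro!: derivative_eq_intros)
 from vector_diff_chain_at [OF this smooth_gaussD(2) [OF assms]] show ?thesis
  by (intro vector_derivative_at) (simp add: parity_def o_def)
qed

lemma annihilation_parity: "smooth_gauss f \<Longrightarrow> annihilation (parity f) = (\<lambda>x. - parity (annihilation f) x)"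
 by (rule ext) (simp add: annihilation_def momentum_def position_def vector_derivative_parity, simp add: parity_def field_simps)

lemma creation_parity: "smooth_gauss f \<Longrightarrow> creation (parity f) = (\<lambda>x. - parity (creation f) x)"
 by (rule ext) (simp add: creation_def momentum_def position_def vector_derivative_parity, simp add: parity_def field_simps)

text \<open>With \<open>b = 2 * \<alpha>\<close> this is the operator in the definition of the
  Wigner function. It is a self-adjoint isometry (\<open>inner_weyl_self_adjoint\<close>,
  \<open>inner_weyl_weyl\<close>), the source of all contraction estimates.\<close>

definition weyl :: "complex \<Rightarrow> wavefun \<Rightarrow> wavefun" where
 "weyl b f = displacement b (parity f)"

lemma weyl_eq: "weyl b f = (\<lambda>x. cis (sqrt 2 * Im b * x - sqrt 2 * Im b * (sqrt 2 * Re b) / 2) * f (sqrt 2 * Re b - x))"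
 by (simp add: weyl_def displacement_def parity_def Let_def)

lemma weyl_L2: "f \<in> L2 \<Longrightarrow> weyl b f \<in> L2" by (simp add: weyl_def displacement_L2 parity_L2)

lemma smooth_gauss_weyl: "smooth_gauss f \<Longrightarrow> smooth_gauss (weyl b f)"
 by (simp add: weyl_def smooth_gauss_displacement smooth_gauss_parity)

lemma weyl_scale: "weyl b (\<lambda>x. a * f x) = (\<lambda>x. a * weyl b f x)" by (simp add: weyl_eq mult_ac)

lemma weyl_sum: "weyl b (\<lambda>x. \<Sum>i\<in>I. a i * f i x) = (\<lambda>x. \<Sum>i\<in>I. a i * weyl b (f i) x)"
 by (simp add: weyl_eq sum_distrib_left mult_ac)

text \<open>Displacement shifts the ladder operator by \<open>b\<close> and parity anticommutes with
  it; this sign produces the alternating sums in the matrix elements.\<close>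

lemma annihilation_weyl:
 assumes "smooth_gauss f"
 shows "annihilation (weyl b f) = (\<lambda>x. b * weyl b f x - weyl b (annihilation f) x)"
 unfolding weyl_def annihilation_displacement [OF smooth_gauss_parity [OF assms]] annihilation_parity [OF assms]
 by (rule ext) (simp add: displacement_def Let_def)

lemma creation_weyl:
 assumes "smooth_gauss f"
 shows "creation (weyl b f) = (\<lambda>x. cnj b * weyl b f x - weyl b (creation f) x)"
 unfolding weyl_def creation_displacement [OF smooth_gauss_parity [OF assms]] creation_parity [OF assms]
 by (rule ext) (simp add: displacement_def Let_def)

lemma inner_weyl_weyl: "inner_L2 (weyl b f) (weyl b g) = inner_L2 f g"
proof -
 define q where "q = sqrt 2 * Re b"
 have "inner_L2 (weyl b f) (weyl b g) = (LINT x|lborel. cnj (f (q + - 1 * x)) * g (q + - 1 * x))"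
  unfolding inner_L2_def weyl_eq q_def
 proof (rule Bochner_Integration.integral_cong [OF refl])
  fix x
  have "cnj (cis a * F) * (cis a * G) = cnj F * G" for a and F G :: complex
   by (simp add: cis_cnj cis_mult)
  then show "cnj (cis (sqrt 2 * Im b * x - sqrt 2 * Im b * (sqrt 2 * Re b) / 2) * f (sqrt 2 * Re b - x)) *
    (cis (sqrt 2 * Im b * x - sqrt 2 * Im b * (sqrt 2 * Re b) / 2) * g (sqrt 2 * Re b - x)) =
    cnj (f (sqrt 2 * Re b + - 1 * x)) * g (sqrt 2 * Re b + - 1 * x)"
   by (simp del: complex_cnj_mult)
 qed
 also have "\<dots> = inner_L2 f g"
  unfolding inner_L2_def using lborel_integral_real_affine [of "- 1" "\<lambda>x. cnj (f x) * g x" q] by simp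
 finally show ?thesis .
qed

lemma inner_weyl_self_adjoint: "inner_L2 (weyl b f) g = inner_L2 f (weyl b g)"
proof -
 define q p where "q = sqrt 2 * Re b" and "p = sqrt 2 * Im b"
 have "inner_L2 f (weyl b g) = (LINT x|lborel. cnj (f (q + - 1 * x)) * (cis (p * (q + - 1 * x) - p * q / 2) * g (q - (q + - 1 * x))))"
  unfolding inner_L2_def weyl_eq
  by (subst lborel_integral_real_affine [where c = "- 1" and t = q]) (simp_all add: q_def p_def)
 also have "\<dots> = inner_L2 (weyl b f) g"
  unfolding inner_L2_def weyl_eq q_def [symmetric] p_def [symmetric]
  by (rule Bochner_Integration.integral_cong) (simp_all add: cis_cnj algebra_simps)
 finally show ?thesis by simp
qed

lemma norm_weyl: "f \<in> L2 \<Longrightarrow> norm_L2 (weyl b f) = norm_L2 f"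
proof -
 assume f: "f \<in> L2"
 show ?thesis
  using inner_weyl_weyl [of b f f] f by ((simp only: inner_self weyl_L2), (simp only: of_real_eq_iff, simp add: power2_eq_iff_nonneg))
qed

text \<open>Rescales the characteristic function of the standard normal distribution by
  \<open>c = 1 / sqrt (2 * a)\<close>.\<close>

lemma gauss_fourier:
 assumes "0 < a"
 shows "(LINT x|lborel. cis (t * x) * of_real (exp (- a * x^2))) = of_real (sqrt (pi / a) * exp (- t\<^sup>2 / (4 * a)))"
proof -
 define c where "c = 1 / sqrt (2 * a)"
 have c: "0 < c" "a * c^2 = 1/2" using assms by (auto simp: c_def power_divide)
 have ch: "(LINT x|lborel. of_real (std_normal_density x) * cis (u * x)) = of_real (exp (- u\<^sup>2 / 2))" for u
 proof -
  have "complex_of_real (exp (- u\<^sup>2 / 2)) = char std_normal_distribution u" by (simp add: char_std_normal_distribution)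
  also have "\<dots> = (LINT x|lborel. std_normal_density x *\<^sub>R exp (\<i> * of_real (u * x)))"
   unfolding char_def
   by (subst integral_density) (auto simp: normal_density_nonneg)
  finally show ?thesis by (simp add: cis_conv_exp scaleR_conv_of_real)
 qed
 have "(LINT x|lborel. cis (t * x) * of_real (exp (- a * x^2))) = \<bar>c\<bar> *\<^sub>R (LINT x|lborel. cis (t * (0 + c * x)) * of_real (exp (- a * (0 + c * x)^2)))"
  using c by (intro lborel_integral_real_affine) auto
 also have "(\<lambda>x. cis (t * (0 + c * x)) * complex_of_real (exp (- a * (0 + c * x)^2))) = (\<lambda>x. of_real (sqrt (2 * pi)) * (of_real (std_normal_density x) * cis (t * c * x)))"
  using c(2) by (auto simp: power_mult_distrib mult.assoc [symmetric] std_normal_density_def)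
 also have "(LINT x|lborel. of_real (sqrt (2 * pi)) * (of_real (std_normal_density x) * cis (t * c * x))) = of_real (sqrt (2 * pi)) * of_real (exp (- (t * c)\<^sup>2 / 2))"
  by (subst integral_mult_right_zero) (simp only: ch)
 also have "\<bar>c\<bar> *\<^sub>R (of_real (sqrt (2 * pi)) * of_real (exp (- (t * c)\<^sup>2 / 2))) = (of_real (sqrt (pi / a) * exp (- t\<^sup>2 / (4 * a))) :: complex)"
  using c by (simp add: c_def real_sqrt_divide real_sqrt_mult field_simps scaleR_conv_of_real)
 finally show ?thesis .
qed

section \<open>Matrix elements of the displaced parity in the Fock basis\<close>

definition mel :: "complex \<Rightarrow> nat \<Rightarrow> nat \<Rightarrow> complex" where
 "mel b k n = inner_L2 (fock k) (weyl b (fock n))"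

lemma mel_cnj: "mel b k n = cnj (mel b n k)"
 unfolding mel_def by (subst inner_cnj) (auto simp: weyl_L2 inner_weyl_self_adjoint)

text \<open>The Gaussians \<open>fock 0 x\<close> and \<open>fock 0 (q - x)\<close> combine into one
  centred at \<open>q / 2\<close>; after recentring, the integral is a Gaussian Fourier
  transform.\<close>

lemma mel_0_0: "mel b 0 0 = of_real (exp (- (cmod b)\<^sup>2 / 2))"
proof -
 define q p where "q = sqrt 2 * Re b" and "p = sqrt 2 * Im b"
 have pipi: "pi powr (- 1/4) * pi powr (- 1/4) = 1 / sqrt pi"
 proof -
  have "pi powr (- 1/4) * pi powr (- 1/4) = pi powr (- (1/2))" by (simp flip: powr_add)
  also have "\<dots> = 1 / sqrt pi" unfolding powr_minus by (simp only: powr_half_sqrt pi_ge_zero inverse_eq_divide)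
  finally show ?thesis .
 qed
 have "mel b 0 0 = (LINT x|lborel. of_real (1 / sqrt pi) * (cis (p * x - p * q / 2) * of_real (exp (- x\<^sup>2 / 2 - (q - x)^2 / 2))))"
  unfolding mel_def inner_L2_def weyl_eq q_def [symmetric] p_def [symmetric]
 proof (rule Bochner_Integration.integral_cong [OF refl])
  fix x
  have ex: "exp (- x\<^sup>2 / 2 - (q - x)^2 / 2) = exp (- x\<^sup>2 / 2) * exp (- (q - x)\<^sup>2 / 2)"
   unfolding exp_add [symmetric] by simp
  have gen: "cnj (complex_of_real (c * u)) * (z * of_real (c * v)) = of_real (c * c) * (z * of_real (u * v))" for c u v z
   by simp
  show "cnj (fock 0 x) * (cis (p * x - p * q / 2) * fock 0 (q - x)) = of_real (1 / sqrt pi) * (cis (p * x - p * q / 2) * of_real (exp (- x\<^sup>2 / 2 - (q - x)^2 / 2)))"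
   unfolding fock.simps pipi [symmetric] ex by (rule gen)
 qed
 also have "\<dots> = of_real (1 / sqrt pi) * (LINT x|lborel. cis (p * x - p * q / 2) * of_real (exp (- x\<^sup>2 / 2 - (q - x)^2 / 2)))"
  by simp
 also have "(LINT x|lborel. cis (p * x - p * q / 2) * complex_of_real (exp (- x\<^sup>2 / 2 - (q - x)^2 / 2)))
   = (LINT x|lborel. cis (p * (q / 2 + 1 * x) - p * q / 2) * of_real (exp (- (q / 2 + 1 * x)\<^sup>2 / 2 - (q - (q / 2 + 1 * x))^2 / 2)))"
  by (subst lborel_integral_real_affine [where c = 1 and t = "q / 2"]) simp_all
 also have "\<dots> = (LINT x|lborel. of_real (exp (- q\<^sup>2 / 4)) * (cis (p * x) * of_real (exp (- 1 * x^2))))"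
 proof (rule Bochner_Integration.integral_cong [OF refl])
  fix x
  have 1: "p * (q / 2 + 1 * x) - p * q / 2 = p * x" by (simp add: algebra_simps)
  have 2: "- (q / 2 + 1 * x)\<^sup>2 / 2 - (q - (q / 2 + 1 * x))^2 / 2 = - q\<^sup>2 / 4 + - 1 * x^2"
   by (simp add: power2_eq_square field_simps)
  show "cis (p * (q / 2 + 1 * x) - p * q / 2) * complex_of_real (exp (- (q / 2 + 1 * x)\<^sup>2 / 2 - (q - (q / 2 + 1 * x))^2 / 2)) = of_real (exp (- q\<^sup>2 / 4)) * (cis (p * x) * of_real (exp (- 1 * x^2)))"
   unfolding 1 2 exp_add by simp
 qed
 also have "\<dots> = of_real (exp (- q\<^sup>2 / 4)) * of_real (sqrt (pi / 1) * exp (- p\<^sup>2 / (4 * 1)))"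
  by (subst integral_mult_right_zero) (simp only: gauss_fourier [of 1] zero_less_one)
 finally have "mel b 0 0 = of_real (1 / sqrt pi * (exp (- q\<^sup>2 / 4) * (sqrt pi * exp (- p\<^sup>2 / 4))))" by simp
 also have "1 / sqrt pi * (exp (- q\<^sup>2 / 4) * (sqrt pi * exp (- p\<^sup>2 / 4))) = exp (- (cmod b)\<^sup>2 / 2)"
 proof -
  have "- (cmod b)\<^sup>2 / 2 = - q\<^sup>2 / 4 + - p\<^sup>2 / 4" by (simp add: cmod_power2 q_def p_def power_mult_distrib)
  then show ?thesis by (simp only: exp_add) simp
 qed
 finally show ?thesis .
qed

lemma mel_0_Suc: "of_real (sqrt (real (Suc n))) * mel b 0 (Suc n) = cnj b * mel b 0 n"
proof -
 have "of_real (sqrt (real (Suc n))) * mel b 0 (Suc n) = inner_L2 (fock 0) (weyl b (creation (fock n)))"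
  unfolding mel_def creation_fock weyl_scale by (simp add: inner_scale_right weyl_L2 del: fock.simps of_nat_Suc)
 also have "weyl b (creation (fock n)) = (\<lambda>x. cnj b * weyl b (fock n) x - creation (weyl b (fock n)) x)"
  by (simp add: creation_weyl [OF smooth_gauss_fock])
 also have "inner_L2 (fock 0) \<dots> = cnj b * mel b 0 n - inner_L2 (fock 0) (creation (weyl b (fock n)))"
  unfolding mel_def
  by (subst inner_diff_right)
    (simp_all add: L2_scale weyl_L2 inner_scale_right smooth_gaussD(9) smooth_gauss_weyl smooth_gauss_fock del: fock.simps)
 also have "inner_L2 (fock 0) (creation (weyl b (fock n))) = 0"
  by (subst creation_adjoint' [symmetric])
    (simp_all add: smooth_gauss_weyl smooth_gauss_fock annihilation_fock_0 inner_L2_def del: fock.simps)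
 finally show ?thesis by simp
qed

text \<open>\<open>creation\<close> on the left vector becomes \<open>annihilation\<close> on the
  right one, is commuted through \<open>weyl b\<close>, and lowers \<open>fock n\<close>.\<close>

lemma mel_Suc:
 "of_real (sqrt (real (Suc k))) * mel b (Suc k) n = b * mel b k n - (if n = 0 then 0 else of_real (sqrt (real n)) * mel b k (n - 1))"
proof -
 have "of_real (sqrt (real (Suc k))) * mel b (Suc k) n = inner_L2 (creation (fock k)) (weyl b (fock n))"
  unfolding mel_def creation_fock by (simp add: inner_scale_left weyl_L2 del: fock.simps of_nat_Suc)
 also have "\<dots> = inner_L2 (fock k) (annihilation (weyl b (fock n)))"
  by (rule creation_adjoint [OF smooth_gauss_fock smooth_gauss_weyl [OF smooth_gauss_fock]])
 also have "\<dots> = b * mel b k n - inner_L2 (fock k) (weyl b (annihilation (fock n)))"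
  unfolding annihilation_weyl [OF smooth_gauss_fock] mel_def
  by (subst inner_diff_right)
    (simp_all add: L2_scale weyl_L2 inner_scale_right smooth_gaussD(10) smooth_gauss_fock del: fock.simps)
 also have "inner_L2 (fock k) (weyl b (annihilation (fock n))) = (if n = 0 then 0 else of_real (sqrt (real n)) * mel b k (n - 1))"
 proof (cases n)
  case 0
  then show ?thesis by (simp add: annihilation_fock_0 weyl_eq del: fock.simps)
 next
  case (Suc m)
  then show ?thesis
   by (simp add: annihilation_fock_Suc weyl_scale inner_scale_right weyl_L2 mel_def del: fock.simps of_nat_Suc)
 qed
 finally show ?thesis .
qed

lemma mel_explicit:
 "of_real (sqrt (fact k * fact n)) * mel b k n = of_real (exp (- (cmod b)\<^sup>2 / 2)) *
  (\<Sum>j\<le>k. (-1) ^ j * of_nat (k choose j) * of_nat (n choose j) * fact j * b ^ (k - j) * cnj b ^ (n - j))"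
proof (induction k arbitrary: n)
 case 0
 have "of_real (sqrt (fact n)) * mel b 0 n = of_real (exp (- (cmod b)\<^sup>2 / 2)) * cnj b ^ n"
 proof (induction n)
  case 0 then show ?case by (simp add: mel_0_0)
 next
  case (Suc n)
  have "of_real (sqrt (fact (Suc n))) * mel b 0 (Suc n) = of_real (sqrt (fact n)) * (of_real (sqrt (real (Suc n))) * mel b 0 (Suc n))"
   by (simp add: real_sqrt_mult)
  then show ?case using Suc unfolding mel_0_Suc by simp
 qed
 then show ?case by simp
next
 case (Suc k)
 define e where "e = complex_of_real (exp (- (cmod b)\<^sup>2 / 2))"
 define T where "T k n j = (-1) ^ j * of_nat (k choose j) * of_nat (n choose j) * fact j * b ^ (k - j) * cnj b ^ (n - j)" for k n j
 let ?d = "(\<Sum>j\<le>k. b * T k n j) - (\<Sum>j\<le>k. of_nat n * T k (n - 1) j)"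
 have IH: "of_real (sqrt (fact k * fact n)) * mel b k n = e * (\<Sum>j\<le>k. T k n j)" for n
  using Suc by (simp add: e_def T_def)
 have "of_real (sqrt (fact (Suc k) * fact n)) * mel b (Suc k) n = of_real (sqrt (fact k * fact n)) * (of_real (sqrt (real (Suc k))) * mel b (Suc k) n)"
  by (simp add: real_sqrt_mult)
 also have "\<dots> = b * (of_real (sqrt (fact k * fact n)) * mel b k n) - of_nat n * (of_real (sqrt (fact k * fact (n - 1))) * mel b k (n - 1))"
 proof (cases n)
  case 0 then show ?thesis unfolding mel_Suc by (simp add: mult_ac)
 next
  case (Suc m)
  have "sqrt (fact k * fact n) * sqrt (real n) = real n * sqrt (fact k * fact m)" using Suc by (simp add: real_sqrt_mult)
  then have "complex_of_real (sqrt (fact k * fact n)) * of_real (sqrt (real n)) = of_nat n * of_real (sqrt (fact k * fact m))"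
   by (metis of_real_mult of_real_of_nat_eq)
  then show ?thesis using Suc unfolding mel_Suc by (simp add: right_diff_distrib)
 qed
 also have "\<dots> = e * (?d)"
  unfolding IH by (simp add: sum_distrib_left right_diff_distrib mult_ac)
 \<comment> \<open>Both sums are rewritten with the same terms \<open>A j\<close>; their
   coefficients then add up by Pascal's rule.\<close>
 also have "?d = (\<Sum>j\<le>Suc k. T (Suc k) n j)"
 proof -
  define A where "A j = (-1) ^ j * of_nat (n choose j) * fact j * b ^ (Suc k - j) * cnj b ^ (n - j)" for j
  have 1: "(\<Sum>j\<le>k. b * T k n j) = (\<Sum>j\<le>Suc k. of_nat (k choose j) * A j)"
  proof -
   have "b * T k n j = of_nat (k choose j) * A j" if "j \<le> k" for j
    using that by (simp add: T_def A_def Suc_diff_le)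
   then show ?thesis by simp
  qed
  have 2: "- (of_nat n * T k (n - 1) j) = of_nat (k choose j) * A (Suc j)" if "j \<le> k" for j
  proof (cases n)
   case 0 then show ?thesis by (simp add: A_def)
  next
   case (Suc m)
   have "n * ((m choose j) * fact j) = (n choose Suc j) * fact (Suc j)"
   proof -
    have "n * (m choose j) = Suc j * (n choose Suc j)" using Suc_times_binomial [of j m] Suc by simp
    then show ?thesis unfolding mult.assoc [symmetric] by (simp add: algebra_simps)
   qed
   then have "(-1) ^ Suc j * of_nat (k choose j) * (complex_of_nat n * (of_nat (m choose j) * fact j)) * b ^ (k - j) * cnj b ^ (m - j)
     = (-1) ^ Suc j * of_nat (k choose j) * (of_nat (n choose Suc j) * fact (Suc j)) * b ^ (k - j) * cnj b ^ (m - j)"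
    by (metis of_nat_fact of_nat_mult)
   then show ?thesis using Suc by (simp add: T_def A_def mult_ac)
  qed
  have "- (\<Sum>j\<le>k. of_nat n * T k (n - 1) j) = (\<Sum>j\<le>k. of_nat (k choose j) * A (Suc j))"
   unfolding sum_negf [symmetric] by (rule sum.cong [OF refl]) (use 2 in auto)
  also have "\<dots> = (\<Sum>j\<le>Suc k. (if j = 0 then 0 else of_nat (k choose (j - 1))) * A j)"
   by (subst sum.atMost_Suc_shift) simp
  finally have "?d = (\<Sum>j\<le>Suc k. (of_nat (k choose j) + (if j = 0 then 0 else of_nat (k choose (j - 1)))) * A j)"
   unfolding 1 diff_conv_add_uminus by (simp only: sum.distrib distrib_right)
  also have "\<dots> = (\<Sum>j\<le>Suc k. T (Suc k) n j)"
  proof (rule sum.cong [OF refl])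
   fix j
   show "(of_nat (k choose j) + (if j = 0 then 0 else of_nat (k choose (j - 1)))) * A j = T (Suc k) n j"
    by ((cases j, auto); (simp add: T_def A_def mult_ac))
  qed
  finally show ?thesis .
 qed
 finally show ?case by (simp add: e_def T_def)
qed

text \<open>Reversing the summation index turns \<open>mel_explicit\<close> into a Laguerre sum. The
  element separates into a pure harmonic \<open>cis (d * t)\<close> and the radial function
  \<open>lagw\<close>, which is what the normalisation of \<open>lagw\<close> is for.\<close>

lemma mel_polar:
 assumes x: "0 \<le> x"
 shows "mel (of_real (sqrt x) * cis t) (n + d) n = (-1) ^ n * cis (real d * t) * of_real (lagw n d x)"
proof -
 define k where "k = n + d"
 define b where "b = of_real (sqrt x) * cis t"
 have nb: "(cmod b)^2 = x" using x by (simp add: b_def norm_mult)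
 have bb: "b ^ (m + d) * cnj b ^ m = of_real (x ^ m * sqrt x ^ d) * cis (real d * t)" for m
 proof -
  have "b * cnj b = of_real x" by (simp add: complex_norm_square [symmetric] nb)
  then have "b ^ m * cnj b ^ m = of_real (x ^ m)" by (simp flip: power_mult_distrib)
  then show ?thesis by (simp add: b_def power_mult_distrib Complex.DeMoivre power_add mult_ac)
 qed
 have "(\<Sum>j\<le>k. (-1) ^ j * of_nat (k choose j) * of_nat (n choose j) * fact j * b ^ (k - j) * cnj b ^ (n - j))
   = (\<Sum>j\<le>n. (-1) ^ j * of_nat (k choose j) * of_nat (n choose j) * fact j * b ^ (k - j) * cnj b ^ (n - j))"
  by (rule sum.mono_neutral_right) (auto simp: k_def)
 also have "\<dots> = (\<Sum>i\<le>n. (-1) ^ (n - i) * of_nat (k choose (n - i)) * of_nat (n choose (n - i)) * fact (n - i) * b ^ (k - (n - i)) * cnj b ^ (n - (n - i)))"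
  by (rule sum.reindex_bij_witness [of _ "\<lambda>i. n - i" "\<lambda>i. n - i"]) auto
 also have "\<dots> = (\<Sum>i\<le>n. (-1) ^ n * fact n * cis (real d * t) * of_real (sqrt x ^ d) * of_real ((-1) ^ i * real (k choose (n - i)) * x ^ i / fact i))"
 proof (rule sum.cong [OF refl])
  fix i assume "i \<in> {..n}"
  then have i: "i \<le> n" by simp
  have e1: "k - (n - i) = i + d" "n - (n - i) = i" using i by (auto simp: k_def)
  have e2: "complex_of_nat (n choose (n - i)) * fact (n - i) = fact n / fact i"
   using binomial_fact_lemma [OF diff_le_self, of n i] i by (simp add: field_simps, metis (no_types, lifting) of_nat_fact of_nat_mult mult.assoc mult.commute)
  have e3: "(-1) ^ (n - i) = ((-1) ^ n * (-1) ^ i :: complex)"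
   using i by (simp add: minus_one_power_iff)
  show "(-1) ^ (n - i) * of_nat (k choose (n - i)) * of_nat (n choose (n - i)) * fact (n - i) * b ^ (k - (n - i)) * cnj b ^ (n - (n - i))
    = (-1) ^ n * fact n * cis (real d * t) * of_real (sqrt x ^ d) * of_real ((-1) ^ i * real (k choose (n - i)) * x ^ i / fact i)"
   unfolding e1 e3 using bb [of i] e2 by (simp add: mult.assoc)
 qed
 also have "\<dots> = (-1) ^ n * fact n * cis (real d * t) * of_real (sqrt x ^ d) * of_real (lag n d x)"
  by (simp only: sum_distrib_left [symmetric] of_real_sum [symmetric]) (simp add: lag_def k_def)
 finally have "of_real (sqrt (fact k * fact n)) * mel b k n = of_real (exp (- x / 2)) * ((-1) ^ n * fact n * cis (real d * t) * of_real (sqrt x ^ d) * of_real (lag n d x))"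
  using mel_explicit [of k n b] by (simp only: nb)
 also have "\<dots> = of_real (sqrt (fact k * fact n)) * ((-1) ^ n * cis (real d * t) * of_real (lagw n d x))"
 proof -
  have "fact n = sqrt (fact k * fact n) * sqrt (fact n / fact k :: real)" by (simp flip: real_sqrt_mult)
  then have "complex_of_real (fact n) = of_real (sqrt (fact k * fact n)) * of_real (sqrt (fact n / fact k))" by (metis of_real_mult)
  then show ?thesis unfolding lagw_def k_def [symmetric] by (simp add: mult_ac)
 qed
 finally show ?thesis by (simp add: k_def b_def)
qed

text \<open>At \<open>b = 0\<close> the displaced parity is parity itself, so the matrix elements
  already computed contain the inner products.\<close>

lemma fock_orthonormal: "inner_L2 (fock m) (fock n) = (if m = n then 1 else 0)"
proof -
 have w: "weyl 0 (fock n) = (\<lambda>x. (-1) ^ n * fock n x)" by (simp add: weyl_def parity_fock displacement_def)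
 have M: "mel 0 m n = (-1) ^ n * inner_L2 (fock m) (fock n)" unfolding mel_def w by (simp add: inner_scale_right)
 have lw: "lagw n d 0 = (if d = 0 then 1 else 0)" for n d
 proof -
  have "lag n 0 0 = (\<Sum>i\<le>n. if i = 0 then 1 else 0)" unfolding lag_def by simp
  then show ?thesis by (simp add: lagw_def)
 qed
 have M0: "mel 0 (n + d) n = (if d = 0 then (-1) ^ n else 0)" for n d
  using mel_polar [of 0 0 n d] by (simp add: lw)
 show ?thesis
 proof (cases "n \<le> m")
  case True
  then show ?thesis using M M0 [of n "m - n"] by auto
 next
  case False
  then show ?thesis using M0 [of m "n - m"] mel_cnj [of 0 m n] M False by simp
 qed
qed

lemma norm_fock [simp]: "norm_L2 (fock n) = 1"
proof -
 have "complex_of_real ((norm_L2 (fock n))^2) = 1" using fock_orthonormal [of n n] by (simp add: inner_self)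
 then have "(norm_L2 (fock n))^2 = 1" by (metis of_real_eq_1_iff)
 then show ?thesis by (simp add: power2_eq_1_iff) (use norm_L2_nonneg [of "fock n"] in linarith)
qed

text \<open>Up to a unimodular factor this is a matrix element of an isometry between unit
  vectors.\<close>

lemma lagw_abs_le_1:
 assumes "0 \<le> x" shows "\<bar>lagw n d x\<bar> \<le> 1"
proof -
 have "cmod (mel (of_real (sqrt x) * cis 0) (n + d) n) \<le> norm_L2 (fock (n + d)) * norm_L2 (weyl (of_real (sqrt x) * cis 0) (fock n))"
  unfolding mel_def by (rule inner_Cauchy_Schwarz) (auto simp: weyl_L2)
 then show ?thesis unfolding mel_polar [OF assms] by (simp add: norm_mult norm_power norm_weyl)
qed

section \<open>Completeness of the Fock basis\<close>

definition fock_coeff :: "wavefun \<Rightarrow> nat \<Rightarrow> complex" where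
 "fock_coeff f n = inner_L2 (fock n) f"

definition fock_partial :: "nat \<Rightarrow> wavefun \<Rightarrow> wavefun" where
 "fock_partial N f = (\<lambda>x. \<Sum>n<N. fock_coeff f n * fock n x)"

lemma fock_partial_L2 [simp]: "fock_partial N f \<in> L2"
 unfolding fock_partial_def by (rule L2_sum) simp

lemma norm_fock_sum_sq:
 assumes "finite A" shows "(norm_L2 (\<lambda>x. \<Sum>n\<in>A. c n * fock n x))^2 = (\<Sum>n\<in>A. (cmod (c n))^2)"
proof -
 have "complex_of_real ((norm_L2 (\<lambda>x. \<Sum>n\<in>A. c n * fock n x))^2) = (\<Sum>m\<in>A. cnj (c m) * (\<Sum>n\<in>A. c n * (if m = n then 1 else 0)))"
  by (simp add: inner_self [symmetric] L2_sum inner_sum_left inner_sum_right fock_orthonormal del: fock.simps of_real_power)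
 also have "\<dots> = (\<Sum>m\<in>A. cnj (c m) * c m)" using assms by (simp add: sum.delta if_distrib cong: if_cong)
 also have "\<dots> = complex_of_real (\<Sum>n\<in>A. (cmod (c n))^2)"
  unfolding of_real_sum by (rule sum.cong [OF refl]) (metis complex_norm_square mult.commute)
 finally show ?thesis by (simp only: of_real_eq_iff)
qed

lemma fock_coeff_partial: "m < N \<Longrightarrow> fock_coeff (fock_partial N f) m = fock_coeff f m"
 unfolding fock_partial_def fock_coeff_def [of "\<lambda>x. \<Sum>n<N. fock_coeff f n * fock n x"]
 by (simp add: inner_sum_right fock_orthonormal if_distrib cong: if_cong del: fock.simps)

lemma bessel_identity:
 assumes f: "f \<in> L2"
 shows "(norm_L2 (\<lambda>x. f x - fock_partial N f x))^2 = (norm_L2 f)^2 - (\<Sum>n<N. (cmod (fock_coeff f n))^2)"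
proof -
 let ?b = "\<Sum>n<N. (cmod (fock_coeff f n))^2"
 define S where "S = fock_partial N f"
 have S: "S \<in> L2" by (simp add: S_def)
 have fS: "inner_L2 S f = of_real ?b"
 proof -
  have "inner_L2 S f = (\<Sum>n<N. cnj (fock_coeff f n) * fock_coeff f n)"
   unfolding S_def fock_partial_def by (simp add: inner_sum_left f fock_coeff_def)
  also have "\<dots> = of_real ?b"
   unfolding of_real_sum by (rule sum.cong [OF refl]) (metis complex_norm_square mult.commute)
  finally show ?thesis .
 qed
 have SS: "inner_L2 S S = of_real ?b"
  unfolding inner_self [OF S] unfolding S_def fock_partial_def by (simp only: norm_fock_sum_sq finite_lessThan)
 have Sf: "inner_L2 f S = of_real ?b"
  using inner_cnj [OF f S] unfolding fS by simp
 have "complex_of_real ((norm_L2 (\<lambda>x. f x - S x))^2) = inner_L2 f f - inner_L2 f S - (inner_L2 S f - inner_L2 S S)"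
  by (simp only: inner_self [symmetric] L2_diff f S inner_diff_left inner_diff_right)
 then have "complex_of_real ((norm_L2 (\<lambda>x. f x - S x))^2) = of_real ((norm_L2 f)^2 - ?b)"
  unfolding Sf fS SS inner_self [OF f] by simp
 then show ?thesis unfolding S_def by (simp only: of_real_eq_iff)
qed

lemma bessel_inequality: "f \<in> L2 \<Longrightarrow> (\<Sum>n<N. (cmod (fock_coeff f n))^2) \<le> (norm_L2 f)^2"
 using bessel_identity [of f N] zero_le_power2 [of "norm_L2 (\<lambda>x. f x - fock_partial N f x)"] by linarith

lemma bessel_summable: "f \<in> L2 \<Longrightarrow> summable (\<lambda>n. (cmod (fock_coeff f n))^2)"
 by (rule summableI_nonneg_bounded [OF _ bessel_inequality]) auto

lemma gauss_weight_L2: "(\<lambda>x. of_real (exp (- x\<^sup>2 / 2))) \<in> L2"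
 using fock_L2 [of 0] L2_scale [of "fock 0" "1 / of_real (pi powr (- 1/4))"] by simp

text \<open>A real function is split into positive and negative parts. Equal transforms at 0 give
  equal masses, and after normalisation both parts are probability densities with the same
  characteristic function. The complex case follows by conjugating and replacing \<open>t\<close>
  with \<open>- t\<close>.\<close>

lemma fourier_injective:
 fixes h :: "real \<Rightarrow> complex"
 assumes h: "integrable lborel h" and F: "\<And>t. (LINT x|lborel. cis (t * x) * h x) = 0"
 shows "AE x in lborel. h x = 0"
proof -
 have real: "AE x in lborel. g x = 0" if g: "integrable lborel g" and G: "\<And>t. (LINT x|lborel. cis (t * x) * of_real (g x)) = 0" for g :: "real \<Rightarrow> real"
 proof -
  define gp gm where "gp x = max 0 (g x)" and "gm x = max 0 (- g x)" for x
  have [measurable]: "g \<in> borel_measurable borel" using g by auto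
  have [measurable]: "gp \<in> borel_measurable borel" "gm \<in> borel_measurable borel"
   unfolding gp_def gm_def by measurable
  have gd: "g x = gp x - gm x" for x by (auto simp: gp_def gm_def)
  have ip: "integrable lborel gp" "integrable lborel gm" using g unfolding gp_def gm_def by auto
  have nn: "0 \<le> gp x" "0 \<le> gm x" for x by (auto simp: gp_def gm_def)
  have Z: "(LINT x|lborel. gp x *\<^sub>R cis (t * x)) = (LINT x|lborel. gm x *\<^sub>R cis (t * x))" for t
  proof -
   have i: "integrable lborel (\<lambda>x. g x *\<^sub>R cis (t * x))" if "integrable lborel g" for g :: "real \<Rightarrow> real"
    by (rule Bochner_Integration.integrable_bound [OF that])
      (auto intro!: borel_measurable_scaleR borel_measurable_integrable [OF that, simplified] borel_measurable_continuous_onI [of "\<lambda>x. cis (t * x)"] continuous_intros)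
   have "0 = (LINT x|lborel. gp x *\<^sub>R cis (t * x) - gm x *\<^sub>R cis (t * x))"
    unfolding scaleR_diff_left [symmetric] gd [symmetric] using G [of t] by (simp add: scaleR_conv_of_real mult.commute)
   also have "\<dots> = (LINT x|lborel. gp x *\<^sub>R cis (t * x)) - (LINT x|lborel. gm x *\<^sub>R cis (t * x))"
    by (rule Bochner_Integration.integral_diff) (intro i ip)+
   finally show ?thesis by simp
  qed
  define c where "c = (LINT x|lborel. gp x)"
  have c': "c = (LINT x|lborel. gm x)" using Z [of 0] by (simp add: scaleR_conv_of_real c_def)
  have AE0: "AE x in lborel. u x = 0" if "integrable lborel u" "\<And>x. 0 \<le> u x" "(LINT x|lborel. u x) = 0" for u :: "real \<Rightarrow> real"
   using integral_nonneg_eq_0_iff_AE [of lborel u] that by auto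
  show ?thesis
  proof (cases "c = 0")
   case True
   show ?thesis using AE0 [OF ip(1) nn(1)] AE0 [OF ip(2) nn(2)] True c' c_def by (auto simp: gd)
  next
   case False
   have "0 \<le> c" unfolding c_def by (rule integral_nonneg_AE) (use nn in auto)
   with False have c: "0 < c" by simp
   define M where "M u = density lborel (\<lambda>x. ennreal (u x / c))" for u :: "real \<Rightarrow> real"
   have dist: "real_distribution (M u)" if "integrable lborel u" "\<And>x. 0 \<le> u x" "(LINT x|lborel. u x) = c" for u
   proof (rule real_distribution.intro, rule prob_spaceI)
    have "emeasure (M u) (space (M u)) = (\<integral>\<^sup>+x. ennreal (u x / c) \<partial>lborel)"
     unfolding M_def using that(1) by (subst emeasure_density) auto
    also have "\<dots> = ennreal (LINT x|lborel. u x / c)"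
     by (rule nn_integral_eq_integral) (use that c in auto)
    also have "\<dots> = 1" using that(3) c by simp
    finally show "emeasure (M u) (space (M u)) = 1" .
    show "real_distribution_axioms (M u)" by unfold_locales (auto simp: M_def)
   qed
   have ch: "char (M u) t = (LINT x|lborel. u x *\<^sub>R cis (t * x)) / of_real c" if "integrable lborel u" "\<And>x. 0 \<le> u x" for u t
   proof -
    have "char (M u) t = (LINT x|lborel. (u x / c) *\<^sub>R exp (\<i> * of_real (t * x)))"
     unfolding char_def M_def using that c by (subst integral_density) auto
    also have "\<dots> = (LINT x|lborel. (u x *\<^sub>R cis (t * x)) / of_real c)"
     by (simp add: cis_conv_exp scaleR_conv_of_real)
    finally show ?thesis by simp
   qed
   have "M gp = M gm"
    by (rule Levy_uniqueness [OF dist dist])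
      (use ip nn c' Z in \<open>auto simp: c_def fun_eq_iff ch\<close>)
   then show ?thesis
    using nn c unfolding M_def by ((subst (asm) sigma_finite_measure.density_unique_iff [OF sigma_finite_lborel], auto), (simp add: gd))
  qed
 qed
 have [measurable]: "h \<in> borel_measurable borel" using h by auto
 have ih: "integrable lborel (\<lambda>x. cis (t * x) * k x)" if "integrable lborel k" for k :: "real \<Rightarrow> complex" and t
  by (rule Bochner_Integration.integrable_bound [OF that])
    (auto simp: norm_mult intro!: borel_measurable_times borel_measurable_integrable [OF that, simplified] borel_measurable_continuous_onI [of "\<lambda>x. cis (t * x)"] continuous_intros)
 have F': "(LINT x|lborel. cis (t * x) * cnj (h x)) = 0" for t
 proof -
  have "(LINT x|lborel. cnj (cis ((- t) * x) * h x)) = 0" by (subst Bochner_Integration.integral_cnj) (simp only: F complex_cnj_zero)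
  then show ?thesis by (simp add: cis_cnj)
 qed
 have ic: "integrable lborel (\<lambda>x. cnj (h x))" using h by simp
 have "AE x in lborel. Re (h x) = 0"
 proof (rule real)
  fix t
  have "(LINT x|lborel. cis (t * x) * of_real (Re (h x))) = (LINT x|lborel. (1/2) * (cis (t * x) * h x) + (1/2) * (cis (t * x) * cnj (h x)))"
   by (rule Bochner_Integration.integral_cong) (auto simp: complex_eq_iff field_simps)
  also have "\<dots> = 0" by (subst Bochner_Integration.integral_add) (auto simp: F F' ih h ic)
  finally show "(LINT x|lborel. cis (t * x) * complex_of_real (Re (h x))) = 0" .
 qed (use h in simp)
 moreover have "AE x in lborel. Im (h x) = 0"
 proof (rule real)
  fix t
  have "(LINT x|lborel. cis (t * x) * of_real (Im (h x))) = (LINT x|lborel. (- \<i>/2) * (cis (t * x) * h x) + (\<i>/2) * (cis (t * x) * cnj (h x)))"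
   by (rule Bochner_Integration.integral_cong) (auto simp: complex_eq_iff field_simps)
  also have "\<dots> = 0" by (subst Bochner_Integration.integral_add) (auto simp: F F' ih h ic)
  finally show "(LINT x|lborel. cis (t * x) * complex_of_real (Im (h x))) = 0" .
 qed (use h in simp)
 ultimately show ?thesis by eventually_elim (simp add: complex_eq_iff)
qed

lemma degree_fock_poly: "degree (fock_poly n) = n"
proof (induction n)
 case (Suc n)
 have nz: "fock_poly n \<noteq> 0"
 proof
  assume "fock_poly n = 0"
  then have "fock n = (\<lambda>x. 0)" by (simp add: fock_eq_gauss_poly gauss_poly_def)
  then show False using norm_fock [of n] by (simp add: norm_L2_def del: norm_fock fock.simps)
 qed
 show ?case
  using Suc nz degree_add_eq_left [of "- pderiv (fock_poly n)" "[:0, 2:] * fock_poly n"] by (simp add: degree_pderiv)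
qed simp

text \<open>Induction on the degree: \<open>fock_poly n\<close> has exact degree \<open>n\<close>,
  so subtracting a multiple of it lowers the degree of \<open>P\<close>.\<close>

lemma orthogonal_gauss_poly:
 assumes f: "f \<in> L2" and o: "\<And>n. inner_L2 (fock n) f = 0"
 shows "inner_L2 (gauss_poly P) f = 0"
proof (induction "degree P" arbitrary: P rule: less_induct)
 case less
 define n where "n = degree P"
 define a where "a = coeff P n / coeff (fock_poly n) n"
 define Q where "Q = P - smult a (fock_poly n)"
 have nz: "coeff (fock_poly n) n \<noteq> 0"
 proof
  assume "coeff (fock_poly n) n = 0"
  then have "fock n = (\<lambda>x. 0)"
   using leading_coeff_0_iff [of "fock_poly n"] by (simp add: degree_fock_poly fock_eq_gauss_poly gauss_poly_def)
  then show False using norm_fock [of n] by (simp add: norm_L2_def del: norm_fock fock.simps)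
 qed
 have Pe: "gauss_poly P = (\<lambda>x. gauss_poly Q x + of_real a * fock n x)"
  by (simp add: Q_def fock_eq_gauss_poly gauss_poly_def algebra_simps)
 have gL: "gauss_poly R \<in> L2" for R by (rule smooth_gaussD [OF smooth_gauss_poly])
 have "inner_L2 (gauss_poly Q) f = 0"
 proof (cases "Q = 0")
  case True then show ?thesis by (simp add: gauss_poly_def inner_L2_def)
 next
  case False
  have "degree Q \<le> n" unfolding Q_def n_def
   by (rule degree_diff_le) (auto simp: degree_fock_poly intro: order_trans [OF degree_smult_le])
  moreover have "coeff Q n = 0" using nz by (simp add: Q_def a_def)
  ultimately show ?thesis using False less unfolding n_def by (metis le_neq_implies_less leading_coeff_0_iff)
 qed
 then show ?case unfolding Pe by (simp add: inner_add_left inner_scale_left f gL L2_scale o)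
qed

text \<open>All moments of \<open>h = exp (- x^2 / 2) * f\<close> vanish, and the exponential series
  may be integrated term by term because \<open>G\<close> is integrable; so the Fourier transform of
  \<open>h\<close> is 0.\<close>

lemma fock_complete:
 assumes f: "f \<in> L2" and o: "\<And>n. inner_L2 (fock n) f = 0"
 shows "AE x in lborel. f x = 0"
proof -
 define h where "h x = of_real (exp (- x\<^sup>2 / 2)) * f x" for x
 have [measurable]: "f \<in> borel_measurable borel" using L2_measurable [OF f] by simp
 have hint: "integrable lborel h"
  using L2_inner_integrable [OF gauss_weight_L2 f] by (simp add: h_def [abs_def])
 have mono: "(LINT x|lborel. of_real (x ^ k) * h x) = 0" for k
 proof -
  have "inner_L2 (gauss_poly (monom 1 k)) f = 0" by (rule orthogonal_gauss_poly [OF f o])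
  then show ?thesis by (simp add: inner_L2_def gauss_poly_def h_def poly_monom mult.assoc)
 qed
 have F: "(LINT x|lborel. cis (t * x) * h x) = 0" for t
 proof -
  define g where "g N x = (\<Sum>k<N. (\<i> * of_real (t * x)) ^ k /\<^sub>R fact k) * h x" for N x
  define G where "G x = exp (\<bar>t\<bar> * \<bar>x\<bar>) * cmod (h x)" for x
  have GL: "(\<lambda>x. of_real (exp (\<bar>t\<bar> * \<bar>x\<bar>)) * of_real (exp (- x\<^sup>2 / 2))) \<in> L2"
  proof (rule gauss_bounded_L2)
   show "gauss_bounded (\<lambda>x. of_real (exp (\<bar>t\<bar> * \<bar>x\<bar>)) * of_real (exp (- x\<^sup>2 / 2)))"
   proof (rule gauss_boundedI [of "1/4" _ "exp (t^2)"])
    fix x :: real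
    have "exp (\<bar>t\<bar> * \<bar>x\<bar>) * exp (- x\<^sup>2 / 2) \<le> exp (t^2) * exp (- (1/4) * x^2)"
     using zero_le_power2 [of "\<bar>t\<bar> - \<bar>x\<bar> / 2"] by ((simp add: power2_diff power_divide), (simp flip: exp_add))
    then show "cmod (of_real (exp (\<bar>t\<bar> * \<bar>x\<bar>)) * of_real (exp (- x\<^sup>2 / 2))) \<le> exp (t^2) * exp (- (1/4) * x^2)"
     by (simp add: norm_mult)
   qed simp
  qed measurable
  have Gi: "integrable lborel G"
   using integrable_norm [OF L2_inner_integrable [OF GL f]] by (simp add: G_def [abs_def] h_def norm_mult mult.assoc)
  have "(\<lambda>N. LINT x|lborel. g N x) \<longlonglongrightarrow> (LINT x|lborel. cis (t * x) * h x)"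
  proof (rule integral_dominated_convergence [where w = G])
   show "AE x in lborel. (\<lambda>N. g N x) \<longlonglongrightarrow> cis (t * x) * h x"
   proof (intro AE_I2)
    fix x
    have "(\<lambda>N. \<Sum>k<N. (\<i> * of_real (t * x)) ^ k /\<^sub>R fact k) \<longlonglongrightarrow> exp (\<i> * of_real (t * x))"
     using exp_converges [of "\<i> * of_real (t * x)"] by (simp add: sums_def)
    then show "(\<lambda>N. g N x) \<longlonglongrightarrow> cis (t * x) * h x"
     unfolding g_def cis_conv_exp by (intro tendsto_mult tendsto_const)
   qed
   show "AE x in lborel. norm (g N x) \<le> G x" for N
   proof (intro AE_I2)
    fix x
    have "cmod (\<Sum>k<N. (\<i> * of_real (t * x)) ^ k /\<^sub>R fact k) \<le> (\<Sum>k<N. (\<bar>t\<bar> * \<bar>x\<bar>) ^ k /\<^sub>R fact k)"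
     by (rule order_trans [OF norm_sum]) (simp add: norm_mult norm_power abs_mult)
    also have "\<dots> \<le> exp (\<bar>t\<bar> * \<bar>x\<bar>)"
     using sum_le_suminf [of "\<lambda>k. (\<bar>t\<bar> * \<bar>x\<bar>) ^ k /\<^sub>R fact k" "{..<N}"] exp_converges [of "\<bar>t\<bar> * \<bar>x\<bar>"]
     by (auto simp: sums_iff)
    finally show "norm (g N x) \<le> G x" unfolding g_def G_def norm_mult by (rule mult_right_mono) simp
   qed
   show "(\<lambda>x. cis (t * x) * h x) \<in> borel_measurable lborel"
    unfolding h_def by (intro borel_measurable_times) (auto intro!: borel_measurable_continuous_onI continuous_intros)
   show "g N \<in> borel_measurable lborel" for N
    unfolding g_def [abs_def] h_def by (intro borel_measurable_times) (auto intro!: borel_measurable_continuous_onI continuous_intros)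
  qed (rule Gi)
  moreover have "(LINT x|lborel. g N x) = 0" for N
  proof -
   have xi: "integrable lborel (\<lambda>x. of_real (x ^ k) * h x)" for k
   proof -
    have "gauss_poly (monom 1 k) \<in> L2" by (rule smooth_gaussD [OF smooth_gauss_poly])
    from L2_inner_integrable [OF this f] show ?thesis by (simp add: gauss_poly_def h_def poly_monom mult.assoc)
   qed
   have ge: "g N = (\<lambda>x. \<Sum>k<N. ((\<i> * of_real t) ^ k /\<^sub>R fact k) * (of_real (x ^ k) * h x))"
    by (rule ext) (simp add: g_def sum_distrib_right sum_distrib_left scaleR_conv_of_real power_mult_distrib mult_ac)
   show ?thesis
    unfolding ge by (subst Bochner_Integration.integral_sum) (auto simp: xi mono simp del: of_real_power)
  qed
  ultimately show ?thesis by (simp add: LIMSEQ_const_iff)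
 qed
 have "AE x in lborel. h x = 0" by (rule fourier_injective [OF hint F])
 then show ?thesis by eventually_elim (simp add: h_def)
qed

lemma fock_partial_diff:
 assumes "N \<le> M"
 shows "(norm_L2 (\<lambda>x. fock_partial M f x - fock_partial N f x))^2 = (\<Sum>n=N..<M. (cmod (fock_coeff f n))\<^sup>2)"
proof -
 have "(\<lambda>x. fock_partial M f x - fock_partial N f x) = (\<lambda>x. \<Sum>n\<in>{N..<M}. fock_coeff f n * fock n x)"
 proof
  fix x
  show "fock_partial M f x - fock_partial N f x = (\<Sum>n\<in>{N..<M}. fock_coeff f n * fock n x)"
   using sum.atLeastLessThan_concat [of 0 N M "\<lambda>n. fock_coeff f n * fock n x"] assms unfolding fock_partial_def lessThan_atLeast0 by (simp add: diff_eq_eq add.commute)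
 qed
 then show ?thesis by (simp only: norm_fock_sum_sq finite_atLeastLessThan)
qed

text \<open>A Riesz-Fischer argument: a rapidly converging subsequence of partial sums has a limit
  \<open>h\<close> almost everywhere, Fatou's lemma makes it a limit in norm, and
  \<open>f - h\<close> is orthogonal to every Fock vector, hence 0 by completeness.\<close>

theorem fock_partial_tendsto:
 assumes f: "f \<in> L2"
 shows "(\<lambda>N. norm_L2 (\<lambda>x. f x - fock_partial N f x)) \<longlonglongrightarrow> 0"
proof -
 define b where "b n = (cmod (fock_coeff f n))^2" for n
 define S where "S N = fock_partial N f" for N
 have S [simp]: "S N \<in> L2" for N by (simp add: S_def)
 have Sm [measurable]: "S N \<in> borel_measurable borel" for N using L2_measurable [OF S] by simp
 have bs: "summable b" unfolding b_def by (rule bessel_summable [OF f])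
 have b0: "0 \<le> b n" for n by (simp add: b_def)
 have "\<exists>N. \<forall>M\<ge>N. norm (\<Sum>n=N..<M. b n) < (1/4) ^ j" for j :: nat
  using summable_Cauchy [THEN iffD1, OF bs, rule_format, of "(1/4) ^ j"] by (metis order_refl zero_less_divide_1_iff zero_less_numeral zero_less_power)
 then obtain N0 where N0: "\<And>j M. N0 j \<le> M \<Longrightarrow> norm (\<Sum>n=N0 j..<M. b n) < (1/4) ^ j" by metis
 \<comment> \<open>Cumulative sums make \<open>r\<close> monotone and the summand
   \<open>Suc j\<close> makes it unbounded; every block that starts at \<open>r j\<close> has
   squared norm at most \<open>(1/4) ^ j\<close>.\<close>
 define r where "r j = Suc j + (\<Sum>i\<le>j. N0 i)" for j
 have rmono: "r i \<le> r j" if "i \<le> j" for i j unfolding r_def using that by (intro add_mono sum_mono2) auto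
 have tail: "(\<Sum>n=r j..<M. b n) \<le> (1/4) ^ j" if "r j \<le> M" for j M
 proof -
  have "N0 j \<le> r j" unfolding r_def by (rule trans_le_add2, rule member_le_sum) auto
  then have "(\<Sum>n=r j..<M. b n) \<le> (\<Sum>n=N0 j..<M. b n)" by (intro sum_mono2) (auto simp: b0)
  also have "\<dots> \<le> (1/4) ^ j" using N0 [of j M] that \<open>N0 j \<le> r j\<close> by simp
  finally show ?thesis .
 qed
 have Sdiff: "(norm_L2 (\<lambda>x. S M x - S (r j) x))^2 \<le> (1/4) ^ j" if "r j \<le> M" for j M
  unfolding S_def fock_partial_diff [OF that] using tail [OF that] by (simp add: b_def)
 define d where "d j x = S (r (Suc j)) x - S (r j) x" for j x
 have dL: "d j \<in> L2" for j unfolding d_def [abs_def] by (rule L2_diff) auto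
 have dm [measurable]: "d j \<in> borel_measurable borel" for j using L2_measurable [OF dL] by simp
 have dn: "norm_L2 (d j) \<le> (1/2) ^ j" for j
 proof (rule power2_le_imp_le)
  show "(norm_L2 (d j))^2 \<le> ((1/2) ^ j)^2"
   using Sdiff [of j "r (Suc j)"] rmono [of j "Suc j"] by (simp add: power_mult_distrib [symmetric] power2_eq_square d_def [abs_def])
 qed simp
 \<comment> \<open>Pairing with a Gaussian converts the bounds on \<open>norm_L2 (d j)\<close> into
   a summable series of integrals by Cauchy-Schwarz; as the weight is positive, the increments are
   then summable at almost every point.\<close>
 define w where "w x = exp (- x\<^sup>2 / 2)" for x :: real
 have wL: "(\<lambda>x. of_real (w x)) \<in> L2" unfolding w_def by (rule gauss_weight_L2)
 define W where "W = norm_L2 (\<lambda>x. of_real (w x))"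
 have "(\<integral>\<^sup>+x. (\<Sum>j. ennreal (cmod (d j x) * w x)) \<partial>lborel) = (\<Sum>j. \<integral>\<^sup>+x. ennreal (cmod (d j x) * w x) \<partial>lborel)"
  by (rule nn_integral_suminf) (simp add: w_def)
 also have "\<dots> \<le> (\<Sum>j. ennreal ((1/2) ^ j * W))"
 proof (rule suminf_le)
  fix j
  have i: "integrable lborel (\<lambda>x. cmod (d j x) * w x)"
   using L2_integrable_norm_mult [OF dL [of j] wL] by (simp add: w_def)
  have "(\<integral>\<^sup>+x. ennreal (cmod (d j x) * w x) \<partial>lborel) = ennreal (LINT x|lborel. cmod (d j x) * w x)"
   by (rule nn_integral_eq_integral [OF i]) (simp add: w_def)
  also have "(LINT x|lborel. cmod (d j x) * w x) \<le> norm_L2 (d j) * W"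
   using Cauchy_Schwarz_norm [OF dL [of j] wL] by (simp add: W_def w_def)
  also have "\<dots> \<le> (1/2) ^ j * W" by (rule mult_right_mono [OF dn]) (simp add: W_def)
  finally show "(\<integral>\<^sup>+x. ennreal (cmod (d j x) * w x) \<partial>lborel) \<le> ennreal ((1/2) ^ j * W)" by (simp add: ennreal_leI)
 qed auto
 also have "\<dots> = ennreal (\<Sum>j. (1/2) ^ j * W)"
  by (rule suminf_ennreal2) (auto simp: W_def intro!: summable_mult2)
 finally have "(\<integral>\<^sup>+x. (\<Sum>j. ennreal (cmod (d j x) * w x)) \<partial>lborel) \<noteq> \<infinity>" by (auto simp: top_unique)
 then have "AE x in lborel. (\<Sum>j. ennreal (cmod (d j x) * w x)) \<noteq> \<infinity>"
  by (intro nn_integral_PInf_AE) (auto simp: w_def)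
 then have conv: "AE x in lborel. convergent (\<lambda>j. S (r j) x)"
 proof eventually_elim
  case (elim x)
  have "summable (\<lambda>j. cmod (d j x) * w x)"
   by (rule summable_suminf_not_top) (use elim in \<open>auto simp: w_def\<close>)
  then have "summable (\<lambda>j. cmod (d j x))" by (rule summable_mult_D [where c = "w x", unfolded mult.commute [of "w x"]]) (simp add: w_def)
  then have "summable (\<lambda>j. d j x)" by (rule summable_norm_cancel)
  then have "convergent (\<lambda>n. \<Sum>j<n. d j x)" by (simp add: summable_iff_convergent)
  moreover have "(\<Sum>j<n. d j x) = S (r n) x - S (r 0) x" for n
   unfolding d_def by (rule sum_lessThan_telescope)
  ultimately show ?case using convergent_diff_const_right_iff by auto
 qed
 define h where "h x = lim (\<lambda>j. S (r j) x)" for x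
 let ?D = "\<lambda>i x. h x - S (r i) x"
 let ?q = "\<lambda>i j x. ennreal ((cmod (S (r j) x - S (r i) x))^2)"
 let ?p = "\<lambda>i x. ennreal ((cmod (h x - S (r i) x))^2)"
 have hm [measurable]: "h \<in> borel_measurable borel" unfolding h_def [abs_def] by simp
 have hlim: "AE x in lborel. (\<lambda>j. S (r j) x) \<longlonglongrightarrow> h x"
  using conv by eventually_elim (simp add: h_def convergent_LIMSEQ_iff)
 have fatou: "(\<integral>\<^sup>+x. ?p i x \<partial>lborel) \<le> ennreal ((1/4) ^ i)" for i
 proof -
  have "(\<integral>\<^sup>+x. ?p i x \<partial>lborel) = (\<integral>\<^sup>+x. liminf (\<lambda>j. ?q i j x) \<partial>lborel)"
  proof (rule nn_integral_cong_AE)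
   show "AE x in lborel. ?p i x = liminf (\<lambda>j. ?q i j x)"
    using hlim
   proof eventually_elim
    case (elim x)
    have "(\<lambda>j. ?q i j x) \<longlonglongrightarrow> ?p i x"
     by (intro tendsto_intros tendsto_ennrealI elim)
    from lim_imp_Liminf [OF sequentially_bot this] show ?case by (rule sym)
   qed
  qed
  also have "\<dots> \<le> liminf (\<lambda>j. \<integral>\<^sup>+x. ?q i j x \<partial>lborel)"
   by (rule nn_integral_liminf) measurable
  also have "\<dots> \<le> ennreal ((1/4) ^ i)"
  proof (rule Liminf_le)
   show "eventually (\<lambda>j. (\<integral>\<^sup>+x. ?q i j x \<partial>lborel) \<le> ennreal ((1/4) ^ i)) sequentially"
    using eventually_ge_at_top [of i]
   proof eventually_elim
    case (elim j)
    have "(\<lambda>x. S (r j) x - S (r i) x) \<in> L2" by (rule L2_diff) auto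
    then have "(\<integral>\<^sup>+x. ?q i j x \<partial>lborel) = ennreal ((norm_L2 (\<lambda>x. S (r j) x - S (r i) x))^2)"
     unfolding norm_L2_sq by (intro nn_integral_eq_integral L2_integrable_sq) auto
    then show ?case using Sdiff [OF rmono [OF elim]] by simp
   qed
  qed simp
  finally show ?thesis .
 qed
 have hS: "(?D i) \<in> L2" for i
 proof -
  have "integrable lborel (\<lambda>x. (cmod (h x - S (r i) x))^2)"
   unfolding integrable_iff_bounded using fatou [of i] by (auto simp: le_less_trans)
  then show ?thesis by (simp add: L2_def)
 qed
 have hn: "norm_L2 (?D i) \<le> (1/2) ^ i" for i
 proof (rule power2_le_imp_le)
  have "ennreal ((norm_L2 (?D i))^2) \<le> ennreal ((1/4) ^ i)"
   using fatou [of i] unfolding norm_L2_sq by (subst nn_integral_eq_integral [symmetric]) (auto intro!: L2_integrable_sq [OF hS])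
  then show "(norm_L2 (?D i))^2 \<le> ((1/2) ^ i)^2"
   by (simp add: power2_eq_square flip: power_mult_distrib)
 qed simp
 have hL: "h \<in> L2" using L2_add [OF hS [of 0] S [of "r 0"]] by simp
 have half0: "(\<lambda>i. (1/2 :: real) ^ i) \<longlonglongrightarrow> 0" by (rule LIMSEQ_power_zero) simp
 have coeff: "inner_L2 (fock n) (\<lambda>x. f x - h x) = 0" for n
 proof -
  define z where "z = inner_L2 (fock n) (\<lambda>x. f x - h x)"
  have fS: "inner_L2 (fock n) (\<lambda>x. f x - S (r i) x) = 0" if "n < r i" for i
   using fock_coeff_partial [OF that, of f] by (simp add: inner_diff_right f S_def fock_coeff_def)
  have zb: "cmod z \<le> (1/2) ^ i" if "n < r i" for i
  proof -
   have "z = inner_L2 (fock n) (\<lambda>x. (f x - S (r i) x) - (h x - S (r i) x))" by (simp add: z_def)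
   also have "\<dots> = inner_L2 (fock n) (\<lambda>x. f x - S (r i) x) - inner_L2 (fock n) (?D i)"
    by (rule inner_diff_right [OF fock_L2 L2_diff [OF f S] hS])
   finally have "cmod z \<le> norm_L2 (fock n) * norm_L2 (?D i)"
    using fS [OF that] inner_Cauchy_Schwarz [OF fock_L2 hS] by (simp del: norm_fock fock.simps)
   then show ?thesis using hn [of i] by (simp del: fock.simps)
  qed
  have "n < r i" if "n \<le> i" for i using that by (simp add: r_def)
  then have "cmod z \<le> 0" by (intro LIMSEQ_le_const [OF half0]) (use zb in blast)
  then show ?thesis by (simp add: z_def)
 qed
 have fh: "AE x in lborel. f x - h x = 0" by (rule fock_complete [OF L2_diff [OF f hL] coeff])
 have fn: "norm_L2 (\<lambda>x. f x - S (r i) x) \<le> (1/2) ^ i" for i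
 proof -
  have "norm_L2 (\<lambda>x. f x - S (r i) x) = norm_L2 (?D i)"
   by (rule norm_L2_cong_AE [OF L2_diff [OF f S] hS]) (use fh in eventually_elim, simp)
  then show ?thesis using hn by simp
 qed
 \<comment> \<open>By Bessel's identity the error decreases with the number of terms, so convergence
   along \<open>r\<close> suffices.\<close>
 have dec: "norm_L2 (\<lambda>x. f x - S M x) \<le> norm_L2 (\<lambda>x. f x - S N x)" if "N \<le> M" for M N
 proof (rule power2_le_imp_le)
  have "(\<Sum>n<N. b n) \<le> (\<Sum>n<M. b n)" using that by (intro sum_mono2) (auto simp: b0)
  then show "(norm_L2 (\<lambda>x. f x - S M x))^2 \<le> (norm_L2 (\<lambda>x. f x - S N x))^2"
   unfolding S_def bessel_identity [OF f] b_def by simp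
 qed simp
 show ?thesis
 proof (rule LIMSEQ_I)
  fix e :: real assume "0 < e"
  then obtain i where i: "(1/2) ^ i < e" using real_arch_pow_inv [of e "1/2"] by auto
  have "norm (norm_L2 (\<lambda>x. f x - S N x) - 0) < e" if "r i \<le> N" for N
   using dec [OF that] fn [of i] i by simp
  then show "\<exists>no. \<forall>n\<ge>no. norm (norm_L2 (\<lambda>x. f x - fock_partial n f x) - 0) < e" unfolding S_def by blast
 qed
qed

lemma parseval_inner:
 assumes f: "f \<in> L2" and g: "g \<in> L2"
 shows "(\<lambda>n. inner_L2 g (fock n) * inner_L2 (fock n) f) sums inner_L2 g f"
 unfolding sums_def
proof (rule LIM_zero_cancel, rule tendsto_norm_zero_cancel, rule Lim_null_comparison)
 show "(\<lambda>N. norm_L2 g * norm_L2 (\<lambda>x. f x - fock_partial N f x)) \<longlonglongrightarrow> 0"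
  by (rule tendsto_mult_right_zero [OF fock_partial_tendsto [OF f]])
 have "norm (norm ((\<Sum>n<N. inner_L2 g (fock n) * inner_L2 (fock n) f) - inner_L2 g f)) \<le> norm_L2 g * norm_L2 (\<lambda>x. f x - fock_partial N f x)" for N
 proof -
  have "inner_L2 g (fock_partial N f) = (\<Sum>n<N. inner_L2 g (fock n) * inner_L2 (fock n) f)"
   unfolding fock_partial_def inner_sum_right [OF g fock_L2] by (simp add: fock_coeff_def mult.commute)
  then have "(\<Sum>n<N. inner_L2 g (fock n) * inner_L2 (fock n) f) - inner_L2 g f = - inner_L2 g (\<lambda>x. f x - fock_partial N f x)"
   by (simp add: inner_diff_right f g)
  then show ?thesis using inner_Cauchy_Schwarz [OF g L2_diff [OF f fock_partial_L2]] by simp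
 qed
 then show "eventually (\<lambda>N. norm (norm ((\<Sum>n<N. inner_L2 g (fock n) * inner_L2 (fock n) f) - inner_L2 g f)) \<le> norm_L2 g * norm_L2 (\<lambda>x. f x - fock_partial N f x)) sequentially"
  by simp
qed

section \<open>Positive semidefinite matrices\<close>

text \<open>Only the real part of the quadratic form is constrained, since hermiticity already makes
  the form real.\<close>

definition psd :: "nat \<Rightarrow> (nat \<Rightarrow> nat \<Rightarrow> complex) \<Rightarrow> bool" where
 "psd K A \<longleftrightarrow> (\<forall>i<K. \<forall>j<K. A j i = cnj (A i j)) \<and>
  (\<forall>c. 0 \<le> Re (\<Sum>i<K. \<Sum>j<K. cnj (c i) * A i j * c j))"

text \<open>Induction by the Schur complement with respect to the last index.\<close>

lemma psd_gram:
 assumes "psd K A"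
 shows "\<exists>v. \<forall>i<K. \<forall>j<K. A i j = (\<Sum>l<K. v l i * cnj (v l j))"
 using assms
proof (induction K arbitrary: A)
 case 0 then show ?case by simp
next
 case (Suc K)
 have herm: "A j i = cnj (A i j)" if "i < Suc K" "j < Suc K" for i j
  using Suc.prems that unfolding psd_def by blast
 have pos: "0 \<le> Re (\<Sum>i<Suc K. \<Sum>j<Suc K. cnj (c i) * A i j * c j)" for c
  using Suc.prems unfolding psd_def by blast
 define a where "a = Re (A K K)"
 let ?Q = "\<lambda>A c :: nat \<Rightarrow> complex. \<Sum>i<K. \<Sum>j<K. cnj (c i) * A i j * c j"
 let ?g = "\<lambda>i j. if a = 0 then 0 else A i K * A K j / of_real a"
 have AKK: "A K K = of_real a" using herm [of K K] by (simp add: a_def complex_eq_iff)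
 define w where "w c = (\<Sum>j<K. A K j * c j)" for c :: "nat \<Rightarrow> complex"
 have quad: "0 \<le> Re (?Q A c) + 2 * Re (cnj x * w c) + a * (cmod x)^2" for c x
 proof -
  define c' where "c' = c(K := x)"
  have c': "c' i = c i" if "i < K" for i using that by (simp add: c'_def)
  have cK: "c' K = x" by (simp add: c'_def)
  have 1: "(\<Sum>j<K. cnj x * A K j * c' j) = cnj x * w c"
   unfolding w_def sum_distrib_left by (rule sum.cong [OF refl]) (simp add: c' mult.assoc)
  have 2: "(\<Sum>i<K. cnj (c' i) * A i K * x) = cnj (cnj x * w c)"
  proof -
   have "cnj (cnj x * w c) = (\<Sum>i<K. x * (cnj (A K i) * cnj (c i)))" by (simp add: w_def sum_distrib_left)
   also have "\<dots> = (\<Sum>i<K. cnj (c' i) * A i K * x)"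
    by (rule sum.cong [OF refl]) (use herm [of K] in \<open>simp add: c' mult_ac\<close>)
   finally show ?thesis by simp
  qed
  have "(\<Sum>i<Suc K. \<Sum>j<Suc K. cnj (c' i) * A i j * c' j)
    = (\<Sum>i<K. (\<Sum>j<K. cnj (c' i) * A i j * c' j) + cnj (c' i) * A i K * x) + ((\<Sum>j<K. cnj x * A K j * c' j) + cnj x * A K K * x)"
   by (simp add: cK)
  also have "\<dots> = (?Q A c') + cnj (cnj x * w c) + (cnj x * w c + of_real (a * (cmod x)^2))"
   using complex_norm_square [of x] unfolding sum.distrib 1 2 AKK by simp
  also have "(?Q A c') = (?Q A c)"
   by (intro sum.cong refl) (simp add: c')
  finally show ?thesis using pos [of c'] by simp
 qed
 have a0: "0 \<le> a" using quad [of "\<lambda>_. 0" 1] by (simp add: w_def)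
 \<comment> \<open>If the corner entry vanishes but \<open>A K j\<close> does not, the vector with
   last component \<open>- t * A K j\<close> makes the form negative for large
   \<open>t\<close>.\<close>
 have zero: "A K j = 0" if "a = 0" "j < K" for j
 proof (rule ccontr)
  assume nz: "A K j \<noteq> 0"
  define c where "c i = (if i = j then 1 else 0 :: complex)" for i
  have wc: "w c = A K j" using that by (simp add: w_def c_def if_distrib cong: if_cong)
  define B where "B = Re (?Q A c)"
  have q: "0 \<le> B - 2 * t * (cmod (A K j))^2" for t
  proof -
   have "cnj (- of_real t * A K j) * A K j = - (of_real t * (A K j * cnj (A K j)))" by simp
   also have "\<dots> = - of_real (t * (cmod (A K j))^2)" by (simp add: complex_norm_square [symmetric])
   finally have eq: "Re (cnj (- of_real t * A K j) * A K j) = - (t * (cmod (A K j))^2)"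
    by (simp only: Re_complex_of_real uminus_complex.sel)
   show ?thesis using quad [of c "- of_real t * A K j", unfolded wc B_def [symmetric] eq] that by simp
  qed
  show False using q [of "(B + 1) / (2 * (cmod (A K j))^2)"] nz by simp
 qed
 define A' where "A' i j = A i j - (?g i j)" for i j
 have "psd K A'"
  unfolding psd_def
 proof (intro conjI allI impI)
  fix i j assume "i < K" "j < K"
  then show "A' j i = cnj (A' i j)" using herm [of i j] herm [of K j] herm [of j K] herm [of K i] by (simp add: A'_def)
 next
  fix c :: "nat \<Rightarrow> complex"
  show "0 \<le> Re (?Q A' c)"
  proof (cases "a = 0")
   case True
   then show ?thesis using quad [of c 0] by (simp add: A'_def)
  next
   case False
   then have a: "0 < a" using a0 by simp
   have cw: "(\<Sum>i<K. cnj (c i) * A i K) = cnj (w c)"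
    unfolding w_def cnj_sum by (rule sum.cong [OF refl]) (use herm [of K] in \<open>simp add: mult_ac\<close>)
   have "(?Q A' c)
    = (?Q A c) - (\<Sum>i<K. \<Sum>j<K. (cnj (c i) * A i K) * (A K j * c j)) / of_real a"
    using False by (simp add: A'_def algebra_simps sum_subtractf sum_divide_distrib)
   also have "(\<Sum>i<K. \<Sum>j<K. (cnj (c i) * A i K) * (A K j * c j)) = cnj (w c) * w c"
    unfolding sum_product [symmetric] cw by (simp add: w_def)
   also have "\<dots> = of_real ((cmod (w c))^2)" by (metis complex_norm_square mult.commute)
   finally have "Re (?Q A' c) = Re (?Q A c) - (cmod (w c))^2 / a"
    by simp
   moreover have "cnj (- w c / of_real a) * w c = of_real (- (cmod (w c))\<^sup>2 / a)"
    using complex_norm_square [of "w c"] by simp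
   \<comment> \<open>This last component minimises the form; the minimum is the form of the Schur
     complement.\<close>
   ultimately show ?thesis using quad [of c "- w c / of_real a"] a by (simp add: norm_divide power2_eq_square)
  qed
 qed
 from Suc.IH [OF this] obtain v where v: "\<And>i j. i < K \<Longrightarrow> j < K \<Longrightarrow> A' i j = (\<Sum>l<K. v l i * cnj (v l j))" by blast
 define v' where "v' l i = (if l = K then (if a = 0 then 0 else A i K / of_real (sqrt a)) else if i < K then v l i else 0)" for l i
 have sq: "complex_of_real (sqrt a) * of_real (sqrt a) = of_real a" using a0 by (simp flip: of_real_mult)
 show ?case
 proof (intro exI [of _ v'] allI impI)
  fix i j assume ij: "i < Suc K" "j < Suc K"
  have hj: "cnj (A j K) = A K j" using herm [of j K] ij by simp
  have K: "v' K i * cnj (v' K j) = (?g i j)"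
   using sq by (simp add: v'_def hj)
  have S: "(\<Sum>l<Suc K. v' l i * cnj (v' l j)) = (\<Sum>l<K. v' l i * cnj (v' l j)) + (?g i j)"
   using K by simp
  show "A i j = (\<Sum>l<Suc K. v' l i * cnj (v' l j))"
  proof (cases "i < K \<and> j < K")
   case True
   then show ?thesis using v unfolding S by (simp add: v'_def A'_def algebra_simps)
  next
   case False
   then have z: "(\<Sum>l<K. v' l i * cnj (v' l j)) = 0" by (auto simp: v'_def)
   show ?thesis
   proof (cases "a = 0")
    case True
    have "A K K = 0" using True AKK by simp
    moreover have "A i K = 0" if "i < K" for i using zero [OF True that] herm [of K i] that by simp
    ultimately show ?thesis using False ij zero [OF True] True unfolding S z by (auto simp: less_Suc_eq)
   next
    case 2: False
    then show ?thesis unfolding S z using False ij AKK by (auto simp: less_Suc_eq)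
   qed
  qed
 qed
qed

lemma sum_sqrt_mult_le:
 fixes f g :: "nat \<Rightarrow> real"
 assumes "\<And>l. 0 \<le> f l" "\<And>l. 0 \<le> g l"
 shows "(\<Sum>l\<in>A. sqrt (f l) * sqrt (g l)) \<le> sqrt (\<Sum>l\<in>A. f l) * sqrt (\<Sum>l\<in>A. g l)"
 using L2_set_mult_ineq [of "\<lambda>l. sqrt (f l)" "\<lambda>l. sqrt (g l)" A] assms by (simp add: L2_set_def)

text \<open>Gram vectors write the trace as a sum over \<open>l\<close> of bilinear forms of
  \<open>M\<close>; the contraction bound for each \<open>l\<close> and Cauchy-Schwarz over
  \<open>l\<close> recombine into partial traces of \<open>A\<close>. The index sets may differ, so
  that off-diagonal blocks can be estimated.\<close>

lemma psd_trace_bound: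
 assumes A: "psd K A" and ST: "S \<subseteq> {..<K}" "T \<subseteq> {..<K}"
  and M: "\<And>a b. cmod (\<Sum>k\<in>T. \<Sum>n\<in>S. cnj (a k) * M k n * b n) \<le> sqrt (\<Sum>k\<in>T. (cmod (a k))^2) * sqrt (\<Sum>n\<in>S. (cmod (b n))^2)"
 shows "cmod (\<Sum>n\<in>S. \<Sum>k\<in>T. A n k * M k n) \<le> sqrt (\<Sum>k\<in>T. Re (A k k)) * sqrt (\<Sum>n\<in>S. Re (A n n))"
proof -
 obtain v where v: "\<And>i j. i < K \<Longrightarrow> j < K \<Longrightarrow> A i j = (\<Sum>l<K. v l i * cnj (v l j))" using psd_gram [OF A] by blast
 have d: "Re (A k k) = (\<Sum>l<K. (cmod (v l k))^2)" if "k < K" for k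
 proof -
  have "A k k = of_real (\<Sum>l<K. (cmod (v l k))^2)"
   unfolding v [OF that that] of_real_sum by (rule sum.cong [OF refl]) (rule complex_norm_square [symmetric])
  then show ?thesis by simp
 qed
 have D: "(\<Sum>l<K. \<Sum>k\<in>U. (cmod (v l k))^2) = (\<Sum>k\<in>U. Re (A k k))" if "U \<subseteq> {..<K}" for U
  by (subst sum.swap) (use d that in \<open>auto intro!: sum.cong\<close>)
 have "(\<Sum>n\<in>S. \<Sum>k\<in>T. A n k * M k n) = (\<Sum>n\<in>S. \<Sum>k\<in>T. \<Sum>l<K. cnj (v l k) * M k n * v l n)"
 proof (intro sum.cong refl)
  fix n k assume "n \<in> S" "k \<in> T"
  then have "A n k = (\<Sum>l<K. v l n * cnj (v l k))" using ST by (intro v) auto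
  then show "A n k * M k n = (\<Sum>l<K. cnj (v l k) * M k n * v l n)" by (simp add: sum_distrib_left mult_ac)
 qed
 also have "\<dots> = (\<Sum>n\<in>S. \<Sum>l<K. \<Sum>k\<in>T. cnj (v l k) * M k n * v l n)" by (intro sum.cong refl sum.swap)
 also have "\<dots> = (\<Sum>l<K. \<Sum>n\<in>S. \<Sum>k\<in>T. cnj (v l k) * M k n * v l n)" by (rule sum.swap)
 also have "\<dots> = (\<Sum>l<K. \<Sum>k\<in>T. \<Sum>n\<in>S. cnj (v l k) * M k n * v l n)" by (intro sum.cong refl sum.swap)
 finally have "cmod (\<Sum>n\<in>S. \<Sum>k\<in>T. A n k * M k n) \<le> (\<Sum>l<K. cmod (\<Sum>k\<in>T. \<Sum>n\<in>S. cnj (v l k) * M k n * v l n))"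
  by (simp add: norm_sum)
 also have "\<dots> \<le> (\<Sum>l<K. sqrt (\<Sum>k\<in>T. (cmod (v l k))^2) * sqrt (\<Sum>n\<in>S. (cmod (v l n))^2))"
  by (intro sum_mono M)
 also have "\<dots> \<le> sqrt (\<Sum>l<K. \<Sum>k\<in>T. (cmod (v l k))^2) * sqrt (\<Sum>l<K. \<Sum>n\<in>S. (cmod (v l n))^2)"
  by (rule sum_sqrt_mult_le) (auto intro: sum_nonneg)
 also have "\<dots> = sqrt (\<Sum>k\<in>T. Re (A k k)) * sqrt (\<Sum>n\<in>S. Re (A n n))" using D ST by simp
 finally show ?thesis .
qed

lemma mel_contraction:
 assumes "finite S" "finite T"
 shows "cmod (\<Sum>k\<in>T. \<Sum>n\<in>S. cnj (a k) * mel u k n * b n) \<le> sqrt (\<Sum>k\<in>T. (cmod (a k))^2) * sqrt (\<Sum>n\<in>S. (cmod (b n))^2)"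
proof -
 define f g where "f = (\<lambda>x. \<Sum>k\<in>T. a k * fock k x)" and "g = (\<lambda>x. \<Sum>n\<in>S. b n * fock n x)"
 have fg: "f \<in> L2" "g \<in> L2" unfolding f_def g_def by (auto intro: L2_sum)
 have "inner_L2 f (weyl u g) = (\<Sum>k\<in>T. cnj (a k) * (\<Sum>n\<in>S. b n * mel u k n))"
  unfolding f_def g_def weyl_sum
  by (subst inner_sum_left, (auto intro!: L2_sum simp: weyl_L2 inner_sum_right mel_def))
 also have "\<dots> = (\<Sum>k\<in>T. \<Sum>n\<in>S. cnj (a k) * mel u k n * b n)" by (simp add: sum_distrib_left mult_ac)
 finally have "cmod (\<Sum>k\<in>T. \<Sum>n\<in>S. cnj (a k) * mel u k n * b n) \<le> norm_L2 f * norm_L2 (weyl u g)"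
  using inner_Cauchy_Schwarz [OF fg(1) weyl_L2 [OF fg(2)], of u] by simp
 also have "norm_L2 (weyl u g) = norm_L2 g" by (rule norm_weyl [OF fg(2)])
 also have "norm_L2 f = sqrt (\<Sum>k\<in>T. (cmod (a k))^2)"
  unfolding f_def using norm_fock_sum_sq [OF assms(2), of a] by (simp add: real_sqrt_unique)
 also have "norm_L2 g = sqrt (\<Sum>n\<in>S. (cmod (b n))^2)"
  unfolding g_def using norm_fock_sum_sq [OF assms(1), of b] by (simp add: real_sqrt_unique)
 finally show ?thesis .
qed

section \<open>Density operators in the Fock basis\<close>

text \<open>This is \<open>2 * \<alpha>\<close> for \<open>\<alpha> = (q + i p) / sqrt 2\<close>,
  the argument of the displacement in \<open>wigner\<close>.\<close>

definition phase_point :: "real \<times> real \<Rightarrow> complex" where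
 "phase_point z = of_real (sqrt 2) * Complex (fst z) (snd z)"

lemma phase_point_polar: "0 \<le> s \<Longrightarrow> phase_point (polar (s, t)) = of_real (sqrt (2 * s)) * cis t"
 by (simp add: phase_point_def polar_def complex_eq_iff real_sqrt_mult)


locale density_state =
 fixes \<rho> :: "wavefun \<Rightarrow> wavefun"
 assumes density: "density_operator \<rho>"
begin

lemma op_L2: "f \<in> L2 \<Longrightarrow> \<rho> f \<in> L2"
 using density unfolding density_operator_def bounded_op_def by blast

lemma op_linear: "f \<in> L2 \<Longrightarrow> g \<in> L2 \<Longrightarrow> AE x in lborel. \<rho> (\<lambda>y. a * f y + b * g y) x = a * \<rho> f x + b * \<rho> g x"
 using density unfolding density_operator_def bounded_op_def by blast

lemma op_inner_linear:
 assumes "f \<in> L2" "g \<in> L2" "h \<in> L2"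
 shows "inner_L2 h (\<rho> (\<lambda>y. a * f y + b * g y)) = a * inner_L2 h (\<rho> f) + b * inner_L2 h (\<rho> g)"
proof -
 have "inner_L2 h (\<rho> (\<lambda>y. a * f y + b * g y)) = inner_L2 h (\<lambda>x. a * \<rho> f x + b * \<rho> g x)"
  by (rule inner_cong_AE_right [OF _ _ _ op_linear]) (use assms in \<open>auto intro: op_L2 L2_lincomb\<close>)
 also have "\<dots> = a * inner_L2 h (\<rho> f) + b * inner_L2 h (\<rho> g)"
  using assms by (simp add: inner_add_right L2_scale op_L2 inner_scale_right)
 finally show ?thesis .
qed

lemma op_inner_sum:
 assumes "h \<in> L2"
 shows "inner_L2 h (\<rho> (\<lambda>x. \<Sum>k<K. c k * fock k x)) = (\<Sum>k<K. c k * inner_L2 h (\<rho> (fock k)))"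
proof (induction K)
 case 0
 show ?case using op_inner_linear [OF L2_zero L2_zero assms, of 0 0] by simp
next
 case (Suc K)
 have "(\<lambda>x. \<Sum>k<K. c k * fock k x) \<in> L2" by (rule L2_sum) simp
 from op_inner_linear [OF this fock_L2 assms, of 1 "c K" K] show ?case by (simp add: Suc)
qed

text \<open>Boundedness carries the convergence of Fock partial sums through the operator; this ties
  the operator to its matrix \<open>dm\<close>.\<close>

lemma op_inner_limit:
 assumes h: "h \<in> L2" and f: "f \<in> L2"
 shows "(\<lambda>k. fock_coeff f k * inner_L2 h (\<rho> (fock k))) sums inner_L2 h (\<rho> f)"
proof -
 let ?S = "\<lambda>N. \<Sum>k<N. fock_coeff f k * inner_L2 h (\<rho> (fock k))"
 let ?r = "\<lambda>N x. f x - fock_partial N f x"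
 obtain C where C: "\<And>f. f \<in> L2 \<Longrightarrow> norm_L2 (\<rho> f) \<le> C * norm_L2 f"
  using density unfolding density_operator_def bounded_op_def by blast
 have lim: "(\<lambda>N. norm_L2 h * (C * norm_L2 (?r N))) \<longlonglongrightarrow> 0"
  by (intro tendsto_mult_right_zero fock_partial_tendsto [OF f])
 have bd: "cmod (?S N - inner_L2 h (\<rho> f)) \<le> norm_L2 h * (C * norm_L2 (?r N))" for N
 proof -
  have d: "(?r N) \<in> L2" by (rule L2_diff [OF f fock_partial_L2])
  have "inner_L2 h (\<rho> (\<lambda>x. 1 * f x + (- 1) * fock_partial N f x)) = inner_L2 h (\<rho> f) - inner_L2 h (\<rho> (fock_partial N f))"
   by (subst op_inner_linear [OF f fock_partial_L2 h]) simp
  moreover have "inner_L2 h (\<rho> (fock_partial N f)) = ?S N"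
   unfolding fock_partial_def by (rule op_inner_sum [OF h])
  ultimately have "?S N - inner_L2 h (\<rho> f) = - inner_L2 h (\<rho> (?r N))" by simp
  then have "cmod (?S N - inner_L2 h (\<rho> f)) \<le> norm_L2 h * norm_L2 (\<rho> (?r N))"
   using inner_Cauchy_Schwarz [OF h op_L2 [OF d]] by simp
  also have "\<dots> \<le> norm_L2 h * (C * norm_L2 (?r N))"
   by (rule mult_left_mono [OF C [OF d]]) simp
  finally show ?thesis by simp
 qed
 have "(\<lambda>N. ?S N - inner_L2 h (\<rho> f)) \<longlonglongrightarrow> 0"
  by (rule Lim_null_comparison [OF always_eventually lim]) (use bd in blast)
 then show ?thesis unfolding sums_def by (rule LIM_zero_cancel)
qed

definition dm :: "nat \<Rightarrow> nat \<Rightarrow> complex" where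
 "dm n k = inner_L2 (fock n) (\<rho> (fock k))"

definition pop :: "nat \<Rightarrow> real" where
 "pop n = Re (dm n n)"

lemma dm_quadratic:
 "(\<Sum>n<K. \<Sum>k<K. cnj (c n) * dm n k * c k) = inner_L2 (\<lambda>x. \<Sum>n<K. c n * fock n x) (\<rho> (\<lambda>x. \<Sum>k<K. c k * fock k x))"
proof -
 have f: "(\<lambda>x. \<Sum>n<K. c n * fock n x) \<in> L2" by (rule L2_sum) simp
 have "inner_L2 (\<lambda>x. \<Sum>n<K. c n * fock n x) (\<rho> (\<lambda>x. \<Sum>k<K. c k * fock k x))
   = (\<Sum>k<K. \<Sum>n<K. cnj (c n) * dm n k * c k)"
  unfolding op_inner_sum [OF f] dm_def by (simp add: inner_sum_left op_L2 sum_distrib_left mult_ac)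
 also have "\<dots> = (\<Sum>n<K. \<Sum>k<K. cnj (c n) * dm n k * c k)" by (rule sum.swap)
 finally show ?thesis by simp
qed

lemma dm_quadratic_nonneg:
 "Im (\<Sum>n<K. \<Sum>k<K. cnj (c n) * dm n k * c k) = 0" "0 \<le> Re (\<Sum>n<K. \<Sum>k<K. cnj (c n) * dm n k * c k)"
 using density L2_sum [of "{..<K}" fock c] unfolding dm_quadratic density_operator_def positive_op_def by auto

text \<open>The quadratic form is real on all vectors. Testing it on the sum of two basis vectors,
  the second with coefficient 1 or \<open>\<i>\<close>, relates the imaginary and the real parts of
  the two entries.\<close>

lemma dm_hermitian: "dm k n = cnj (dm n k)"
proof -
 have two: "(\<Sum>i<Suc (max n k). \<Sum>j<Suc (max n k). cnj (c i) * dm i j * c j) = cnj a * dm n n * a + cnj a * dm n k * b + (cnj b * dm k n * a + cnj b * dm k k * b)"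
  if "n \<noteq> k" and c: "c = (\<lambda>i. if i = n then a else if i = k then b else 0)" for a b c
 proof -
  have inner: "(\<Sum>j<Suc (max n k). x j * c j) = x n * a + x k * b" for x :: "nat \<Rightarrow> complex"
  proof -
   have "(\<Sum>j<Suc (max n k). x j * c j) = (\<Sum>j\<in>{n, k}. x j * c j)"
    by (rule sum.mono_neutral_right) (auto simp: c)
   then show ?thesis using that by simp
  qed
  have outer: "(\<Sum>i<Suc (max n k). cnj (c i) * y i) = cnj a * y n + cnj b * y k" for y :: "nat \<Rightarrow> complex"
  proof -
   have "(\<Sum>i<Suc (max n k). cnj (c i) * y i) = (\<Sum>i\<in>{n, k}. cnj (c i) * y i)"
    by (rule sum.mono_neutral_right) (auto simp: c)
   then show ?thesis using that by simp
  qed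
  have "(\<Sum>j<Suc (max n k). cnj (c i) * dm i j * c j) = cnj (c i) * (dm i n * a + dm i k * b)" for i
   unfolding inner [symmetric] sum_distrib_left by (simp add: mult.assoc)
  then show ?thesis by (simp only: outer) (simp add: algebra_simps)
 qed
 have diag: "Im (dm m m) = 0" for m
  using dm_quadratic_nonneg(1) [where K = "Suc m" and c = "\<lambda>i. if i = m then 1 else 0"] by simp
 show ?thesis
 proof (cases "n = k")
  case True then show ?thesis using diag [of n] by (simp add: complex_eq_iff)
 next
  case False
  show ?thesis
   using dm_quadratic_nonneg(1) [where K = "Suc (max n k)" and c = "\<lambda>i. if i = n then 1 else if i = k then 1 else 0"] diag [of n] diag [of k] dm_quadratic_nonneg(1) [where K = "Suc (max n k)" and c = "\<lambda>i. if i = n then 1 else if i = k then \<i> else 0"] unfolding two [OF False refl] by (simp add: complex_eq_iff)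
 qed
qed

lemma dm_psd: "psd K dm"
 unfolding psd_def using dm_hermitian dm_quadratic_nonneg(2) by blast

lemma dm_diag: "dm n n = of_real (pop n)"
 using dm_hermitian [of n n] by (simp add: pop_def complex_eq_iff)

lemma pop_nonneg: "0 \<le> pop n"
using dm_quadratic_nonneg(2) [where K = "Suc n" and c = "\<lambda>i. if i = n then 1 else 0"] by (simp add: pop_def)

lemma pop_sums: "pop sums 1"
proof -
 have "(\<lambda>n. dm n n) sums 1" using density by (simp add: density_operator_def dm_def)
 from sums_Re [OF this] show ?thesis by (simp add: pop_def [abs_def])
qed

lemma sum_pop_le: "finite A \<Longrightarrow> (\<Sum>n\<in>A. pop n) \<le> 1"
 using sum_le_suminf [OF sums_summable [OF pop_sums], of A] pop_nonneg sums_unique [OF pop_sums] by auto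

definition eps :: "nat \<Rightarrow> real" where
 "eps K = 1 - (\<Sum>n<K. pop n)"

lemma eps_bounds: "0 \<le> eps K" "eps K \<le> 1"
 using sum_pop_le [of "{..<K}"] sum_nonneg [of "{..<K}" pop] pop_nonneg by (auto simp: eps_def)

lemma eps_tendsto: "eps \<longlonglongrightarrow> 0"
 using tendsto_diff [OF tendsto_const [of 1] pop_sums [unfolded sums_def]] by (simp add: eps_def [abs_def])

lemma sum_pop_tail: "N \<le> K \<Longrightarrow> (\<Sum>n=N..<K. pop n) \<le> eps N"
 using sum_pop_le [of "{..<K}"] sum.atLeastLessThan_concat [of 0 N K pop] by (simp add: eps_def lessThan_atLeast0)

lemma trace_bound:
 assumes "finite S" "finite T"
 shows "cmod (\<Sum>n\<in>S. \<Sum>k\<in>T. dm n k * mel b k n) \<le> sqrt (\<Sum>k\<in>T. pop k) * sqrt (\<Sum>n\<in>S. pop n)"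
proof -
 obtain K where "S \<union> T \<subseteq> {..<K}" using assms finite_nat_iff_bounded [of "S \<union> T"] by auto
 then show ?thesis unfolding pop_def
  by (intro psd_trace_bound [OF dm_psd, of _ K] mel_contraction assms) auto
qed

lemma dm_bound: "(cmod (dm n k))^2 \<le> pop n * pop k"
proof -
 obtain v where v: "\<And>i j. i < Suc (max n k) \<Longrightarrow> j < Suc (max n k) \<Longrightarrow> dm i j = (\<Sum>l<Suc (max n k). v l i * cnj (v l j))"
  using psd_gram [OF dm_psd [of "Suc (max n k)"]] by auto
 define A where "A = {..<Suc (max n k)}"
 have d: "pop i = (\<Sum>l\<in>A. (cmod (v l i))^2)" if "i < Suc (max n k)" for i
 proof -
  have "dm i i = of_real (\<Sum>l\<in>A. (cmod (v l i))^2)"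
   unfolding v [OF that that] of_real_sum A_def by (rule sum.cong [OF refl]) (rule complex_norm_square [symmetric])
  then show ?thesis by (simp add: pop_def)
 qed
 have "cmod (dm n k) \<le> (\<Sum>l\<in>A. \<bar>cmod (v l n)\<bar> * \<bar>cmod (v l k)\<bar>)"
  using norm_sum [of "\<lambda>l. v l n * cnj (v l k)" A] v [of n k] by (simp add: A_def norm_mult)
 also have "\<dots> \<le> L2_set (\<lambda>l. cmod (v l n)) A * L2_set (\<lambda>l. cmod (v l k)) A" by (rule L2_set_mult_ineq)
 finally have "(cmod (dm n k))^2 \<le> (sqrt (pop n) * sqrt (pop k))^2"
  unfolding L2_set_def by ((simp add: d), (rule power_mono, simp))
 then show ?thesis using pop_nonneg by (simp add: power_mult_distrib)
qed

text \<open>The trace formula for a square truncation of the density matrix: a finite sum that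
  approximates \<open>pi * wig\<close> uniformly on phase space (\<open>wig_approx\<close>).\<close>

definition wfin :: "nat \<Rightarrow> complex \<Rightarrow> complex" where
 "wfin K b = (\<Sum>n<K. \<Sum>k<K. dm n k * mel b k n)"

lemma wfin_real: "Im (wfin K b) = 0"
proof -
 have "cnj (wfin K b) = (\<Sum>n<K. \<Sum>k<K. dm k n * mel b n k)"
  unfolding wfin_def by (simp add: dm_hermitian [symmetric] mel_cnj [symmetric])
 also have "\<dots> = wfin K b" unfolding wfin_def by (rule sum.swap)
 finally show ?thesis by (simp add: complex_eq_iff)
qed

lemma wfin_norm_le: "cmod (wfin K b) \<le> 1"
proof -
 have "cmod (wfin K b) \<le> sqrt (\<Sum>k<K. pop k) * sqrt (\<Sum>n<K. pop n)" unfolding wfin_def by (rule trace_bound) auto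
 also have "\<dots> = (\<Sum>k<K. pop k)" using pop_nonneg by (simp add: sum_nonneg)
 finally show ?thesis using sum_pop_le [of "{..<K}"] by simp
qed

lemma rect_diff:
 assumes "N \<le> K"
 shows "cmod ((\<Sum>n<N. \<Sum>k<K. dm n k * mel b k n) - wfin N b) \<le> sqrt (eps N)"
proof -
 have "(\<Sum>n<N. \<Sum>k<K. dm n k * mel b k n) - wfin N b = (\<Sum>n<N. \<Sum>k=N..<K. dm n k * mel b k n)"
  unfolding wfin_def sum_subtractf [symmetric]
 proof (rule sum.cong [OF refl])
  fix n
  show "(\<Sum>k<K. dm n k * mel b k n) - (\<Sum>k<N. dm n k * mel b k n) = (\<Sum>k=N..<K. dm n k * mel b k n)"
   using sum.atLeastLessThan_concat [of 0 N K "\<lambda>k. dm n k * mel b k n"] assms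
   unfolding lessThan_atLeast0 by (simp add: diff_eq_eq add.commute)
 qed
 also have "cmod \<dots> \<le> sqrt (\<Sum>k=N..<K. pop k) * sqrt (\<Sum>n<N. pop n)" by (rule trace_bound) auto
 also have "\<dots> \<le> sqrt (eps N) * 1"
  using sum_pop_tail [OF assms] sum_pop_le [of "{..<N}"] eps_bounds [of N] by (intro mult_mono) (auto simp: sum_nonneg pop_nonneg)
 finally show ?thesis by simp
qed

text \<open>The difference consists of two strips, each bounded by the square root of the missing
  population. The bound is independent of \<open>b\<close>, so limits in \<open>K\<close> are
  uniform.\<close>

lemma wfin_diff:
 assumes "N \<le> K" shows "cmod (wfin K b - wfin N b) \<le> 2 * sqrt (eps N)"
proof -
 have "wfin K b - (\<Sum>n<N. \<Sum>k<K. dm n k * mel b k n) = (\<Sum>n=N..<K. \<Sum>k<K. dm n k * mel b k n)"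
  using sum.atLeastLessThan_concat [of 0 N K "\<lambda>n. \<Sum>k<K. dm n k * mel b k n"] assms
  unfolding lessThan_atLeast0 wfin_def by (simp add: diff_eq_eq add.commute)
 also have "cmod \<dots> \<le> sqrt (\<Sum>k<K. pop k) * sqrt (\<Sum>n=N..<K. pop n)" by (rule trace_bound) auto
 also have "\<dots> \<le> 1 * sqrt (eps N)"
  using sum_pop_tail [OF assms] sum_pop_le [of "{..<K}"] by (intro mult_mono, auto simp: sum_nonneg pop_nonneg)
 finally show ?thesis
  using rect_diff [OF assms, of b] norm_triangle_ineq [of "wfin K b - (\<Sum>n<N. \<Sum>k<K. dm n k * mel b k n)" "(\<Sum>n<N. \<Sum>k<K. dm n k * mel b k n) - wfin N b"] by simp
qed

lemma trace_partial_diff: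
 "cmod ((\<Sum>n<N. inner_L2 (fock n) (\<rho> (weyl b (fock n)))) - wfin N b) \<le> sqrt (eps N)"
proof -
 have "(\<lambda>K. \<Sum>n<N. \<Sum>k<K. dm n k * mel b k n) \<longlonglongrightarrow> (\<Sum>n<N. inner_L2 (fock n) (\<rho> (weyl b (fock n))))"
 proof (rule tendsto_sum)
  fix n
  show "(\<lambda>K. \<Sum>k<K. dm n k * mel b k n) \<longlonglongrightarrow> inner_L2 (fock n) (\<rho> (weyl b (fock n)))"
   using op_inner_limit [OF fock_L2 [of n] weyl_L2 [OF fock_L2 [of n], of b]]
   by (simp add: sums_def dm_def mel_def fock_coeff_def mult.commute del: fock.simps)
 qed
 then have "(\<lambda>K. cmod ((\<Sum>n<N. \<Sum>k<K. dm n k * mel b k n) - wfin N b)) \<longlonglongrightarrow> cmod ((\<Sum>n<N. inner_L2 (fock n) (\<rho> (weyl b (fock n)))) - wfin N b)"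
  by (rule tendsto_norm [OF tendsto_diff [OF _ tendsto_const]])
 then show ?thesis by (rule LIMSEQ_le_const2) (use rect_diff in blast)
qed

text \<open>The trace is a single series whose terms are limits in the second index;
  \<open>trace_partial_diff\<close> identifies its partial sums with the square truncations up to a
  vanishing error.\<close>

lemma trace_sums:
 "\<exists>T. (\<lambda>n. inner_L2 (fock n) (\<rho> (weyl b (fock n)))) sums T \<and> (\<lambda>N. wfin N b) \<longlonglongrightarrow> T"
proof -
 have e0: "(\<lambda>N. sqrt (eps N)) \<longlonglongrightarrow> 0" using tendsto_real_sqrt [OF eps_tendsto] by simp
 have "Cauchy (\<lambda>N. wfin N b)"
 proof (rule metric_CauchyI)
  fix e :: real assume "0 < e"
  then have "eventually (\<lambda>N. sqrt (eps N) < e / 4) sequentially" by (intro order_tendstoD(2) [OF e0]) simp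
  then obtain N where N: "sqrt (eps N) < e / 4" by (auto simp: eventually_sequentially)
  have "cmod (wfin m b - wfin n b) < e" if "N \<le> m" "N \<le> n" for m n
   using wfin_diff [OF that(1), of b] wfin_diff [OF that(2), of b] N
    norm_triangle_ineq4 [of "wfin m b - wfin N b" "wfin n b - wfin N b"] by simp
  then show "\<exists>M. \<forall>m\<ge>M. \<forall>n\<ge>M. dist (wfin m b) (wfin n b) < e" by (auto simp: dist_norm)
 qed
 then obtain T where T: "(\<lambda>N. wfin N b) \<longlonglongrightarrow> T" using Cauchy_convergent_iff convergent_def by blast
 have "(\<lambda>N. (\<Sum>n<N. inner_L2 (fock n) (\<rho> (weyl b (fock n)))) - wfin N b) \<longlonglongrightarrow> 0"
  by (rule Lim_null_comparison [OF _ e0]) (use trace_partial_diff in auto)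
 from tendsto_add [OF this T] show ?thesis using T by (auto simp: sums_def)
qed

definition wig :: "real \<times> real \<Rightarrow> real" where
 "wig z = wigner \<rho> (fst z) (snd z)"

lemma wfin_tendsto: "(\<lambda>N. Re (wfin N (phase_point z)) / pi) \<longlonglongrightarrow> wig z"
proof -
 obtain T where T: "(\<lambda>n. inner_L2 (fock n) (\<rho> (weyl (phase_point z) (fock n)))) sums T" "(\<lambda>N. wfin N (phase_point z)) \<longlonglongrightarrow> T"
  using trace_sums by blast
 have e: "2 * (Complex (fst z) (snd z) / of_real (sqrt 2)) = phase_point z"
  by (simp add: phase_point_def complex_eq_iff real_div_sqrt field_simps)
 show ?thesis
  using sums_unique [OF T(1)] T(2) unfolding wig_def wigner_def Let_def e trace_op_def by ((simp add: weyl_def), (auto intro!: tendsto_intros))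
qed

lemma wig_approx: "\<bar>wig z - Re (wfin N (phase_point z)) / pi\<bar> \<le> 2 * sqrt (eps N) / pi"
proof (rule LIMSEQ_le_const2)
 show "(\<lambda>K. \<bar>Re (wfin K (phase_point z)) / pi - Re (wfin N (phase_point z)) / pi\<bar>) \<longlonglongrightarrow> \<bar>wig z - Re (wfin N (phase_point z)) / pi\<bar>"
  by (intro tendsto_intros wfin_tendsto)
 have "\<bar>Re (wfin K (phase_point z)) / pi - Re (wfin N (phase_point z)) / pi\<bar> \<le> 2 * sqrt (eps N) / pi" if "N \<le> K" for K
 proof -
  have "\<bar>Re (wfin K (phase_point z) - wfin N (phase_point z))\<bar> \<le> 2 * sqrt (eps N)"
   by (rule order_trans [OF abs_Re_le_cmod wfin_diff [OF that]])
  then show ?thesis by (simp add: field_simps)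
 qed
 then show "\<exists>N'. \<forall>K\<ge>N'. \<bar>Re (wfin K (phase_point z)) / pi - Re (wfin N (phase_point z)) / pi\<bar> \<le> 2 * sqrt (eps N) / pi" by blast
qed

lemma wig_abs_le: "\<bar>wig z\<bar> \<le> 1 / pi"
proof (rule LIMSEQ_le_const2)
 show "(\<lambda>K. \<bar>Re (wfin K (phase_point z)) / pi\<bar>) \<longlonglongrightarrow> \<bar>wig z\<bar>" by (intro tendsto_intros wfin_tendsto)
 have "\<bar>Re (wfin K (phase_point z)) / pi\<bar> \<le> 1 / pi" for K
  using order_trans [OF abs_Re_le_cmod wfin_norm_le [of K "phase_point z"]] by (simp add: divide_right_mono)
 then show "\<exists>N. \<forall>K\<ge>N. \<bar>Re (wfin K (phase_point z)) / pi\<bar> \<le> 1 / pi" by blast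
qed

lemma mel_continuous: "continuous_on UNIV (\<lambda>z. mel (phase_point z) k n)"
proof -
 have "mel b k n = of_real (exp (- (cmod b)\<^sup>2 / 2)) * (\<Sum>j\<le>k. (-1) ^ j * of_nat (k choose j) * of_nat (n choose j) * fact j * b ^ (k - j) * cnj b ^ (n - j)) / of_real (sqrt (fact k * fact n))" for b
  unfolding mel_explicit [symmetric] by (simp del: of_real_mult real_sqrt_mult)
 then show ?thesis
  unfolding phase_point_def Complex_eq by (simp only:) (intro continuous_intros, auto)
qed

lemma wfin_continuous: "continuous_on UNIV (\<lambda>z. Re (wfin K (phase_point z)))"
 unfolding wfin_def by (intro continuous_intros mel_continuous)

lemma wfin_measurable [measurable]: "(\<lambda>z. Re (wfin K (phase_point z))) \<in> borel_measurable borel"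
 by (rule borel_measurable_continuous_onI [OF wfin_continuous])

lemma wig_measurable [measurable]: "wig \<in> borel_measurable borel"
proof (rule borel_measurable_LIMSEQ_metric)
 show "(\<lambda>N. Re (wfin N (phase_point z)) / pi) \<longlonglongrightarrow> wig z" for z by (rule wfin_tendsto)
qed measurable

end

section \<open>Harmonics and moments of the Wigner function\<close>

lemma set_integral_cis:
 "set_integrable lborel {0<..<2*pi} (\<lambda>t. cis (of_int k * t))"
 "(LINT t:{0<..<2*pi}|lborel. cis (of_int k * t)) = (if k = 0 then of_real (2 * pi) else 0)"
proof -
 let ?c = "\<lambda>t. cis (of_int k * t)"
 have c: "continuous_on UNIV (\<lambda>t::real. cis (of_int k * t))" by (intro continuous_intros)
 have 1: "set_integrable lborel {0..2*pi} ?c"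
  unfolding set_integrable_def by (rule borel_integrable_compact) (auto intro: continuous_on_subset [OF c])
 show 2: "set_integrable lborel {0<..<2*pi} ?c"
  by (rule set_integrable_subset [OF 1]) auto
 have "(LINT t:{0<..<2*pi}|lborel. cis (of_int k * t)) = integral {0<..<2*pi} ?c"
  by (rule set_borel_integral_eq_integral(2) [OF 2])
 also have "\<dots> = integral {0..2*pi} ?c"
  by (rule integral_spike_set) (rule negligible_subset [of "{0, 2 * pi}"]; force)+
 finally show "(LINT t:{0<..<2*pi}|lborel. cis (of_int k * t)) = (if k = 0 then of_real (2 * pi) else 0)"
  unfolding integral_cis_nat .
qed

lemma set_integral_sum:
 fixes f :: "'i \<Rightarrow> 'a \<Rightarrow> complex"
 assumes "finite I" "\<And>i. i \<in> I \<Longrightarrow> set_integrable M A (f i)"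
 shows "set_integrable M A (\<lambda>x. \<Sum>i\<in>I. f i x)" "(LINT x:A|M. \<Sum>i\<in>I. f i x) = (\<Sum>i\<in>I. LINT x:A|M. f i x)"
 using assms unfolding set_integrable_def set_lebesgue_integral_def
 by (auto simp only: scaleR_sum_right intro!: Bochner_Integration.integrable_sum Bochner_Integration.integral_sum)

lemma gamma_integral:
 fixes a :: real assumes a: "0 < a"
 shows "has_bochner_integral lborel (\<lambda>s. indicator {0<..} s *\<^sub>R (s ^ i * exp (- (a * s)))) (fact i / a ^ Suc i)"
proof -
 have "has_bochner_integral lborel (\<lambda>x. erlang_density 0 a x * x ^ i) (fact i / a ^ i)"
  using nn_integral_erlang_ith_moment [OF a, of 0 i] by (intro has_bochner_integral_nn_integral, use a in \<open>auto simp: erlang_density_def\<close>)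
 then have "has_bochner_integral lborel (\<lambda>x. erlang_density 0 a x * x ^ i * (1 / a)) (fact i / a ^ i * (1 / a))"
  by (rule has_bochner_integral_mult_left)
 then have "has_bochner_integral lborel (\<lambda>x. erlang_density 0 a x * x ^ i * (1 / a)) (fact i / a ^ Suc i)"
  by (simp add: mult_ac)
 then show ?thesis
 proof (rule iffD1 [OF has_bochner_integral_cong_AE, rotated 3])
  show "AE x in lborel. erlang_density 0 a x * x ^ i * (1 / a) = indicator {0<..} x *\<^sub>R (x ^ i * exp (- (a * x)))"
   using AE_lborel_singleton [of "0::real"]
   by eventually_elim (use a in \<open>auto simp: erlang_density_def\<close>)
 qed auto
qed

text \<open>The Laplace transform of a Laguerre polynomial: termwise gamma integrals, summed by the
  binomial theorem.\<close>

lemma lag_gamma_integral: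
 assumes a: "0 < a"
 shows "has_bochner_integral lborel (\<lambda>s. indicator {0<..} s *\<^sub>R (lag n 0 (2 * s) * exp (- (a * s)))) ((1 - 2 / a) ^ n / a)"
proof -
 have "has_bochner_integral lborel
   (\<lambda>s. \<Sum>i\<le>n. ((-1) ^ i * real (n choose i) * 2 ^ i / fact i) * (indicator {0<..} s *\<^sub>R (s ^ i * exp (- (a * s)))))
   (\<Sum>i\<le>n. ((-1) ^ i * real (n choose i) * 2 ^ i / fact i) * (fact i / a ^ Suc i))"
  by (intro has_bochner_integral_sum has_bochner_integral_mult_right gamma_integral a)
 moreover have "(\<Sum>i\<le>n. ((-1) ^ i * real (n choose i) * 2 ^ i / fact i) * (indicator {0<..} s *\<^sub>R (s ^ i * exp (- (a * s)))))
   = indicator {0<..} s *\<^sub>R (lag n 0 (2 * s) * exp (- (a * s)))" for s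
  unfolding lag_0_conv [OF order_refl] sum_distrib_right scaleR_sum_right
  by (rule sum.cong [OF refl]) (simp add: power_mult_distrib)
 moreover have "(\<Sum>i\<le>n. ((-1) ^ i * real (n choose i) * 2 ^ i / fact i) * (fact i / a ^ Suc i)) = (1 - 2 / a) ^ n / a"
 proof -
  have "(1 - 2 / a) ^ n = (- 2 / a + 1) ^ n" by simp
  also have "\<dots> = (\<Sum>i\<le>n. real (n choose i) * (- 2 / a) ^ i)" by (subst binomial_ring) simp
  finally have e: "(1 - 2 / a) ^ n / a = (\<Sum>i\<le>n. real (n choose i) * (- 2 / a) ^ i / a)" by (simp add: sum_divide_distrib)
  have "(- 2 / a) ^ i = (-1) ^ i * 2 ^ i / a ^ i" for i
   by (simp only: power_divide) (simp add: power_minus [of 2])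
  then show ?thesis unfolding e by (intro sum.cong refl) (simp add: mult_ac)
 qed
 ultimately show ?thesis by simp
qed

text \<open>\<open>mel_polar\<close> covers only \<open>k \<ge> n\<close>; the other triangle is its
  conjugate, and \<open>min\<close> and \<open>max\<close> treat both at once.\<close>

definition mlag :: "nat \<Rightarrow> nat \<Rightarrow> real \<Rightarrow> real" where
 "mlag k n x = (-1) ^ min k n * lagw (min k n) (max k n - min k n) x"

lemma mel_polar_mlag:
 assumes x: "0 \<le> x"
 shows "mel (of_real (sqrt x) * cis t) k n = of_real (mlag k n x) * cis (of_int (int k - int n) * t)"
proof (cases "n \<le> k")
 case True
 then obtain d where k: "k = n + d" using le_Suc_ex by blast
 show ?thesis using mel_polar [OF x, of t n d] by (simp add: k mlag_def)
next
 case False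
 then obtain d where n: "n = k + d" using le_Suc_ex nat_le_linear by blast
 have "mel (of_real (sqrt x) * cis t) k n = cnj (mel (of_real (sqrt x) * cis t) (k + d) k)"
  unfolding n by (rule mel_cnj)
 then show ?thesis unfolding mel_polar [OF x] by (simp add: n mlag_def cis_cnj)
qed

context density_state
begin

text \<open>By \<open>harm_integral\<close> this is the \<open>d\<close>-th angular Fourier
  coefficient of \<open>wfin\<close> on the circle of squared radius \<open>s\<close>; only the
  \<open>d\<close>-th off-diagonal contributes to it.\<close>

definition harm :: "nat \<Rightarrow> nat \<Rightarrow> real \<Rightarrow> complex" where
 "harm K d s = (\<Sum>n<K - d. dm n (n + d) * of_real ((-1) ^ n * lagw n d (2 * s)))"

lemma harm_integral:
 assumes s: "0 \<le> s"
 shows "set_integrable lborel {0<..<2*pi} (\<lambda>t. wfin K (of_real (sqrt (2 * s)) * cis t) * cis (of_int (- int d) * t))"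
  and "(LINT t:{0<..<2*pi}|lborel. wfin K (of_real (sqrt (2 * s)) * cis t) * cis (of_int (- int d) * t)) = of_real (2 * pi) * harm K d s"
proof -
 define c where "c n k = dm n k * of_real (mlag k n (2 * s))" for n k
 have eq: "wfin K (of_real (sqrt (2 * s)) * cis t) * cis (of_int (- int d) * t) = (\<Sum>n<K. \<Sum>k<K. c n k * cis (of_int (int k - int n - int d) * t))" for t
  unfolding wfin_def sum_distrib_right
 proof (intro sum.cong refl)
  fix n k
  have "of_int (int k - int n) * t + of_int (- int d) * t = of_int (int k - int n - int d) * t" by (simp add: algebra_simps)
  then have "cis (of_int (int k - int n) * t) * cis (of_int (- int d) * t) = cis (of_int (int k - int n - int d) * t)"
   by (simp only: cis_mult)
  then show "dm n k * mel (of_real (sqrt (2 * s)) * cis t) k n * cis (of_int (- int d) * t) = c n k * cis (of_int (int k - int n - int d) * t)"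
   using s by (simp only: mel_polar_mlag c_def mult.assoc zero_le_mult_iff) (simp add: mel_polar_mlag mult.assoc)
 qed
 have si: "set_integrable lborel {0<..<2*pi} (\<lambda>t. c n k * cis (of_int j * t))" for n k j
  by (rule set_integrable_mult_right) (rule set_integral_cis(1))
 show "set_integrable lborel {0<..<2*pi} (\<lambda>t. wfin K (of_real (sqrt (2 * s)) * cis t) * cis (of_int (- int d) * t))"
  unfolding eq by (intro set_integral_sum(1) finite_lessThan si)
 have "(LINT t:{0<..<2*pi}|lborel. wfin K (of_real (sqrt (2 * s)) * cis t) * cis (of_int (- int d) * t))
   = (\<Sum>n<K. \<Sum>k<K. c n k * (if int k - int n - int d = 0 then of_real (2 * pi) else 0))"
  unfolding eq
  by (simp only: set_integral_sum(2) [OF finite_lessThan set_integral_sum(1) [OF finite_lessThan si]]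
    set_integral_sum(2) [OF finite_lessThan si] set_integral_mult_right set_integral_cis(2))
 also have "\<dots> = (\<Sum>n<K. if n + d < K then of_real (2 * pi) * c n (n + d) else 0)"
 proof (rule sum.cong [OF refl])
  fix n
  have "(int k - int n - int d = 0) = (k = n + d)" for k by linarith
  then show "(\<Sum>k<K. c n k * (if int k - int n - int d = 0 then of_real (2 * pi) else 0)) = (if n + d < K then of_real (2 * pi) * c n (n + d) else 0)"
   by (simp add: if_distrib cong: if_cong)
 qed
 also have "\<dots> = of_real (2 * pi) * harm K d s"
  unfolding harm_def sum_distrib_left c_def by ((rule sum.mono_neutral_cong_right, auto), (simp add: mlag_def))
 finally show "(LINT t:{0<..<2*pi}|lborel. wfin K (of_real (sqrt (2 * s)) * cis t) * cis (of_int (- int d) * t)) = of_real (2 * pi) * harm K d s" .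
qed

lemma harm_0_eq: "harm K 0 s = of_real (\<Sum>n<K. pop n * ((-1) ^ n * lagw n 0 (2 * s)))"
 unfolding harm_def by (simp add: dm_diag)

lemma wfin_ang:
 assumes "0 \<le> s"
 shows "set_integrable lborel {0<..<2*pi} (\<lambda>t. Re (wfin K (of_real (sqrt (2 * s)) * cis t)))"
  and "(LINT t:{0<..<2*pi}|lborel. Re (wfin K (of_real (sqrt (2 * s)) * cis t))) = 2 * pi * Re (harm K 0 s)"
proof -
 have w: "set_integrable lborel {0<..<2*pi} (\<lambda>t. wfin K (of_real (sqrt (2 * s)) * cis t))"
  "(LINT t:{0<..<2*pi}|lborel. wfin K (of_real (sqrt (2 * s)) * cis t)) = of_real (2 * pi) * harm K 0 s"
  using harm_integral [OF assms, of K 0] by simp_all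
 show "set_integrable lborel {0<..<2*pi} (\<lambda>t. Re (wfin K (of_real (sqrt (2 * s)) * cis t)))"
  using integrable_Re [OF w(1) [unfolded set_integrable_def]] unfolding set_integrable_def by simp
 show "(LINT t:{0<..<2*pi}|lborel. Re (wfin K (of_real (sqrt (2 * s)) * cis t))) = 2 * pi * Re (harm K 0 s)"
  using integral_Re [OF w(1) [unfolded set_integrable_def]] arg_cong [OF w(2), of Re]
  unfolding set_lebesgue_integral_def by simp
qed

lemma wfin_ge:
 assumes "\<And>z. 0 \<le> wig z" shows "- 2 * sqrt (eps K) \<le> Re (wfin K b)"
proof -
 define z where "z = (Re b / sqrt 2, Im b / sqrt 2)"
 have z: "phase_point z = b" by (simp add: phase_point_def z_def complex_eq_iff)
 have "0 \<le> (Re (wfin K b) + 2 * sqrt (eps K)) / pi"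
  using wig_approx [of z K] assms [of z] unfolding z by (simp add: add_divide_distrib)
 then show ?thesis using pi_gt_zero by (simp add: zero_le_divide_iff)
qed

text \<open>A Fourier coefficient of a nonnegative function is at most its mean. The truncation may
  be slightly negative, so the constant \<open>u\<close> is added first; coefficients with
  \<open>d > 0\<close> do not see it.\<close>

lemma harm_bound:
 assumes pos: "\<And>z. 0 \<le> wig z" and s: "0 \<le> s" and d: "0 < d"
 shows "cmod (harm K d s) \<le> Re (harm K 0 s) + 2 * sqrt (eps K)"
proof -
 define u where "u = 2 * sqrt (eps K)"
 define w where "w t = wfin K (of_real (sqrt (2 * s)) * cis t)" for t
 have wr: "w t = of_real (Re (w t))" for t using wfin_real by (simp add: w_def complex_eq_iff)
 have ge: "0 \<le> Re (w t) + u" for t using wfin_ge [OF pos, of K "of_real (sqrt (2 * s)) * cis t"] unfolding w_def u_def by linarith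
 have c: "set_integrable lborel {0<..<2*pi} (\<lambda>t. of_real u * cis (of_int (- int d) * t))"
  by (rule set_integrable_mult_right) (rule set_integral_cis(1))
 have "of_real (2 * pi) * harm K d s = (LINT t:{0<..<2*pi}|lborel. w t * cis (of_int (- int d) * t) + of_real u * cis (of_int (- int d) * t))"
  using d by (subst set_integral_add(2) [OF _ c])
   (simp_all only: w_def harm_integral [OF s] set_integral_mult_right set_integral_cis(2), simp)
 also have "cmod \<dots> \<le> (LINT t:{0<..<2*pi}|lborel. cmod (w t * cis (of_int (- int d) * t) + of_real u * cis (of_int (- int d) * t)))"
  by (rule set_integral_norm_bound) (intro set_integral_add(1) c, simp only: w_def harm_integral [OF s])
 also have "\<dots> = (LINT t:{0<..<2*pi}|lborel. Re (w t) + u)"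
 proof -
  have "cmod (w t * cis (of_int (- int d) * t) + of_real u * cis (of_int (- int d) * t)) = Re (w t) + u" for t
  proof -
   have "w t * cis (of_int (- int d) * t) + of_real u * cis (of_int (- int d) * t) = of_real (Re (w t) + u) * cis (of_int (- int d) * t)"
    by (subst wr) (simp add: distrib_right)
   then show ?thesis using ge [of t] by (simp only: norm_mult norm_of_real norm_cis) simp
  qed
  then show ?thesis by simp
 qed
 also have "\<dots> = 2 * pi * Re (harm K 0 s) + 2 * pi * u"
  unfolding w_def
  by (subst set_integral_add(2) [OF wfin_ang(1) [OF s]])
   (simp_all only: wfin_ang(2) [OF s], simp_all add: set_integrable_def set_lebesgue_integral_def)
 finally have "2 * pi * cmod (harm K d s) \<le> 2 * pi * (Re (harm K 0 s) + u)" by (simp add: norm_mult distrib_left)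
 then show ?thesis by (simp add: u_def)
qed

lemma exp_radius_integrable: "0 < e \<Longrightarrow> integrable lborel (\<lambda>z. exp (- (e * radius_sq z)))"
 using radial_integral(1) [of "\<lambda>s. exp (- (e * s))"] gamma_integral [of e 0]
 by (auto simp: set_integrable_def has_bochner_integral_iff)

lemma integrable_bounded_mult_exp:
 assumes [measurable]: "f \<in> borel_measurable borel" and b: "\<And>z. \<bar>f z\<bar> \<le> (B::real)" and e: "0 < e"
 shows "integrable lborel (\<lambda>z. f z * exp (- (e * radius_sq z)))"
proof (rule Bochner_Integration.integrable_bound)
 show "integrable lborel (\<lambda>z. B * exp (- (e * radius_sq z)))" using exp_radius_integrable [OF e] by simp
 show "AE z in lborel. norm (f z * exp (- (e * radius_sq z))) \<le> norm (B * exp (- (e * radius_sq z)))"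
  using b order_trans [OF abs_ge_zero b] by (intro AE_I2) (simp add: abs_mult mult_right_mono)
qed simp

text \<open>The angular integral leaves only the populations, and the Laplace transform of Laguerre
  polynomials turns the damped integral into their generating function at
  \<open>(1 - e) / (1 + e)\<close>.\<close>

lemma wfin_moment:
 assumes e: "0 < e"
 shows "(LINT z|lborel. Re (wfin K (phase_point z)) * exp (- (e * radius_sq z))) = pi * (\<Sum>n<K. pop n * ((1 - e) ^ n / (1 + e) ^ Suc n))"
proof -
 define g where "g s = (\<Sum>n<K. (pi * pop n * (-1) ^ n) * (indicator {0<..} s *\<^sub>R (lag n 0 (2 * s) * exp (- ((1 + e) * s)))))" for s
 have b: "\<bar>Re (wfin K (phase_point z))\<bar> \<le> 1" for z
  using order_trans [OF abs_Re_le_cmod wfin_norm_le] .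
 have "(LINT z|lborel. Re (wfin K (phase_point z)) * exp (- (e * radius_sq z))) =
  (LINT s|lborel. LINT t|lborel. (indicator {0<..} s * indicator {0<..<2*pi} t / 2) *\<^sub>R
    (Re (wfin K (phase_point (polar (s, t)))) * exp (- (e * radius_sq (polar (s, t))))))"
  by (rule integral_polar [OF integrable_bounded_mult_exp [OF wfin_measurable b e]])
 also have "\<dots> = (LINT s|lborel. g s)"
 proof (rule Bochner_Integration.integral_cong [OF refl])
  fix s :: real
  show "(LINT t|lborel. (indicator {0<..} s * indicator {0<..<2*pi} t / 2) *\<^sub>R
    (Re (wfin K (phase_point (polar (s, t)))) * exp (- (e * radius_sq (polar (s, t)))))) = g s"
  proof (cases "0 < s")
   case True
   have "(LINT t|lborel. (indicator {0<..} s * indicator {0<..<2*pi} t / 2) *\<^sub>R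
     (Re (wfin K (phase_point (polar (s, t)))) * exp (- (e * radius_sq (polar (s, t))))))
     = exp (- (e * s)) * pi * Re (harm K 0 s)"
    using True wfin_ang(2) [of s K] by (simp add: phase_point_polar set_lebesgue_integral_def algebra_simps)
   also have "\<dots> = g s"
    unfolding g_def harm_0_eq Re_complex_of_real sum_distrib_left using True
    by (intro sum.cong refl) (simp add: lagw_def distrib_right exp_add [symmetric] mult_ac exp_minus_inverse, simp add: exp_add exp_diff exp_minus field_simps)
   finally show ?thesis .
  qed (simp add: g_def)
 qed
 also have "\<dots> = (\<Sum>n<K. (pi * pop n * (-1) ^ n) * ((1 - 2 / (1 + e)) ^ n / (1 + e)))"
  unfolding g_def using e
  by (intro has_bochner_integral_integral_eq has_bochner_integral_sum has_bochner_integral_mult_right lag_gamma_integral) auto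
 also have "\<dots> = pi * (\<Sum>n<K. pop n * ((1 - e) ^ n / (1 + e) ^ Suc n))"
  unfolding sum_distrib_left
 proof (rule sum.cong [OF refl])
  fix n
  have "(1 - e) / (1 + e) = (-1) * (1 - 2 / (1 + e))" using e by (simp add: field_simps)
  then have "((1 - e) / (1 + e)) ^ n = (-1) ^ n * (1 - 2 / (1 + e)) ^ n" by (simp only: power_mult_distrib)
  moreover have "(1 - e) ^ n / (1 + e) ^ Suc n = ((1 - e) / (1 + e)) ^ n / (1 + e)" by (simp add: power_divide)
  ultimately show "pi * pop n * (-1) ^ n * ((1 - 2 / (1 + e)) ^ n / (1 + e)) = pi * (pop n * ((1 - e) ^ n / (1 + e) ^ Suc n))"
   by simp
 qed
 finally show ?thesis .
qed

end

lemma gamma_integral_0: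
 fixes a :: real assumes "0 < a"
 shows "set_integrable lborel {0<..} (\<lambda>s. exp (- (a * s)))" "(LINT s:{0<..}|lborel. exp (- (a * s))) = 1 / a"
 using gamma_integral [OF assms, of 0] by (auto simp: has_bochner_integral_iff set_integrable_def set_lebesgue_integral_def)

lemma exp_radius_integral: "0 < e \<Longrightarrow> (LINT z|lborel. exp (- (e * radius_sq z))) = pi / e"
 using radial_integral(2) [of "\<lambda>s. exp (- (e * s))"] gamma_integral_0 [of e] by simp

section \<open>Normalisation, second moment and entropy of nonnegative states with bounded
  energy\<close>

locale nonneg_state = density_state +
 fixes E :: real
 assumes wig_nonneg: "0 \<le> wig z" and E_pos: "0 < E" and energy: "mean_photon_number \<rho> \<le> ennreal E"
begin

lemma energy_sum: "(\<Sum>n<K. real n * pop n) \<le> E"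
proof -
 have t: "Re (inner_L2 (number_op (fock n)) (\<rho> (fock n))) = real n * pop n" for n
 proof -
  have "inner_L2 (number_op (fock n)) (\<rho> (fock n)) = of_nat n * dm n n"
   unfolding number_op_fock dm_def by (subst inner_scale_left) (simp_all add: op_L2 del: fock.simps)
  then show ?thesis by (simp add: dm_diag)
 qed
 have "ennreal (\<Sum>n<K. real n * pop n) = (\<Sum>n<K. ennreal (real n * pop n))"
  by (rule sum_ennreal [symmetric]) (simp add: pop_nonneg)
 also have "\<dots> \<le> mean_photon_number \<rho>"
  unfolding mean_photon_number_def t by (rule sum_le_suminf) auto
 also have "\<dots> \<le> ennreal E" by (rule energy)
 finally show ?thesis using E_pos by (simp add: ennreal_le_iff)
qed

lemma energy_sum': "finite A \<Longrightarrow> (\<Sum>n\<in>A. real n * pop n) \<le> E"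
proof -
 assume "finite A"
 then obtain K where "A \<subseteq> {..<K}" using finite_nat_iff_bounded by blast
 then have "(\<Sum>n\<in>A. real n * pop n) \<le> (\<Sum>n<K. real n * pop n)" by (intro sum_mono2) (auto simp: pop_nonneg)
 then show ?thesis using energy_sum [of K] by linarith
qed

lemma sum_pop_pos_le: "finite A \<Longrightarrow> 0 \<notin> A \<Longrightarrow> (\<Sum>n\<in>A. pop n) \<le> E"
proof -
 assume A: "finite A" "0 \<notin> A"
 have "(\<Sum>n\<in>A. pop n) \<le> (\<Sum>n\<in>A. real n * pop n)"
 proof (rule sum_mono)
  fix n assume "n \<in> A"
  then show "pop n \<le> real n * pop n" using A pop_nonneg mult_right_mono [of 1 "real n" "pop n"] by (cases n, auto)
 qed
 then show ?thesis using energy_sum' [OF A(1)] by linarith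
qed

lemma pop_0_ge: "1 - E \<le> pop 0"
proof -
 have "(\<lambda>K. pop 0 + (1 - pop 0 - eps K)) \<longlonglongrightarrow> pop 0 + (1 - pop 0 - 0)" by (intro tendsto_intros eps_tendsto)
 moreover have "pop 0 + (1 - pop 0 - eps K) \<le> pop 0 + E" if "1 \<le> K" for K
  using that sum_pop_pos_le [of "{1..<K}"] by (simp add: sum.atLeast_Suc_lessThan eps_def lessThan_atLeast0)
 ultimately have "pop 0 + (1 - pop 0 - 0) \<le> pop 0 + E" by (intro LIMSEQ_le_const2) auto
 then show ?thesis by simp
qed

lemma wig_exp_integrable: "0 < e \<Longrightarrow> integrable lborel (\<lambda>z. wig z * exp (- (e * radius_sq z)))"
 by (rule integrable_bounded_mult_exp [OF wig_measurable wig_abs_le])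

text \<open>Damping makes the integrals converge before integrability of \<open>wig\<close> is
  known. Bernoulli's inequality expands the generating function to first order in \<open>e\<close>,
  precise enough to yield the mass in the limit and the second moment from a difference
  quotient.\<close>

lemma wig_moment_bounds:
 assumes e: "0 < e" "e < 1"
 shows "1 - e * (1 + 2 * E) \<le> (LINT z|lborel. wig z * exp (- (e * radius_sq z)))"
  and "(LINT z|lborel. wig z * exp (- (e * radius_sq z))) \<le> 1"
proof -
 let ?e = "\<lambda>z. exp (- (e * radius_sq z))"
 define G where "G = (LINT z|lborel. wig z * ?e z)"
 define S where "S K = (\<Sum>n<K. pop n * ((1 - e) ^ n / (1 + e) ^ Suc n))" for K
 have dist: "\<bar>S K - G\<bar> \<le> 2 * sqrt (eps K) / e" for K
 proof -
  have iw: "integrable lborel (\<lambda>z. Re (wfin K (phase_point z)) * ?e z)"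
   by (rule integrable_bounded_mult_exp [OF wfin_measurable _ e(1), of _ 1]) (rule order_trans [OF abs_Re_le_cmod wfin_norm_le])
  have eq: "pi * (G - S K) = (LINT z|lborel. pi * (wig z * ?e z) - Re (wfin K (phase_point z)) * ?e z)"
   using wig_exp_integrable [OF e(1)] iw wfin_moment [OF e(1), of K] by (simp add: G_def S_def right_diff_distrib)
  have "\<bar>pi * (G - S K)\<bar> \<le> (LINT z|lborel. \<bar>pi * (wig z * ?e z) - Re (wfin K (phase_point z)) * ?e z\<bar>)"
   unfolding eq by simp
  also have "\<dots> \<le> (LINT z|lborel. 2 * sqrt (eps K) * ?e z)"
  proof (rule integral_mono)
   fix z
   define r where "r = Re (wfin K (phase_point z))"
   have "pi * \<bar>wig z - r / pi\<bar> \<le> pi * (2 * sqrt (eps K) / pi)"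
    unfolding r_def by (rule mult_left_mono [OF wig_approx]) simp
   then have le: "\<bar>pi * wig z - r\<bar> \<le> 2 * sqrt (eps K)" by (simp add: field_simps)
   have "pi * (wig z * ?e z) - r * ?e z = (pi * wig z - r) * ?e z"
    by (simp add: left_diff_distrib)
   then show "\<bar>pi * (wig z * ?e z) - Re (wfin K (phase_point z)) * ?e z\<bar> \<le> 2 * sqrt (eps K) * ?e z"
    using mult_right_mono [OF le, of "?e z"] unfolding r_def by (simp only: abs_mult abs_exp_cancel exp_ge_zero)
  qed (use wig_exp_integrable [OF e(1)] iw exp_radius_integrable [OF e(1)] in auto)
  also have "\<dots> = pi * (2 * sqrt (eps K) / e)" using exp_radius_integral [OF e(1)] by simp
  finally show ?thesis by ((simp only: abs_mult abs_of_pos [OF pi_gt_zero]), (simp only: mult_le_cancel_left_pos pi_gt_zero))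
 qed
 have "(\<lambda>K. 2 * sqrt (eps K) / e) \<longlonglongrightarrow> 2 * sqrt 0 / e" by (intro tendsto_intros eps_tendsto) (use e in auto)
 then have e0: "(\<lambda>K. 2 * sqrt (eps K) / e) \<longlonglongrightarrow> 0" by simp
 have "(\<lambda>K. S K - G) \<longlonglongrightarrow> 0"
  by (rule Lim_null_comparison [OF always_eventually e0]) (simp add: dist)
 then have lim: "S \<longlonglongrightarrow> G" by (rule LIM_zero_cancel)
 have up: "S K \<le> 1" for K
 proof -
  have "pop n * ((1 - e) ^ n / (1 + e) ^ Suc n) \<le> pop n" for n
  proof -
   have "(1 - e) ^ n \<le> 1" using e by (intro power_le_one) auto
   moreover have "1 \<le> (1 + e) ^ Suc n" using e by (intro one_le_power) auto
   ultimately have "(1 - e) ^ n / (1 + e) ^ Suc n \<le> 1" by simp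
   then show ?thesis using pop_nonneg mult_left_mono [of _ 1 "pop n"] by fastforce
  qed
  then have "S K \<le> (\<Sum>n<K. pop n)" unfolding S_def by (intro sum_mono)
  then show ?thesis using sum_pop_le [of "{..<K}"] by simp
 qed
 then show "(LINT z|lborel. wig z * ?e z) \<le> 1"
  using LIMSEQ_le_const2 [OF lim] unfolding G_def by blast
 have lo: "(\<Sum>n<K. pop n) - e * (1 + 2 * E) \<le> S K" for K
 proof -
  have "pop n - e * (pop n + 2 * (real n * pop n)) \<le> pop n * ((1 - e) ^ n / (1 + e) ^ Suc n)" for n
  proof -
   have "1 - e \<le> 1 / (1 + e)" using e by (simp add: field_simps)
   then have "(1 - e) ^ Suc n \<le> (1 / (1 + e)) ^ Suc n" using e by (intro power_mono) auto
   then have "(1 - e) ^ n * (1 - e) ^ Suc n \<le> (1 - e) ^ n * (1 / (1 + e) ^ Suc n)"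
    using e by (intro mult_left_mono) (auto simp: power_divide)
   moreover have "1 + real (n + Suc n) * (- e) \<le> (1 + (- e)) ^ (n + Suc n)" using e by (intro Bernoulli_inequality) simp
   ultimately have "1 - (1 + 2 * real n) * e \<le> (1 - e) ^ n / (1 + e) ^ Suc n" by (simp add: power_add algebra_simps)
   from mult_left_mono [OF this pop_nonneg [of n]] show ?thesis by (simp add: algebra_simps)
  qed
  then have "(\<Sum>n<K. pop n - e * (pop n + 2 * (real n * pop n))) \<le> S K" unfolding S_def by (intro sum_mono)
  moreover have "e * ((\<Sum>n<K. pop n) + 2 * (\<Sum>n<K. real n * pop n)) \<le> e * (1 + 2 * E)"
   using e energy_sum [of K] sum_pop_le [of "{..<K}"] by simp
  ultimately show ?thesis by (simp add: sum_subtractf sum.distrib sum_distrib_left algebra_simps)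
 qed
 have "(\<lambda>K. (\<Sum>n<K. pop n) - e * (1 + 2 * E)) \<longlonglongrightarrow> 1 - e * (1 + 2 * E)"
  using pop_sums by (intro tendsto_intros) (simp add: sums_def)
 from LIMSEQ_le [OF this lim] lo show "1 - e * (1 + 2 * E) \<le> (LINT z|lborel. wig z * ?e z)"
  unfolding G_def by blast
qed

definition cut :: "nat \<Rightarrow> real" where "cut i = 1 / (real i + 2)"

lemma cut_bounds: "0 < cut i" "cut i < 1" by (auto simp: cut_def)

lemma cut_tendsto: "cut \<longlonglongrightarrow> 0"
 unfolding cut_def by (rule real_tendsto_divide_at_top [OF tendsto_const])
  (auto intro!: filterlim_tendsto_add_at_top filterlim_real_sequentially simp: add.commute [of _ 2])

lemma cut_mono: "i \<le> j \<Longrightarrow> cut j \<le> cut i" by (auto simp: cut_def field_simps)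

lemma exp_cut_lim: "(\<lambda>i. c * exp (- (cut i * x))) \<longlonglongrightarrow> c"
 using tendsto_mult [OF tendsto_const tendsto_exp [OF tendsto_minus [OF tendsto_mult_left_zero [OF cut_tendsto, of x]]], of c] by simp

lemma wig_integrable: "integrable lborel wig" and wig_integral: "(LINT z|lborel. wig z) = 1"
proof -
 define f where "f i z = wig z * exp (- (cut i * radius_sq z))" for i z
 have 1: "integrable lborel (f i)" for i unfolding f_def by (rule wig_exp_integrable [OF cut_bounds(1)])
 have 2: "AE z in lborel. mono (\<lambda>i. f i z)"
  by (auto intro!: AE_I2 monoI mult_left_mono mult_right_mono cut_mono wig_nonneg simp: f_def)
 have 3: "AE z in lborel. 0 \<le> f i z" for i by (simp add: f_def wig_nonneg)
 have 4: "AE z in lborel. (\<lambda>i. f i z) \<longlonglongrightarrow> wig z" unfolding f_def by (intro AE_I2 exp_cut_lim)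
 have 5: "(\<lambda>i. integral\<^sup>L lborel (f i)) \<longlonglongrightarrow> 1"
 proof (rule tendsto_sandwich)
  show "\<forall>\<^sub>F i in sequentially. 1 - cut i * (1 + 2 * E) \<le> integral\<^sup>L lborel (f i)"
   unfolding f_def using wig_moment_bounds(1) [OF cut_bounds] by simp
  show "\<forall>\<^sub>F i in sequentially. integral\<^sup>L lborel (f i) \<le> 1"
   unfolding f_def using wig_moment_bounds(2) [OF cut_bounds] by simp
  show "(\<lambda>i. 1 - cut i * (1 + 2 * E)) \<longlonglongrightarrow> 1"
   using tendsto_diff [OF tendsto_const tendsto_mult_left_zero [OF cut_tendsto, of "1 + 2 * E"], of 1] by simp
 qed simp
 show "integrable lborel wig" "(LINT z|lborel. wig z) = 1"
  by (rule integral_monotone_convergence_nonneg [OF 1 2 3 4 5], simp)+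
qed

lemma wig_radius_integrable: "integrable lborel (\<lambda>z. wig z * radius_sq z)"
 and wig_radius_integral: "(LINT z|lborel. wig z * radius_sq z) \<le> 1 + 2 * E"
proof -
 define f where "f i z = wig z * radius_sq z * exp (- (cut i * radius_sq z))" for i z
 \<comment> \<open>From \<open>y * exp (- y) \<le> 1 - exp (- y)\<close>: the damped second moment
   is at most a difference quotient of the damped mass, which \<open>wig_moment_bounds\<close>
   bounds by \<open>1 + 2 * E\<close>.\<close>
 have le: "f i z \<le> (wig z - wig z * exp (- (cut i * radius_sq z))) / cut i" for i z
 proof -
  define y where "y = cut i * radius_sq z"
  have "(1 + y) * exp (- y) \<le> exp y * exp (- y)" by simp
  then have "y * exp (- y) \<le> 1 - exp (- y)" by (simp add: exp_minus_inverse algebra_simps)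
  from mult_left_mono [OF this wig_nonneg [of z]]
  show ?thesis using cut_bounds(1) [of i] by (simp add: f_def y_def algebra_simps pos_le_divide_eq)
 qed
 have nn: "0 \<le> f i z" for i z by (simp add: f_def wig_nonneg)
 have gi: "integrable lborel (\<lambda>z. (wig z - wig z * exp (- (cut i * radius_sq z))) / cut i)" for i
  using wig_integrable wig_exp_integrable [OF cut_bounds(1), of i] by auto
 have [measurable]: "f i \<in> borel_measurable borel" for i unfolding f_def by measurable
 have 1: "integrable lborel (f i)" for i
  by (rule Bochner_Integration.integrable_bound [OF gi [of i]])
   (use le nn order_trans [OF le abs_ge_self] in \<open>auto simp del: split_paired_All intro!: AE_I2\<close>)
 have b: "integral\<^sup>L lborel (f i) \<le> 1 + 2 * E" for i
 proof -
  have "integral\<^sup>L lborel (f i) \<le> (LINT z|lborel. (wig z - wig z * exp (- (cut i * radius_sq z))) / cut i)"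
   by (rule integral_mono [OF 1 gi le])
  also have "\<dots> \<le> 1 + 2 * E"
   using wig_integrable wig_exp_integrable [OF cut_bounds(1), of i] wig_integral wig_moment_bounds(1) [OF cut_bounds, of i] cut_bounds(1) [of i] by (simp add: pos_divide_le_eq mult.commute)
  finally show ?thesis .
 qed
 have m: "f i z \<le> f j z" if "i \<le> j" for i j z
  unfolding f_def using that by (auto intro!: mult_left_mono mult_right_mono cut_mono wig_nonneg mult_nonneg_nonneg)
 have 2: "AE z in lborel. mono (\<lambda>i. f i z)" by (auto intro!: AE_I2 monoI m)
 have 3: "AE z in lborel. 0 \<le> f i z" for i by (simp add: nn)
 have 4: "AE z in lborel. (\<lambda>i. f i z) \<longlonglongrightarrow> wig z * radius_sq z" unfolding f_def by (intro AE_I2 exp_cut_lim)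
 have "incseq (\<lambda>i. integral\<^sup>L lborel (f i))" by (intro monoI integral_mono 1 m)
 then obtain I where 5: "(\<lambda>i. integral\<^sup>L lborel (f i)) \<longlonglongrightarrow> I" "\<And>i. integral\<^sup>L lborel (f i) \<le> I"
  by (rule incseq_convergent) (use b in auto)
 note conv = integral_monotone_convergence_nonneg [OF 1 2 3 4 5(1)]
 show "integrable lborel (\<lambda>z. wig z * radius_sq z)" by (rule conv(1)) simp
 have "(LINT z|lborel. wig z * radius_sq z) = I" by (rule conv(2)) simp
 then show "(LINT z|lborel. wig z * radius_sq z) \<le> 1 + 2 * E" using LIMSEQ_le_const2 [OF 5(1)] b by simp
qed

lemma wig_ln_nonpos: "wig z * ln (wig z) \<le> - (wig z * ln pi)"
proof (cases "wig z = 0")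
 case False
 then have p: "0 < wig z" using wig_nonneg [of z] by simp
 then have "ln (wig z) \<le> ln (1 / pi)" using wig_abs_le [of z] by simp
 then show ?thesis using mult_left_mono [of "ln (wig z)" "- ln pi" "wig z"] p by (simp add: ln_div)
qed simp

text \<open>\<open>ln x \<le> x - 1\<close> at the ratio of a Gaussian to \<open>wig z\<close>;
  together with the finite second moment this makes \<open>wig z * ln (wig z)\<close>
  integrable.\<close>

lemma wig_ln_ge: "- (wig z * ln (wig z)) \<le> wig z * radius_sq z + exp (- radius_sq z)"
proof (cases "wig z = 0")
 case False
 then have p: "0 < wig z" using wig_nonneg [of z] by simp
 have "ln (exp (- radius_sq z) / wig z) \<le> exp (- radius_sq z) / wig z - 1" by (rule ln_le_minus_one) (simp add: p)
 then have "- radius_sq z - ln (wig z) \<le> exp (- radius_sq z) / wig z - 1" using p by (simp add: ln_div)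
 from mult_left_mono [OF this less_imp_le [OF p]] show ?thesis using p by (simp add: algebra_simps)
qed simp

lemma wig_ln_integrable: "integrable lborel (\<lambda>z. wig z * ln (wig z))"
proof (rule Bochner_Integration.integrable_bound)
 show "integrable lborel (\<lambda>z. wig z * radius_sq z + exp (- radius_sq z))"
  using wig_radius_integrable exp_radius_integrable [of 1] by auto
 have "\<bar>wig z * ln (wig z)\<bar> \<le> \<bar>wig z * radius_sq z + exp (- radius_sq z)\<bar>" for z
 proof -
  have "wig z * ln pi \<ge> 0" using pi_ge_two wig_nonneg by simp
  then show ?thesis using wig_ln_nonpos [of z] wig_ln_ge [of z] by linarith
 qed
 then show "AE z in lborel. norm (wig z * ln (wig z)) \<le> norm (wig z * radius_sq z + exp (- radius_sq z))" by simp
qed simp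

lemma entropy_eq: "wigner_entropy (wigner \<rho>) = - (LINT z|lborel. wig z * ln (wig z))"
 by (simp add: wigner_entropy_def wig_def split_def)

end

section \<open>The deficit in terms of the first row of the density matrix\<close>

text \<open>The lower incomplete gamma function with parameter \<open>k + 1\<close>.\<close>

definition gam :: "nat \<Rightarrow> real \<Rightarrow> real" where
 "gam k R = (LINT s:{0<..<R}|lborel. s ^ k * exp (- s))"

lemma gam_integrable: "set_integrable lborel {0<..<R} (\<lambda>s. s ^ k * exp (- s :: real))"
 by (rule set_integrable_subset [of _ "{0<..}"])
  (use gamma_integral [of 1 k] in \<open>auto simp: set_integrable_def has_bochner_integral_iff\<close>)

lemma gam_le_fact: "gam k R \<le> fact k"
proof -
 have g: "set_integrable lborel {0<..} (\<lambda>s. s ^ k * exp (- s :: real))" "(LINT s:{0<..}|lborel. s ^ k * exp (- s :: real)) = fact k"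
  using gamma_integral [of 1 k] by (auto simp: set_integrable_def set_lebesgue_integral_def has_bochner_integral_iff)
 have "gam k R \<le> (LINT s:{0<..}|lborel. s ^ k * exp (- s :: real))"
  unfolding gam_def set_lebesgue_integral_def
  by (rule integral_mono) (use gam_integrable [of R k] g(1) in \<open>auto simp: set_integrable_def indicator_def\<close>)
 then show ?thesis using g(2) by simp
qed

lemma gam_nonneg: "0 \<le> gam k R"
 unfolding gam_def set_lebesgue_integral_def by (rule Bochner_Integration.integral_nonneg) (auto simp: indicator_def)

lemma gam_add_le: "0 \<le> R \<Longrightarrow> gam (k + j) R \<le> R ^ j * gam k R"
proof -
 assume R: "0 \<le> R"
 have "gam (k + j) R \<le> (LINT s:{0<..<R}|lborel. R ^ j * (s ^ k * exp (- s)))"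
  unfolding gam_def
 proof (rule set_integral_mono [OF gam_integrable])
  show "set_integrable lborel {0<..<R} (\<lambda>s. R ^ j * (s ^ k * exp (- s)))"
   by (rule set_integrable_mult_right [OF gam_integrable])
  fix s assume "s \<in> {0<..<R}"
  then show "s ^ (k + j) * exp (- s) \<le> R ^ j * (s ^ k * exp (- s))" using power_mono [of s R j] by (simp add: power_add)
 qed
 then show ?thesis by (simp add: gam_def)
qed

lemma exp_ball_integrable: "set_integrable lborel {0<..<R} (\<lambda>s::real. exp (c * s))"
proof (rule set_integrable_subset [of _ "{0..R}"])
 show "set_integrable lborel {0..R} (\<lambda>s. exp (c * s))"
  unfolding set_integrable_def by (rule borel_integrable_compact) (auto intro!: continuous_intros)
qed auto

lemma gam_1:
 assumes R: "0 < R" shows "gam 1 R = 1 - (1 + R) * exp (- R)"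
proof -
 have "gam 1 R = integral {0<..<R} (\<lambda>s. s ^ 1 * exp (- s))"
  unfolding gam_def by (rule set_borel_integral_eq_integral(2) [OF gam_integrable])
 also have "\<dots> = integral {0..R} (\<lambda>s. s * exp (- s))"
  unfolding power_one_right by (rule integral_spike_set) (rule negligible_subset [of "{0, R}"]; force)+
 also have "((\<lambda>s. s * exp (- s)) has_integral (- (1 + R) * exp (- R)) - (- (1 + 0) * exp (- 0))) {0..R}"
  using R by (intro fundamental_theorem_of_calculus)
   (auto intro!: derivative_eq_intros simp: has_real_derivative_iff_has_vector_derivative [symmetric] algebra_simps)
 then have "integral {0..R} (\<lambda>s. s * exp (- s)) = (- (1 + R) * exp (- R)) - (- (1 + 0) * exp (- 0))" by auto
 finally show ?thesis by (simp add: algebra_simps)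
qed

lemma integral_exp_le:
 fixes R :: real assumes R: "0 < R" shows "(LINT s:{0<..<R}|lborel. exp s) \<le> exp R"
proof -
 have si: "set_integrable lborel {0<..<R} exp" using exp_ball_integrable [of R 1] by simp
 have "(LINT s:{0<..<R}|lborel. exp s) = integral {0<..<R} exp"
  by (rule set_borel_integral_eq_integral(2) [OF si])
 also have "\<dots> = integral {0..R} exp"
  by (rule integral_spike_set) (rule negligible_subset [of "{0, R}"]; force)+
 also have "(exp has_integral exp R - exp 0) {0..R}"
  using R by (intro fundamental_theorem_of_calculus)
   (auto intro!: derivative_eq_intros simp: has_real_derivative_iff_has_vector_derivative [symmetric])
 then have "integral {0..R} exp = exp R - exp 0" by auto
 finally show ?thesis by simp
qed

lemma ball_integrable:
 assumes [measurable]: "f \<in> borel_measurable borel" and b: "\<And>z. radius_sq z < R \<Longrightarrow> \<bar>f z\<bar> \<le> (C::real)"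
 shows "integrable lborel (\<lambda>z. indicator {..<R} (radius_sq z) * f z)"
proof (rule Bochner_Integration.integrable_bound)
 have "set_integrable lborel {0<..} (\<lambda>s. C * indicator {..<R} s :: real)"
 proof -
  have "integrable lborel (\<lambda>s. C * indicator {0<..<R} s :: real)" by (cases "0 < R") auto
  moreover have "(\<lambda>s::real. indicator {0<..} s *\<^sub>R (C * indicator {..<R} s)) = (\<lambda>s. C * indicator {0<..<R} s)"
   by (auto simp: indicator_def)
  ultimately show ?thesis by (simp only: set_integrable_def)
 qed
 then show "integrable lborel (\<lambda>z. C * indicator {..<R} (radius_sq z))" by (intro radial_integral(1)) auto
 show "AE z in lborel. norm (indicator {..<R} (radius_sq z) * f z) \<le> norm (C * indicator {..<R} (radius_sq z))"
  using order_trans [OF b abs_ge_self] by (intro AE_I2) (auto simp: indicator_def)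
qed simp

text \<open>Reduces an integral over a disc to a radial majorant; the factor 2 compensates the
  Jacobian 1/2.\<close>

lemma ball_integral_le:
 assumes [measurable]: "f \<in> borel_measurable borel" and b: "\<And>z. radius_sq z < R \<Longrightarrow> \<bar>f z\<bar> \<le> (C::real)"
  and g: "set_integrable lborel {0<..<R} g"
  and le: "\<And>s. 0 < s \<Longrightarrow> s < R \<Longrightarrow> (LINT t:{0<..<2*pi}|lborel. f (polar (s, t))) \<le> 2 * g s"
 shows "(LINT z|lborel. indicator {..<R} (radius_sq z) * f z) \<le> (LINT s:{0<..<R}|lborel. g s)"
proof -
 define F where "F z = indicator {..<R} (radius_sq z) * f z" for z
 have iF: "integrable lborel F" unfolding F_def by (rule ball_integrable [OF assms(1) b])
 define H where "H s = (LINT t|lborel. (indicator {0<..} s * indicator {0<..<2*pi} t / 2) *\<^sub>R F (polar (s, t)))" for s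
 have "integrable (lborel \<Otimes>\<^sub>M lborel) (\<lambda>z. (indicator ({0<..} \<times> {0<..<2*pi}) z / 2) *\<^sub>R F (polar z))"
  using iF by (subst integrable_polar_iff [symmetric]) (auto simp: F_def)
 from lborel_pair.integrable_fst' [OF this]
 have iH: "integrable lborel H" by (simp only: H_def [abs_def] indicator_times fst_conv snd_conv)
 have "(LINT z|lborel. F z) = (LINT s|lborel. H s)" unfolding H_def by (rule integral_polar [OF iF])
 also have "\<dots> \<le> (LINT s|lborel. indicator {0<..<R} s *\<^sub>R g s)"
 proof (rule integral_mono [OF iH])
  show "integrable lborel (\<lambda>s. indicator {0<..<R} s *\<^sub>R g s)" using g by (simp add: set_integrable_def)
  fix s :: real
  show "H s \<le> indicator {0<..<R} s *\<^sub>R g s"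
  proof (cases "0 < s \<and> s < R")
   case True
   have "H s = (LINT t|lborel. (1/2) * (indicator {0<..<2*pi} t *\<^sub>R f (polar (s, t))))"
    using True unfolding H_def F_def by simp
   also have "\<dots> = (1/2) * (LINT t:{0<..<2*pi}|lborel. f (polar (s, t)))"
    unfolding set_lebesgue_integral_def by simp
   finally show ?thesis using le [of s] True by simp
  next
   case False
   then show ?thesis unfolding H_def F_def by (simp add: indicator_def)
  qed
 qed
 finally show ?thesis by (simp add: F_def set_lebesgue_integral_def)
qed

lemma trig_parseval:
 fixes c :: "nat \<Rightarrow> complex"
 assumes A: "finite A"
 shows "set_integrable lborel {0<..<2*pi} (\<lambda>t. (cmod (\<Sum>k\<in>A. c k * cis (of_int (int k) * t)))^2)"
  and "(LINT t:{0<..<2*pi}|lborel. (cmod (\<Sum>k\<in>A. c k * cis (of_int (int k) * t)))\<^sup>2) = 2 * pi * (\<Sum>k\<in>A. (cmod (c k))^2)"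
proof -
 let ?F = "\<lambda>t. \<Sum>k\<in>A. c k * cis (of_int (int k) * t)"
 define F where "F t = (\<Sum>k\<in>A. \<Sum>j\<in>A. (c k * cnj (c j)) * cis (of_int (int k - int j) * t))" for t
 have eq: "of_real ((cmod (?F t))^2) = F t" for t
 proof -
  have "of_real ((cmod (?F t))^2)
    = (?F t) * (\<Sum>j\<in>A. cnj (c j) * cis (- (of_int (int j) * t)))"
   by (subst complex_norm_square) (simp add: cis_cnj)
  also have "\<dots> = F t"
   unfolding sum_product F_def
  proof (intro sum.cong refl)
   fix k j
   have "of_int (int k) * t + - (of_int (int j) * t) = of_int (int k - int j) * t" by (simp add: algebra_simps)
   then have "cis (of_int (int k) * t) * cis (- (of_int (int j) * t)) = cis (of_int (int k - int j) * t)" by (simp only: cis_mult)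
   then show "c k * cis (of_int (int k) * t) * (cnj (c j) * cis (- (of_int (int j) * t))) = c k * cnj (c j) * cis (of_int (int k - int j) * t)"
    by simp
  qed
  finally show ?thesis .
 qed
 have si: "set_integrable lborel {0<..<2*pi} (\<lambda>t. (c k * cnj (c j)) * cis (of_int (int k - int j) * t))" for k j
  by (rule set_integrable_mult_right) (rule set_integral_cis(1))
 have iF: "set_integrable lborel {0<..<2*pi} F"
  unfolding F_def by (intro set_integral_sum(1) A si)
 have "(LINT t:{0<..<2*pi}|lborel. F t) = (\<Sum>k\<in>A. \<Sum>j\<in>A. (c k * cnj (c j)) * (if k = j then of_real (2 * pi) else 0))"
  unfolding F_def
  by (simp only: set_integral_sum(2) [OF A set_integral_sum(1) [OF A si]]
    set_integral_sum(2) [OF A si] set_integral_mult_right set_integral_cis(2)) simp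
 also have "\<dots> = of_real (2 * pi * (\<Sum>k\<in>A. (cmod (c k))^2))"
  using A by (simp add: if_distrib sum_distrib_left mult_ac complex_norm_square flip: of_real_power cong: if_cong)
 finally have I: "(LINT t:{0<..<2*pi}|lborel. F t) = of_real (2 * pi * (\<Sum>k\<in>A. (cmod (c k))^2))" .
 have R: "(cmod (?F t))^2 = Re (F t)" for t
  unfolding eq [symmetric] by simp
 show "set_integrable lborel {0<..<2*pi} (\<lambda>t. (cmod (?F t))^2)"
  unfolding R using integrable_Re [OF iF [unfolded set_integrable_def]] unfolding set_integrable_def by simp
 show "(LINT t:{0<..<2*pi}|lborel. (cmod (?F t))\<^sup>2) = 2 * pi * (\<Sum>k\<in>A. (cmod (c k))^2)"
  unfolding R using integral_Re [OF iF [unfolded set_integrable_def]] arg_cong [OF I, of Re]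
  unfolding set_lebesgue_integral_def by simp
qed

lemma lagw_0_sq: "0 \<le> x \<Longrightarrow> (lagw 0 k x)^2 = x ^ k / fact k * exp (- x)"
proof -
 assume x: "0 \<le> x"
 have "(exp (- x / 2))^2 = exp (- x)" by (simp add: power2_eq_square exp_add [symmetric])
 moreover have "(sqrt x ^ k)^2 = x ^ k" using x by (metis power_commutes power_mult power_mult_distrib real_sqrt_pow2 mult.commute)
 ultimately show ?thesis by (simp add: lagw_def power_mult_distrib)
qed

lemma lagw_0_0: "lagw 0 0 (2 * s) = exp (- s)" by (simp add: lagw_def)

context nonneg_state
begin

lemma harm_0_approx:
 assumes "1 \<le> K" "0 \<le> s" shows "\<bar>Re (harm K 0 s) - exp (- s)\<bar> \<le> 2 * E"
proof -
 have "(\<Sum>n<K. pop n * ((-1) ^ n * lagw n 0 (2 * s))) = pop 0 * exp (- s) + (\<Sum>n\<in>{1..<K}. pop n * ((-1) ^ n * lagw n 0 (2 * s)))"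
  unfolding lessThan_atLeast0 using assms by (simp add: sum.atLeast_Suc_lessThan lagw_0_0)
 then have eq: "Re (harm K 0 s) - exp (- s) = (pop 0 - 1) * exp (- s) + (\<Sum>n\<in>{1..<K}. pop n * ((-1) ^ n * lagw n 0 (2 * s)))"
  by (simp add: harm_0_eq algebra_simps)
 have "\<bar>(pop 0 - 1) * exp (- s)\<bar> \<le> E * 1"
  using assms pop_0_ge sum_pop_le [of "{0}"] unfolding abs_mult by (intro mult_mono, auto)
 moreover have "\<bar>\<Sum>n\<in>{1..<K}. pop n * ((-1) ^ n * lagw n 0 (2 * s))\<bar> \<le> E"
 proof -
  have "\<bar>\<Sum>n\<in>{1..<K}. pop n * ((-1) ^ n * lagw n 0 (2 * s))\<bar> \<le> (\<Sum>n\<in>{1..<K}. pop n * 1)"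
   using lagw_abs_le_1 [of "2 * s"] assms pop_nonneg
   by (intro order_trans [OF sum_abs] sum_mono) (auto simp: abs_mult power_abs intro!: mult_left_le)
  then show ?thesis using sum_pop_pos_le [of "{1..<K}"] by simp
 qed
 ultimately show ?thesis unfolding eq by linarith
qed

definition row :: "nat \<Rightarrow> real \<Rightarrow> real \<Rightarrow> complex" where
 "row K s t = (\<Sum>k\<in>{1..<K}. (dm 0 k * of_real (lagw 0 k (2 * s))) * cis (of_int (int k) * t))"

text \<open>Splitting off row 0 and column 0 leaves a block of trace at most \<open>E\<close>. As
  the displaced parity is a contraction, this block contributes at most \<open>E\<close>, however
  large its indices are.\<close>

lemma wfin_row_approx:
 assumes K: "1 \<le> K" and s: "0 \<le> s"
 shows "\<bar>Re (wfin K (of_real (sqrt (2 * s)) * cis t)) - exp (- s) - 2 * Re (row K s t)\<bar> \<le> E * exp (- s) + E"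
proof -
 define b where "b = of_real (sqrt (2 * s)) * cis t"
 define f where "f n k = dm n k * mel b k n" for n k
 let ?r = "\<Sum>n\<in>{1..<K}. \<Sum>k\<in>{1..<K}. f n k"
 have m: "mel b k 0 = of_real (lagw 0 k (2 * s)) * cis (of_int (int k) * t)" for k
  using mel_polar_mlag [of "2 * s" t k 0] s by (simp add: b_def mlag_def)
 have split: "(\<Sum>n<K. g n) = g 0 + (\<Sum>n\<in>{1..<K}. g n)" for g :: "nat \<Rightarrow> complex"
  unfolding lessThan_atLeast0 using K by (simp add: sum.atLeast_Suc_lessThan)
 have r: "(\<Sum>k\<in>{1..<K}. f 0 k) = row K s t" by (simp add: f_def row_def m mult.assoc)
 have c: "f n 0 = cnj (f 0 n)" for n unfolding f_def by (subst dm_hermitian, subst mel_cnj) simp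
 have c': "(\<Sum>n\<in>{1..<K}. f n 0) = cnj (row K s t)"
  unfolding r [symmetric] cnj_sum by (rule sum.cong [OF refl]) (rule c)
 have "wfin K b = (\<Sum>k<K. f 0 k) + (\<Sum>n\<in>{1..<K}. \<Sum>k<K. f n k)" unfolding wfin_def f_def [symmetric] by (rule split)
 also have "(\<Sum>k<K. f 0 k) = f 0 0 + row K s t" unfolding split [of "f 0"] r ..
 also have "(\<Sum>n\<in>{1..<K}. \<Sum>k<K. f n k) = (\<Sum>n\<in>{1..<K}. f n 0 + (\<Sum>k\<in>{1..<K}. f n k))"
  by (rule sum.cong [OF refl]) (rule split)
 also have "\<dots> = cnj (row K s t) + ?r" unfolding sum.distrib c' ..
 finally have "wfin K b = f 0 0 + row K s t + (cnj (row K s t) + ?r)" .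
 then have "Re (wfin K b) = Re (f 0 0) + 2 * Re (row K s t) + Re ?r" by simp
 moreover have "\<bar>Re ?r\<bar> \<le> E"
 proof -
  have "cmod ?r \<le> sqrt (\<Sum>k\<in>{1..<K}. pop k) * sqrt (\<Sum>n\<in>{1..<K}. pop n)"
   unfolding f_def by (rule trace_bound) auto
  also have "\<dots> = (\<Sum>k\<in>{1..<K}. pop k)" using pop_nonneg by (simp add: sum_nonneg)
  also have "\<dots> \<le> E" by (rule sum_pop_pos_le) auto
  finally show ?thesis using abs_Re_le_cmod order_trans by blast
 qed
 moreover have "\<bar>pop 0 * exp (- s) - exp (- s)\<bar> \<le> E * exp (- s)"
 proof -
  have "\<bar>pop 0 - 1\<bar> \<le> E" using sum_pop_le [of "{0}"] pop_0_ge by auto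
  from mult_right_mono [OF this, of "exp (- s)"] show ?thesis
   by (simp add: abs_mult [of _ "exp (- s)", simplified, symmetric] left_diff_distrib)
 qed
 ultimately show ?thesis using m [of 0] unfolding b_def [symmetric] by (simp add: f_def dm_diag lagw_0_0)
qed

lemma row_integral:
 assumes s: "0 \<le> s"
 shows "set_integrable lborel {0<..<2*pi} (\<lambda>t. (cmod (row K s t))^2)"
  and "(LINT t:{0<..<2*pi}|lborel. (cmod (row K s t))\<^sup>2) = 2 * pi * (\<Sum>k\<in>{1..<K}. (cmod (dm 0 k))\<^sup>2 * ((2 * s) ^ k / fact k * exp (- (2 * s))))"
 unfolding row_def by (rule trig_parseval, simp, subst trig_parseval(2))
  (use s in \<open>simp_all add: norm_mult power_mult_distrib [of "cmod _"] lagw_0_sq\<close>)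

text \<open>The integrand is the function \<open>F\<close> of \<open>deficit_upper\<close> at
  squared radius \<open>s\<close>. Its quadratic part is treated by Parseval for the row, with a
  factor 3 for separating three terms (hence \<open>12 = 3 * 2^2\<close>); its linear part sees only
  the zeroth harmonic.\<close>

lemma angular_bound:
 assumes K: "1 \<le> K" and s: "0 < s" "s < R"
 shows "(LINT t:{0<..<2*pi}|lborel. pi * exp s * ((Re (wfin K (of_real (sqrt (2 * s)) * cis t)) - exp (- s)) / pi)^2
    + (1 - s) * ((Re (wfin K (of_real (sqrt (2 * s)) * cis t)) - exp (- s)) / pi))
   \<le> 2 * (3 * E^2 * exp (- s) + 3 * E^2 * exp s + 12 * (\<Sum>k\<in>{1..<K}. (cmod (dm 0 k))\<^sup>2 * 2 ^ k / fact k * (s ^ k * exp (- s))) + 2 * E * (1 + R))"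
proof -
 let ?b = "\<lambda>s t. 3 * E^2 * exp (- (2 * s)) + 3 * E^2 + 12 * (cmod (row K s t))^2"
 define u where "u t = Re (wfin K (of_real (sqrt (2 * s)) * cis t)) - exp (- s)" for t
 have s0: "0 \<le> s" using s by simp
 have const: "set_integrable lborel {0<..<2*pi} (\<lambda>t. c :: real)" "(LINT t:{0<..<2*pi}|lborel. c :: real) = 2 * pi * c" for c
  by (simp_all add: set_integrable_def set_lebesgue_integral_def)
 have iu: "set_integrable lborel {0<..<2*pi} u" "(LINT t:{0<..<2*pi}|lborel. u t) = 2 * pi * (Re (harm K 0 s) - exp (- s))"
  unfolding u_def using set_integral_diff [OF wfin_ang(1) [OF s0, of K] const(1) [of "exp (- s)"]]
  by (simp_all only: wfin_ang(2) [OF s0] const(2) right_diff_distrib)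
 have sq: "(u t)^2 \<le> 3 * E^2 * exp (- (2 * s)) + 3 * E^2 + 12 * (cmod (row K s t))^2" for t
 proof -
  have "\<bar>u t\<bar> \<le> E * exp (- s) + E + 2 * cmod (row K s t)"
   using wfin_row_approx [OF K s0, of t] abs_Re_le_cmod [of "row K s t"] unfolding u_def by linarith
  then have "(u t)^2 \<le> (E * exp (- s) + E + 2 * cmod (row K s t))^2" by (metis abs_ge_zero power2_abs power_mono)
  also have "\<dots> \<le> 3 * ((E * exp (- s))^2 + E^2 + (2 * cmod (row K s t))^2)"
  proof -
   have "(a + b + c)^2 \<le> 3 * (a^2 + b^2 + c^2)" for a b c :: real
    using sum_squares_ge_zero [of "a - b" "b - c"] zero_le_power2 [of "a - c"] by (simp add: power2_eq_square algebra_simps)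
   then show ?thesis .
  qed
  also have "(E * exp (- s))^2 = E^2 * exp (- (2 * s))" by (simp add: power2_eq_square exp_add [symmetric])
  finally show ?thesis by simp
 qed
 define Q where "Q t = (exp s / pi) * ?b s t + ((1 - s) / pi) * u t" for t
 have i1: "set_integrable lborel {0<..<2*pi} (\<lambda>t. (exp s / pi) * ?b s t)"
  by (intro set_integrable_mult_right set_integral_add(1) const(1) row_integral(1) s0)
 have i2: "set_integrable lborel {0<..<2*pi} (\<lambda>t. ((1 - s) / pi) * u t)" by (intro set_integrable_mult_right iu(1))
 have iQ: "set_integrable lborel {0<..<2*pi} Q" unfolding Q_def by (intro set_integral_add(1) i1 i2)
 have sum_eq: "(LINT t:{0<..<2*pi}|lborel. 3 * E^2 * exp (- (2 * s)) + 3 * E^2 + 12 * (cmod (row K s t))^2) =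
   2 * pi * (3 * E^2 * exp (- (2 * s)) + 3 * E^2) + 12 * (2 * pi * (\<Sum>k\<in>{1..<K}. (cmod (dm 0 k))\<^sup>2 * ((2 * s) ^ k / fact k * exp (- (2 * s)))))"
  using set_integral_add(2) [OF const(1) [of "3 * E^2 * exp (- (2 * s)) + 3 * E^2"] set_integrable_mult_right [OF row_integral(1) [OF s0, of K], of 12]]
  by (simp only: const(2) set_integral_mult_right row_integral(2) [OF s0])
 have ee: "exp s * exp (- (2 * s)) = exp (- s)" by (simp add: exp_add [symmetric])
 have "(LINT t:{0<..<2*pi}|lborel. pi * exp s * (u t / pi)^2 + (1 - s) * (u t / pi)) \<le> (LINT t:{0<..<2*pi}|lborel. Q t)"
 proof (cases "set_integrable lborel {0<..<2*pi} (\<lambda>t. pi * exp s * (u t / pi)^2 + (1 - s) * (u t / pi))")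
  case True
  show ?thesis
  proof (rule set_integral_mono [OF True iQ])
   fix t
   show "pi * exp s * (u t / pi)^2 + (1 - s) * (u t / pi) \<le> Q t"
    using mult_left_mono [OF sq [of t], of "exp s / pi"] by (simp add: Q_def power2_eq_square)
  qed
 next
  \<comment> \<open>Domination by the integrable bound rules this case out.\<close>
  case False
  have "set_integrable lborel {0<..<2*pi} (\<lambda>t. pi * exp s * (u t / pi)^2 + (1 - s) * (u t / pi))"
  proof (rule set_integral_add(1))
   have m2: "(\<lambda>t. indicator {0<..<2*pi} t *\<^sub>R (pi * exp s * (u t / pi)^2)) \<in> borel_measurable lborel"
   proof -
    have "(\<lambda>t. pi * exp s * ((indicator {0<..<2*pi} t *\<^sub>R u t) / pi)^2) \<in> borel_measurable lborel"
     using iu(1) unfolding set_integrable_def set_borel_measurable_def by measurable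
    moreover have "(\<lambda>t. pi * exp s * ((indicator {0<..<2*pi} t *\<^sub>R u t) / pi)^2) = (\<lambda>t. indicator {0<..<2*pi} t *\<^sub>R (pi * exp s * (u t / pi)^2))"
     by (auto simp: indicator_def)
    ultimately show ?thesis by simp
   qed
   show "set_integrable lborel {0<..<2*pi} (\<lambda>t. pi * exp s * (u t / pi)^2)"
    unfolding set_integrable_def
   proof (rule Bochner_Integration.integrable_bound [OF i1 [unfolded set_integrable_def] m2], rule AE_I2)
    fix t :: real
    show "norm (indicator {0<..<2*pi} t *\<^sub>R (pi * exp s * (u t / pi)^2)) \<le> norm (indicator {0<..<2*pi} t *\<^sub>R ((exp s / pi) * ?b s t))"
     using mult_left_mono [OF sq [of t], of "exp s / pi"] by ((simp add: power2_eq_square), (cases "t \<in> {0<..<2*pi}", auto simp: abs_mult intro: order_trans [OF _ abs_ge_self]))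
   qed
   show "set_integrable lborel {0<..<2*pi} (\<lambda>t. (1 - s) * (u t / pi))" using i2 by (simp add: mult_ac)
  qed
  with False show ?thesis by simp
 qed
 also have "\<dots> = 2 * (3 * E^2 * (exp s * exp (- (2 * s))) + 3 * E^2 * exp s + 12 * (\<Sum>k\<in>{1..<K}. (cmod (dm 0 k))\<^sup>2 * 2 ^ k / fact k * (s ^ k * (exp s * exp (- (2 * s))))) + (1 - s) * (Re (harm K 0 s) - exp (- s)))"
  unfolding Q_def by ((subst set_integral_add(2) [OF i1 i2], simp only: set_integral_mult_right sum_eq iu(2)), (simp add: field_simps sum_distrib_left))
 also have "\<dots> \<le> 2 * (3 * E^2 * exp (- s) + 3 * E^2 * exp s + 12 * (\<Sum>k\<in>{1..<K}. (cmod (dm 0 k))\<^sup>2 * 2 ^ k / fact k * (s ^ k * exp (- s))) + 2 * E * (1 + R))"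
 proof -
  have "\<bar>(1 - s) * (Re (harm K 0 s) - exp (- s))\<bar> \<le> (1 + R) * (2 * E)"
   unfolding abs_mult using s harm_0_approx [OF K s0] by (intro mult_mono) auto
  then have le: "(1 - s) * (Re (harm K 0 s) - exp (- s)) \<le> 2 * E * (1 + R)" by (simp only: mult_ac)
  show ?thesis unfolding ee by (rule mult_left_mono [OF add_left_mono [OF le]]) simp
 qed
 finally show ?thesis unfolding u_def .
qed

text \<open>Inside the disc, \<open>ln x \<le> x - 1\<close> at \<open>x = W / w0\<close> bounds
  \<open>W * ln (W / w0)\<close> by the chi-square density plus \<open>W - w0\<close>; writing
  \<open>W * s = (W - w0) * s + w0 * s\<close> produces the linear term of \<open>F\<close> and the
  function \<open>k\<close>. Outside, \<open>W \<le> 1 / pi\<close> makes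
  \<open>W * ln W + W * ln pi\<close> nonpositive. The integral of \<open>k\<close> misses 1 by
  \<open>(1 + R) * exp (- R)\<close>.\<close>

lemma deficit_upper:
 assumes R: "0 < R" and B: "\<And>K. (\<Sum>k\<in>{1..<K}. (cmod (dm 0 k))\<^sup>2 * 2 ^ k / fact k * gam k R) \<le> B"
 shows "1 + ln pi - wigner_entropy (wigner \<rho>) \<le> 3 * E^2 * (1 + exp R) + 2 * E * R * (1 + R) + (1 + R) * exp (- R) + 12 * B"
proof -
 let ?g = "\<lambda>k s. s ^ k * exp (- s)"
 define w0 where "w0 z = exp (- radius_sq z) / pi" for z
 define F where "F w z = pi * exp (radius_sq z) * (w - w0 z)^2 + (1 - radius_sq z) * (w - w0 z)" for w z
 define b where "b = pi * exp R * 2^2 + (1 + R) * 2"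
 have w0m [measurable]: "w0 \<in> borel_measurable borel" unfolding w0_def by measurable
 have w0b: "0 \<le> w0 z" "w0 z \<le> 1" for z
 proof -
  have "exp (- radius_sq z) \<le> 1" by simp
  then have "exp (- radius_sq z) \<le> pi" using pi_ge_two by linarith
  then show "w0 z \<le> 1" unfolding w0_def by simp
 qed (simp add: w0_def)
 have pi1: "1 / pi \<le> 1" using pi_ge_two by simp
 have Fb: "\<bar>F w z\<bar> \<le> b" if "\<bar>w\<bar> \<le> 1 / pi" "radius_sq z < R" for w z
 proof -
  have d: "\<bar>w - w0 z\<bar> \<le> 2" using that(1) w0b [of z] pi1 by linarith
  have ar: "\<bar>1 - radius_sq z\<bar> \<le> 1 + R" "0 \<le> 1 + R" using that(2) radius_sq_nonneg [of z] by linarith+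
  have "\<bar>F w z\<bar> \<le> pi * exp (radius_sq z) * \<bar>w - w0 z\<bar>\<^sup>2 + \<bar>1 - radius_sq z\<bar> * \<bar>w - w0 z\<bar>"
   unfolding F_def by (rule order_trans [OF abs_triangle_ineq]) (simp add: abs_mult)
  also have "\<dots> \<le> b" unfolding b_def
   using d that(2) ar by (intro add_mono mult_mono power_mono) auto
  finally show ?thesis .
 qed
 define wK where "wK K z = Re (wfin K (phase_point z)) / pi" for K z
 have wKm [measurable]: "wK K \<in> borel_measurable borel" for K unfolding wK_def by measurable
 have wKb: "\<bar>wK K z\<bar> \<le> 1 / pi" for K z
  unfolding wK_def using order_trans [OF abs_Re_le_cmod wfin_norm_le [of K "phase_point z"]] by (simp add: divide_right_mono)
 have Fm [measurable]: "(\<lambda>z. F (w z) z) \<in> borel_measurable borel" if [measurable]: "w \<in> borel_measurable borel" for w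
  unfolding F_def by measurable
 define h where "h K s = 3 * E^2 * exp ((- 1) * s) + 3 * E^2 * exp (1 * s)
    + 12 * (\<Sum>k\<in>{1..<K}. (cmod (dm 0 k))\<^sup>2 * 2 ^ k / fact k * ?g k s) + 2 * E * (1 + R)" for K s
 have ball_const: "set_integrable lborel {0<..<R} (\<lambda>s. c)" "(LINT s:{0<..<R}|lborel. c) = R * c" for c :: real
  using R by (simp_all add: set_integrable_def set_lebesgue_integral_def)
 have sum_gam: "set_integrable lborel {0<..<R} (\<lambda>s. \<Sum>k\<in>A. d k * ?g k s)"
   "(LINT s:{0<..<R}|lborel. \<Sum>k\<in>A. d k * ?g k s) = (\<Sum>k\<in>A. d k * gam k R)" if "finite A" for A and d :: "nat \<Rightarrow> real"
 proof -
  have "integrable lborel (\<lambda>s. \<Sum>k\<in>A. d k * (indicator {0<..<R} s *\<^sub>R ?g k s))"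
   "(LINT s|lborel. (\<Sum>k\<in>A. d k * (indicator {0<..<R} s *\<^sub>R ?g k s))) = (\<Sum>k\<in>A. d k * gam k R)"
   using gam_integrable [of R] unfolding set_integrable_def gam_def set_lebesgue_integral_def by auto
  moreover have "(\<Sum>k\<in>A. d k * (indicator {0<..<R} s *\<^sub>R ?g k s)) = indicator {0<..<R} s *\<^sub>R (\<Sum>k\<in>A. d k * ?g k s)" for s
   unfolding scaleR_sum_right by (rule sum.cong [OF refl]) simp
  ultimately show "set_integrable lborel {0<..<R} (\<lambda>s. \<Sum>k\<in>A. d k * ?g k s)"
   "(LINT s:{0<..<R}|lborel. \<Sum>k\<in>A. d k * ?g k s) = (\<Sum>k\<in>A. d k * gam k R)"
   unfolding set_integrable_def set_lebesgue_integral_def by simp_all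
 qed
 note si = set_integrable_mult_right [OF exp_ball_integrable [of R "-1"], of "3 * E^2"]
  set_integrable_mult_right [OF exp_ball_integrable [of R 1], of "3 * E^2"]
  set_integrable_mult_right [OF sum_gam(1) [OF finite_atLeastLessThan], of 12] ball_const(1) [of "2 * E * (1 + R)"]
 have hi: "set_integrable lborel {0<..<R} (h K)" for K
  unfolding h_def by (intro set_integral_add(1) si)
 have hI: "(LINT s:{0<..<R}|lborel. h K s) \<le> 3 * E^2 * (1 + exp R) + 2 * E * R * (1 + R) + 12 * B" for K
 proof -
  have "(LINT s:{0<..<R}|lborel. h K s) = 3 * E^2 * gam 0 R + 3 * E^2 * (LINT s:{0<..<R}|lborel. exp s)
    + 12 * (\<Sum>k\<in>{1..<K}. (cmod (dm 0 k))\<^sup>2 * 2 ^ k / fact k * gam k R) + R * (2 * E * (1 + R))"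
   unfolding h_def
   by (simp only: set_integral_add(2) [OF set_integral_add(1) [OF set_integral_add(1) [OF si(1,2)] si(3)] si(4)]
     set_integral_add(2) [OF set_integral_add(1) [OF si(1,2)] si(3)] set_integral_add(2) [OF si(1,2)]
     set_integral_mult_right sum_gam(2) [OF finite_atLeastLessThan] ball_const(2)) (simp add: gam_def)
  also have "\<dots> \<le> 3 * E^2 * 1 + 3 * E^2 * exp R + 12 * B + R * (2 * E * (1 + R))"
   using gam_le_fact [of 0 R] integral_exp_le [OF R] B [of K] R E_pos by (intro add_mono mult_left_mono) auto
  finally show ?thesis by (simp add: algebra_simps)
 qed
 have approx: "(LINT z|lborel. indicator {..<R} (radius_sq z) * F (wK K z) z) \<le> 3 * E^2 * (1 + exp R) + 2 * E * R * (1 + R) + 12 * B" if K: "1 \<le> K" for K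
 proof -
  have "(LINT z|lborel. indicator {..<R} (radius_sq z) * F (wK K z) z) \<le> (LINT s:{0<..<R}|lborel. h K s)"
  proof (rule ball_integral_le [OF Fm [OF wKm] Fb [OF wKb] hi])
   fix s assume s: "0 < s" "s < R"
   have "F (wK K (polar (s, t))) (polar (s, t)) = pi * exp s * ((Re (wfin K (of_real (sqrt (2 * s)) * cis t)) - exp (- s)) / pi)^2
    + (1 - s) * ((Re (wfin K (of_real (sqrt (2 * s)) * cis t)) - exp (- s)) / pi)" for t
    using s by (simp add: F_def wK_def w0_def phase_point_polar diff_divide_distrib)
   then show "(LINT t:{0<..<2*pi}|lborel. F (wK K (polar (s, t))) (polar (s, t))) \<le> 2 * h K s"
    using angular_bound [OF K s] unfolding h_def by simp
  qed
  then show ?thesis using hI [of K] by linarith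
 qed
 \<comment> \<open>The estimates hold for the truncations, where row and harmonics are finite sums;
   boundedness on the disc, uniform in \<open>K\<close>, allows the limit.\<close>
 have lim: "(\<lambda>K. LINT z|lborel. indicator {..<R} (radius_sq z) * F (wK K z) z) \<longlonglongrightarrow> (LINT z|lborel. indicator {..<R} (radius_sq z) * F (wig z) z)"
 proof (rule integral_dominated_convergence)
  show "integrable lborel (\<lambda>z. indicator {..<R} (radius_sq z) * b)" by (rule ball_integrable [of _ _ "\<bar>b\<bar>"]) auto
  show "AE z in lborel. (\<lambda>K. indicator {..<R} (radius_sq z) * F (wK K z) z) \<longlonglongrightarrow> indicator {..<R} (radius_sq z) * F (wig z) z"
   unfolding F_def wK_def by (intro AE_I2 tendsto_intros wfin_tendsto)
  show "AE z in lborel. norm (indicator {..<R} (radius_sq z) * F (wK K z) z) \<le> indicator {..<R} (radius_sq z) * b" for K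
   using Fb [OF wKb] by (intro AE_I2) (auto simp: indicator_def)
 qed measurable
 have main: "(LINT z|lborel. indicator {..<R} (radius_sq z) * F (wig z) z) \<le> 3 * E^2 * (1 + exp R) + 2 * E * R * (1 + R) + 12 * B"
  by (rule LIMSEQ_le_const2 [OF lim]) (use approx in blast)
 have i1: "integrable lborel (\<lambda>z. indicator {..<R} (radius_sq z) * F (wig z) z)"
  by (rule ball_integrable [OF Fm [OF wig_measurable] Fb [OF wig_abs_le]])
 define k where "k s = indicator {..<R} s * (s * exp (- s) / pi)" for s :: real
 have ke: "(\<lambda>s. indicator {0<..} s *\<^sub>R k s) = (\<lambda>s. (indicator {0<..<R} s *\<^sub>R (s ^ 1 * exp (- s))) / pi)"
  by (auto simp: k_def indicator_def)
 have km: "k \<in> borel_measurable borel" unfolding k_def by measurable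
 have ki: "set_integrable lborel {0<..} k"
  using gam_integrable [of R 1] unfolding set_integrable_def ke by simp
 have kI: "(LINT s:{0<..}|lborel. k s) = gam 1 R / pi"
  unfolding set_lebesgue_integral_def ke gam_def by simp
 have i2: "integrable lborel (\<lambda>z. k (radius_sq z))" "(LINT z|lborel. k (radius_sq z)) = 1 - (1 + R) * exp (- R)"
  using radial_integral [OF km ki] gam_1 [OF R] by (simp_all only: kI) simp
 have pw: "wig z * ln (wig z) \<le> - (wig z * ln pi) + indicator {..<R} (radius_sq z) * F (wig z) z - k (radius_sq z)" for z
 proof (cases "radius_sq z < R")
  case True
  have kz: "k (radius_sq z) = radius_sq z * w0 z" using True by (simp add: k_def w0_def)
  have "wig z * ln (wig z) + wig z * ln pi + wig z * radius_sq z \<le> pi * exp (radius_sq z) * (wig z - w0 z)^2 + (wig z - w0 z)"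
  proof (cases "wig z = 0")
   case z: True
   show ?thesis unfolding z by (simp add: w0_def power2_eq_square exp_minus algebra_simps)
  next
   case False
   then have p: "0 < wig z" using wig_nonneg [of z] by simp
   have w0p: "0 < w0 z" by (simp add: w0_def)
   have "ln (wig z / w0 z) \<le> wig z / w0 z - 1" by (rule ln_le_minus_one) (simp add: p w0p)
   then have "wig z * (ln (wig z) + radius_sq z + ln pi) \<le> wig z * (wig z / w0 z - 1)"
    using p by (simp add: w0_def ln_div ln_mult)
   moreover have "wig z * (wig z / w0 z - 1) = (wig z - w0 z)^2 / w0 z + (wig z - w0 z)" using w0p by (simp add: power2_eq_square field_simps)
   moreover have "(wig z - w0 z)^2 / w0 z = pi * exp (radius_sq z) * (wig z - w0 z)^2"
    by (simp add: w0_def exp_minus field_simps)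
   ultimately show ?thesis by (simp add: algebra_simps)
  qed
  then show ?thesis using True kz by (simp add: F_def algebra_simps)
 next
  case False
  then show ?thesis using wig_ln_nonpos [of z] by (simp add: k_def)
 qed
 have "(LINT z|lborel. wig z * ln (wig z)) \<le> (LINT z|lborel. - (wig z * ln pi) + indicator {..<R} (radius_sq z) * F (wig z) z - k (radius_sq z))"
  by (rule integral_mono [OF wig_ln_integrable _ pw]) (use i1 i2(1) wig_integrable in auto)
 also have "\<dots> = - ln pi + (LINT z|lborel. indicator {..<R} (radius_sq z) * F (wig z) z) - (1 - (1 + R) * exp (- R))"
  using i1 i2 wig_integrable wig_integral by simp
 finally show ?thesis using main unfolding entropy_eq by linarith
qed

end

section \<open>Positivity bounds for the first row\<close>

lemma power_div_fact_le_exp: "0 \<le> x \<Longrightarrow> x ^ d / fact d \<le> exp (x :: real)"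
proof -
 assume x: "0 \<le> x"
 have s: "(\<lambda>n. x ^ n / fact n) sums exp x" using exp_converges [of x] by (simp add: field_simps)
 have "(\<Sum>n\<in>{d}. x ^ n / fact n) \<le> (\<Sum>n. x ^ n / fact n)"
  using x by (intro sum_le_suminf sums_summable [OF s]) auto
 then show ?thesis using sums_unique [OF s] by simp
qed

text \<open>Such points lie far beyond the oscillatory range of the low levels, so that the crude
  bound with \<open>r = 1/20\<close> already decays exponentially.\<close>

lemma lagw_exp_small:
 assumes L: "0 \<le> L" "L \<le> s" and n: "real n \<le> L / 20" and d: "real d \<le> 2 * L / 5 + 1"
 shows "\<bar>lagw n d (2 * s)\<bar> \<le> exp (2 - L / 20)"
proof -
 have s: "0 \<le> s" using L by simp
 have e2: "5 \<le> exp (2::real)"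
 proof -
  have "(5/2 :: real) ^ 2 \<le> exp 1 ^ 2" using exp_lower_Taylor_quadratic [of "1::real"] by simp
  then show ?thesis by (simp add: power2_eq_square exp_add [symmetric])
 qed
 have e4: "20 \<le> exp (4::real)"
 proof -
  have "(5 :: real) * 5 \<le> exp 2 * exp 2" using e2 by (intro mult_mono) auto
  then show ?thesis by (simp add: exp_add [symmetric])
 qed
 \<comment> \<open>Splitting off \<open>5 ^ d\<close> replaces \<open>exp (2 * s)\<close> by
   \<open>exp (2 * s / 5)\<close> at the price of \<open>exp (2 * d)\<close>, affordable because
   \<open>d\<close> is at most about \<open>2 * L / 5\<close>.\<close>
 have "(2 * s) ^ d / fact d = 5 ^ d * ((2 * s / 5) ^ d / fact d)" by (simp add: power_divide)
 also have "\<dots> \<le> exp 2 ^ d * exp (2 * s / 5)"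
  using s e2 by (intro mult_mono power_mono power_div_fact_le_exp) auto
 also have "\<dots> = (exp (real d + s / 5))^2" by (simp add: exp_of_nat_mult [symmetric] exp_add [symmetric])
 finally have "sqrt ((2 * s) ^ d / fact d) \<le> sqrt ((exp (real d + s / 5))^2)" by (rule real_sqrt_le_mono)
 then have sq: "sqrt ((2 * s) ^ d / fact d) \<le> exp (real d + s / 5)" by simp
 have p1: "(1 + 1/20) ^ (n + d) \<le> exp (real (n + d) / 20)"
  using power_mono [OF exp_ge_add_one_self [of "1/20"], of "n + d"] by (simp add: exp_of_nat_mult [symmetric])
 have p2: "1 / (1/20) ^ n \<le> exp (4 * real n)"
  using power_mono [OF e4, of n] by (simp add: exp_of_nat_mult [symmetric] power_divide mult.commute)
 have "\<bar>lagw n d (2 * s)\<bar> \<le> sqrt ((2 * s) ^ d / fact d) * exp (- (2 * s) / 2) * ((1 + 1/20) ^ (n + d) * exp (2 * s * (1/20)) / (1/20) ^ n)"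
  by (rule lagw_crude) (use s in auto)
 also have "\<dots> = sqrt ((2 * s) ^ d / fact d) * exp (- (2 * s) / 2) * ((1 + 1/20) ^ (n + d) * exp (2 * s * (1/20)) * (1 / (1/20) ^ n))" by simp
 also have "\<dots> \<le> exp (real d + s / 5) * exp (- (2 * s) / 2) * (exp (real (n + d) / 20) * exp (2 * s * (1/20)) * exp (4 * real n))"
  by (intro mult_mono sq p1 p2 order_refl) auto
 also have "\<dots> \<le> exp (2 - L / 20)" using L n d by (simp add: exp_add [symmetric] field_simps)
 finally show ?thesis .
qed

text \<open>\<open>G\<close> satisfies \<open>G' = - G - 2 * (exp (- s) * lag n 0 (2 * s))\<close>,
  so a primitive is \<open>- G / 2\<close> minus half a primitive of \<open>G\<close>. Over a window
  of fixed length both parts are controlled by the bound on \<open>lag1\<close>, uniformly in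
  \<open>n\<close>.\<close>

lemma lag_primitive:
 assumes R: "0 < R"
 shows "\<exists>H. (\<forall>s\<in>{R..R+2}. (H has_real_derivative exp (- s) * lag n 0 (2 * s)) (at s)) \<and> \<bar>H (R + 2) - H R\<bar> \<le> 14 / R powr (1/3)"
proof -
 define G where "G s = exp (- s) * lag1 n (2 * s)" for s
 define b where "b = 7 / R powr (1/3)"
 have dG: "(G has_real_derivative - G s - 2 * (exp (- s) * lag n 0 (2 * s))) (at s)" for s
 proof -
  have "((\<lambda>s. lag1 n (2 * s)) has_real_derivative - lag n 0 (2 * s) * 2) (at s)"
   by (rule DERIV_chain2 [OF DERIV_lag1]) (auto intro!: derivative_eq_intros)
  then show ?thesis unfolding G_def by (auto intro!: derivative_eq_intros simp: algebra_simps)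
 qed
 have Gb: "\<bar>G s\<bar> \<le> b" if "R \<le> s" for s
 proof -
  have "\<bar>G s\<bar> \<le> 14 / (pi * (2 * s) powr (1/3))"
   using lag1_bound [of "2 * s" n] that R by (simp add: G_def abs_mult)
  also have "\<dots> \<le> 14 / (2 * R powr (1/3))"
   using that R pi_ge_two by (intro divide_left_mono mult_mono powr_mono2) auto
  finally show ?thesis by (simp add: b_def)
 qed
 have cG: "continuous_on UNIV G" using dG by (intro DERIV_continuous_on) (blast intro: has_field_derivative_at_within)
 \<comment> \<open>Starting at \<open>R / 2\<close> makes \<open>R\<close> an interior point, so
   that the derivative of \<open>I\<close> is two-sided.\<close>
 define I where "I t = integral {R/2..t} G" for t
 have dI: "(I has_real_derivative G s) (at s)" if "s \<in> {R..R+2}" for s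
 proof -
  have "(I has_real_derivative G s) (at s within {R/2..R+3})"
   unfolding I_def by (rule integral_has_real_derivative) (use that R cG in \<open>auto intro: continuous_on_subset\<close>)
  moreover have "at s within {R/2..R+3} = at s" by (rule at_within_interior) (use that R in simp)
  ultimately show ?thesis by (simp only:)
 qed
 define H where "H t = - G t / 2 - I t / 2" for t
 have dH: "(H has_real_derivative exp (- s) * lag n 0 (2 * s)) (at s)" if "s \<in> {R..R+2}" for s
  unfolding H_def using dG [of s] dI [OF that] by (auto intro!: derivative_eq_intros simp: field_simps)
 obtain z where z: "R < z" "z < R + 2" "I (R + 2) - I R = (R + 2 - R) * G z"
  using MVT2 [of R "R + 2" I G] dI by auto
 have "H (R + 2) - H R = - (G (R + 2) - G R) / 2 - G z" using z(3) unfolding H_def by (simp add: field_simps)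
 moreover have "\<bar>G (R + 2)\<bar> \<le> b" "\<bar>G R\<bar> \<le> b" "\<bar>G z\<bar> \<le> b" using Gb z by auto
 ultimately have "\<bar>H (R + 2) - H R\<bar> \<le> 2 * b" by argo
 then show ?thesis using dH by (auto simp: b_def intro!: exI [of _ H])
qed

text \<open>The row-0 term loses a definite factor per unit of \<open>s\<close>, so its difference
  between \<open>s\<close> and \<open>s + 1\<close> remains comparable to its value.\<close>

lemma lagw_0_step:
 assumes s: "0 < s" "2 * real k \<le> s"
 shows "lagw 0 k (2 * (s + 1)) \<le> lagw 0 k (2 * s) / 2"
proof (rule power2_le_imp_le)
 have "(1 + 1 / s) ^ k \<le> exp (1 / s) ^ k" using s by (intro power_mono) auto
 also have "\<dots> \<le> exp (1 / 2)" using s by (simp add: exp_of_nat_mult [symmetric])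
 finally have a: "(1 + 1 / s) ^ k \<le> exp (1 / 2)" .
 have "2 \<le> exp (3/4 :: real)" using exp_lower_Taylor_quadratic [of "3/4::real"] by (simp add: power2_eq_square)
 then have "2 * 2 \<le> exp (3/4 :: real) * exp (3/4)" by (intro mult_mono) auto
 then have e: "exp (- (3/2) :: real) \<le> 1 / 4" by (simp add: exp_add [symmetric] exp_minus field_simps)
 have "(lagw 0 k (2 * (s + 1)))^2 = ((2 * s) ^ k / fact k * exp (- (2 * s))) * ((1 + 1 / s) ^ k * exp (- 2))"
 proof -
  have "2 * (s + 1) = 2 * s * (1 + 1 / s)" using s by (simp add: field_simps)
  then have "(2 * (s + 1)) ^ k = (2 * s) ^ k * (1 + 1 / s) ^ k" by (simp only: power_mult_distrib)
  then show ?thesis using s by (simp add: exp_add [symmetric] lagw_0_sq)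
 qed
 also have "\<dots> \<le> ((2 * s) ^ k / fact k * exp (- (2 * s))) * (exp (1 / 2) * exp (- 2))"
  using a s by (intro mult_left_mono mult_right_mono) auto
 also have "exp (1 / 2) * exp (- 2) = exp (- (3/2) :: real)" by (simp add: exp_add [symmetric])
 also have "((2 * s) ^ k / fact k * exp (- (2 * s))) * exp (- (3/2)) \<le> (lagw 0 k (2 * s) / 2)^2"
  using e s by (simp add: lagw_0_sq field_simps)
 finally show "(lagw 0 k (2 * (s + 1)))^2 \<le> (lagw 0 k (2 * s) / 2)^2" .
qed (use s in \<open>simp add: lagw_def\<close>)

lemma lagw_diff_le:
 assumes n: "1 \<le> n" and R: "0 < R" "R \<le> s"
 shows "\<bar>lagw n d (2 * s) - lagw n d (2 * (s + 1))\<bar> \<le> 32 * sqrt (sqrt (real n * real (n + d))) / R"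
proof -
 obtain m where m: "n = Suc m" using n by (cases n) auto
 define M where "M = 32 * sqrt (sqrt (real n * real (n + d)))"
 have "\<exists>D. (lagw n d has_real_derivative D) (at x) \<and> \<bar>D\<bar> \<le> M / x" if "0 < x" for x
  using lagw_deriv_bound [OF that, of m d] unfolding m M_def by auto
 then obtain D where D: "\<And>x. 0 < x \<Longrightarrow> (lagw n d has_real_derivative D x) (at x)" "\<And>x. 0 < x \<Longrightarrow> \<bar>D x\<bar> \<le> M / x" by metis
 obtain z where z: "2 * s < z" "lagw n d (2 * (s + 1)) - lagw n d (2 * s) = (2 * (s + 1) - 2 * s) * D z"
  using MVT2 [of "2 * s" "2 * (s + 1)" "lagw n d" D] D(1) R by auto
 have "\<bar>D z\<bar> \<le> M / z" using D(2) z R by simp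
 also have "\<dots> \<le> M / (2 * R)" using z R by (intro divide_left_mono) (auto simp: M_def)
 finally show ?thesis using z(2) by (simp add: M_def)
qed

context nonneg_state
begin

text \<open>The contribution of the rows \<open>n \<ge> 1\<close> to the \<open>k\<close>-th
  harmonic, which has to be removed in order to isolate \<open>dm 0 k\<close>.\<close>

definition rest :: "nat \<Rightarrow> nat \<Rightarrow> real \<Rightarrow> complex" where
 "rest K k s = (\<Sum>n\<in>{1..<K - k}. dm n (n + k) * of_real ((-1) ^ n * lagw n k (2 * s)))"

lemma harm_rest: "k < K \<Longrightarrow> harm K k s = dm 0 k * of_real (lagw 0 k (2 * s)) + rest K k s"
 unfolding harm_def rest_def lessThan_atLeast0 by (simp add: sum.atLeast_Suc_lessThan)

lemma dm_le: "cmod (dm n k) \<le> sqrt (pop n) * sqrt (pop k)"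
 using dm_bound [of n k] pop_nonneg by (simp add: real_sqrt_mult [symmetric] real_le_rsqrt)

lemma sqrt_mult_le: "0 \<le> a \<Longrightarrow> 0 \<le> b \<Longrightarrow> sqrt a * sqrt b \<le> (a + b) / 2"
 using arith_geo_mean_sqrt [of a b] by (simp add: real_sqrt_mult)

lemma rest_norm_le:
 assumes s: "0 \<le> s" shows "cmod (rest K k s) \<le> E"
proof -
 have "cmod (rest K k s) \<le> (\<Sum>n\<in>{1..<K - k}. (pop n + pop (n + k)) / 2)"
  unfolding rest_def
 proof (rule order_trans [OF norm_sum sum_mono])
  fix n
  have "cmod (dm n (n + k) * of_real ((-1) ^ n * lagw n k (2 * s))) = cmod (dm n (n + k)) * \<bar>lagw n k (2 * s)\<bar>"
   by (simp add: norm_mult norm_power)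
  also have "\<dots> \<le> cmod (dm n (n + k)) * 1" using lagw_abs_le_1 [of "2 * s" n k] s by (intro mult_left_mono) auto
  also have "\<dots> \<le> (pop n + pop (n + k)) / 2" using dm_le [of n "n + k"] sqrt_mult_le [OF pop_nonneg [of n] pop_nonneg [of "n + k"]] by linarith
  finally show "cmod (dm n (n + k) * of_real ((-1) ^ n * lagw n k (2 * s))) \<le> (pop n + pop (n + k)) / 2" .
 qed
 also have "\<dots> = ((\<Sum>n\<in>{1..<K - k}. pop n) + (\<Sum>n\<in>{1..<K - k}. pop (n + k))) / 2"
  by (simp add: sum_divide_distrib [symmetric] sum.distrib)
 also have "(\<Sum>n\<in>{1..<K - k}. pop (n + k)) = (\<Sum>n\<in>{1 + k..<K - k + k}. pop n)" by (rule sum.shift_bounds_nat_ivl [symmetric])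
 finally show ?thesis using sum_pop_pos_le [of "{1..<K - k}"] sum_pop_pos_le [of "{1 + k..<K - k + k}"] by simp
qed

text \<open>Removes the truncation: \<open>sqrt (eps K)\<close> tends to 0, while \<open>a\<close>
  and \<open>b\<close> do not depend on \<open>K\<close>.\<close>

lemma limit_eps_le:
 assumes "\<And>K. k < K \<Longrightarrow> a \<le> b + c * sqrt (eps K)" shows "a \<le> b"
proof -
 have "(\<lambda>K. b + c * sqrt (eps K)) \<longlonglongrightarrow> b + c * sqrt 0" by (intro tendsto_intros eps_tendsto)
 then have "a \<le> b + c * sqrt 0" by (rule LIMSEQ_le_const) (use assms in \<open>auto intro!: exI [of _ "Suc k"]\<close>)
 then show ?thesis by simp
qed

text \<open>No differencing: \<open>rest\<close> is estimated by its size \<open>E\<close>, and the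
  zeroth harmonic adds \<open>2 * E\<close>. This is weaker than the window bound at
  \<open>s\<close> near \<open>R\<close>, but holds for every positive \<open>k\<close>.\<close>

lemma row_bound_trivial:
 assumes k: "0 < k" and s: "0 \<le> s"
 shows "cmod (dm 0 k) * lagw 0 k (2 * s) \<le> exp (- s) + 3 * E"
proof (rule limit_eps_le [of k _ _ 2])
 fix K assume K: "k < K"
 have "cmod (dm 0 k * of_real (lagw 0 k (2 * s))) \<le> cmod (harm K k s) + cmod (rest K k s)"
  using norm_triangle_ineq4 [of "harm K k s" "rest K k s"] unfolding harm_rest [OF K] by simp
 moreover have "0 \<le> lagw 0 k (2 * s)" using s by (simp add: lagw_def)
 ultimately show "cmod (dm 0 k) * lagw 0 k (2 * s) \<le> exp (- s) + 3 * E + 2 * sqrt (eps K)"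
  using rest_norm_le [OF s, of K k] harm_bound [OF wig_nonneg s k, of K] harm_0_approx [OF _ s, of K] K by (simp add: norm_mult)
qed

end

locale cutoff_state = nonneg_state +
 fixes L R :: real
 assumes L: "10 \<le> L" and E_eq: "E = exp (- L)" and R_eq: "R = L + 4/3 * ln L"
  and L_exp: "exp (2 - L / 20) \<le> L powr (- 4/3)"
begin

lemma R_ge: "L \<le> R" "10 \<le> R" "0 < R"
proof -
 have "0 \<le> ln L" using L by simp
 then show "L \<le> R" "10 \<le> R" "0 < R" using L unfolding R_eq by linarith+
qed

lemma exp_R: "exp (- R) = E * L powr (- 4/3)"
using L unfolding E_eq powr_def by (simp add: R_eq exp_add [symmetric])

text \<open>Two regimes. For \<open>n \<le> L / 20\<close> the Laguerre functions are exponentially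
  small. For larger \<open>n\<close> the derivative bound is a fourth root of
  \<open>n * (n + k)\<close> over \<open>R\<close>, which together with
  \<open>sqrt (pop n) * sqrt (pop (n + k))\<close> forms the geometric mean of \<open>a\<close> and
  \<open>b\<close>; since \<open>n > L / 20\<close>, each of these is at most
  \<open>sqrt (20 / L)\<close> times an energy term. The resulting \<open>L powr (- 3/2)\<close> is
  better than the required \<open>L powr (- 4/3)\<close>.\<close>

lemma rest_diff:
 assumes k: "real k \<le> 2 * L / 5 + 1" and s: "R \<le> s"
 shows "cmod (rest K k s - rest K k (s + 1)) \<le> 160 * exp (- R)"
proof -
 let ?p = "\<lambda>n. real n * pop n + real (n + k) * pop (n + k)"
 let ?d = "\<lambda>n. dm n (n + k) * of_real ((-1) ^ n * lagw n k (2 * s)) - dm n (n + k) * of_real ((-1) ^ n * lagw n k (2 * (s + 1)))"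
 define c where "c = 80 * L powr (- 4/3)"
 have c0: "0 \<le> c" by (simp add: c_def)
 have "cmod (rest K k s - rest K k (s + 1)) \<le> (\<Sum>n\<in>{1..<K - k}. c * ?p n)"
  unfolding rest_def sum_subtractf [symmetric]
 proof (rule order_trans [OF norm_sum sum_mono])
  fix n assume n: "n \<in> {1..<K - k}"
  define \<Delta> where "\<Delta> = \<bar>lagw n k (2 * s) - lagw n k (2 * (s + 1))\<bar>"
  have eq: "cmod (?d n) = cmod (dm n (n + k)) * \<Delta>"
  proof -
   have "?d n
    = dm n (n + k) * of_real ((-1) ^ n * (lagw n k (2 * s) - lagw n k (2 * (s + 1))))" by (simp only: right_diff_distrib of_real_diff)
   then show ?thesis unfolding \<Delta>_def by (simp only: norm_mult norm_of_real abs_mult power_abs) simp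
  qed
  have np: "pop n \<le> real n * pop n" "pop (n + k) \<le> real (n + k) * pop (n + k)"
   using n pop_nonneg mult_right_mono [of 1 "real n" "pop n"] mult_right_mono [of 1 "real (n + k)" "pop (n + k)"] by auto
  have "cmod (dm n (n + k)) * \<Delta> \<le> c * ?p n"
  proof (cases "real n \<le> L / 20")
   case True
   have "\<Delta> \<le> 2 * exp (2 - L / 20)"
    using lagw_exp_small [of L s n k] lagw_exp_small [of L "s + 1" n k] True k s R_ge L unfolding \<Delta>_def by auto
   then have \<Delta>: "\<Delta> \<le> 2 * L powr (- 4/3)" using L_exp by linarith
   have "cmod (dm n (n + k)) * \<Delta> \<le> ((pop n + pop (n + k)) / 2) * (2 * L powr (- 4/3))"
    using dm_le [of n "n + k"] sqrt_mult_le [OF pop_nonneg [of n] pop_nonneg [of "n + k"]] pop_nonneg [of n] pop_nonneg [of "n + k"]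
    by (intro mult_mono \<Delta>) (auto simp: \<Delta>_def)
   also have "\<dots> = L powr (- 4/3) * (pop n + pop (n + k))" by simp
   also have "\<dots> \<le> c * ?p n"
    unfolding c_def using np pop_nonneg [of n] pop_nonneg [of "n + k"] by (intro mult_mono) auto
   finally show ?thesis .
  next
   case False
   define a b where "a = sqrt (real n) * pop n" and "b = sqrt (real (n + k)) * pop (n + k)"
   have ab: "0 \<le> a" "0 \<le> b" using pop_nonneg by (auto simp: a_def b_def)
   have rt: "(L / 20) powr (1/2) * a \<le> real n * pop n" "(L / 20) powr (1/2) * b \<le> real (n + k) * pop (n + k)"
   proof -
    have r: "(L / 20) powr (1/2) * (sqrt (real m) * pop m) \<le> real m * pop m" if "L / 20 \<le> real m" for m
    proof -
     have "(L / 20) powr (1/2) \<le> sqrt (real m)" using that L by (simp add: powr_half_sqrt)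
     then have "(L / 20) powr (1/2) * (sqrt (real m) * pop m) \<le> sqrt (real m) * (sqrt (real m) * pop m)"
      using pop_nonneg by (intro mult_right_mono) auto
     then show ?thesis by (simp add: mult.assoc [symmetric])
    qed
    show "(L / 20) powr (1/2) * a \<le> real n * pop n" "(L / 20) powr (1/2) * b \<le> real (n + k) * pop (n + k)"
     using r [of n] r [of "n + k"] False by (auto simp: a_def b_def)
   qed
   have "cmod (dm n (n + k)) * \<Delta> \<le> (sqrt (pop n) * sqrt (pop (n + k))) * (32 * sqrt (sqrt (real n * real (n + k))) / R)"
    unfolding \<Delta>_def using n R_ge s by (intro mult_mono dm_le lagw_diff_le) (auto simp: pop_nonneg)
   also have "\<dots> = 32 / R * (sqrt a * sqrt b)"
    by (simp add: a_def b_def real_sqrt_mult mult_ac)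
   also have "\<dots> \<le> 32 / R * ((a + b) / 2)" using R_ge ab by (intro mult_left_mono sqrt_mult_le) auto
   also have "\<dots> = 16 / R * (a + b)" using R_ge by (simp add: field_simps)
   also have "\<dots> \<le> 16 / L * (a + b)" using R_ge L ab by (intro mult_right_mono divide_left_mono) auto
   also have "\<dots> \<le> 16 / L * (?p n / (L / 20) powr (1/2))"
   proof (rule mult_left_mono)
    have "(L / 20) powr (1/2) * (a + b) \<le> ?p n" using rt by (simp add: distrib_left)
    then show "a + b \<le> ?p n / (L / 20) powr (1/2)"
     using L by (simp add: pos_le_divide_eq mult.commute)
   qed (use L in simp)
   also have "\<dots> = 16 / (L * (L / 20) powr (1/2)) * ?p n" by simp
   also have "\<dots> \<le> c * ?p n"
   proof (rule mult_right_mono)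
    have "16 / (L * (L / 20) powr (1/2)) = 16 * sqrt 20 / L powr (3/2)"
     using L by (simp add: powr_half_sqrt real_sqrt_divide powr_add [of L 1 "1/2", simplified])
    also have "\<dots> = 16 * sqrt 20 * L powr (- 3/2)" by (simp add: powr_minus_divide)
    also have "\<dots> \<le> 16 * 5 * L powr (- 4/3)"
     using L by (intro mult_mono powr_mono real_le_lsqrt) auto
    finally show "16 / (L * (L / 20) powr (1/2)) \<le> c" by (simp add: c_def)
   qed (use pop_nonneg in auto)
   finally show ?thesis .
  qed
  then show "cmod (?d n)
   \<le> c * ?p n" unfolding eq .
 qed
 also have "\<dots> = c * ((\<Sum>n\<in>{1..<K - k}. real n * pop n) + (\<Sum>n\<in>{1..<K - k}. real (n + k) * pop (n + k)))"
  by (simp only: sum_distrib_left [symmetric] sum.distrib)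
 also have "(\<Sum>n\<in>{1..<K - k}. real (n + k) * pop (n + k)) = (\<Sum>n\<in>{1 + k..<K - k + k}. real n * pop n)"
  by (rule sum.shift_bounds_nat_ivl [symmetric])
 also have "c * ((\<Sum>n\<in>{1..<K - k}. real n * pop n) + (\<Sum>n\<in>{1 + k..<K - k + k}. real n * pop n)) \<le> c * (E + E)"
  by (intro mult_left_mono add_mono energy_sum' c0) auto
 also have "\<dots> = 160 * exp (- R)" unfolding exp_R c_def by simp
 finally show ?thesis .
qed

text \<open>With \<open>F\<close> a primitive of the zeroth harmonic, the mean value theorem for
  \<open>F s + F (s + 1)\<close> finds one \<open>s\<close> where the sum over the pair equals the
  integral over the window of length 2. One \<open>s\<close> must serve both points, since the
  higher harmonics are differenced between them. The vacuum contributes 1 to the constant, the other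
  levels \<open>280 = 14 * 20\<close>.\<close>

lemma harm_0_window:
 assumes K: "1 \<le> K"
 shows "\<exists>s\<in>{R..R+1}. Re (harm K 0 s) + Re (harm K 0 (s + 1)) \<le> 281 * exp (- R)"
proof -
 obtain H where H: "\<And>n s. s \<in> {R..R+2} \<Longrightarrow> (H n has_real_derivative exp (- s) * lag n 0 (2 * s)) (at s)"
   "\<And>n. \<bar>H n (R + 2) - H n R\<bar> \<le> 14 / R powr (1/3)"
  using lag_primitive [OF R_ge(3)] by metis
 define F where "F s = (\<Sum>n<K. pop n * ((-1) ^ n * H n s))" for s
 have dF: "(F has_real_derivative Re (harm K 0 s)) (at s)" if "s \<in> {R..R+2}" for s
  unfolding F_def harm_0_eq Re_complex_of_real
  using H(1) [OF that] by (auto intro!: derivative_eq_intros sum.cong simp: lagw_def)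
 have sh: "((\<lambda>s. F (s + 1)) has_real_derivative Re (harm K 0 (s + 1))) (at s)" if "s \<in> {R..R+1}" for s
  using dF [of "s + 1"] that by (intro iffD1 [OF DERIV_shift]) auto
 have "((\<lambda>s. F s + F (s + 1)) has_real_derivative Re (harm K 0 s) + Re (harm K 0 (s + 1))) (at s)" if "s \<in> {R..R+1}" for s
  using that by (intro DERIV_add dF sh) auto
 then obtain s where s: "R < s" "s < R + 1" "F (R + 1) + F (R + 1 + 1) - (F R + F (R + 1)) = (R + 1 - R) * (Re (harm K 0 s) + Re (harm K 0 (s + 1)))"
  using MVT2 [of R "R + 1" "\<lambda>s. F s + F (s + 1)" "\<lambda>s. Re (harm K 0 s) + Re (harm K 0 (s + 1))"] by auto
 then have "Re (harm K 0 s) + Re (harm K 0 (s + 1)) = F (R + 2) - F R" by (simp add: add.assoc)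
 also have "\<dots> = pop 0 * (H 0 (R + 2) - H 0 R) + (\<Sum>n\<in>{1..<K}. pop n * ((-1) ^ n * (H n (R + 2) - H n R)))"
  using K unfolding F_def sum_subtractf [symmetric] lessThan_atLeast0 by (simp add: algebra_simps sum.atLeast_Suc_lessThan)
 also have "\<dots> \<le> 1 * exp (- R) + (\<Sum>n\<in>{1..<K}. 280 * L powr (- 4/3) * (real n * pop n))"
 proof (intro add_mono sum_mono)
  have "H 0 (R + 2) - H 0 R \<le> exp (- R)"
  proof -
   obtain z where z: "H 0 (R + 2) + exp (- (R + 2)) - (H 0 R + exp (- R)) = (R + 2 - R) * (exp (- z) * lag 0 0 (2 * z) - exp (- z))"
    using MVT2 [of R "R + 2" "\<lambda>s. H 0 s + exp (- s)" "\<lambda>s. exp (- s) * lag 0 0 (2 * s) - exp (- s)"] H(1) [of _ 0]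
    by (force intro!: derivative_eq_intros)
   then have "H 0 (R + 2) - H 0 R = exp (- R) - exp (- (R + 2))" by simp
   then show ?thesis by simp
  qed
  then show "pop 0 * (H 0 (R + 2) - H 0 R) \<le> 1 * exp (- R)"
   using sum_pop_le [of "{0}"] by (intro order_trans [OF mult_left_mono [OF _ pop_nonneg] mult_right_mono], auto)
  fix n assume n: "n \<in> {1..<K}"
  have "\<bar>H n (R + 2) - H n R\<bar> \<le> 280 * L powr (- 4/3) * real n"
  proof (cases "real n \<le> L / 20")
   case True
   obtain z where z: "R < z" "z < R + 2" "H n (R + 2) - H n R = (R + 2 - R) * (exp (- z) * lag n 0 (2 * z))"
    using MVT2 [of R "R + 2" "H n" "\<lambda>s. exp (- s) * lag n 0 (2 * s)"] H(1) by auto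
   have "\<bar>H n (R + 2) - H n R\<bar> \<le> 2 * exp (2 - L / 20)"
    using lagw_exp_small [of L z n 0] z True R_ge L by (simp add: lagw_def)
   also have "\<dots> \<le> 280 * L powr (- 4/3) * real n"
    using L_exp n mult_mono [of 2 "280 * real n" "L powr (- 4/3)" "L powr (- 4/3)"] by simp
   finally show ?thesis .
  next
   case False
   have "\<bar>H n (R + 2) - H n R\<bar> \<le> 14 / R powr (1/3)" by (rule H(2))
   also have "\<dots> \<le> 14 / L powr (1/3)" using R_ge L by (intro divide_left_mono powr_mono2) auto
   also have "\<dots> \<le> 280 * (1 / (L powr (1/3) * L powr 1)) * real n" using False L by (simp add: field_simps)
   also have "L powr (1/3) * L powr 1 = L powr (4/3)" using L powr_add [of L "1/3" 1] by simp
   also have "1 / L powr (4/3) = L powr (- 4/3)" by (simp add: powr_minus_divide)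
   finally show ?thesis .
  qed
  then have "\<bar>(-1) ^ n * (H n (R + 2) - H n R)\<bar> \<le> 280 * L powr (- 4/3) * real n" by (simp add: abs_mult)
  then have "(-1) ^ n * (H n (R + 2) - H n R) \<le> 280 * L powr (- 4/3) * real n" by linarith
  from mult_left_mono [OF this pop_nonneg [of n]] show "pop n * ((-1) ^ n * (H n (R + 2) - H n R)) \<le> 280 * L powr (- 4/3) * (real n * pop n)"
   by (simp add: mult_ac)
 qed
 also have "\<dots> \<le> 1 * exp (- R) + 280 * L powr (- 4/3) * E"
  unfolding sum_distrib_left [symmetric] by (intro add_left_mono mult_left_mono energy_sum') auto
 also have "\<dots> = 281 * exp (- R)" unfolding exp_R by simp
 finally show ?thesis using s by auto
qed

lemma lagw_0_ge:
 assumes "s \<in> {R..R+1}" shows "sqrt ((2 * R) ^ k / fact k) * exp (- (R + 1)) \<le> lagw 0 k (2 * s)"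
proof (rule power2_le_imp_le)
 have "(sqrt ((2 * R) ^ k / fact k) * exp (- (R + 1)))^2 \<le> (2 * s) ^ k / fact k * exp (- (2 * s))"
  using R_ge assms by ((simp add: power_mult_distrib, simp add: power2_eq_square exp_add [symmetric]), (intro mult_mono divide_right_mono power_mono, auto))
 also have "\<dots> = (lagw 0 k (2 * s))^2" using assms R_ge by (subst lagw_0_sq) auto
 finally show "(sqrt ((2 * R) ^ k / fact k) * exp (- (R + 1)))^2 \<le> (lagw 0 k (2 * s))^2" .
qed (use assms R_ge in \<open>simp add: lagw_def\<close>)

text \<open>At the pair of points of \<open>harm_0_window\<close> both \<open>k\<close>-th harmonics
  are dominated by the zeroth ones, and \<open>rest_diff\<close> removes the other rows:
  \<open>281 + 160 = 441\<close>. By \<open>lagw_0_step\<close> the difference of the row-0 term is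
  at least half its value, which doubles the constant.\<close>

lemma row_bound_window:
 assumes k: "0 < k" "real k \<le> 2 * L / 5 + 1"
 shows "(cmod (dm 0 k))^2 * ((2 * R) ^ k / fact k) \<le> 2400^2 * 2"
proof -
 have "cmod (dm 0 k) * (sqrt ((2 * R) ^ k / fact k) * exp (- (R + 1))) \<le> 882 * exp (- R)"
 proof (rule limit_eps_le [of k _ _ 8])
  fix K assume K: "k < K"
  then have K1: "1 \<le> K" by simp
  obtain s where s: "s \<in> {R..R+1}" "Re (harm K 0 s) + Re (harm K 0 (s + 1)) \<le> 281 * exp (- R)"
   using harm_0_window [OF K1] by blast
  have s0: "0 \<le> s" "0 \<le> s + 1" "0 < s" using s R_ge by auto
  have lw: "lagw 0 k (2 * (s + 1)) \<le> lagw 0 k (2 * s) / 2"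
   by (rule lagw_0_step) (use s k L R_ge in auto)
  have eq: "dm 0 k * of_real (lagw 0 k (2 * s) - lagw 0 k (2 * (s + 1))) = (harm K k s - harm K k (s + 1)) - (rest K k s - rest K k (s + 1))"
   unfolding harm_rest [OF K] by (simp only: of_real_diff) (simp only: algebra_simps)
  have "cmod (dm 0 k * of_real (lagw 0 k (2 * s) - lagw 0 k (2 * (s + 1)))) \<le> cmod (harm K k s) + cmod (harm K k (s + 1)) + cmod (rest K k s - rest K k (s + 1))"
   unfolding eq using norm_triangle_ineq4 [of "harm K k s - harm K k (s + 1)" "rest K k s - rest K k (s + 1)"] norm_triangle_ineq4 [of "harm K k s" "harm K k (s + 1)"] by linarith
  also have "\<dots> \<le> 441 * exp (- R) + 4 * sqrt (eps K)"
   using harm_bound [OF wig_nonneg s0(1) k(1), of K] harm_bound [OF wig_nonneg s0(2) k(1), of K] s(2) rest_diff [OF k(2), of s K] s(1) by auto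
  finally have b: "cmod (dm 0 k) * \<bar>lagw 0 k (2 * s) - lagw 0 k (2 * (s + 1))\<bar> \<le> 441 * exp (- R) + 4 * sqrt (eps K)"
   by (simp only: norm_mult norm_of_real)
  have "sqrt ((2 * R) ^ k / fact k) * exp (- (R + 1)) \<le> 2 * \<bar>lagw 0 k (2 * s) - lagw 0 k (2 * (s + 1))\<bar>"
   using lagw_0_ge [OF s(1), of k] lw by argo
  then have "cmod (dm 0 k) * (sqrt ((2 * R) ^ k / fact k) * exp (- (R + 1))) \<le> cmod (dm 0 k) * (2 * \<bar>lagw 0 k (2 * s) - lagw 0 k (2 * (s + 1))\<bar>)"
   by (rule mult_left_mono) simp
  then show "cmod (dm 0 k) * (sqrt ((2 * R) ^ k / fact k) * exp (- (R + 1))) \<le> 882 * exp (- R) + 8 * sqrt (eps K)"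
   using b by linarith
 qed
 then have "(cmod (dm 0 k) * sqrt ((2 * R) ^ k / fact k)) * exp (- (R + 1)) \<le> (882 * exp 1) * exp (- (R + 1))"
  by (simp add: exp_add [symmetric] mult.assoc)
 then have "cmod (dm 0 k) * sqrt ((2 * R) ^ k / fact k) \<le> 882 * exp 1" by simp
 also have "\<dots> \<le> 882 * 3" using exp_le by simp
 finally have "(cmod (dm 0 k) * sqrt ((2 * R) ^ k / fact k))^2 \<le> (882 * 3)^2"
  using R_ge by (intro power_mono mult_nonneg_nonneg) auto
 then show ?thesis using R_ge by (simp add: power_mult_distrib)
qed

lemma row_bound_all:
 assumes k: "0 < k"
 shows "(cmod (dm 0 k))^2 * ((2 * (R + 1)) ^ k / fact k) \<le> 100 * L ^ 3"
proof -
 \<comment> \<open>Evaluated at \<open>R + 1\<close> instead of \<open>R\<close>, so that the ratio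
   of \<open>R\<close> to \<open>R + 1\<close> provides geometric decay in
   \<open>row_sum_bound\<close>.\<close>
 define s where "s = R + 1"
 have s: "0 \<le> s" using R_ge by (simp add: s_def)
 have "cmod (dm 0 k) * lagw 0 k (2 * s) \<le> exp (- s) + 3 * E" by (rule row_bound_trivial [OF k s])
 also have "\<dots> = (1 + 3 * exp 1 * L powr (4/3)) * exp (- s)"
 proof -
  have "E = exp (- R) * L powr (4/3)" using L unfolding exp_R by (simp add: powr_add [symmetric])
  also have "exp (- R) = exp 1 * exp (- s)" by (simp add: s_def exp_add [symmetric])
  finally show ?thesis by (simp add: algebra_simps)
 qed
 also have "\<dots> \<le> (10 * L powr (3/2)) * exp (- s)"
 proof (rule mult_right_mono)
  have "L powr (4/3) \<le> L powr (3/2)" "1 \<le> L powr (3/2)" using L by (auto intro: powr_mono ge_one_powr_ge_zero)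
  then have "3 * exp 1 * L powr (4/3) \<le> 9 * L powr (3/2)" using exp_le by (intro mult_mono) auto
  then show "1 + 3 * exp 1 * L powr (4/3) \<le> 10 * L powr (3/2)" using \<open>1 \<le> L powr (3/2)\<close> by linarith
 qed simp
 finally have "(cmod (dm 0 k) * lagw 0 k (2 * s))^2 \<le> ((10 * L powr (3/2)) * exp (- s))^2"
  using s by (intro power_mono mult_nonneg_nonneg) (auto simp: lagw_def)
 moreover have "((10 * L powr (3/2)) * exp (- s))^2 = 100 * L ^ 3 * exp (- (2 * s))"
 proof -
  have "(L powr (3/2))^2 = L powr (3/2 + 3/2)" unfolding power2_eq_square by (rule powr_add [symmetric])
  also have "\<dots> = L ^ 3" using L by simp
  finally have "(L powr (3/2))^2 = L ^ 3" .
  then show ?thesis by (simp add: power2_eq_square exp_add [symmetric] algebra_simps)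
 qed
 ultimately show ?thesis using s unfolding s_def by (simp add: lagw_0_sq field_simps)
qed

end

section \<open>Asymptotics\<close>

lemma exponent_bounds: "5/3 < b_star" "b_star < 2" "0 < c_star" "c_star < 1" "0 < r_star"
proof -
 have r: "1/3 < r_star" "r_star < 3/8" using r_star by auto
 show r0: "0 < r_star" using r by simp
 show b: "5/3 < b_star" "b_star < 2" using r r0 by (auto simp: field_simps b_star_eq)
 show "0 < c_star" "c_star < 1" using r b by (auto simp: c_star_def)
qed

lemma c_star_b_star: "b_star * c_star = 3/2 - 4 * r_star / 3"
 using exponent_bounds by (simp add: c_star_def)

lemma r_star_b_star: "r_star * (b_star + 1) = 1"
 using exponent_bounds by (simp add: b_star_eq)

text \<open>The rate of the theorem in terms of \<open>L = ln (1 / E)\<close>; the factors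
  \<open>gamma_exp\<close> and \<open>beta_exp\<close> are resolved in
  \<open>target_eq\<close>.\<close>

definition target :: "real \<Rightarrow> real" where
 "target L = exp (- L) * 2 powr (r_star * L + c_star * ln L) / L"

lemma target_eq:
 assumes L: "0 < L" shows "exp (- L) powr gamma_exp / ln (1 / exp (- L)) powr beta_exp = target L"
proof -
 have l: "ln (1 / exp (- L)) = L" by (simp add: ln_div)
 have "exp (- L) powr gamma_exp / L powr beta_exp = exp (- L * gamma_exp) * exp (- (beta_exp * ln L))"
  using L by (simp add: powr_def exp_minus divide_inverse mult_ac del: exp_minus) (simp add: exp_minus)
 also have "\<dots> = exp (- L + ln 2 * (r_star * L + c_star * ln L) - ln L)"
  by (simp add: exp_add [symmetric] gamma_exp_def beta_exp_def algebra_simps)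
 also have "\<dots> = target L" using L by ((simp only: exp_add exp_diff), (simp add: target_def powr_def mult.commute))
 finally show ?thesis unfolding l .
qed

text \<open>In this order: exponential smallness of the low levels; \<open>R \<le> 2 * L\<close> and
  the upper bound on \<open>n\<close>; the second-order error in \<open>stirling_balance\<close>;
  the far tail in \<open>row_sum_bound\<close>; dominance of the target over \<open>E\<close> times
  powers of \<open>L\<close>.\<close>

definition large :: "real \<Rightarrow> bool" where
 "large L \<longleftrightarrow> 10 \<le> L \<and> exp (2 - L / 20) \<le> L powr (- 4/3) \<and> ln L + 1 \<le> L / 100 \<and> (2 * ln L + 1)\<^sup>2 \<le> L / 4 \<and>
   100 * L ^ 3 * (2 * L + 1) * (1/2) powr (3 * L / 200) \<le> 1 \<and> 20 * L ^ 3 \<le> 2 powr (L / 3) / L"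

lemma eventually_large: "eventually large at_top"
 unfolding large_def
proof (intro eventually_conj)
 show "\<forall>\<^sub>F L::real in at_top. 10 \<le> L" by simp
 show "\<forall>\<^sub>F L::real in at_top. exp (2 - L / 20) \<le> L powr (- 4/3)" by real_asymp
 show "\<forall>\<^sub>F L::real in at_top. ln L + 1 \<le> L / 100" by real_asymp
 show "\<forall>\<^sub>F L::real in at_top. (2 * ln L + 1)^2 \<le> L / 4" by real_asymp
 show "\<forall>\<^sub>F L::real in at_top. 100 * L ^ 3 * (2 * L + 1) * (1/2) powr (3 * L / 200) \<le> 1" by real_asymp
 show "\<forall>\<^sub>F L::real in at_top. 20 * L ^ 3 \<le> 2 powr (L / 3) / L" by real_asymp
qed

text \<open>Both halves of the theorem use the same \<open>n\<close>; the tolerance 1 absorbs the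
  rounding of the balance point.\<close>

locale scale =
 fixes L R :: real and n :: nat
 assumes large: "large L" and R_def: "R = L + 4/3 * ln L" and n_near: "\<bar>real n - (r_star * L + c_star * ln L)\<bar> \<le> 1"
begin

lemma L_ge: "10 \<le> L" and ln_L: "1 \<le> ln L" "ln L + 1 \<le> L / 100"
proof -
 show L: "10 \<le> L" "ln L + 1 \<le> L / 100" using large by (auto simp: large_def)
 show "1 \<le> ln L" using L exp_le by (simp add: ln_ge_iff)
qed

lemma R_bounds: "L \<le> R" "R \<le> 2 * L" "0 < R"
 using L_ge ln_L unfolding R_def by linarith+

lemma n_bounds: "L / 4 \<le> real n" "real n \<le> 77 * L / 200" "1 \<le> n"
proof -
 have r: "1/3 * L \<le> r_star * L" "r_star * L \<le> 3/8 * L" using r_star L_ge by auto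
 have c: "0 \<le> c_star * ln L" "c_star * ln L \<le> 1 * ln L" using exponent_bounds ln_L by auto
 show "L / 4 \<le> real n" "real n \<le> 77 * L / 200" using r c n_near ln_L L_ge by linarith+
 then show "1 \<le> n" using L_ge by linarith
qed

text \<open>\<open>Q\<close> is the logarithm of \<open>n * n! * exp L / (2 * R) ^ n\<close>. After
  Stirling's formula the terms of order \<open>L\<close> and \<open>ln L\<close> cancel by
  \<open>r_star_b_star\<close> and \<open>c_star_b_star\<close>. What is left is bounded: at most 1
  from Stirling, 3 from \<open>ln N - ln L\<close>, 2 from rounding and 1 from the quadratic error
  in \<open>ln t\<close>.\<close>

lemma stirling_balance:
 "exp (- 8) * ((2 * R) ^ n * exp (- L)) \<le> real n * fact n" "real n * fact n \<le> exp 8 * ((2 * R) ^ n * exp (- L))"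
proof -
 define d where "d = real n - (r_star * L + c_star * ln L)"
 have d: "\<bar>d\<bar> \<le> 1" using n_near by (simp add: d_def)
 have n0: "0 < real n" using n_bounds by simp
 define N where "N = real n"
 define Q where "Q = ln N + ln (fact n) - N * ln (2 * R) + L"
 \<comment> \<open>\<open>N\<close> is compared with \<open>r_star * R\<close> rather than
   \<open>r_star * L\<close>: since \<open>b_star = ln (2 / r_star)\<close>, this gives
   \<open>ln N - ln (2 * R) = ln t - b_star\<close> exactly.\<close>
 define t where "t = N / (r_star * R)"
 have rR: "0 < r_star * R" using exponent_bounds R_bounds by simp
 have t0: "0 < t" using n0 rR by (simp add: t_def N_def)
 have lnt: "ln t = ln N - ln (2 * R) + b_star"
  using n0 R_bounds exponent_bounds by (simp add: t_def N_def ln_div ln_mult b_star_def)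
 define e where "e = ln (fact n) + N - (N + 1/2) * ln N"
 define g where "g = N - r_star * R"
 have g: "g = (c_star - 4/3 * r_star) * ln L + d" by (simp add: g_def N_def d_def R_def algebra_simps)
 have Q: "Q = e + 3/2 * ln N - N - N * b_star + L + N * ln t"
  unfolding Q_def e_def lnt by (simp add: algebra_simps)
 have lo: "g \<le> N * ln t"
 proof -
  have "ln (1 / t) \<le> 1 / t - 1" using t0 by (intro ln_le_minus_one) simp
  then have "N * (1 - 1 / t) \<le> N * ln t" using t0 n0 by (simp add: ln_div N_def)
  moreover have "N * (1 - 1 / t) = g" using n0 rR by (simp add: t_def g_def N_def field_simps)
  ultimately show ?thesis by simp
 qed
 have hi: "N * ln t \<le> g + 1"
 proof -
  have "N * ln t \<le> N * (t - 1)" using ln_le_minus_one [OF t0] by (intro mult_left_mono, auto simp: N_def)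
  also have "\<dots> = g + g^2 / (r_star * R)"
   using exponent_bounds(5) R_bounds(3) by (simp add: g_def t_def field_simps power2_eq_square)
  also have "g^2 / (r_star * R) \<le> 1"
  proof -
   have "\<bar>(c_star - 4/3 * r_star) * ln L\<bar> \<le> 2 * ln L" using exponent_bounds r_star ln_L by (simp add: abs_mult)
   then have "\<bar>g\<bar> \<le> 2 * ln L + 1" using d unfolding g by linarith
   then have "g^2 \<le> (2 * ln L + 1)^2" by (metis abs_ge_zero power2_abs power_mono)
   also have "\<dots> \<le> r_star * R"
    using large r_star R_bounds L_ge mult_mono [of "1/4" r_star L R] by (simp add: large_def)
   finally show ?thesis using rR by simp
  qed
  finally show ?thesis by simp
 qed
 have key: "3/2 * ln N - N - N * b_star + L + g = 3/2 * (ln N - ln L) - b_star * d"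
 proof -
  have N: "N = r_star * L + c_star * ln L + d" by (simp add: N_def d_def)
  have "3/2 * ln N - N - N * b_star + L + g = 3/2 * ln N - b_star * N + L - r_star * R" by (simp add: g_def)
  also have "\<dots> = 3/2 * ln N + L * (1 - r_star * (b_star + 1)) - (b_star * c_star + 4/3 * r_star) * ln L - b_star * d"
   unfolding N R_def by (simp add: algebra_simps)
  also have "\<dots> = 3/2 * (ln N - ln L) - b_star * d" unfolding r_star_b_star c_star_b_star by simp
  finally show ?thesis .
 qed
 have nL: "- 2 \<le> ln N - ln L" "ln N - ln L \<le> 0"
 proof -
  show "ln N - ln L \<le> 0" using n_bounds n0 by (simp add: N_def)
  have "(2::real) * 2 \<le> exp 1 * exp 1" using exp_ge_add_one_self [of "1::real"] by (intro mult_mono) auto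
  then have "4 \<le> exp (2::real)" by (simp add: exp_add [symmetric])
  then have "ln 4 \<le> ln (exp (2::real))" by (subst ln_le_cancel_iff) auto
  then have "ln 4 \<le> (2::real)" by simp
  moreover have "ln (L / 4) \<le> ln N" using n_bounds by (simp add: N_def)
  ultimately show "- 2 \<le> ln N - ln L" using L_ge by (simp add: ln_div)
 qed
 have bd: "\<bar>b_star * d\<bar> \<le> 2" unfolding abs_mult using exponent_bounds d mult_mono [of "\<bar>b_star\<bar>" 2 "\<bar>d\<bar>" 1] by simp
 have Qe: "Q = e + (3/2 * (ln N - ln L) - b_star * d) - g + N * ln t" unfolding Q key [symmetric] by simp
 have Qb: "- 8 \<le> Q" "Q \<le> 8"
  using lo hi nL abs_le_D1 [OF bd] abs_le_D2 [OF bd] ln_fact_bounds [of n] n_bounds(3) unfolding Qe by ((auto simp: e_def N_def), argo+)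
 have eq: "real n * fact n = exp Q * ((2 * R) ^ n * exp (- L))"
 proof -
  have "(2 * R) ^ n = exp (N * ln (2 * R))" using R_bounds by (simp add: N_def exp_of_nat_mult)
  then show ?thesis using n0 by (simp add: Q_def exp_add [symmetric] exp_add N_def algebra_simps)
 qed
 show "exp (- 8) * ((2 * R) ^ n * exp (- L)) \<le> real n * fact n" "real n * fact n \<le> exp 8 * ((2 * R) ^ n * exp (- L))"
  using Qb R_bounds unfolding eq by auto
qed

lemma target_bounds:
 "target L \<le> 2 * (exp (- L) * 2 ^ n / real n)" "exp (- L) * 2 ^ n / real n \<le> 8 * target L"
proof -
 define x where "x = r_star * L + c_star * ln L"
 have p: "(2::real) ^ n = 2 powr real n" by (simp add: powr_realpow)
 have l: "2 powr x / 2 \<le> 2 ^ n"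
 proof -
  have "2 powr x / 2 = 2 powr (x - 1)" by (simp add: powr_diff)
  also have "\<dots> \<le> 2 powr real n" using n_near by (intro powr_mono) (auto simp: x_def)
  finally show ?thesis by (simp add: p)
 qed
 have u: "2 ^ n \<le> 2 * 2 powr x"
 proof -
  have "2 powr real n \<le> 2 powr (x + 1)" using n_near by (intro powr_mono) (auto simp: x_def)
  then show ?thesis by (simp add: p powr_add)
 qed
 have "target L = exp (- L) * 2 powr x / L" by (simp add: target_def x_def)
 also have "\<dots> \<le> exp (- L) * (2 * 2 ^ n) / real n" using l n_bounds by (intro frac_le mult_left_mono, auto)
 finally show "target L \<le> 2 * (exp (- L) * 2 ^ n / real n)" by (simp add: mult_ac)
 have "exp (- L) * 2 ^ n / real n \<le> exp (- L) * (2 * 2 powr x) / (L / 4)"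
  using u n_bounds by (intro frac_le mult_left_mono, auto)
 also have "\<dots> = 8 * target L" by (simp add: target_def x_def)
 finally show "exp (- L) * 2 ^ n / real n \<le> 8 * target L" .
qed

lemma target_large: "exp (- L) * (20 * L ^ 3) \<le> target L"
proof -
 have "1/3 * L \<le> r_star * L" using r_star L_ge by simp
 moreover have "0 \<le> c_star * ln L" using exponent_bounds ln_L by simp
 ultimately have "2 powr (L / 3) \<le> 2 powr (r_star * L + c_star * ln L)" by simp
 then have "2 powr (L / 3) / L \<le> 2 powr (r_star * L + c_star * ln L) / L" using L_ge by (intro divide_right_mono) auto
 then have "20 * L ^ 3 \<le> 2 powr (r_star * L + c_star * ln L) / L" using large by (simp add: large_def)
 from mult_left_mono [OF this, of "exp (- L)"] show ?thesis by (simp add: target_def)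
qed

end

text \<open>Lets the energy bound for every \<open>k\<close> below \<open>n\<close> be charged at
  \<open>n\<close>, because \<open>2 ^ k / k\<close> does not decrease.\<close>

lemma two_power_le: "1 \<le> k \<Longrightarrow> k \<le> n \<Longrightarrow> real n * 2 ^ k \<le> real k * 2 ^ n"
proof -
 assume k: "1 \<le> k" "k \<le> n"
 define j where "j = n - k"
 have n: "n = k + j" using k by (simp add: j_def)
 have "real j + 1 \<le> 2 ^ j"
  by (metis less_eq_real_def add.commute of_nat_Suc of_nat_less_iff of_nat_numeral of_nat_power Suc_leI less_exp of_nat_le_iff)
 have "real n \<le> real k * (real j + 1)" using k by (simp add: n algebra_simps mult_left_mono [of 1 "real k" "real j", simplified])
 also have "\<dots> \<le> real k * 2 ^ j" using \<open>real j + 1 \<le> 2 ^ j\<close> by (rule mult_left_mono) simp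
 finally show ?thesis by (simp add: n power_add)
qed

section \<open>Upper bound: summing the row and collecting the error terms\<close>

locale scaled_state = cutoff_state \<rho> E L R + scale L R n for \<rho> E L R n
begin

lemma fact_ratio_decay:
 "real (n + j) \<le> R / 2 \<Longrightarrow> fact (n + j) / R ^ (n + j) \<le> fact n / R ^ n * (1/2) ^ j"
proof (induction j)
 case (Suc j)
 have "fact (n + Suc j) / R ^ (n + Suc j) = (fact (n + j) / R ^ (n + j)) * (real (n + Suc j) / R)" by (simp add: field_simps)
 also have "\<dots> \<le> (fact n / R ^ n * (1/2) ^ j) * (1 / 2)"
  using Suc by (intro mult_mono Suc.IH, auto simp: field_simps)
 finally show ?case by simp
qed simp

lemma fact_ratio_le: "fact n / R ^ n \<le> exp 8 * (E * 2 ^ n / real n)"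
proof -
 have "fact n / R ^ n = 2 ^ n / real n * (real n * fact n / (2 * R) ^ n)" using n_bounds by simp
 also have "\<dots> \<le> 2 ^ n / real n * (exp 8 * E)"
  using stirling_balance(2) R_ge by (intro mult_left_mono) (auto simp: E_eq field_simps)
 finally show ?thesis by (simp add: mult_ac)
qed

text \<open>Three ranges. Below \<open>n\<close> the energy constraint is used and is worst at
  \<open>n\<close>. From \<open>n\<close> to \<open>k0\<close> the window bound gives
  \<open>n! / R ^ n\<close> with geometric decay, as \<open>k \<le> R / 2\<close>. From
  \<open>k0\<close> on only the crude bound is available; its loss of powers of \<open>L\<close> is
  paid for by the decay accumulated between \<open>n\<close> and \<open>k0\<close>.\<close>

lemma row_sum_bound:
 "(\<Sum>k\<in>{1..<K}. (cmod (dm 0 k))\<^sup>2 * 2 ^ k / fact k * gam k R) \<le> (1 + (4 * 2400^2 + 1) * exp 8) * (E * 2 ^ n / real n)"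
proof -
 define t where "t k = (cmod (dm 0 k))^2 * 2 ^ k / fact k * gam k R" for k
 have t0: "0 \<le> t k" for k by (simp add: t_def gam_nonneg)
 \<comment> \<open>\<open>2 * L / 5\<close> exceeds the bound \<open>77 * L / 200\<close> on
   \<open>n\<close> by \<open>3 * L / 200\<close>, the exponent in \<open>large\<close>, yet stays
   below \<open>R / 2\<close>.\<close>
 define k0 where "k0 = nat \<lceil>2 * L / 5\<rceil>"
 have k0: "2 * L / 5 \<le> real k0" "real k0 \<le> 2 * L / 5 + 1" unfolding k0_def using L by linarith+
 have nk: "n \<le> k0" using n_bounds k0 L by linarith
 have half: "real k0 \<le> R / 2" using k0 L R_ge by linarith
 define f where "f k = fact k / R ^ k" for k
 have f0: "0 \<le> f k" for k using R_ge by (simp add: f_def)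
 have dec: "f (n + j) \<le> f n * (1/2) ^ j" if "n + j \<le> k0" for j
  unfolding f_def by (rule fact_ratio_decay) (use that half in linarith)
 have s1: "(\<Sum>k\<in>{1..<n}. t k) \<le> E * 2 ^ n / real n"
 proof -
  have "t k \<le> 2 ^ n / real n * (real k * pop k)" if "k \<in> {1..<n}" for k
  proof -
   have "pop 0 * pop k \<le> 1 * pop k" using sum_pop_le [of "{0}"] pop_nonneg by (intro mult_right_mono) auto
   then have "(cmod (dm 0 k))^2 * (gam k R / fact k) * 2 ^ k \<le> pop k * 1 * 2 ^ k"
    using dm_bound [of 0 k] pop_nonneg gam_nonneg gam_le_fact [of k R] by (intro mult_mono, auto)
   also have "\<dots> \<le> pop k * (real k * 2 ^ n / real n)"
   proof -
    have "2 ^ k \<le> real k * 2 ^ n / real n" using two_power_le [of k n] that by (simp add: pos_le_divide_eq mult.commute)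
    from mult_left_mono [OF this pop_nonneg [of k]] show ?thesis by simp
   qed
   finally show ?thesis by (simp add: t_def mult_ac)
  qed
  then have "(\<Sum>k\<in>{1..<n}. t k) \<le> (\<Sum>k\<in>{1..<n}. 2 ^ n / real n * (real k * pop k))" by (rule sum_mono)
  also have "\<dots> \<le> 2 ^ n / real n * E" unfolding sum_distrib_left [symmetric] by (intro mult_left_mono energy_sum') auto
  finally show ?thesis by (simp add: mult.commute)
 qed
 have s2: "(\<Sum>k\<in>{n..<k0}. t k) \<le> 4 * 2400^2 * f n"
 proof -
  have "t (j + n) \<le> 2 * 2400^2 * (f n * (1/2) ^ j)" if "j \<in> {0..<k0 - n}" for j
  proof -
   have "t (j + n) = ((cmod (dm 0 (j + n)))^2 * ((2 * R) ^ (j + n) / fact (j + n))) * (gam (j + n) R / R ^ (j + n))"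
    using R_ge by (simp add: t_def)
   also have "\<dots> \<le> (2400^2 * 2) * f (n + j)"
    using n_bounds that k0 gam_le_fact [of "j + n" R] gam_nonneg R_ge
    by (intro mult_mono row_bound_window) (auto simp: f_def add.commute divide_right_mono)
   also have "\<dots> \<le> (2400^2 * 2) * (f n * (1/2) ^ j)" by (rule mult_left_mono [OF dec]) (use that in auto)
   finally show ?thesis by simp
  qed
  then have "(\<Sum>j\<in>{0..<k0 - n}. t (j + n)) \<le> (\<Sum>j\<in>{0..<k0 - n}. 2 * 2400^2 * (f n * (1/2) ^ j))" by (rule sum_mono)
  also have "\<dots> = 2 * 2400^2 * f n * (\<Sum>j<k0 - n. (1/2) ^ j)" by (simp add: sum_distrib_left lessThan_atLeast0 mult.assoc)
  also have "\<dots> \<le> 2 * 2400^2 * f n * 2" using f0 by (intro mult_left_mono) (auto simp: geometric_sum)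
  finally show ?thesis using nk sum.shift_bounds_nat_ivl [of t 0 n "k0 - n"] by simp
 qed
 have s3: "(\<Sum>k\<in>{k0..<K}. t k) \<le> f n"
 proof (cases "k0 \<le> K")
  case True
  define q where "q = R / (R + 1)"
  have q: "0 \<le> q" "q < 1" "1 / (1 - q) = R + 1" using R_ge by (auto simp: q_def field_simps)
  have "t (j + k0) \<le> 100 * L ^ 3 * f k0 * q ^ j" for j
  proof -
   have "t (j + k0) = ((cmod (dm 0 (j + k0)))^2 * ((2 * (R + 1)) ^ (j + k0) / fact (j + k0))) * (gam (j + k0) R / (R + 1) ^ (j + k0))"
    using R_ge unfolding t_def power_mult_distrib by simp
   also have "\<dots> \<le> (100 * L ^ 3) * (R ^ j * fact k0 / (R + 1) ^ (j + k0))"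
    using R_ge L gam_nonneg order_trans [OF gam_add_le [of R k0 j] mult_left_mono [OF gam_le_fact]] nk n_bounds by (intro mult_mono row_bound_all divide_right_mono, auto simp: add.commute)
   also have "R ^ j * fact k0 / (R + 1) ^ (j + k0) \<le> q ^ j * f k0"
    using R_ge q unfolding f_def by ((simp add: q_def power_add power_divide), (intro mult_left_mono divide_left_mono power_mono, auto))
   finally show ?thesis using L by (simp add: mult_ac)
  qed
  then have "(\<Sum>j\<in>{0..<K - k0}. t (j + k0)) \<le> (\<Sum>j\<in>{0..<K - k0}. 100 * L ^ 3 * f k0 * q ^ j)" by (rule sum_mono)
  also have "\<dots> = 100 * L ^ 3 * f k0 * (\<Sum>j<K - k0. q ^ j)" by (simp add: sum_distrib_left lessThan_atLeast0)
  also have "\<dots> \<le> 100 * L ^ 3 * f k0 * (R + 1)"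
  proof (rule mult_left_mono)
   have "(\<Sum>j<K - k0. q ^ j) = (1 - q ^ (K - k0)) / (1 - q)" using q by (simp add: sum_gp_strict)
   also have "\<dots> \<le> 1 / (1 - q)" using q by (intro divide_right_mono) auto
   finally show "(\<Sum>j<K - k0. q ^ j) \<le> R + 1" using q by simp
  qed (use f0 L in auto)
  also have "\<dots> \<le> 100 * L ^ 3 * (f n * (1/2) powr (3 * L / 200)) * (2 * L + 1)"
  proof -
   have "f k0 \<le> f n * (1/2) ^ (k0 - n)" using dec [of "k0 - n"] nk by simp
   also have "(1/2 :: real) ^ (k0 - n) = (1/2) powr real (k0 - n)" by (simp add: powr_realpow)
   also have "\<dots> \<le> (1/2) powr (3 * L / 200)" using k0 n_bounds by (intro powr_mono', auto simp: of_nat_diff)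
   finally have "f k0 \<le> f n * (1/2) powr (3 * L / 200)" using f0 by (simp add: mult_left_mono)
   then show ?thesis using R_bounds L f0 by (intro mult_mono) auto
  qed
  also have "\<dots> = f n * (100 * L ^ 3 * (2 * L + 1) * (1/2) powr (3 * L / 200))" by simp
  also have "\<dots> \<le> f n * 1" using large f0 by (intro mult_left_mono) (auto simp: large_def)
  finally show ?thesis using True sum.shift_bounds_nat_ivl [of t 0 k0 "K - k0"] by simp
 qed (use f0 in simp)
 have "(\<Sum>k\<in>{1..<K}. t k) \<le> (\<Sum>k\<in>{1..<n} \<union> {n..<k0} \<union> {k0..<K}. t k)" by (rule sum_mono2) (use t0 in auto)
 also have "\<dots> \<le> E * 2 ^ n / real n + (4 * 2400^2 + 1) * (exp 8 * (E * 2 ^ n / real n))"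
  using s1 s2 s3 fact_ratio_le unfolding f_def by ((subst sum.union_disjoint, (use nk in auto)[3], subst sum.union_disjoint, auto); simp)
 finally show ?thesis by (simp add: t_def algebra_simps)
qed

lemma deficit_le_target:
 "1 + ln pi - wigner_entropy (wigner \<rho>) \<le> (1 + 96 * (1 + (4 * 2400^2 + 1) * exp 8)) * target L"
proof -
 define B where "B = (1 + (4 * 2400^2 + 1) * exp 8) * (E * 2 ^ n / real n)"
 have d: "1 + ln pi - wigner_entropy (wigner \<rho>) \<le> 3 * E^2 * (1 + exp R) + 2 * E * R * (1 + R) + (1 + R) * exp (- R) + 12 * B"
  by (rule deficit_upper [OF R_ge(3)]) (use row_sum_bound in \<open>simp add: B_def\<close>)
 have "B \<le> (1 + (4 * 2400^2 + 1) * exp 8) * (8 * target L)"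
  unfolding B_def E_eq by (rule mult_left_mono [OF target_bounds(2)]) simp
 \<comment> \<open>As \<open>E * exp R = L powr (4/3)\<close>, all these terms are \<open>E\<close>
   times powers of \<open>L\<close>, and the target exceeds \<open>E\<close> by an exponential in
   \<open>L\<close>.\<close>
 moreover have "3 * E^2 * (1 + exp R) + 2 * E * R * (1 + R) + (1 + R) * exp (- R) \<le> target L"
 proof -
  have L1: "1 \<le> L" using L by simp
  have E1: "E \<le> 1" using L by (simp add: E_eq)
  have pw: "L powr (4/3) \<le> L ^ 3" using L1 powr_mono [of "4/3" 3 L] by simp
  have "exp R = L powr (4/3) / E"
  proof -
   have p: "L powr (- 4/3) = 1 / L powr (4/3)" using powr_minus_divide [of L "4/3"] by simp
   have "exp R = 1 / exp (- R)" by (simp add: exp_minus divide_inverse)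
   then show ?thesis unfolding exp_R p by simp
  qed
  then have "3 * E^2 * (1 + exp R) = E * (3 * E + 3 * L powr (4/3))" by (simp add: power2_eq_square field_simps)
  also have "\<dots> \<le> E * (3 * L ^ 3 + 3 * L ^ 3)" using E_pos E1 pw one_le_power [OF L1, of 3] by simp
  finally have a: "3 * E^2 * (1 + exp R) \<le> E * (6 * L ^ 3)" by simp
  have L2: "L * L \<le> L ^ 3 / 10" using L by (simp add: power3_eq_cube)
  have "R * (1 + R) \<le> (2 * L) * (3 * L)" using R_bounds L by (intro mult_mono) auto
  moreover have "0 \<le> L * L" by simp
  ultimately have "R * (1 + R) \<le> L ^ 3" using L2 by linarith
  from mult_left_mono [OF this, of "2 * E"] have b: "2 * E * R * (1 + R) \<le> E * (2 * L ^ 3)" using E_pos by simp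
  have "(1 + R) * exp (- R) \<le> (3 * L) * E"
  proof (rule mult_mono)
   have "L powr (- 4/3) \<le> L powr 0" using L1 by (intro powr_mono) auto
   then show "exp (- R) \<le> E" using E_pos L unfolding exp_R by simp
  qed (use R_bounds L in auto)
  also have "\<dots> \<le> L ^ 3 * E"
  proof (rule mult_right_mono)
   have "3 * L \<le> L * L" using L by simp
   then show "3 * L \<le> L ^ 3" using L2 L by linarith
  qed (use E_pos in simp)
  finally have "3 * E^2 * (1 + exp R) + 2 * E * R * (1 + R) + (1 + R) * exp (- R) \<le> E * (6 * L ^ 3) + E * (2 * L ^ 3) + E * L ^ 3"
   using a b by (simp add: algebra_simps)
  also have "\<dots> \<le> E * (20 * L ^ 3)" using E_pos L by simp
  also have "\<dots> \<le> target L" using target_large by (simp add: E_eq)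
  finally show ?thesis .
 qed
 ultimately show ?thesis using d by (simp add: algebra_simps)
qed

end

lemma entropy_deficit_sup_upper:
 assumes "large L"
 shows "entropy_deficit_sup (exp (- L)) \<le> ereal ((1 + 96 * (1 + (4 * 2400^2 + 1) * exp 8)) * target L)"
 unfolding entropy_deficit_sup_def
proof (rule Sup_least, clarify)
 fix \<rho> assume d: "density_operator \<rho>" and pos: "\<forall>q p. 0 \<le> wigner \<rho> q p" and m: "mean_photon_number \<rho> \<le> ennreal (exp (- L))"
 define n where "n = nat \<lceil>r_star * L + c_star * ln L\<rceil>"
 interpret density_state \<rho> by standard (rule d)
 have L: "10 \<le> L" using assms by (simp add: large_def)
 have n: "\<bar>real n - (r_star * L + c_star * ln L)\<bar> \<le> 1"
  using exponent_bounds L unfolding n_def by (simp, linarith)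
 interpret scaled_state \<rho> "exp (- L)" L "L + 4/3 * ln L" n
  by standard (use pos m assms n in \<open>auto simp: wig_def large_def\<close>)
 show "ereal (1 + ln pi - wigner_entropy (wigner \<rho>)) \<le> ereal ((1 + 96 * (1 + (4 * 2400^2 + 1) * exp 8)) * target L)"
  using deficit_le_target by simp
qed

section \<open>Finite mixtures of pure states\<close>

definition mixture :: "'i set \<Rightarrow> ('i \<Rightarrow> real) \<Rightarrow> ('i \<Rightarrow> wavefun) \<Rightarrow> wavefun \<Rightarrow> wavefun" where
 "mixture I w \<psi> f = (\<lambda>x. \<Sum>j\<in>I. (of_real (w j) * inner_L2 (\<psi> j) f) * \<psi> j x)"

locale pure_mixture =
 fixes I :: "'i set" and w :: "'i \<Rightarrow> real" and \<psi> :: "'i \<Rightarrow> wavefun"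
 assumes fin: "finite I" and w_nonneg: "j \<in> I \<Longrightarrow> 0 \<le> w j" and w_sum: "(\<Sum>j\<in>I. w j) = 1"
  and L2: "j \<in> I \<Longrightarrow> \<psi> j \<in> L2" and norm_1: "j \<in> I \<Longrightarrow> norm_L2 (\<psi> j) = 1"
begin

lemma mixture_inner: "g \<in> L2 \<Longrightarrow> inner_L2 g (mixture I w \<psi> f) = (\<Sum>j\<in>I. of_real (w j) * (inner_L2 g (\<psi> j) * inner_L2 (\<psi> j) f))"
 unfolding mixture_def by (subst inner_sum_right) (auto simp: L2 mult_ac intro!: sum.cong)

lemma mixture_L2: "mixture I w \<psi> f \<in> L2"
 unfolding mixture_def by (rule L2_sum) (rule L2)

lemma mixture_norm_le:
 assumes f: "f \<in> L2" shows "norm_L2 (mixture I w \<psi> f) \<le> norm_L2 f"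
proof -
 define g where "g = mixture I w \<psi> f"
 have g: "g \<in> L2" unfolding g_def by (rule mixture_L2)
 have "(norm_L2 g)^2 = cmod (inner_L2 g g)" by (simp add: inner_self [OF g] norm_power)
 also have "inner_L2 g g = (\<Sum>j\<in>I. of_real (w j) * (inner_L2 g (\<psi> j) * inner_L2 (\<psi> j) f))"
  by (subst (2) g_def) (rule mixture_inner [OF g])
 also have "cmod \<dots> \<le> (\<Sum>j\<in>I. w j * (norm_L2 g * norm_L2 f))"
 proof (rule order_trans [OF norm_sum sum_mono])
  fix j assume j: "j \<in> I"
  have "cmod (inner_L2 g (\<psi> j)) * cmod (inner_L2 (\<psi> j) f) \<le> (norm_L2 g * 1) * (1 * norm_L2 f)"
   using inner_Cauchy_Schwarz [OF g L2 [OF j]] inner_Cauchy_Schwarz [OF L2 [OF j] f] norm_1 [OF j]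
   by (intro mult_mono) auto
  then show "cmod (of_real (w j) * (inner_L2 g (\<psi> j) * inner_L2 (\<psi> j) f)) \<le> w j * (norm_L2 g * norm_L2 f)"
   using w_nonneg [OF j] by (simp add: norm_mult mult_left_mono)
 qed
 also have "\<dots> = norm_L2 g * norm_L2 f" unfolding sum_distrib_right [symmetric] w_sum by simp
 finally show ?thesis
  using norm_L2_nonneg [of f] unfolding g_def [symmetric] by ((simp add: power2_eq_square), (cases "norm_L2 g = 0", auto simp: mult_le_cancel_left))
qed

lemma density_mixture: "density_operator (mixture I w \<psi>)"
 unfolding density_operator_def bounded_op_def positive_op_def
proof (intro conjI ballI allI)
 fix f g :: wavefun and a b
 assume "f \<in> L2" "g \<in> L2"
 then have i: "j \<in> I \<Longrightarrow> inner_L2 (\<psi> j) (\<lambda>y. a * f y + b * g y) = a * inner_L2 (\<psi> j) f + b * inner_L2 (\<psi> j) g" for j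
  by (simp add: inner_add_right inner_scale_right L2 L2_scale)
 show "AE x in lborel. mixture I w \<psi> (\<lambda>y. a * f y + b * g y) x = a * mixture I w \<psi> f x + b * mixture I w \<psi> g x"
  unfolding mixture_def sum_distrib_left sum.distrib [symmetric]
  by (intro AE_I2 sum.cong refl) (simp add: i algebra_simps)
next
 show "\<exists>C. \<forall>f\<in>L2. norm_L2 (mixture I w \<psi> f) \<le> C * norm_L2 f"
  using mixture_norm_le by (intro exI [of _ 1]) auto
next
 fix f assume f: "f \<in> L2"
 have "inner_L2 f (mixture I w \<psi> f) = (\<Sum>j\<in>I. of_real (w j * (cmod (inner_L2 (\<psi> j) f))^2))"
  unfolding mixture_inner [OF f]
 proof (rule sum.cong [OF refl])
  fix j assume "j \<in> I"
  then have "inner_L2 f (\<psi> j) = cnj (inner_L2 (\<psi> j) f)" by (intro inner_cnj f L2)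
  then show "of_real (w j) * (inner_L2 f (\<psi> j) * inner_L2 (\<psi> j) f) = of_real (w j * (cmod (inner_L2 (\<psi> j) f))^2)"
   by (metis complex_norm_square mult.commute of_real_mult)
 qed
 then show "Im (inner_L2 f (mixture I w \<psi> f)) = 0" "0 \<le> Re (inner_L2 f (mixture I w \<psi> f))"
  using w_nonneg by (auto intro!: sum_nonneg)
next
 \<comment> \<open>Parseval evaluates the trace of each rank-one term as a squared norm.\<close>
 have "(\<lambda>n. \<Sum>j\<in>I. of_real (w j) * (inner_L2 (fock n) (\<psi> j) * inner_L2 (\<psi> j) (fock n))) sums (\<Sum>j\<in>I. of_real (w j) * inner_L2 (\<psi> j) (\<psi> j))"
 proof (intro sums_sum sums_mult)
  fix j assume "j \<in> I"
  then show "(\<lambda>n. inner_L2 (fock n) (\<psi> j) * inner_L2 (\<psi> j) (fock n)) sums inner_L2 (\<psi> j) (\<psi> j)"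
   using parseval_inner [of "\<psi> j" "\<psi> j"] L2 by (simp add: mult.commute)
 qed
 moreover have "(\<Sum>j\<in>I. of_real (w j) * inner_L2 (\<psi> j) (\<psi> j)) = of_real (\<Sum>j\<in>I. w j)"
  unfolding of_real_sum by (rule sum.cong [OF refl]) (simp add: inner_self L2 norm_1)
 ultimately show "(\<lambda>n. inner_L2 (fock n) (mixture I w \<psi> (fock n))) sums 1" by (simp add: mixture_inner w_sum)
qed (rule mixture_L2)

text \<open>The trace of a rank-one projector times the displaced parity is an expectation value, by
  Parseval and self-adjointness.\<close>

lemma wigner_mixture:
 "wigner (mixture I w \<psi>) (fst z) (snd z) = (\<Sum>j\<in>I. w j * Re (inner_L2 (\<psi> j) (weyl (phase_point z) (\<psi> j)))) / pi"
proof -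
 define b where "b = phase_point z"
 have e: "2 * (Complex (fst z) (snd z) / of_real (sqrt 2)) = b"
  by (simp add: b_def phase_point_def complex_eq_iff real_div_sqrt field_simps)
 have "(\<lambda>n. \<Sum>j\<in>I. of_real (w j) * (inner_L2 (fock n) (\<psi> j) * inner_L2 (\<psi> j) (weyl b (fock n)))) sums (\<Sum>j\<in>I. of_real (w j) * inner_L2 (\<psi> j) (weyl b (\<psi> j)))"
 proof (intro sums_sum sums_mult)
  fix j assume "j \<in> I"
  then show "(\<lambda>n. inner_L2 (fock n) (\<psi> j) * inner_L2 (\<psi> j) (weyl b (fock n))) sums inner_L2 (\<psi> j) (weyl b (\<psi> j))"
   using parseval_inner [of "\<psi> j" "weyl b (\<psi> j)"] L2 weyl_L2 by (simp add: mult.commute inner_weyl_self_adjoint)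
 qed
 then show ?thesis
  unfolding trace_op_def weyl_def [symmetric] wigner_def Let_def e by (simp add: mixture_inner sums_iff b_def [symmetric])
qed

lemma mean_photon_mixture:
 assumes e: "\<And>j K. j \<in> I \<Longrightarrow> (\<Sum>n<K. real n * (cmod (inner_L2 (fock n) (\<psi> j)))^2) \<le> e j"
 shows "mean_photon_number (mixture I w \<psi>) \<le> ennreal (\<Sum>j\<in>I. w j * e j)"
proof -
 let ?c = "\<lambda>n j. (cmod (inner_L2 (fock n) (\<psi> j)))^2"
 let ?m = "\<lambda>n. inner_L2 (number_op (fock n)) (mixture I w \<psi> (fock n))"
 have t: "Re (?m n) = (\<Sum>j\<in>I. w j * (real n * ?c n j))" for n
 proof -
  have "?m n = of_nat n * (\<Sum>j\<in>I. of_real (w j) * (inner_L2 (fock n) (\<psi> j) * inner_L2 (\<psi> j) (fock n)))"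
   unfolding number_op_fock by (subst inner_scale_left) (simp_all add: mixture_L2 mixture_inner del: fock.simps)
  also have "\<dots> = of_real (\<Sum>j\<in>I. w j * (real n * ?c n j))"
   unfolding of_real_sum sum_distrib_left
  proof (rule sum.cong [OF refl])
   fix j assume "j \<in> I"
   then have "inner_L2 (\<psi> j) (fock n) = cnj (inner_L2 (fock n) (\<psi> j))" by (intro inner_cnj fock_L2 L2)
   then have "inner_L2 (fock n) (\<psi> j) * inner_L2 (\<psi> j) (fock n) = of_real (?c n j)"
    by (metis complex_norm_square)
   then show "of_nat n * (of_real (w j) * (inner_L2 (fock n) (\<psi> j) * inner_L2 (\<psi> j) (fock n))) = of_real (w j * (real n * ?c n j))"
    by (simp del: fock.simps of_real_power)
  qed
  finally show ?thesis by (simp only: Re_complex_of_real)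
 qed
 have "(\<Sum>n<K. ennreal (Re (?m n))) \<le> ennreal (\<Sum>j\<in>I. w j * e j)" for K
 proof -
  have "(\<Sum>n<K. ennreal (Re (?m n))) = ennreal (\<Sum>n<K. \<Sum>j\<in>I. w j * (real n * ?c n j))"
   unfolding t by (rule sum_ennreal) (auto intro!: sum_nonneg mult_nonneg_nonneg w_nonneg)
  also have "(\<Sum>n<K. \<Sum>j\<in>I. w j * (real n * ?c n j)) = (\<Sum>j\<in>I. w j * (\<Sum>n<K. real n * ?c n j))"
   by (subst sum.swap) (simp only: sum_distrib_left)
  also have "ennreal \<dots> \<le> ennreal (\<Sum>j\<in>I. w j * e j)"
   by (intro ennreal_leI sum_mono mult_left_mono e w_nonneg)
  finally show ?thesis .
 qed
 then show ?thesis unfolding mean_photon_number_def suminf_eq_SUP by (rule SUP_least)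
qed

end

text \<open>The interference of the two Fock states is a pure harmonic of amplitude
  \<open>sqrt p\<close>, although the energy is only \<open>n * p\<close>; this is the source of the
  entropy deficit.\<close>

lemma fock_superposition:
 fixes p :: real assumes n: "0 < n" and p: "0 \<le> p" "p \<le> 1"
 defines "v \<equiv> (\<lambda>x. of_real (sqrt (1 - p)) * fock 0 x + of_real (sqrt p) * fock n x)"
 shows "v \<in> L2" "norm_L2 v = 1" "(\<Sum>m<K. real m * (cmod (inner_L2 (fock m) v))^2) \<le> real n * p"
  "0 \<le> s \<Longrightarrow> Re (inner_L2 v (weyl (of_real (sqrt (2 * s)) * cis t) v)) =
    (1 - p) * exp (- s) + 2 * sqrt (1 - p) * sqrt p * (cos (real n * t) * lagw 0 n (2 * s)) + p * ((-1) ^ n * lagw n 0 (2 * s))"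
proof -
 define a b :: complex where "a = of_real (sqrt (1 - p))" and "b = of_real (sqrt p)"
 have ab: "cnj a = a" "cnj b = b" "a * a = of_real (1 - p)" "b * b = of_real p"
  using p by (simp_all add: a_def b_def flip: of_real_mult of_real_diff)
 have v: "v = (\<lambda>x. a * fock 0 x + b * fock n x)" by (simp add: v_def a_def b_def)
 show L: "v \<in> L2" unfolding v by (intro L2_add L2_scale fock_L2)
 have r: "inner_L2 f v = a * inner_L2 f (fock 0) + b * inner_L2 f (fock n)" if "f \<in> L2" for f
  unfolding v using that by (simp add: inner_add_right inner_scale_right L2_scale del: fock.simps)
 have l: "inner_L2 v f = a * inner_L2 (fock 0) f + b * inner_L2 (fock n) f" if "f \<in> L2" for f
  unfolding v using that by (simp add: inner_add_left inner_scale_left L2_scale ab del: fock.simps)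
 have "inner_L2 v v = 1" using n by (simp add: l r L fock_orthonormal ab del: fock.simps)
 then show "norm_L2 v = 1" unfolding inner_self [OF L]
  by (metis norm_L2_nonneg of_real_eq_1_iff power_one real_sqrt_abs abs_of_nonneg real_sqrt_one)
 have c: "real m * (cmod (inner_L2 (fock m) v))^2 = (if m = n then real n * p else 0)" for m
  using n p by (auto simp: r fock_orthonormal b_def norm_mult simp del: fock.simps)
 show "(\<Sum>m<K. real m * (cmod (inner_L2 (fock m) v))^2) \<le> real n * p" unfolding c using p by simp
 assume s: "0 \<le> s"
 define u where "u = of_real (sqrt (2 * s)) * cis t"
 have W: "weyl u v = (\<lambda>x. a * weyl u (fock 0) x + b * weyl u (fock n) x)"
  unfolding v by (simp add: weyl_eq algebra_simps)
 have rw: "inner_L2 f (weyl u v) = a * inner_L2 f (weyl u (fock 0)) + b * inner_L2 f (weyl u (fock n))" if "f \<in> L2" for f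
  unfolding W using that by (simp add: inner_add_right inner_scale_right L2_scale weyl_L2 del: fock.simps)
 have m: "mel u k j = of_real (mlag k j (2 * s)) * cis (of_int (int k - int j) * t)" for k j
  unfolding u_def by (rule mel_polar_mlag) (use s in simp)
 have "inner_L2 v (weyl u v) = (a * a) * mel u 0 0 + (a * b) * (mel u 0 n + mel u n 0) + (b * b) * mel u n n"
  by (simp add: l rw weyl_L2 L mel_def algebra_simps del: fock.simps)
 then have "Re (inner_L2 v (weyl u v)) = (1 - p) * exp (- s) + sqrt (1 - p) * sqrt p * (2 * (cos (real n * t) * lagw 0 n (2 * s))) + p * ((-1) ^ n * lagw n 0 (2 * s))"
  using lagw_0_0 [of s] unfolding ab m by (simp add: mlag_def a_def b_def flip: of_real_mult of_real_diff)
 then show "Re (inner_L2 v (weyl (of_real (sqrt (2 * s)) * cis t) v)) =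
    (1 - p) * exp (- s) + 2 * sqrt (1 - p) * sqrt p * (cos (real n * t) * lagw 0 n (2 * s)) + p * ((-1) ^ n * lagw n 0 (2 * s))"
  unfolding u_def by simp
qed

section \<open>Rotated squeezed states\<close>

text \<open>A normalised Gaussian with complex width parameter \<open>A + i B\<close>;
  \<open>B\<close> shears its Wigner function.\<close>

definition squeezed :: "real \<Rightarrow> real \<Rightarrow> wavefun" where
 "squeezed A B = (\<lambda>x. of_real (sqrt (sqrt (A / pi)) * exp (- (A / 2) * x^2)) * cis (- (B / 2) * x^2))"

lemma squeezed_norm: "cmod (squeezed A B x) = sqrt (sqrt (A / pi)) * exp (- (A / 2) * x^2)" if "0 < A"
 using that by (simp add: squeezed_def norm_mult)

lemma squeezed_derivative:
 assumes "0 < A"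
 shows "(squeezed A B has_vector_derivative - (Complex A B * of_real x * squeezed A B x)) (at x)"
proof -
 have e: "squeezed A B = (\<lambda>x. of_real (sqrt (sqrt (A / pi))) * exp (- (Complex A B / 2) * (of_real x * of_real x)))"
 proof
  fix x
  have "of_real (- (A / 2) * x^2) + \<i> * of_real (- (B / 2) * x^2) = - (Complex A B / 2) * (of_real x * of_real x)"
   by (simp add: complex_eq_iff power2_eq_square)
  then have "exp (of_real (- (A / 2) * x^2)) * exp (\<i> * of_real (- (B / 2) * x^2)) = exp (- (Complex A B / 2) * (of_real x * of_real x))"
   by (simp only: exp_add [symmetric])
  then show "squeezed A B x = of_real (sqrt (sqrt (A / pi))) * exp (- (Complex A B / 2) * (of_real x * of_real x))"
   unfolding squeezed_def cis_conv_exp of_real_mult [of "sqrt _"] exp_of_real [symmetric] by simp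
 qed
 show ?thesis unfolding e
  by (auto intro!: derivative_eq_intros has_vector_derivative_mult_right simp: field_simps
   | rule has_vector_derivative_real_field)+
qed

lemma smooth_gauss_squeezed:
 assumes A: "0 < A" shows "smooth_gauss (squeezed A B)"
proof (rule smooth_gaussI [OF squeezed_derivative [OF A]])
 have g: "gauss_bounded (squeezed A B)"
  by (rule gauss_boundedI [of "A / 2" _ "sqrt (sqrt (A / pi))"]) (use A in \<open>auto simp: squeezed_norm\<close>)
 then show "gauss_bounded (squeezed A B)" .
 from gauss_bounded_bounded_mult [OF gauss_bounded_mult_id [OF g], of "\<lambda>_. - Complex A B" "cmod (Complex A B)"]
 show "gauss_bounded (\<lambda>x. - (Complex A B * of_real x * squeezed A B x))" by (simp add: mult_ac)
 show "continuous_on UNIV (\<lambda>x. - (Complex A B * of_real x * squeezed A B x))"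
  unfolding squeezed_def by (intro continuous_intros)
qed

lemma squeezed_parity: "parity (squeezed A B) = squeezed A B" by (simp add: parity_def squeezed_def)

lemma squeezed_norm_L2:
 assumes A: "0 < A" shows "norm_L2 (squeezed A B) = 1"
proof -
 have "(cmod (squeezed A B x))^2 = sqrt (A / pi) * exp (- A * x^2)" for x
  using A by (simp add: squeezed_norm power_mult_distrib) (simp add: power2_eq_square exp_add [symmetric])
 then show ?thesis using A unfolding norm_L2_def using gauss_integrable(2) [OF A] by (simp add: real_sqrt_mult [symmetric])
qed

lemma squeezed_annihilation:
 assumes A: "0 < A"
 shows "annihilation (squeezed A B) = (\<lambda>x. (of_real (1 / sqrt 2) * Complex (1 - A) (- B)) * (of_real x * squeezed A B x))"
proof
 fix x
 have vd: "vector_derivative (squeezed A B) (at x) = - (Complex A B * of_real x * squeezed A B x)"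
  by (rule vector_derivative_at [OF squeezed_derivative [OF A]])
 have C: "Complex (1 - A) (- B) = 1 - Complex A B" by (simp add: complex_eq_iff)
 show "annihilation (squeezed A B) x = (of_real (1 / sqrt 2) * Complex (1 - A) (- B)) * (of_real x * squeezed A B x)"
  unfolding annihilation_def position_def momentum_def vd C by (simp add: field_simps)
qed

lemma squeezed_annihilation_norm:
 assumes A: "0 < A"
 shows "(norm_L2 (annihilation (squeezed A B)))^2 \<le> 2 * (((1 - A)^2 + B^2) / A)"
proof -
 define c where "c = ((1 - A)^2 + B^2) / 2"
 have c: "0 \<le> c" by (simp add: c_def)
 have i: "integrable lborel (\<lambda>x. exp (- (A / 2) * x^2))" "(LINT x|lborel. exp (- (A / 2) * x^2)) = sqrt (pi / (A / 2))"
  using gauss_integrable [of "A / 2"] A by auto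
 have "(norm_L2 (annihilation (squeezed A B)))^2 = (LINT x|lborel. (cmod (annihilation (squeezed A B) x))^2)" by (rule norm_L2_sq)
 also have "\<dots> \<le> (LINT x|lborel. c * sqrt (A / pi) * (2 / A) * exp (- (A / 2) * x^2))"
 proof (rule integral_mono)
  show "integrable lborel (\<lambda>x. (cmod (annihilation (squeezed A B) x))^2)"
   by (rule L2_integrable_sq [OF smooth_gaussD(10) [OF smooth_gauss_squeezed [OF A]]])
  show "integrable lborel (\<lambda>x. c * sqrt (A / pi) * (2 / A) * exp (- (A / 2) * x^2))" using i by auto
  fix x
  have "(cmod (annihilation (squeezed A B) x))^2 = c * sqrt (A / pi) * (x^2 * exp (- A * x^2))"
  proof -
   have "(exp (- (A / 2) * x^2))^2 = exp (- A * x^2)" by (simp add: power2_eq_square exp_add [symmetric])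
   then show ?thesis
    unfolding squeezed_annihilation [OF A] using A by (simp add: norm_mult power_mult_distrib squeezed_norm cmod_power2 c_def norm_divide power_divide)
  qed
  also have "\<dots> \<le> c * sqrt (A / pi) * (2 / A * exp (- (A / 2) * x^2))"
  proof (rule mult_left_mono)
   \<comment> \<open>\<open>z \<le> exp z\<close> replaces the exact second moment by a Gaussian
     integral of half the rate; only the order of the result matters.\<close>
   have "(A / 2 * x^2) * exp (- A * x^2) \<le> exp (A / 2 * x^2) * exp (- A * x^2)"
    using exp_ge_add_one_self [of "A / 2 * x^2"] by (simp add: field_simps)
   also have "\<dots> = exp (- (A / 2) * x^2)" by (simp add: exp_add [symmetric])
   finally show "x^2 * exp (- A * x^2) \<le> 2 / A * exp (- (A / 2) * x^2)" using A by (simp add: field_simps)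
  qed (use A c in auto)
  finally show "(cmod (annihilation (squeezed A B) x))^2 \<le> c * sqrt (A / pi) * (2 / A) * exp (- (A / 2) * x^2)" by simp
 qed
 also have "\<dots> = c * (2 / A) * (sqrt (A / pi) * sqrt (pi / (A / 2)))" using i by simp
 also have "sqrt (A / pi) * sqrt (pi / (A / 2)) = sqrt 2" using A by (simp add: real_sqrt_mult [symmetric])
 also have "c * (2 / A) * sqrt 2 \<le> c * (2 / A) * 2" using A c by (intro mult_left_mono real_le_lsqrt) auto
 also have "\<dots> = 2 * (((1 - A)^2 + B^2) / A)" using A by (simp add: c_def field_simps)
 finally show ?thesis .
qed

text \<open>Parity fixes \<open>squeezed A B\<close>, so \<open>weyl\<close> acts on it as the
  displacement by \<open>(q + i p) / sqrt 2\<close>, which centres it at \<open>(q, p)\<close>; the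
  facts about \<open>weyl\<close> apply directly.\<close>

definition squeezed_at :: "real \<Rightarrow> real \<Rightarrow> real \<Rightarrow> real \<Rightarrow> wavefun" where
 "squeezed_at A B q p = weyl (Complex q p / of_real (sqrt 2)) (squeezed A B)"

lemma squeezed_at_eq: "squeezed_at A B q p x = cis (p * x - p * q / 2) * squeezed A B (q - x)"
unfolding squeezed_at_def weyl_eq by simp_all

lemma squeezed_at:
 assumes A: "0 < A"
 shows "squeezed_at A B q p \<in> L2" "norm_L2 (squeezed_at A B q p) = 1" "smooth_gauss (squeezed_at A B q p)"
proof -
 note s = smooth_gauss_squeezed [OF A, of B]
 show "smooth_gauss (squeezed_at A B q p)" unfolding squeezed_at_def by (rule smooth_gauss_weyl [OF s])
 show "squeezed_at A B q p \<in> L2" "norm_L2 (squeezed_at A B q p) = 1"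
  unfolding squeezed_at_def using smooth_gaussD(6) [OF s] by (simp_all add: weyl_L2 norm_weyl squeezed_norm_L2 [OF A])
qed

lemma squeezed_at_wigner:
 assumes A: "0 < A"
 shows "inner_L2 (squeezed_at A B q\<^sub>0 p\<^sub>0) (weyl (phase_point (q, p)) (squeezed_at A B q\<^sub>0 p\<^sub>0))
  = of_real (exp (- A * (q - q\<^sub>0)^2 - (p - p\<^sub>0 + B * (q - q\<^sub>0))^2 / A))"
proof -
 define Q t where "Q = q - q\<^sub>0" and "t = 2 * (p - p\<^sub>0 + B * Q)"
 define c where "c = sqrt (A / pi) * exp (- A * Q^2)"
 have e: "phase_point (q, p) = 2 * (Complex q p / of_real (sqrt 2))"
  by (simp add: phase_point_def complex_eq_iff real_div_sqrt field_simps)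
 have "cis (2 * p * y) * (squeezed_at A B q\<^sub>0 p\<^sub>0 (q - y) * cnj (squeezed_at A B q\<^sub>0 p\<^sub>0 (q + y)))
   = of_real c * (cis (t * y) * of_real (exp (- A * y^2)))" for y
 proof -
  have r: "sqrt (sqrt (A / pi)) * exp (- (A / 2) * (q\<^sub>0 - (q - y))^2) * (sqrt (sqrt (A / pi)) * exp (- (A / 2) * (q\<^sub>0 - (q + y))^2)) = c * exp (- A * y^2)"
   using A by (simp add: power2_eq_square algebra_simps exp_add [symmetric] Q_def c_def)
  have ph: "2 * p * y + (p\<^sub>0 * (q - y) - p\<^sub>0 * q\<^sub>0 / 2 + - (B / 2) * (q\<^sub>0 - (q - y))^2 - (p\<^sub>0 * (q + y) - p\<^sub>0 * q\<^sub>0 / 2 + - (B / 2) * (q\<^sub>0 - (q + y))^2)) = t * y"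
   unfolding t_def Q_def by (simp add: power2_eq_square algebra_simps)
  have "squeezed_at A B q\<^sub>0 p\<^sub>0 x = of_real (sqrt (sqrt (A / pi)) * exp (- (A / 2) * (q\<^sub>0 - x)^2)) * cis (p\<^sub>0 * x - p\<^sub>0 * q\<^sub>0 / 2 + - (B / 2) * (q\<^sub>0 - x)^2)" for x
   unfolding squeezed_at_eq squeezed_def cis_mult [symmetric] by (simp only: mult_ac)
  note sq = this
  have gen: "cis c * ((of_real r1 * cis a1) * cnj (of_real r2 * cis a2)) = of_real (r1 * r2) * cis (c + (a1 - a2))" for c r1 a1 r2 a2
   by (simp add: cis_mult cis_cnj)
  have "cis (2 * p * y) * (squeezed_at A B q\<^sub>0 p\<^sub>0 (q - y) * cnj (squeezed_at A B q\<^sub>0 p\<^sub>0 (q + y)))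
   = of_real (sqrt (sqrt (A / pi)) * exp (- (A / 2) * (q\<^sub>0 - (q - y))^2) * (sqrt (sqrt (A / pi)) * exp (- (A / 2) * (q\<^sub>0 - (q + y))^2)))
    * cis (2 * p * y + (p\<^sub>0 * (q - y) - p\<^sub>0 * q\<^sub>0 / 2 + - (B / 2) * (q\<^sub>0 - (q - y))^2 - (p\<^sub>0 * (q + y) - p\<^sub>0 * q\<^sub>0 / 2 + - (B / 2) * (q\<^sub>0 - (q + y))^2)))"
   unfolding sq by (rule gen)
  then show ?thesis unfolding r ph by simp
 qed
 then have "inner_L2 (squeezed_at A B q\<^sub>0 p\<^sub>0) (weyl (phase_point (q, p)) (squeezed_at A B q\<^sub>0 p\<^sub>0))
  = (LINT y|lborel. of_real c * (cis (t * y) * of_real (exp (- A * y^2))))"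
  unfolding e weyl_def inner_displaced_parity by simp
 also have "\<dots> = of_real c * of_real (sqrt (pi / A) * exp (- t\<^sup>2 / (4 * A)))"
  by (subst integral_mult_right_zero) (simp only: gauss_fourier [OF A])
 also have "\<dots> = of_real (exp (- A * Q^2 - (p - p\<^sub>0 + B * Q)^2 / A))"
 proof -
  have t: "- t\<^sup>2 / (4 * A) = - ((p - p\<^sub>0 + B * Q)^2 / A)" unfolding t_def power_mult_distrib by simp
  have "c * (sqrt (pi / A) * exp (- t\<^sup>2 / (4 * A))) = exp (- A * Q^2) * exp (- ((p - p\<^sub>0 + B * Q)^2 / A))"
   using A unfolding t c_def by (simp add: real_sqrt_mult [symmetric])
  then show ?thesis by (simp add: exp_add [symmetric] flip: of_real_mult)
 qed
 finally show ?thesis by (simp add: Q_def)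
qed

text \<open>The mean photon number is the squared norm of \<open>annihilation f\<close>, and
  Bessel's inequality supplies the direction needed.\<close>

lemma number_sum_le_annihilation:
 assumes f: "smooth_gauss f"
 shows "(\<Sum>n<K. real n * (cmod (inner_L2 (fock n) f))^2) \<le> (norm_L2 (annihilation f))^2"
proof -
 have t: "real (Suc n) * (cmod (inner_L2 (fock (Suc n)) f))^2 = (cmod (fock_coeff (annihilation f) n))^2" for n
 proof -
  have "fock_coeff (annihilation f) n = inner_L2 (creation (fock n)) f"
   unfolding fock_coeff_def by (rule creation_adjoint [OF smooth_gauss_fock f, symmetric])
  also have "\<dots> = of_real (sqrt (real (Suc n))) * inner_L2 (fock (Suc n)) f"
   unfolding creation_fock using smooth_gaussD(6) [OF f] by (subst inner_scale_left) (simp_all del: fock.simps)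
  finally show ?thesis by (simp add: norm_mult power_mult_distrib del: fock.simps of_nat_Suc)
 qed
 have "(\<Sum>n<K. real n * (cmod (inner_L2 (fock n) f))^2) \<le> (\<Sum>n<Suc K. real n * (cmod (inner_L2 (fock n) f))^2)" by (intro sum_mono2) auto
 also have "\<dots> \<le> (norm_L2 (annihilation f))^2"
  by ((subst sum.lessThan_Suc_shift, simp add: t del: fock.simps of_nat_Suc), (rule bessel_inequality [OF smooth_gaussD(10) [OF f]]))
 finally show ?thesis .
qed

text \<open>Displacement adds the amplitude \<open>a\<close> to the annihilation operator; the
  triangle inequality separates the energy of the centre from that of the squeezing.\<close>

lemma squeezed_at_number:
 assumes A: "0 < A"
 shows "(\<Sum>n<K. real n * (cmod (inner_L2 (fock n) (squeezed_at A B q p)))^2) \<le> q^2 + p^2 + 4 * (((1 - A)^2 + B^2) / A)"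
proof -
 define a where "a = Complex q p / of_real (sqrt 2)"
 define f where "f = squeezed A B"
 note s = smooth_gauss_squeezed [OF A, of B, folded f_def]
 note S = squeezed_at(3) [OF A, of B q p]
 have af: "annihilation f \<in> L2" by (rule smooth_gaussD(10) [OF s])
 have pa: "parity (annihilation f) = (\<lambda>x. (-1) * annihilation f x)"
  using annihilation_parity [OF s] unfolding f_def squeezed_parity by (simp add: fun_eq_iff)
 have disp: "displacement a (annihilation f) = (\<lambda>x. (-1) * weyl a (annihilation f) x)"
  unfolding weyl_def pa by (simp add: displacement_def Let_def)
 have "annihilation (squeezed_at A B q p) = (\<lambda>x. displacement a (annihilation f) x + a * displacement a f x)"
  using annihilation_displacement [OF s, of a] squeezed_parity [of A B] unfolding squeezed_at_def weyl_def f_def a_def by simp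
 also have "displacement a f = squeezed_at A B q p" using squeezed_parity [of A B] unfolding squeezed_at_def weyl_def f_def a_def by simp
 finally have eq: "annihilation (squeezed_at A B q p) = (\<lambda>x. (-1) * weyl a (annihilation f) x + a * squeezed_at A B q p x)" unfolding disp .
 have "norm_L2 (annihilation (squeezed_at A B q p)) \<le> norm_L2 (\<lambda>x. (-1) * weyl a (annihilation f) x) + norm_L2 (\<lambda>x. a * squeezed_at A B q p x)"
  unfolding eq by (intro norm_L2_triangle L2_scale weyl_L2 af squeezed_at(1) [OF A])
 also have "\<dots> = norm_L2 (annihilation f) + cmod a"
  by (subst norm_L2_scale [OF weyl_L2 [OF af]], subst norm_L2_scale [OF squeezed_at(1) [OF A]]) (simp add: norm_weyl [OF af] squeezed_at(2) [OF A])
 finally have "(norm_L2 (annihilation (squeezed_at A B q p)))^2 \<le> (norm_L2 (annihilation f) + cmod a)^2" by simp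
 also have "\<dots> \<le> 2 * (norm_L2 (annihilation f))^2 + 2 * (cmod a)^2"
  using zero_le_power2 [of "norm_L2 (annihilation f) - cmod a"] by (simp add: power2_eq_square algebra_simps)
 also have "\<dots> \<le> 2 * (2 * (((1 - A)^2 + B^2) / A)) + (q^2 + p^2)"
 proof -
  have "2 * (cmod a)^2 = q^2 + p^2" by (simp add: a_def power_divide cmod_power2)
  then show ?thesis using squeezed_annihilation_norm [OF A, of B] unfolding f_def by linarith
 qed
 finally show ?thesis using number_sum_le_annihilation [OF S, of K] by simp
qed

lemma polar_surj: "\<exists>t. z = polar (radius_sq z, t)"
proof -
 define c where "c = Complex (fst z) (snd z)"
 have m: "cmod c = sqrt (radius_sq z)" by (simp add: c_def cmod_def radius_sq_def)
 have c: "c = of_real (cmod c) * cis (Arg c)" using rcis_cmod_Arg [of c] by (simp add: rcis_def)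
 show ?thesis using arg_cong [OF c, of Re] arg_cong [OF c, of Im] unfolding m by (auto simp: c_def polar_def prod_eq_iff)
qed

text \<open>The parameters belong to the quadratic form with eigenvalue \<open>k\<close> along the
  ray at angle \<open>t\<close> and \<open>1 / k\<close> across it, so the state is thin radially
  and long tangentially; \<open>d\<close> is the coefficient of the squared momentum in this form,
  which is \<open>1 / A\<close> in \<open>squeezed_at_wigner\<close>.\<close>

definition squeezed_ring :: "real \<Rightarrow> real \<Rightarrow> real \<Rightarrow> wavefun" where
 "squeezed_ring k r t =
   (let d = k * (sin t)^2 + (cos t)^2 / k; b = cos t * sin t * (k - 1 / k)
   in squeezed_at (1 / d) (b / d) (r * cos t) (r * sin t))"

lemma squeezed_ring:
 assumes k: "1 \<le> k"
 shows "squeezed_ring k r u \<in> L2" "norm_L2 (squeezed_ring k r u) = 1"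
  "(\<Sum>n<K. real n * (cmod (inner_L2 (fock n) (squeezed_ring k r u)))^2) \<le> r^2 + 8 * k"
  "0 \<le> s \<Longrightarrow> inner_L2 (squeezed_ring k r u) (weyl (phase_point (polar (s, v))) (squeezed_ring k r u))
    = of_real (exp (- (k * (sqrt s * cos (v - u) - r)^2 + (sqrt s * sin (v - u))^2 / k)))"
proof -
 let ?r = "squeezed_ring k r u"
 define c t where "c = cos u" and "t = sin u"
 have ct: "c^2 + t^2 = 1" by (simp add: c_def t_def)
 define m where "m = 1 / k"
 have m: "k * m = 1" "0 < m" "m \<le> 1" using k by (auto simp: m_def)
 define d b where "d = k * t^2 + c^2 * m" and "b = c * t * (k - m)"
 have eq: "squeezed_ring k r u = squeezed_at (1 / d) (b / d) (r * c) (r * t)"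
  by (simp add: squeezed_ring_def Let_def d_def b_def c_def t_def m_def)
 have d: "0 < d"
 proof (cases "t = 0")
  case True
  then show ?thesis using ct m by (simp add: d_def)
 next
  case False
  have "0 < k * t^2" using False k by simp
  moreover have "0 \<le> c^2 * m" using m by simp
  ultimately show ?thesis unfolding d_def by linarith
 qed
 then have A: "0 < 1 / d" by simp
 show "squeezed_ring k r u \<in> L2" "norm_L2 ?r = 1"
  unfolding eq by (rule squeezed_at [OF A])+
 \<comment> \<open>The quadratic form has determinant \<open>k * m = 1\<close>, as it must for a
   pure Gaussian state.\<close>
 have ad: "(k * c^2 + t^2 * m) * d = 1 + b^2"
 proof -
  have "(k * c^2 + t^2 * m) * d - b^2 = (k * m) * (c^2 + t^2)^2" unfolding d_def b_def by algebra
  then show ?thesis unfolding m ct by simp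
 qed
 have "((1 - 1 / d)^2 + (b / d)^2) / (1 / d) = d - 2 + (1 + b^2) / d"
  using d by (simp add: field_simps power2_eq_square)
 also have "(1 + b^2) / d = k * c^2 + t^2 * m" unfolding ad [symmetric] using d by simp
 also have "d - 2 + (k * c^2 + t^2 * m) = (k + m) * (c^2 + t^2) - 2" by (simp add: d_def algebra_simps)
 also have "\<dots> \<le> 2 * k" unfolding ct using m k by simp
 finally have e: "((1 - 1 / d)^2 + (b / d)^2) / (1 / d) \<le> 2 * k" .
 show "(\<Sum>n<K. real n * (cmod (inner_L2 (fock n) ?r))^2) \<le> r^2 + 8 * k"
  using squeezed_at_number [OF A, where B = "b / d" and K = K and q = "r * c" and p = "r * t"] e unfolding power_mult_distrib distrib_left [symmetric] ct eq by linarith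
 assume s: "0 \<le> s"
 define x y where "x = sqrt s * cos v" and "y = sqrt s * sin v"
 define Q P where "Q = x - r * c" and "P = y - r * t"
 have "- (1 / d) * Q^2 - (P + b / d * Q)^2 / (1 / d) = - ((Q^2 + (d * P + b * Q)^2) / d)"
  by (simp add: field_simps power2_eq_square)
 also have "Q^2 + (d * P + b * Q)^2 = d * (k * (Q * c + P * t)^2 + (P * c - Q * t)^2 * m)"
 proof -
  have "Q^2 + (d * P + b * Q)^2 = Q^2 * (1 + b^2) + d * (d * P^2 + 2 * b * P * Q)" by (simp add: power2_eq_square algebra_simps)
  also have "\<dots> = d * ((k * c^2 + t^2 * m) * Q^2 + d * P^2 + 2 * b * P * Q)" unfolding ad [symmetric] by (simp add: algebra_simps)
  also have "(k * c^2 + t^2 * m) * Q^2 + d * P^2 + 2 * b * P * Q = k * (Q * c + P * t)^2 + (P * c - Q * t)^2 * m"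
   unfolding d_def b_def by (simp add: power2_eq_square algebra_simps)
  finally show ?thesis .
 qed
 also have "Q * c + P * t = sqrt s * cos (v - u) - r"
 proof -
  have "Q * c + P * t = sqrt s * (cos v * c + sin v * t) - r * (c^2 + t^2)"
   by (simp add: Q_def P_def x_def y_def power2_eq_square algebra_simps)
  then show ?thesis unfolding ct by (simp add: c_def t_def cos_diff)
 qed
 also have "P * c - Q * t = sqrt s * sin (v - u)"
  by (simp add: Q_def P_def x_def y_def c_def t_def sin_diff algebra_simps)
 finally have "- (1 / d) * Q^2 - (P + b / d * Q)^2 / (1 / d) = - (k * (sqrt s * cos (v - u) - r)^2 + (sqrt s * sin (v - u))^2 / k)"
  using d by (simp add: m_def)
 moreover have "polar (s, v) = (x, y)" by (simp add: polar_def x_def y_def)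
 ultimately show "inner_L2 ?r (weyl (phase_point (polar (s, v))) ?r)
    = of_real (exp (- (k * (sqrt s * cos (v - u) - r)^2 + (sqrt s * sin (v - u))^2 / k)))"
  unfolding eq using squeezed_at_wigner [OF A, of "b / d" "r * c" "r * t" x y] by (simp only: Q_def P_def)
qed

text \<open>Rounds \<open>x\<close> down to a multiple of \<open>2 * pi / J\<close>; reducing the
  integer quotient modulo \<open>J\<close> changes the angle by full turns only.\<close>

lemma grid_angle:
 assumes J: "0 < J"
 shows "\<exists>j<J. \<exists>u. 0 \<le> u \<and> u \<le> 2 * pi / real J \<and> cos (x - 2 * pi * real j / real J) = cos u \<and> sin (x - 2 * pi * real j / real J) = sin u"
proof -
 define m where "m = \<lfloor>x * real J / (2 * pi)\<rfloor>"
 define j where "j = nat (m mod int J)"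
 define u where "u = x - 2 * pi * of_int m / real J"
 have j: "j < J" "int j = m mod int J" using J by (auto simp: j_def nat_less_iff)
 have m: "of_int m = real j + real J * of_int (m div int J)"
 proof -
  have "of_int m = (of_int (int j + int J * (m div int J)) :: real)" using j by simp
  then show ?thesis by simp
 qed
 have fl: "of_int m \<le> x * real J / (2 * pi)" "x * real J / (2 * pi) \<le> of_int m + 1" unfolding m_def by linarith+
 have u: "u = (x * real J - 2 * pi * of_int m) / real J" using J by (simp add: u_def diff_divide_distrib)
 have e: "0 \<le> u" "u \<le> 2 * pi / real J"
  using fl unfolding u by ((auto simp: field_simps), (auto intro: divide_right_mono))
 have x: "x - 2 * pi * real j / real J = u + 2 * pi * of_int (m div int J)"
  unfolding u_def m using J by (simp add: field_simps)
 have "cos (u + 2 * pi * of_int (m div int J)) = cos u" "sin (u + 2 * pi * of_int (m div int J)) = sin u"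
  by (simp_all add: cos_add sin_add)
 then have "cos (x - 2 * pi * real j / real J) = cos u" "sin (x - 2 * pi * real j / real J) = sin u" by (simp_all only: x)
 then show ?thesis using j(1) e by blast
qed

section \<open>The trial state and the positivity of its Wigner function\<close>

locale lower_scale = scale +
 assumes huge: "exp 10100 \<le> L" "200 \<le> L powr (1/3)"
begin

text \<open>The squeezing factor and, up to rounding, the number of ring states. Neighbouring
  centres are at most \<open>2 * pi / kap\<close> apart in angle, so the circle departs from a
  tangent by a multiple of \<open>sqrt R / kap^2\<close>. In the exponent of the thin direction this
  becomes a multiple of \<open>R / kap ^ 3\<close>, which is bounded.\<close>

definition kap :: real where "kap = L powr (1/3)"
definition Jn :: nat where "Jn = nat \<lceil>kap\<rceil>"
definition E :: real where "E = exp (- L)"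
text \<open>After the loss of \<open>exp 8\<close> in \<open>stirling_balance\<close> the constant
  leaves \<open>exp (- 10000)\<close>; its square root, the relative size of the cross term at
  \<open>s = R\<close>, is far below the factor \<open>exp (- 4352)\<close> lost in
  \<open>ring_ge\<close>.\<close>

definition pw :: real where "pw = exp (- 10008) * E / real n"
text \<open>Each ring state has at most \<open>R + 8 * kap \<le> 4 * L\<close> photons, so the ring
  uses at most half of the energy.\<close>

definition qw :: real where "qw = E / (8 * L)"

lemma kap: "200 \<le> kap" "kap ^ 3 = L"
proof -
 show "200 \<le> kap" using huge by (simp add: kap_def)
 show "kap ^ 3 = L" using L_ge powr_powr [of L "1/3" 3] unfolding kap_def by simp
qed

lemma Jn: "0 < Jn" "kap \<le> real Jn" "real Jn \<le> 2 * kap"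
 unfolding Jn_def using kap(1) by linarith+

lemma L_200: "200 \<le> L" using ln_L by linarith

lemma E_small: "0 < E" "E \<le> 1/200"
proof -
 show "0 < E" by (simp add: E_def)
 have "200 \<le> exp L" using L_200 exp_ge_add_one_self [of L] by linarith
 then show "E \<le> 1/200" by (simp add: E_def exp_minus field_simps)
qed

lemma pw: "0 < pw" "pw \<le> E" "real n * pw \<le> E / 2"
proof -
 have n: "1 \<le> real n" using n_bounds by simp
 show "0 < pw" using n E_small by (simp add: pw_def)
 have "exp (- 10008 :: real) \<le> 1/2" using exp_ge_add_one_self [of 10008] by (simp add: exp_minus field_simps)
 from mult_right_mono [OF this less_imp_le [OF E_small(1)]]
 show *: "real n * pw \<le> E / 2" using n by (simp add: pw_def)
 have "pw \<le> real n * pw" using n \<open>0 < pw\<close> by simp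
 then show "pw \<le> E" using * E_small by linarith
qed

lemma qw: "0 < qw" "qw \<le> E" "qw * (R + 8 * kap) \<le> E / 2"
proof -
 show "0 < qw" using E_small L_ge by (simp add: qw_def)
 show "qw \<le> E" using E_small L_ge by (simp add: qw_def field_simps)
 have "8 * kap \<le> 2 * L"
 proof -
  have "4 * kap \<le> (kap * kap) * kap" using kap(1) mult_mono [of 2 kap 2 kap] by simp
  then show ?thesis using kap(2) by (simp add: power3_eq_cube)
 qed
 then have "qw * (R + 8 * kap) \<le> qw * (4 * L)" using R_bounds \<open>0 < qw\<close> by simp
 then show "qw * (R + 8 * kap) \<le> E / 2" using L_ge by (simp add: qw_def)
qed

definition wt :: "nat \<Rightarrow> real" where
 "wt j = (if j = 0 then 1 - qw else qw / real Jn)"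

definition st :: "nat \<Rightarrow> wavefun" where
 "st j = (if j = 0 then (\<lambda>x. of_real (sqrt (1 - pw)) * fock 0 x + of_real (sqrt pw) * fock n x)
      else squeezed_ring kap (sqrt R) (2 * pi * real (j - 1) / real Jn))"

definition rho :: "wavefun \<Rightarrow> wavefun" where "rho = mixture {..Jn} wt st"

lemma sum_states: "(\<Sum>j\<le>Jn. f j) = f 0 + (\<Sum>j<Jn. f (Suc j))" for f :: "nat \<Rightarrow> real"
 by (subst lessThan_Suc_atMost [symmetric]) (rule sum.lessThan_Suc_shift)

lemma kap_1: "1 \<le> kap" using kap by simp

lemma pw01: "0 \<le> pw" "pw \<le> 1" using pw E_small by auto

lemma n_pos: "0 < n" using n_bounds by simp

sublocale pure_mixture "{..Jn}" wt st
proof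
 show "(\<Sum>j\<le>Jn. wt j) = 1" using Jn by (simp only: sum_states) (simp add: wt_def)
 show "0 \<le> wt j" for j using qw E_small by (auto simp: wt_def)
 show "st j \<in> L2" "norm_L2 (st j) = 1" for j
  using fock_superposition(1,2) [OF n_pos pw01] squeezed_ring(1,2) [OF kap_1] by (simp_all add: st_def)
qed simp

lemma rho_density: "density_operator rho" unfolding rho_def by (rule density_mixture)

lemma rho_energy: "mean_photon_number rho \<le> ennreal E"
proof -
 define e where "e j = (if j = 0 then real n * pw else R + 8 * kap)" for j :: nat
 have "mean_photon_number rho \<le> ennreal (\<Sum>j\<le>Jn. wt j * e j)"
  unfolding rho_def
 proof (rule mean_photon_mixture)
  fix j K
  show "(\<Sum>m<K. real m * (cmod (inner_L2 (fock m) (st j)))^2) \<le> e j"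
   using fock_superposition(3) [OF n_pos pw01, of K]
    squeezed_ring(3) [OF kap_1, where K = K and r = "sqrt R" and u = "2 * pi * real (j - 1) / real Jn"] R_bounds
   by (cases j) (simp_all add: st_def e_def del: fock.simps)
 qed
 also have "(\<Sum>j\<le>Jn. wt j * e j) = (1 - qw) * (real n * pw) + qw * (R + 8 * kap)"
  using Jn by (simp only: sum_states) (simp add: wt_def e_def)
 also have "\<dots> \<le> 1 * (E / 2) + E / 2" using pw qw by (intro add_mono mult_mono, auto)
 finally show ?thesis by (simp add: ennreal_leI)
qed

definition ring :: "real \<Rightarrow> real \<Rightarrow> real" where
 "ring s v = (\<Sum>j<Jn. exp (- (kap * (sqrt s * cos (v - 2 * pi * real j / real Jn) - sqrt R)^2 + (sqrt s * sin (v - 2 * pi * real j / real Jn))^2 / kap))) / real Jn"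

definition main :: "real \<Rightarrow> real \<Rightarrow> real" where
 "main s v = 2 * sqrt (1 - pw) * sqrt pw * (cos (real n * v) * lagw 0 n (2 * s))"

lemma wigner_rho:
 assumes s: "0 \<le> s"
 shows "pi * wigner rho (fst (polar (s, v))) (snd (polar (s, v))) =
  (1 - qw) * ((1 - pw) * exp (- s) + main s v + pw * ((-1) ^ n * lagw n 0 (2 * s))) + qw * ring s v"
proof -
 define z where "z = polar (s, v)"
 have pp: "phase_point z = of_real (sqrt (2 * s)) * cis v" unfolding z_def by (rule phase_point_polar [OF s])
 have "pi * wigner rho (fst z) (snd z) = (1 - qw) * Re (inner_L2 (st 0) (weyl (phase_point z) (st 0)))
   + (\<Sum>j<Jn. qw / real Jn * Re (inner_L2 (st (Suc j)) (weyl (phase_point z) (st (Suc j)))))"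
  unfolding rho_def wigner_mixture sum_states by (simp add: wt_def)
 also have "Re (inner_L2 (st 0) (weyl (phase_point z) (st 0))) = (1 - pw) * exp (- s) + main s v + pw * ((-1) ^ n * lagw n 0 (2 * s))"
  unfolding pp main_def st_def using fock_superposition(4) [OF n_pos pw01 s, of v] by (simp del: fock.simps)
 also have "(\<Sum>j<Jn. qw / real Jn * Re (inner_L2 (st (Suc j)) (weyl (phase_point z) (st (Suc j))))) = qw * ring s v"
  unfolding ring_def sum_divide_distrib sum_distrib_left z_def
  by (rule sum.cong [OF refl]) (simp add: st_def squeezed_ring(4) [OF kap_1 s])
 finally show ?thesis unfolding z_def .
qed

lemma ring_bounds: "0 \<le> ring s v" "ring s v \<le> 1"
proof -
 show "0 \<le> ring s v" unfolding ring_def by (intro divide_nonneg_nonneg sum_nonneg) auto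
 have "(\<Sum>j<Jn. exp (- (kap * (sqrt s * cos (v - 2 * pi * real j / real Jn) - sqrt R)^2 + (sqrt s * sin (v - 2 * pi * real j / real Jn))^2 / kap))) \<le> (\<Sum>j<Jn. 1)"
 proof (rule sum_mono)
  fix j
  show "exp (- (kap * (sqrt s * cos (v - 2 * pi * real j / real Jn) - sqrt R)^2 + (sqrt s * sin (v - 2 * pi * real j / real Jn))^2 / kap)) \<le> 1"
   using kap(1) by (simp add: field_simps)
 qed
 then show "ring s v \<le> 1" unfolding ring_def using Jn(1) by simp
qed

text \<open>A point at squared radius \<open>R + t\<close> lies on the tangent to the circle of
  radius \<open>sqrt R\<close> at the direction turned back by \<open>y\<close>, at distance
  \<open>sqrt t\<close> from the point of contact. A ring state centred near that direction is long
  along this tangent, so \<open>t\<close> enters the exponent only as a multiple of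
  \<open>t / kap\<close>. The offset \<open>e\<close> to the grid adds the constants
  \<open>4096 + 256 = 4352\<close>.\<close>

lemma ring_ge:
 assumes t: "0 \<le> t" shows "exp (- 4352 - 4/5 * t) / real Jn \<le> ring (R + t) v"
proof -
 define s where "s = R + t"
 define r where "r = sqrt R"
 have s: "0 < s" "R \<le> s" using R_bounds t by (auto simp: s_def)
 have r: "0 \<le> r" "r^2 = R" using R_bounds by (auto simp: r_def)
 define y where "y = arccos (sqrt (R / s))"
 have le1: "sqrt (R / s) \<le> 1" using s by simp
 have ge0: "0 \<le> sqrt (R / s)" using s R_bounds by simp
 have cs: "cos y = sqrt (R / s)" unfolding y_def by (rule cos_arccos) (use le1 ge0 in linarith)+
 have sn: "sin y = sqrt (t / s)"
 proof -
  have "sin y = sqrt (1 - (sqrt (R / s))^2)" unfolding y_def by (rule sin_arccos) (use le1 ge0 in linarith)+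
  also have "1 - (sqrt (R / s))^2 = t / s" using s R_bounds by (simp add: s_def field_simps)
  finally show ?thesis .
 qed
 have sc: "sqrt s * cos y = r" "sqrt s * sin y = sqrt t"
  using s unfolding cs sn r_def by (simp_all add: real_sqrt_mult [symmetric])
 obtain j e where j: "j < Jn" and e: "0 \<le> e" "e \<le> 2 * pi / real Jn"
  and cse: "cos (v - y - 2 * pi * real j / real Jn) = cos e" "sin (v - y - 2 * pi * real j / real Jn) = sin e"
  using grid_angle [OF Jn(1), of "v - y"] by blast
 define u where "u = 2 * pi * real j / real Jn"
 have u: "v - u = (v - y - u) + y" by simp
 have U: "sqrt s * cos (v - u) - r = r * (cos e - 1) - sqrt t * sin e"
 proof -
  have "sqrt s * cos (v - u) = cos (v - y - u) * (sqrt s * cos y) - sin (v - y - u) * (sqrt s * sin y)"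
   unfolding u cos_add by (simp add: algebra_simps)
  then show ?thesis using cse unfolding sc u_def by (simp add: algebra_simps)
 qed
 have V: "sqrt s * sin (v - u) = sqrt t * cos e + r * sin e"
 proof -
  have "sqrt s * sin (v - u) = sin (v - y - u) * (sqrt s * cos y) + cos (v - y - u) * (sqrt s * sin y)"
   unfolding u sin_add by (simp add: algebra_simps)
  then show ?thesis using cse unfolding sc u_def by simp
 qed
 have e8: "e \<le> 8 / kap"
 proof -
  have "2 * pi / real Jn \<le> 8 / kap" using Jn kap pi_less_4 by (intro frac_le) auto
  then show ?thesis using e by linarith
 qed
 have e2: "e^2 \<le> 64 / kap^2" using power_mono [OF e8 e(1), of 2] by (simp add: power_divide)
 have c1: "\<bar>cos e - 1\<bar> \<le> e^2 / 2"
 proof -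
  have "1 - cos e = 2 * (sin (e / 2))^2" using cos_double_sin [of "e / 2"] by simp
  also have "\<dots> \<le> 2 * (e / 2)^2"
  proof -
   have "\<bar>sin (e / 2)\<bar> \<le> \<bar>e / 2\<bar>" by (rule abs_sin_x_le_abs_x)
   then show ?thesis by (simp only: abs_le_square_iff)
  qed
  also have "\<dots> = e^2 / 2" by (simp add: power_divide)
  finally show ?thesis using cos_le_one [of e] by linarith
 qed
 have s1: "\<bar>sin e\<bar> \<le> e" using abs_sin_x_le_abs_x [of e] e by simp
 have sq: "(a + b)^2 \<le> 2 * (a^2 + b^2)" for a b :: real
  using zero_le_power2 [of "a - b"] by (simp add: power2_eq_square algebra_simps)
 have k0: "0 < kap" using kap by simp
 have RL: "R / kap ^ 3 \<le> 2" using R_bounds kap by (simp add: divide_le_eq)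
 have "kap * (sqrt s * cos (v - u) - r)^2 \<le> 4096 + 128 * t / kap"
 proof -
  have "\<bar>r * (cos e - 1) - sqrt t * sin e\<bar> \<le> r * (e^2 / 2) + sqrt t * e"
  proof -
   have "\<bar>r * (cos e - 1)\<bar> \<le> r * (e^2 / 2)" using mult_left_mono [OF c1 r(1)] r(1) by (simp only: abs_mult abs_of_nonneg)
   moreover have "\<bar>sqrt t * sin e\<bar> \<le> sqrt t * e" using s1 t by (simp add: abs_mult mult_left_mono)
   ultimately show ?thesis by linarith
  qed
  then have "(r * (cos e - 1) - sqrt t * sin e)^2 \<le> (r * (e^2 / 2) + sqrt t * e)^2" by (metis abs_ge_zero power2_abs power_mono)
  also have "\<dots> \<le> 2 * ((r * (e^2 / 2))^2 + (sqrt t * e)^2)" by (rule sq)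
  also have "\<dots> = R / 2 * (e^2)^2 + 2 * t * e^2" using t r by (simp add: power_mult_distrib power_divide)
  also have "\<dots> \<le> R / 2 * (64 / kap^2)^2 + 2 * t * (64 / kap^2)"
   using R_bounds t e2 by (intro add_mono mult_left_mono power_mono) auto
  finally have "kap * (sqrt s * cos (v - u) - r)^2 \<le> kap * (R / 2 * (64 / kap^2)^2 + 2 * t * (64 / kap^2))"
   using k0 unfolding U by simp
  also have "\<dots> = 2048 * (R / kap ^ 3) + 128 * t / kap" by (simp add: field_simps power2_eq_square power3_eq_cube)
  finally show ?thesis using RL by linarith
 qed
 moreover have "(sqrt s * sin (v - u))^2 / kap \<le> 256 + 2 * t / kap"
 proof -
  have "(sqrt t * cos e + r * sin e)^2 \<le> 2 * ((sqrt t * cos e)^2 + (r * sin e)^2)" by (rule sq)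
  also have "\<dots> = 2 * (t * (cos e)^2 + R * (sin e)^2)" using t r by (simp add: power_mult_distrib)
  also have "\<dots> \<le> 2 * (t * 1 + R * (64 / kap^2))"
  proof -
   have "(sin e)^2 \<le> e^2" using s1 e by (simp add: abs_le_square_iff [symmetric])
   then have "(sin e)^2 \<le> 64 / kap^2" using e2 by linarith
   moreover have "(cos e)^2 \<le> 1" by (simp add: abs_square_le_1)
   ultimately show ?thesis using t R_bounds by (intro mult_left_mono add_mono) auto
  qed
  finally have "(sqrt s * sin (v - u))^2 / kap \<le> 2 * (t * 1 + R * (64 / kap^2)) / kap"
   unfolding V using k0 by (intro divide_right_mono) auto
  also have "\<dots> = 128 * (R / kap ^ 3) + 2 * t / kap" using k0 by (simp add: field_simps power2_eq_square power3_eq_cube)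
  finally show ?thesis using RL by linarith
 qed
 ultimately have "kap * (sqrt s * cos (v - u) - r)^2 + (sqrt s * sin (v - u))^2 / kap \<le> 4352 + 130 * t / kap" by simp
 \<comment> \<open>\<open>200 \<le> kap\<close> makes the ring decay no faster than the rate 4/5 of
   \<open>cross_outside\<close>.\<close>
 also have "130 * t / kap \<le> 4/5 * t" using kap t mult_left_mono [of 200 kap t] k0 by (simp add: divide_le_eq)
 finally have ex: "kap * (sqrt s * cos (v - u) - r)^2 + (sqrt s * sin (v - u))^2 / kap \<le> 4352 + 4/5 * t" by simp
 define g where "g j = exp (- (kap * (sqrt s * cos (v - 2 * pi * real j / real Jn) - r)^2 + (sqrt s * sin (v - 2 * pi * real j / real Jn))^2 / kap))" for j
 have "exp (- 4352 - 4/5 * t) \<le> g j" unfolding g_def using ex unfolding u_def by simp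
 also have "g j \<le> (\<Sum>j<Jn. g j)" using j by (intro member_le_sum) (auto simp: g_def)
 finally have "exp (- 4352 - 4/5 * t) / real Jn \<le> (\<Sum>j<Jn. g j) / real Jn" by (rule divide_right_mono) simp
 then show ?thesis unfolding ring_def g_def s_def r_def .
qed

lemma pw_power: "pw * ((2 * R) ^ n / fact n) \<le> exp (- 10000)"
proof -
 have "E * (2 * R) ^ n / (real n * fact n) \<le> exp 8"
  using stirling_balance(1) n_pos by (simp add: E_def exp_minus field_simps)
 from mult_left_mono [OF this, of "exp (- 10008)"]
 show ?thesis by (simp add: pw_def exp_add [symmetric])
qed

lemma lagw_0_nonneg: "0 \<le> s \<Longrightarrow> 0 \<le> lagw 0 k (2 * s)" by (simp add: lagw_def)

lemma main_abs_le: "0 \<le> s \<Longrightarrow> \<bar>main s v\<bar> \<le> 2 * (sqrt pw * lagw 0 n (2 * s))"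
proof -
 assume s: "0 \<le> s"
 have "\<bar>main s v\<bar> = 2 * (sqrt (1 - pw) * \<bar>cos (real n * v)\<bar>) * (sqrt pw * lagw 0 n (2 * s))"
  using pw01 lagw_0_nonneg [OF s] unfolding main_def by (simp add: abs_mult)
 also have "\<dots> \<le> 2 * (1 * 1) * (sqrt pw * lagw 0 n (2 * s))"
  using pw01 lagw_0_nonneg [OF s] by (intro mult_right_mono mult_left_mono mult_mono) auto
 finally show ?thesis by simp
qed

text \<open>The squared ratio to the vacuum is \<open>pw * (2 * s) ^ n / n!\<close>, which grows
  with \<open>s\<close> and is bounded at \<open>s = R\<close> by \<open>pw_power\<close>.\<close>

lemma cross_inside: "0 \<le> s \<Longrightarrow> s \<le> R \<Longrightarrow> sqrt pw * lagw 0 n (2 * s) \<le> exp (- 5000) * exp (- s)"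
proof (rule power2_le_imp_le)
 assume s: "0 \<le> s" "s \<le> R"
 have "(sqrt pw * lagw 0 n (2 * s))^2 = pw * ((2 * s) ^ n / fact n) * exp (- (2 * s))"
  using pw01 s by (simp add: power_mult_distrib lagw_0_sq)
 also have "\<dots> \<le> pw * ((2 * R) ^ n / fact n) * exp (- (2 * s))"
  using pw01 s by (intro mult_right_mono mult_left_mono divide_right_mono power_mono) auto
 also have "\<dots> \<le> exp (- 10000) * exp (- (2 * s))" using pw_power by (intro mult_right_mono) auto
 also have "\<dots> = (exp (- 5000) * exp (- s))^2" by (simp add: power2_eq_square exp_add [symmetric])
 finally show "(sqrt pw * lagw 0 n (2 * s))^2 \<le> (exp (- 5000) * exp (- s))^2" .
qed simp

text \<open>As \<open>n \<le> 2 * R / 5\<close>, the factor \<open>(1 + t / R) ^ n\<close> grows at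
  most like \<open>exp (2/5 * t)\<close>; under the square root this reduces the decay rate from 1
  to 4/5.\<close>

lemma cross_outside: "0 \<le> t \<Longrightarrow> sqrt pw * lagw 0 n (2 * (R + t)) \<le> exp (- 5000 - R - 4/5 * t)"
proof (rule power2_le_imp_le)
 assume t: "0 \<le> t"
 define s where "s = R + t"
 have "2 * s = (2 * R) * (1 + t / R)" using R_bounds by (simp add: s_def field_simps)
 then have "(2 * s) ^ n = (2 * R) ^ n * (1 + t / R) ^ n" by (simp only: power_mult_distrib)
 also have "(1 + t / R) ^ n \<le> exp (t / R) ^ n" using t R_bounds by (intro power_mono) auto
 also have "exp (t / R) ^ n = exp (real n * (t / R))" by (rule exp_of_nat_mult [symmetric])
 also have "real n * (t / R) \<le> 2/5 * t"
 proof -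
  have "real n \<le> 2/5 * R" using n_bounds R_bounds by linarith
  from mult_right_mono [OF this t] show ?thesis using R_bounds by (simp add: divide_le_eq mult_ac)
 qed
 finally have pws: "(2 * s) ^ n \<le> (2 * R) ^ n * exp (2/5 * t)" using R_bounds by simp
 have "(sqrt pw * lagw 0 n (2 * s))^2 = pw * ((2 * s) ^ n / fact n) * exp (- (2 * s))"
  using pw01 t R_bounds by (simp add: s_def power_mult_distrib lagw_0_sq)
 also have "\<dots> \<le> pw * (((2 * R) ^ n * exp (2/5 * t)) / fact n) * exp (- (2 * s))"
  using pw01 pws by (intro mult_right_mono mult_left_mono divide_right_mono) auto
 also have "\<dots> \<le> exp (- 10000) * (exp (2/5 * t) * exp (- (2 * s)))" using pw_power by (simp add: field_simps)
 also have "\<dots> = (exp (- 5000 - R - 4/5 * t))^2" by (simp add: power2_eq_square exp_add [symmetric] s_def)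
 finally show "(sqrt pw * lagw 0 n (2 * (R + t)))^2 \<le> (exp (- 5000 - R - 4/5 * t))^2" by (simp add: s_def)
qed simp

lemma exp_5000: "32 * exp (- 5000 :: real) < exp (- 4352)"
proof -
 have "(2::real) ^ 5 \<le> exp 1 ^ 5" using exp_ge_add_one_self [of "1::real"] by (intro power_mono) auto
 then have "32 * exp (- 5000 :: real) \<le> exp 5 * exp (- 5000)" by (simp add: exp_of_nat_mult [symmetric])
 also have "\<dots> < exp (- 4352)" by (simp add: exp_add [symmetric])
 finally show ?thesis .
qed

lemma exp_5000_small: "exp (- 5000 :: real) \<le> 1/64"
 using exp_ge_add_one_self [of 5000] by (simp add: exp_minus field_simps)

text \<open>Up to \<open>s = R\<close> the vacuum dominates, beyond it the ring outweighs the cross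
  term. The contribution of the \<open>n\<close>-th Fock state is nonnegative from
  \<open>2 * n + 1\<close> on by \<open>alternating_lag_mono\<close>; before that it is at most
  \<open>E = exp (- L)\<close>, small against \<open>exp (- s)\<close> because
  \<open>2 * n + 1\<close> is well below \<open>L\<close>.\<close>

lemma wigner_rho_pos: "0 < wigner rho (fst z) (snd z)"
proof -
 define s where "s = radius_sq z"
 have s: "0 \<le> s" by (simp add: s_def)
 obtain v where z: "z = polar (s, v)" using polar_surj [of z] by (auto simp: s_def)
 define T where "T = (-1) ^ n * lagw n 0 (2 * s)"
 have Tpos: "0 \<le> T" if "2 * real n + 1 \<le> s"
  using alternating_lag_mono [of n "2 * s"] that by (simp add: T_def lagw_def mult_ac)
 have q1: "0 < 1 - qw" "1 - qw \<le> 1" using qw E_small by auto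
 have "0 < (1 - qw) * ((1 - pw) * exp (- s) + main s v + pw * T) + qw * ring s v"
 proof (cases "s \<le> R")
  case True
  have m: "- (1/32 * exp (- s)) \<le> main s v"
  proof -
   have "2 * (sqrt pw * lagw 0 n (2 * s)) \<le> 2 * (1/64 * exp (- s))"
    by (intro mult_left_mono order_trans [OF cross_inside [OF s True] mult_right_mono [OF exp_5000_small]]) auto
   then show ?thesis using main_abs_le [OF s, of v] by linarith
  qed
  have t: "- (1/4 * exp (- s)) \<le> pw * T"
  proof (cases "2 * real n + 1 \<le> s")
   case True
   have "0 \<le> pw * T" using Tpos [OF True] pw01 by simp
   moreover have "0 \<le> exp (- s)" by simp
   ultimately show ?thesis by linarith
  next
   case False
   have "\<bar>pw * T\<bar> \<le> E * 1"
    unfolding abs_mult using lagw_abs_le_1 [of "2 * s" n 0] s pw by (intro mult_mono) (auto simp: T_def abs_mult power_abs)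
   also have "\<dots> = exp (- L)" by (simp add: E_def)
   also have "\<dots> \<le> 1/4 * exp (- s)"
   proof -
    have "exp (- L) \<le> exp (- 3) * exp (- s)" using False n_bounds L_200 by (simp add: exp_add [symmetric])
    also have "\<dots> \<le> 1/4 * exp (- s)"
     using exp_ge_add_one_self [of "3::real"] by (intro mult_right_mono) (auto simp: exp_minus field_simps)
    finally show ?thesis .
   qed
   finally show ?thesis by linarith
  qed
  have "1/2 * exp (- s) \<le> (1 - pw) * exp (- s)" using pw E_small by simp
  moreover have "0 < exp (- s)" by simp
  ultimately have "0 < (1 - pw) * exp (- s) + main s v + pw * T" using m t by linarith
  then have "0 < (1 - qw) * ((1 - pw) * exp (- s) + main s v + pw * T)" using q1 by simp
  moreover have "0 \<le> qw * ring s v" using qw ring_bounds by simp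
  ultimately show ?thesis by linarith
 next
  case False
  define t where "t = s - R"
  have t: "0 \<le> t" "s = R + t" using False by (auto simp: t_def)
  define X where "X = exp (- R - 4/5 * t)"
  have X: "0 < X" by (simp add: X_def)
  have T0: "0 \<le> pw * T" using n_bounds R_bounds False L_200 Tpos pw01 by simp
  have main: "- (2 * exp (- 5000) * X) \<le> main s v"
  proof -
   have "exp (- 5000 - R - 4/5 * t) = exp (- 5000) * X" by (simp add: X_def exp_add [symmetric])
   then show ?thesis using main_abs_le [OF s, of v] cross_outside [OF t(1)] t(2) by auto
  qed
  have "exp (- 4352) * X \<le> 16 * (qw * ring s v)"
  proof -
   \<comment> \<open>A single ring state has weight \<open>qw / Jn\<close>, of order
     \<open>E / (L * kap)\<close>: \<open>R\<close> is the squared radius at which the vacuum has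
     decayed to that order.\<close>
   have eR: "exp (- R) = E / (L * kap)"
   proof -
    have "- R = - L + - (4/3 * ln L)" by (simp add: R_def)
    then have "exp (- R) = E * exp (- (4/3 * ln L))" by (simp only: exp_add E_def)
    also have "exp (- (4/3 * ln L)) = 1 / L powr (4/3)" using L_ge by (simp add: powr_def exp_minus inverse_eq_divide)
    also have "L powr (4/3) = L * kap" unfolding kap_def using L_ge powr_add [of L 1 "1/3"] by simp
    finally show ?thesis by simp
   qed
   have "exp (- 4352) * X = exp (- R) * exp (- 4352 - 4/5 * t)" by (simp add: X_def exp_add [symmetric])
   also have "\<dots> \<le> 16 * (E / (8 * L)) * (exp (- 4352 - 4/5 * t) / real Jn)"
    using Jn E_small L_ge kap unfolding eR by (simp add: field_simps)
   also have "\<dots> \<le> 16 * (E / (8 * L)) * ring s v"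
    unfolding t(2) using ring_ge [OF t(1)] E_small L_ge by (intro mult_left_mono) auto
   finally show ?thesis by (simp add: qw_def)
  qed
  moreover have "32 * exp (- 5000) * X < exp (- 4352) * X" using exp_5000 X by simp
  ultimately have r: "2 * exp (- 5000) * X < qw * ring s v" by linarith
  have "0 \<le> (1 - pw) * exp (- s)" using pw01 by simp
  then have "- (2 * exp (- 5000) * X) \<le> (1 - pw) * exp (- s) + main s v + pw * T" using main T0 by linarith
  from mult_left_mono [OF this, of "1 - qw"]
  have "(1 - qw) * (- (2 * exp (- 5000) * X)) \<le> (1 - qw) * ((1 - pw) * exp (- s) + main s v + pw * T)" using q1 by simp
  moreover have "1 * (- (2 * exp (- 5000) * X)) \<le> (1 - qw) * (- (2 * exp (- 5000) * X))" using q1 X by simp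
  ultimately show ?thesis using r by linarith
 qed
 then have "0 < pi * wigner rho (fst z) (snd z)" unfolding z T_def wigner_rho [OF s] .
 then show ?thesis by (simp add: zero_less_mult_iff)
qed

end

section \<open>The entropy deficit of the trial state\<close>

lemma gam_ge:
 assumes R: "0 < R" shows "fact n * (1 - real (Suc n) / R) \<le> gam n R"
proof -
 have g: "integrable lborel (\<lambda>s. indicator {0<..} s *\<^sub>R (s ^ i * exp (- s :: real)))"
  "(LINT s|lborel. indicator {0<..} s *\<^sub>R (s ^ i * exp (- s :: real))) = fact i" for i
  using gamma_integral [of 1 i] by (auto simp: has_bochner_integral_iff)
 have gi: "integrable lborel (\<lambda>s. indicator {0<..<R} s *\<^sub>R (s ^ n * exp (- s)))"
  using gam_integrable [of R n] by (simp add: set_integrable_def)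
 \<comment> \<open>Markov's inequality: beyond \<open>R\<close> the integrand is at most
   \<open>s / R\<close> times itself.\<close>
 have "(LINT s|lborel. indicator {0<..} s *\<^sub>R (s ^ n * exp (- s :: real)))
   \<le> (LINT s|lborel. indicator {0<..<R} s *\<^sub>R (s ^ n * exp (- s)) + (indicator {0<..} s *\<^sub>R (s ^ Suc n * exp (- s))) / R)"
 proof (rule integral_mono [OF g(1)])
  show "integrable lborel (\<lambda>s. indicator {0<..<R} s *\<^sub>R (s ^ n * exp (- s)) + (indicator {0<..} s *\<^sub>R (s ^ Suc n * exp (- s))) / R)"
   using gi g(1) [of "Suc n"] by auto
  fix s :: real
  have "s ^ n * exp (- s) \<le> s ^ Suc n * exp (- s) / R" if "R \<le> s"
   using that R by (simp add: field_simps)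
  moreover have "0 \<le> s ^ Suc n * exp (- s) / R" if "0 < s" using that R by simp
  ultimately show "indicator {0<..} s *\<^sub>R (s ^ n * exp (- s)) \<le> indicator {0<..<R} s *\<^sub>R (s ^ n * exp (- s)) + (indicator {0<..} s *\<^sub>R (s ^ Suc n * exp (- s))) / R"
   by (auto simp: indicator_def)
 qed
 also have "\<dots> = gam n R + fact (Suc n) / R" using gi g [of "Suc n"] by (simp add: gam_def set_lebesgue_integral_def)
 finally have "fact n \<le> gam n R + fact (Suc n) / R" unfolding g(2) .
 then show ?thesis by (simp add: algebra_simps)
qed

lemma cos_sq_integral:
 assumes n: "0 < n"
 shows "set_integrable lborel {0<..<2*pi} (\<lambda>t. (cos (real n * t))^2)" "(LINT t:{0<..<2*pi}|lborel. (cos (real n * t))\<^sup>2) = pi"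
proof -
 have eq: "(cos (real n * t))^2 = 1/2 + 1/2 * Re (cis (of_int (2 * int n) * t))" for t
  using cos_double_cos [of "real n * t"] by (simp add: mult.assoc diff_divide_distrib)
 have c: "set_integrable lborel {0<..<2*pi} (\<lambda>t. 1/2 :: real)" "(LINT t:{0<..<2*pi}|lborel. 1/2 :: real) = pi"
  by (simp_all add: set_integrable_def set_lebesgue_integral_def)
 have z: "set_integrable lborel {0<..<2*pi} (\<lambda>t. Re (cis (of_int (2 * int n) * t)))" "(LINT t:{0<..<2*pi}|lborel. Re (cis (of_int (2 * int n) * t))) = 0"
  using integrable_Re [OF set_integral_cis(1) [of "2 * int n", unfolded set_integrable_def]]
   integral_Re [OF set_integral_cis(1) [of "2 * int n", unfolded set_integrable_def]] arg_cong [OF set_integral_cis(2) [of "2 * int n"], of Re] n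
  unfolding set_lebesgue_integral_def set_integrable_def by simp_all
 show "set_integrable lborel {0<..<2*pi} (\<lambda>t. (cos (real n * t))^2)"
  unfolding eq by (intro set_integral_add(1) c(1) set_integrable_mult_right z(1))
 show "(LINT t:{0<..<2*pi}|lborel. (cos (real n * t))\<^sup>2) = pi"
  unfolding eq by (subst set_integral_add(2) [OF c(1) set_integrable_mult_right [OF z(1)]]) (simp only: set_integral_mult_right z(2) c(2))
qed

lemma x_ln_x_ge: "0 < y \<Longrightarrow> y - 1 \<le> y * ln (y :: real)"
proof -
 assume y: "0 < y"
 have "ln (1 / y) \<le> 1 / y - 1" using y by (intro ln_le_minus_one) simp
 then show ?thesis using y by (simp add: ln_div field_simps)
qed

text \<open>\<open>y ln y - y + 1 \<ge> (sqrt y - 1)\<^sup>2\<close>, and \<open>(1 + sqrt 2)\<^sup>2 \<le> 6\<close>.\<close>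

lemma x_ln_x_ge_square:
 assumes y: "0 < y" "y \<le> (2 :: real)" shows "y - 1 + (y - 1)^2 / 6 \<le> y * ln y"
proof -
 define r where "r = sqrt y"
 have r: "0 < r" "r * r = y" using y by (auto simp: r_def)
 have "r \<le> sqrt 2" using y by (simp add: r_def)
 also have "\<dots> \<le> 1.44" by (rule real_le_lsqrt) (auto simp: power2_eq_square)
 finally have r2: "(r + 1)^2 \<le> 6" using r power_mono [of "r + 1" "2.44" 2] by (simp add: power2_eq_square)
 have "(y - 1)^2 = (r - 1)^2 * (r + 1)^2" unfolding r(2) [symmetric] by (simp add: power2_eq_square algebra_simps)
 also have "\<dots> \<le> (r - 1)^2 * 6" using r2 by (rule mult_left_mono) simp
 finally have 1: "(y - 1)^2 / 6 \<le> (r - 1)^2" by simp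
 have "r - 1 \<le> r * ln r" by (rule x_ln_x_ge [OF r(1)])
 then have "2 * r * (r - 1) \<le> y * ln y" using r unfolding r(2) [symmetric] by (simp add: ln_mult)
 then show ?thesis using 1 unfolding r(2) [symmetric] by (simp add: power2_eq_square algebra_simps)
qed

context lower_scale
begin

text \<open>The facts proved for the upper bound now supply integrability, mass and second moment of
  the trial Wigner function.\<close>

sublocale state: nonneg_state rho E
proof
 show "density_operator rho" by (rule rho_density)
 then interpret density_state rho by unfold_locales
 show "0 \<le> wig z" for z unfolding wig_def using wigner_rho_pos [of z] by simp
qed (use E_small rho_energy in auto)

text \<open>The interference term, written through \<open>mel\<close> so that its continuity on
  phase space is immediate; \<open>osc_polar\<close> is the form used in estimates.\<close>

definition osc :: "real \<times> real \<Rightarrow> real" where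
 "osc z = (1 - qw) * (2 * sqrt (1 - pw) * sqrt pw * Re (mel (phase_point z) n 0))"

lemma osc_polar: "0 \<le> s \<Longrightarrow> osc (polar (s, v)) = (1 - qw) * main s v"
 using mel_polar_mlag [of "2 * s" v n 0] by (simp add: osc_def phase_point_polar main_def mlag_def)

lemma osc_measurable [measurable]: "osc \<in> borel_measurable borel"
 unfolding osc_def by (intro borel_measurable_continuous_onI continuous_intros state.mel_continuous)

text \<open>In units of \<open>E\<close> the errors are 2 for the lost vacuum weight, 1 for the
  \<open>n\<close>-th Fock state and 1 for the ring.\<close>

lemma wig_osc: "\<bar>pi * state.wig z - exp (- radius_sq z) - osc z\<bar> \<le> 4 * E"
proof -
 define s where "s = radius_sq z"
 have s: "0 \<le> s" by (simp add: s_def)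
 obtain v where z: "z = polar (s, v)" using polar_surj [of z] by (auto simp: s_def)
 define T where "T = (-1) ^ n * lagw n 0 (2 * s)"
 have T: "\<bar>T\<bar> \<le> 1" using lagw_abs_le_1 [of "2 * s" n 0] s by (simp add: T_def abs_mult)
 have qp: "0 < qw" "qw \<le> E" "0 < pw" "pw \<le> E" "E \<le> 1/200" using qw pw E_small by auto
 have e: "pi * state.wig z - exp (- s) - osc z = ((1 - qw) * (1 - pw) - 1) * exp (- s) + (1 - qw) * (pw * T) + qw * ring s v"
  using wigner_rho [OF s, of v] osc_polar [OF s, of v] unfolding state.wig_def z T_def by (simp add: algebra_simps)
 have "\<bar>((1 - qw) * (1 - pw) - 1) * exp (- s)\<bar> \<le> (2 * E) * 1"
  unfolding abs_mult
 proof (rule mult_mono)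
  have "(1 - qw) * (1 - pw) - 1 = qw * pw - (qw + pw)" by (simp add: algebra_simps)
  moreover have "0 \<le> qw * pw" "qw * pw \<le> qw * 1" using qp by auto
  ultimately show "\<bar>(1 - qw) * (1 - pw) - 1\<bar> \<le> 2 * E" using qp by linarith
 qed (use qp s in auto)
 moreover have "\<bar>(1 - qw) * (pw * T)\<bar> \<le> 1 * (E * 1)"
  unfolding abs_mult using qp T by (intro mult_mono) auto
 moreover have "\<bar>qw * ring s v\<bar> \<le> E * 1"
  unfolding abs_mult using qp ring_bounds [of s v] by (intro mult_mono) auto
 ultimately show ?thesis unfolding s_def [symmetric] e by linarith
qed

lemma osc_small: "radius_sq z \<le> R \<Longrightarrow> \<bar>osc z\<bar> \<le> 1/4 * exp (- radius_sq z)"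
proof -
 define s where "s = radius_sq z"
 assume "radius_sq z \<le> R"
 then have s: "0 \<le> s" "s \<le> R" by (simp_all add: s_def)
 obtain v where z: "z = polar (s, v)" using polar_surj [of z] by (auto simp: s_def)
 have "\<bar>osc z\<bar> = (1 - qw) * \<bar>main s v\<bar>" unfolding z osc_polar [OF s(1)] using qw E_small by (simp add: abs_mult)
 also have "\<dots> \<le> 1 * (2 * (1/64 * exp (- s)))"
  using qw order_trans [OF main_abs_le [OF s(1), of v] mult_left_mono [OF order_trans [OF cross_inside [OF s] mult_right_mono [OF exp_5000_small]]]]
  by (intro mult_mono) auto
 finally show ?thesis unfolding s_def [symmetric] by linarith
qed

text \<open>On the disc \<open>s < L / 2\<close> the Wigner function is at most twice the vacuum, so
  \<open>x_ln_x_ge_square\<close> bounds the relative entropy from below by a sixth of the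
  chi-square distance, whose main part is the interference term. The disc contains a fixed share of
  the mass of \<open>s ^ n * exp (- s)\<close>, yet \<open>E * exp (L / 2)\<close> is still small.
  The loss \<open>5 * E\<close> covers \<open>2 * E\<close> from the second moment and
  \<open>16 * E / 6\<close> from the errors.\<close>

lemma deficit_lower:
 "exp (- 10008) / 60 * (E * 2 ^ n / real n) - 5 * E \<le> 1 + ln pi - wigner_entropy (wigner rho)"
proof -
 define w0 where "w0 z = exp (- radius_sq z) / pi" for z
 define W where "W = state.wig"
 define ball where "ball z = (indicator {..<L / 2} (radius_sq z) :: real)" for z
 define Y where "Y z = pi * exp (radius_sq z) * (W z - w0 z)^2" for z
 have [measurable]: "w0 \<in> borel_measurable borel" "W \<in> borel_measurable borel"
  unfolding w0_def W_def by measurable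
 have Ym: "Y \<in> borel_measurable borel" unfolding Y_def by measurable
 have w0p: "0 < w0 z" for z by (simp add: w0_def)
 have Wp: "0 < W z" for z unfolding W_def state.wig_def by (rule wigner_rho_pos)
 have pieq: "pi * w0 z = exp (- radius_sq z)" for z by (simp add: w0_def)
 have EL: "E * exp (L / 2) = exp (- (L / 2))" by (simp add: E_def exp_add [symmetric])
 have small: "exp (- (L / 2)) \<le> 1/16"
  using exp_ge_add_one_self [of "L / 2"] L_200 by (simp add: exp_minus field_simps)
 have W2: "W z \<le> 2 * w0 z" if "radius_sq z < L / 2" for z
 proof -
  have "4 * E \<le> 1/4 * exp (- radius_sq z)"
  proof -
   have "E = exp (- (L / 2)) * exp (- (L / 2))" by (simp add: E_def exp_add [symmetric])
   also have "\<dots> \<le> 1/16 * exp (- radius_sq z)" using small that by (intro mult_mono) auto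
   finally show ?thesis by simp
  qed
  then have "pi * W z \<le> pi * (2 * w0 z)"
   using wig_osc [of z] osc_small [of z] that R_bounds L_ge pieq [of z] unfolding W_def by linarith
  then show ?thesis by simp
 qed
 have Yb: "\<bar>Y z\<bar> \<le> pi * exp (L / 2) * 2^2" if "radius_sq z < L / 2" for z
 proof -
  have "w0 z \<le> 1"
  proof -
   have "exp (- radius_sq z) \<le> 1" by simp
   then have "exp (- radius_sq z) \<le> pi" using pi_ge_two by linarith
   then show ?thesis unfolding w0_def by simp
  qed
  then have "\<bar>W z - w0 z\<bar> \<le> 2" using Wp [of z] W2 [OF that] by linarith
  then have "(W z - w0 z)^2 \<le> 2^2" by (metis abs_ge_zero power2_abs power_mono)
  then show ?thesis unfolding Y_def using that by (auto simp: abs_mult intro!: mult_mono)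
 qed
 have iY: "integrable lborel (\<lambda>z. ball z * Y z)" unfolding ball_def by (rule ball_integrable [OF Ym Yb])
 have pointwise: "W z - w0 z - W z * radius_sq z - W z * ln pi + ball z * Y z / 6 \<le> W z * ln (W z)" for z
 proof -
  define y where "y = W z / w0 z"
  have y: "0 < y" "W z = w0 z * y" using Wp [of z] w0p [of z] by (auto simp: y_def)
  have ln: "ln (W z) = ln y - radius_sq z - ln pi" using y(1) unfolding y(2) by (simp add: w0_def ln_mult ln_div)
  have Yy: "Y z = w0 z * (y - 1)^2" by (simp add: w0_def exp_add [symmetric] power2_eq_square field_simps Y_def y(2))
  have "y - 1 + ball z * (y - 1)^2 / 6 \<le> y * ln y"
  proof (cases "radius_sq z < L / 2")
   case True
   show ?thesis using W2 [OF True] w0p [of z] x_ln_x_ge_square [OF y(1)] True by (simp add: y_def divide_le_eq ball_def)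
  next
   case False
   then show ?thesis using x_ln_x_ge [OF y(1)] by (simp add: ball_def)
  qed
  from mult_left_mono [OF this less_imp_le [OF w0p [of z]]]
  show ?thesis unfolding ln Yy unfolding y(2) by (simp add: algebra_simps)
 qed
 have iw0: "integrable lborel w0" "(LINT z|lborel. w0 z) = 1"
  using state.exp_radius_integrable [of 1] exp_radius_integral [of 1] by (simp_all add: w0_def [abs_def])
 note iW = state.wig_integrable [folded W_def] state.wig_integral [folded W_def] state.wig_radius_integrable [folded W_def]
  state.wig_radius_integral [folded W_def] state.wig_ln_integrable [folded W_def]
 have "(LINT z|lborel. W z - w0 z - W z * radius_sq z - W z * ln pi + ball z * Y z / 6) \<le> (LINT z|lborel. W z * ln (W z))"
  by (rule integral_mono [OF _ iW(5) pointwise]) (use iW iw0 iY in auto)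
 also have "(LINT z|lborel. W z - w0 z - W z * radius_sq z - W z * ln pi + ball z * Y z / 6)
   = 1 - 1 - (LINT z|lborel. W z * radius_sq z) - ln pi + (LINT z|lborel. ball z * Y z) / 6"
  using iW iw0 iY by simp
 finally have d: "(LINT z|lborel. ball z * Y z) / 6 - 2 * E \<le> 1 + ln pi - wigner_entropy (wigner rho)"
  using iW(4) unfolding state.entropy_eq W_def [symmetric] by linarith
 define c where "c = (1 - qw)^2 * (1 - pw) * pw"
 \<comment> \<open>The sign is reversed because \<open>ball_integral_le\<close> gives upper bounds.
   For an error \<open>e\<close> of modulus at most \<open>4 * E\<close>,
   \<open>osc^2 / 2 - 16 * E^2\<close> is at most \<open>(osc + e)^2\<close>.\<close>
 define f where "f z = - (exp (radius_sq z) / pi * ((osc z)^2 / 2 - 16 * E^2))" for z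
 define g where "g s = (- (c * 2 ^ n / fact n)) * (s ^ n * exp (- s)) + 16 * E^2 * exp (1 * s)" for s
 have fm: "f \<in> borel_measurable borel" unfolding f_def by measurable
 have fb: "\<bar>f z\<bar> \<le> exp (L / 2) / pi * 17" if "radius_sq z < L / 2" for z
 proof -
  have "radius_sq z \<le> R" using that R_bounds by linarith
  moreover have "exp (- radius_sq z) \<le> 1" by simp
  ultimately have "\<bar>osc z\<bar> \<le> 1" using osc_small [of z] by linarith
  then have "(osc z)^2 \<le> 1" by (simp add: abs_square_le_1)
  moreover have "E^2 \<le> 1" using E_small by (simp add: power_le_one)
  ultimately have "\<bar>(osc z)\<^sup>2 / 2 - 16 * E^2\<bar> \<le> 17" using zero_le_power2 [of "osc z"] zero_le_power2 [of E] by linarith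
  then show ?thesis unfolding f_def using that by (auto simp: abs_mult intro!: mult_mono divide_right_mono)
 qed
 have gi1: "set_integrable lborel {0<..<L/2} (\<lambda>s. (- (c * 2 ^ n / fact n)) * (s ^ n * exp (- s)))"
  by (intro set_integrable_mult_right gam_integrable)
 have gi2: "set_integrable lborel {0<..<L/2} (\<lambda>s. 16 * E^2 * exp (1 * s))"
  by (intro set_integrable_mult_right exp_ball_integrable)
 have "(LINT z|lborel. ball z * f z) \<le> (LINT s:{0<..<L/2}|lborel. g s)"
  unfolding ball_def
 proof (rule ball_integral_le [OF fm fb])
  show "set_integrable lborel {0<..<L/2} g" unfolding g_def by (intro set_integral_add(1) gi1 gi2)
  fix s assume s: "0 < s" "s < L / 2"
  define k where "k = 2 * c * (lagw 0 n (2 * s))^2"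
  have fz: "f (polar (s, t)) = (- (exp s / pi * k)) * (cos (real n * t))^2 + 16 * E^2 * exp s / pi" for t
  proof -
   have "(osc (polar (s, t)))^2 / 2 = k * (cos (real n * t))^2"
    using s pw01 by ((simp only: osc_polar main_def power_mult_distrib less_imp_le), (simp add: k_def c_def mult_ac))
   then show ?thesis unfolding f_def using s by (simp add: algebra_simps)
  qed
  have i1: "set_integrable lborel {0<..<2*pi} (\<lambda>t. (- (exp s / pi * k)) * (cos (real n * t))^2)"
   by (rule set_integrable_mult_right [OF cos_sq_integral(1) [OF n_pos]])
  have i2: "set_integrable lborel {0<..<2*pi} (\<lambda>t. 16 * E^2 * exp s / pi)" "(LINT t:{0<..<2*pi}|lborel. 16 * E^2 * exp s / pi) = 2 * (16 * E^2 * exp s)"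
   by (simp_all add: set_integrable_def set_lebesgue_integral_def)
  have "(LINT t:{0<..<2*pi}|lborel. f (polar (s, t))) = (- (exp s / pi * k)) * pi + 2 * (16 * E^2 * exp s)"
   unfolding fz by (subst set_integral_add(2) [OF i1 i2(1)]) (simp only: set_integral_mult_right cos_sq_integral(2) [OF n_pos] i2(2))
  also have "exp s / pi * k * pi = 2 * (c * 2 ^ n / fact n * (s ^ n * exp (- s)))"
   using s by (simp add: lagw_0_sq exp_add [symmetric] k_def)
  then have "(- (exp s / pi * k)) * pi + 2 * (16 * E^2 * exp s) = 2 * g s" by (simp add: g_def)
  finally show "(LINT t:{0<..<2*pi}|lborel. f (polar (s, t))) \<le> 2 * g s" by simp
 qed
 also have "\<dots> = (- (c * 2 ^ n / fact n)) * gam n (L / 2) + 16 * E^2 * (LINT s:{0<..<L/2}|lborel. exp s)"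
  unfolding g_def by (subst set_integral_add(2) [OF gi1 gi2]) (simp only: set_integral_mult_right gam_def mult_1)
 also have "\<dots> \<le> - (pw * 2 ^ n / 10) + 16 * E"
 proof (rule add_mono)
  have "1/5 * fact n \<le> gam n (L / 2)"
  proof -
   \<comment> \<open>At the cut-off \<open>L / 2\<close> the quotient
     \<open>(n + 1) / (L / 2)\<close> is at most 4/5, since \<open>n \<le> 77 * L / 200\<close> and
     \<open>L \<ge> 200\<close>.\<close>
   have "fact n * (1/5) \<le> fact n * (1 - real (Suc n) / (L / 2))" using n_bounds L_200 by (simp add: divide_le_eq)
   also have "\<dots> \<le> gam n (L / 2)" by (rule gam_ge) (use L_ge in simp)
   finally show ?thesis by simp
  qed
  moreover have "pw / 2 \<le> c"
  proof -
   have "(9/10)^2 * (9/10) * pw \<le> (1 - qw)^2 * (1 - pw) * pw"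
    using qw pw E_small by (intro mult_right_mono mult_mono power_mono) auto
   then show ?thesis using pw01 unfolding c_def by (simp add: power2_eq_square)
  qed
  ultimately have "(pw / 2 * 2 ^ n / fact n) * (1/5 * fact n) \<le> (c * 2 ^ n / fact n) * gam n (L / 2)"
   using pw01 by (intro mult_mono divide_right_mono mult_right_mono) auto
  then show "(- (c * 2 ^ n / fact n)) * gam n (L / 2) \<le> - (pw * 2 ^ n / 10)" by simp
  have "E^2 * (LINT s:{0<..<L/2}|lborel. exp s) \<le> E^2 * exp (L / 2)" using L_ge by (intro mult_left_mono integral_exp_le) auto
  also have "\<dots> = E * exp (- (L / 2))" unfolding EL [symmetric] by (simp add: power2_eq_square)
  also have "\<dots> \<le> E * 1" using E_small L_ge by simp
  finally show "16 * E^2 * (LINT s:{0<..<L/2}|lborel. exp s) \<le> 16 * E" by simp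
 qed
 finally have F: "(LINT z|lborel. ball z * f z) \<le> - (pw * 2 ^ n / 10) + 16 * E" .
 have "(LINT z|lborel. - (ball z * f z)) \<le> (LINT z|lborel. ball z * Y z)"
 proof (rule integral_mono)
  show "integrable lborel (\<lambda>z. - (ball z * f z))" unfolding ball_def using ball_integrable [OF fm fb] by simp
  show "integrable lborel (\<lambda>z. ball z * Y z)" by (rule iY)
  fix z
  define e where "e = pi * W z - exp (- radius_sq z) - osc z"
  have "e^2 \<le> (4 * E)^2" using wig_osc [of z] unfolding e_def W_def by (metis abs_ge_zero power2_abs power_mono)
  then have "(osc z)^2 / 2 - 16 * E^2 \<le> (osc z + e)^2"
   using zero_le_power2 [of "osc z + 2 * e"] by (simp add: power2_eq_square algebra_simps)
  moreover have "osc z + e = pi * (W z - w0 z)" by (simp add: e_def right_diff_distrib pieq)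
  ultimately have "(osc z)^2 / 2 - 16 * E^2 \<le> pi^2 * (W z - w0 z)^2" by (simp add: power_mult_distrib)
  then have "exp (radius_sq z) / pi * ((osc z)^2 / 2 - 16 * E^2) \<le> exp (radius_sq z) / pi * (pi^2 * (W z - w0 z)^2)"
   by (rule mult_left_mono) simp
  also have "\<dots> = Y z" by (simp add: Y_def power2_eq_square)
  finally have "- f z \<le> Y z" by (simp add: f_def)
  from mult_left_mono [OF this, of "ball z"] show "- (ball z * f z) \<le> ball z * Y z" by (simp add: ball_def)
 qed
 then show ?thesis using F d E_small by (simp add: pw_def)
qed

lemma deficit_ge_target: "exp (- 10008) / 240 * target L \<le> 1 + ln pi - wigner_entropy (wigner rho)"
proof -
 have "exp (- 10008) / 120 * target L \<le> exp (- 10008) / 120 * (2 * (E * 2 ^ n / real n))"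
  unfolding E_def by (rule mult_left_mono [OF target_bounds(1)]) simp
 then have 1: "exp (- 10008) / 120 * target L \<le> exp (- 10008) / 60 * (E * 2 ^ n / real n)" by simp
 \<comment> \<open>The loss \<open>5 * E\<close> is absorbed by the target, which is at least
   \<open>20 * L ^ 3 * E\<close>; the condition \<open>exp 10100 \<le> L\<close> outweighs the tiny
   constant in front.\<close>
 have "60 \<le> exp (- 10008) * L ^ 3"
 proof -
  have "60 \<le> exp (92 :: real)" using exp_ge_add_one_self [of "92::real"] by simp
  also have "\<dots> = exp (- 10008) * exp 10100" by (simp add: exp_add [symmetric])
  also have "\<dots> \<le> exp (- 10008) * L ^ 3"
  proof (rule mult_left_mono)
   have "L * 1 \<le> L * (L * L)" using L_ge mult_mono [of 1 L 1 L] by simp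
   then show "exp 10100 \<le> L ^ 3" using huge by (simp add: power3_eq_cube)
  qed simp
  finally show ?thesis .
 qed
 from mult_left_mono [OF this, of "E / 12"]
 have "5 * E \<le> exp (- 10008) / 240 * (E * (20 * L ^ 3))" using E_small by (simp add: mult.commute)
 also have "\<dots> \<le> exp (- 10008) / 240 * target L"
  unfolding E_def by (rule mult_left_mono [OF target_large]) simp
 finally show ?thesis using deficit_lower 1 by linarith
qed

end

theorem theorem6:
 shows "\<exists>C\<^sub>1>0. \<exists>C\<^sub>2>0. \<exists>E\<^sub>0>0. \<forall>E. 0 < E \<and> E < E\<^sub>0 \<longrightarrow>
   ereal (C\<^sub>1 * E powr gamma_exp / ln (1 / E) powr beta_exp) \<le> entropy_deficit_sup E \<and>
   entropy_deficit_sup E \<le> ereal (C\<^sub>2 * E powr gamma_exp / ln (1 / E) powr beta_exp) \<and>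
   (\<exists>\<rho>. density_operator \<rho> \<and> (\<forall>q p. 0 < wigner \<rho> q p) \<and> mean_photon_number \<rho> \<le> ennreal E \<and>
     C\<^sub>1 * E powr gamma_exp / ln (1 / E) powr beta_exp \<le> 1 + ln pi - wigner_entropy (wigner \<rho>))"
proof -
 define C\<^sub>1 C\<^sub>2 :: real where "C\<^sub>1 = exp (- 10008) / 240" and "C\<^sub>2 = 1 + 96 * (1 + (4 * 2400\<^sup>2 + 1) * exp 8)"
 have C: "0 < C\<^sub>1" "0 < C\<^sub>2" unfolding C\<^sub>1_def C\<^sub>2_def by (auto intro!: add_pos_nonneg)
 have "\<forall>\<^sub>F L::real in at_top. 200 \<le> L powr (1/3)" by real_asymp
 then have "\<forall>\<^sub>F L in at_top. large L \<and> exp 10100 \<le> L \<and> 200 \<le> L powr (1/3)"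
  using eventually_large eventually_ge_at_top [of "exp 10100 :: real"] by eventually_elim simp
 then obtain L\<^sub>0 where L0: "\<And>L. L\<^sub>0 \<le> L \<Longrightarrow> large L \<and> exp 10100 \<le> L \<and> 200 \<le> L powr (1/3)"
  by (auto simp: eventually_at_top_linorder)
 have main: "ereal (C\<^sub>1 * E powr gamma_exp / ln (1 / E) powr beta_exp) \<le> entropy_deficit_sup E \<and>
   entropy_deficit_sup E \<le> ereal (C\<^sub>2 * E powr gamma_exp / ln (1 / E) powr beta_exp) \<and>
   (\<exists>\<rho>. density_operator \<rho> \<and> (\<forall>q p. 0 < wigner \<rho> q p) \<and> mean_photon_number \<rho> \<le> ennreal E \<and>
     C\<^sub>1 * E powr gamma_exp / ln (1 / E) powr beta_exp \<le> 1 + ln pi - wigner_entropy (wigner \<rho>))"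
  if E: "0 < E" "E < exp (- L\<^sub>0)" for E
 proof -
  define L where "L = - ln E"
  have EL: "E = exp (- L)" using E by (simp add: L_def)
  have "L\<^sub>0 \<le> L" using E EL by simp
  then have L: "large L" "exp 10100 \<le> L" "200 \<le> L powr (1/3)" using L0 by blast+
  have L10: "10 \<le> L" using L by (simp add: large_def)
  have T: "E powr gamma_exp / ln (1 / E) powr beta_exp = target L" unfolding EL using L10 by (intro target_eq) simp
  define n where "n = nat \<lceil>r_star * L + c_star * ln L\<rceil>"
  have "0 \<le> r_star * L + c_star * ln L" using exponent_bounds L10 by (intro add_nonneg_nonneg mult_nonneg_nonneg) auto
  then have n: "\<bar>real n - (r_star * L + c_star * ln L)\<bar> \<le> 1" unfolding n_def by linarith
  interpret lower_scale L "L + 4/3 * ln L" n by standard (use L n in auto)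
  have pos: "0 < wigner rho q p" for q p using wigner_rho_pos [of "(q, p)"] by simp
  have m: "mean_photon_number rho \<le> ennreal E" using rho_energy by (simp add: EL E_def)
  have lo: "C\<^sub>1 * E powr gamma_exp / ln (1 / E) powr beta_exp \<le> 1 + ln pi - wigner_entropy (wigner rho)"
   using deficit_ge_target unfolding C\<^sub>1_def times_divide_eq_right [symmetric] T .
  \<comment> \<open>The supremum asks for nonnegativity, so the strictly positive state is
    admissible and serves both lower-bound claims.\<close>
  have "ereal (1 + ln pi - wigner_entropy (wigner rho)) \<le> entropy_deficit_sup E"
   unfolding entropy_deficit_sup_def using rho_density pos m by (intro Sup_upper) (auto intro: less_imp_le)
  then have "ereal (C\<^sub>1 * E powr gamma_exp / ln (1 / E) powr beta_exp) \<le> entropy_deficit_sup E"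
   using lo by (meson ereal_less_eq(3) order_trans)
  moreover have "entropy_deficit_sup E \<le> ereal (C\<^sub>2 * E powr gamma_exp / ln (1 / E) powr beta_exp)"
   using entropy_deficit_sup_upper [OF L(1)] unfolding C\<^sub>2_def times_divide_eq_right [symmetric] T unfolding EL .
  ultimately show ?thesis using rho_density pos m lo by blast
 qed
 show ?thesis
  by (rule exI [of _ C\<^sub>1], rule conjI [OF C(1)], rule exI [of _ C\<^sub>2], rule conjI [OF C(2)],
    rule exI [of _ "exp (- L\<^sub>0)"], rule conjI [OF exp_gt_zero]) (use main in blast)
qed

end
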